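(* Let $n\ge 1$ and $r,s\ge 0$ be integers. There is an action of the quantum walled Brauer-Clifford superalgebra $\mathsf{BC}_{r,s}(q)$ on the mixed tensor space $\mathbf V_q^{r,s}=\mathbf V_q^{\otimes r}\otimes(\mathbf V_q^* )^{\otimes s}$ which supercommutes with the action of $\mathfrak U_q(\mathfrak q(n))$, such that the action of each generator is given by $$\mathsf t_i\mapsto \mathrm{id}^{\otimes(i-1)}\otimes PS\otimes \mathrm{id}^{\otimes(r+s-1-i)},\qquad \mathsf c_i\mapsto \mathrm{id}^{\otimes(i-1)}\otimes\Phi\otimes\mathrm{id}^{\otimes(r+s-i)},$$ $$\mathsf t_i^*\mapsto \mathrm{id}^{\otimes(r+i-1)}\otimes P^{T}S^{T}\otimes\mathrm{id}^{\otimes(s-1-i)},\qquad \mathsf c_i^*\mapsto \mathrm{id}^{\otimes(r+i-1)}\otimes\Phi^{T}\otimes\mathrm{id}^{\otimes(s-i)},$$ $$\mathsf e\mapsto \mathrm{id}^{\otimes(r-1)}\otimes\cap\cup\otimes\mathrm{id}^{\otimes(s-1)},$$ where $P=\sum_{i,j\in I}(-1)^{|j|}E_{ij}\otimes E_{ji}\in\mathrm{End}(\mathbf V_q\otimes\mathbf V_q)$, $\Phi=\sum_{i\in I}(-1)^{|i|}E_{i,-i}\in\mathrm{End}(\mathbf V_q)$ and ${}^T$ is the supertranspose. Explicitly, identifying $\mathbf V_q^*$ with $\mathbf V_q$ via $\omega_i\leftrightarrow v_i$ and writing $\xi=q-q^{-1}$, $$PS=\sum_{i,j\in I}(-1)^{|i|}q^{(\delta_{ij}+\delta_{-i,j})(1-2|j|)}E_{ji}\otimes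 E_{ij}+\xi\sum_{i,j\in I,\,i<j}\bigl(E_{ii}\otimes E_{jj}-(-1)^{|i|+|j|}E_{i,-i}\otimes E_{-j,j}\bigr),$$ $$P^TS^T=\sum_{i,j\in I}(-1)^{|i|}q^{(\delta_{ij}+\delta_{-i,j})(1-2|j|)}E_{ji}\otimes E_{ij}+\xi\sum_{i,j\in I,\,j<i}\bigl(E_{ii}\otimes E_{jj}-E_{i,-i}\otimes E_{-j,j}\bigr),$$ $$\Phi^T=\sum_{i\in I}E_{i,-i},\qquad \cap\cup=q^{-(2n+1)}\sum_{i,j\in I}(-1)^{|i||j|}q^{2j(1-2|j|)}E_{ij}\otimes E_{ij}.$$
   Context: Superspaces are $\mathbb Z_2$-graded; $|x|$ is the parity of a homogeneous $x$; tensor products of maps and algebras follow the sign rule $(A\otimes B)(x\otimes y)=(-1)^{|B||x|}Ax\otimes By$. Two operators $X,Y$ supercommute if $XY=(-1)^{|X||Y|}YX$. Let $q$ be an indeterminate, $\xi=q-q^{-1}$, and $I=\{\pm1,\dots,\pm n\}$ with the order of integers. In exponents, for $i\in I$, $|i|=1$ if $i<0$ and $|i|=0$ if $i>0$ (so $1-2|j|=\pm1$ is the sign of $j$). $\mathbf V_q=\mathbb C(q)^{(n|n)}$ has basis $v_i$, $i\in I$, with $v_i$ of parity $|i|$; $E_{ij}$ ($i,j\in I$) are the matrix units, of parity $|i|+|j|$; $\omega_i$ is the dual basis of $\mathbf V_q^*$. The supertranspose is $E_{ij}^T=(-1)^{(|i|+|j|)|i|}E_{ji}$, applied to each tensor factor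 on $\mathrm{End}(\mathbf V_q)^{\otimes 2}$. Put $$S=\sum_{i,j\in I}S_{ij}\otimes E_{ij}=\sum_{i,j\in I}q^{(\delta_{ij}+\delta_{i,-j})(1-2|j|)}E_{ii}\otimes E_{jj}+\xi\sum_{i,j\in I,\,i<j}(-1)^{|i|}(E_{ji}+E_{-j,-i})\otimes E_{ij}.$$ The even maps $\cap:\mathbb C(q)\to\mathbf V_q\otimes\mathbf V_q^*$ and $\cup:\mathbf V_q\otimes\mathbf V_q^*\to\mathbb C(q)$ are $\cap(1)=\sum_{i\in I}v_i\otimes\omega_i$ and $\cup(v_i\otimes\omega_j)=(-1)^{|i|}q^{2i(1-2|i|)-(2n+1)}\delta_{ij}$. The quantum queer superalgebra $\mathfrak U_q(\mathfrak q(n))$ is the unital associative $\mathbb C(q)$-superalgebra generated by $\mathsf u_{ij}$ ($i\le j$, $i,j\in I$), of parity $|i|+|j|$, with relations $\mathsf u_{ii}\mathsf u_{-i,-i}=1=\mathsf u_{-i,-i}\mathsf u_{ii}$ and $U^{12}U^{13}S^{23}=S^{23}U^{13}U^{12}$ in $\mathfrak U_q(\mathfrak q(n))\otimes\mathrm{End}(\mathbf V_q)^{\otimes2}$, where $U=\sum_{i\le j}\mathsf u_{ij}\otimes E_{ij}$ and superscripts indicate tensor positions. It is a Hopf superalgebra with $\Delta(\mathsf u_{ij})=\sum_{k\in I}(-1)^{(|i|+|k|)(|k|+|j|)}\mathsf u_{ik}\otimes\mathsf u_{kj}$ (with $\mathsf u_{ab}=0$ if $a>b$), counit $U\mapsto1$,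 antipode $U\mapsto U^{-1}$. It acts on $\mathbf V_q$ by $\mathsf u_{ij}\mapsto S_{ij}$, on $\mathbf V_q^*$ by $(u\omega)(v)=(-1)^{|u||\omega|}\omega(\mathrm{antipode}(u)v)$, and on $\mathbf V_q^{r,s}$ via the coproduct. $\mathsf{BC}_{r,s}(q)$ is the associative $\mathbb C(q)$-superalgebra generated by even elements $\mathsf t_1,\dots,\mathsf t_{r-1},\mathsf t_1^*,\dots,\mathsf t_{s-1}^*,\mathsf e$ and odd elements $\mathsf c_1,\dots,\mathsf c_r,\mathsf c_1^*,\dots,\mathsf c_s^*$ with the following relations for indices in the allowable range (generators and relations with out-of-range indices are omitted; $\mathsf e$ is present only if $r,s\ge1$): (1) $\mathsf t_i^2-(q-q^{-1})\mathsf t_i-1=0$, $\mathsf t_i\mathsf t_{i+1}\mathsf t_i=\mathsf t_{i+1}\mathsf t_i\mathsf t_{i+1}$, $\mathsf t_i\mathsf t_j=\mathsf t_j\mathsf t_i$ ($|i-j|>1$); the same relations with every $\mathsf t$ replaced by $\mathsf t^*$; $\mathsf t_i\mathsf t_j^*=\mathsf t_j^*\mathsf t_i$. (2) $\mathsf e^2=0$, $\mathsf e\mathsf t_{r-1}\mathsf e=\mathsf e$, $\mathsf e\mathsf t_j=\mathsf t_j\mathsf e$ ($j\ne r-1$), $\mathsf e\mathsf t_1^*\mathsf e=\mathsf e$, $\mathsf e\mathsf t_j^*=\mathsf t_j^*\mathsf e$ ($j\neq1$). (3) $\mathsf e\mathsf t_{r-1}^{-1}\mathsf t_1^*\mathsf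 e\mathsf t_1^*\mathsf t_{r-1}^{-1}=\mathsf t_{r-1}^{-1}\mathsf t_1^*\mathsf e\mathsf t_1^*\mathsf t_{r-1}^{-1}\mathsf e$. (4) $\mathsf c_i^2=-1$, $\mathsf c_i\mathsf c_j=-\mathsf c_j\mathsf c_i$ ($i\ne j$), $\mathsf c_i\mathsf c_j^*=-\mathsf c_j^*\mathsf c_i$, $(\mathsf c_i^* )^2=1$, $\mathsf c_i^*\mathsf c_j^*=-\mathsf c_j^*\mathsf c_i^*$ ($i\neq j$). (5) $\mathsf t_i\mathsf c_i=\mathsf c_{i+1}\mathsf t_i$, $\mathsf t_i\mathsf c_j=\mathsf c_j\mathsf t_i$ ($j\ne i,i+1$), $\mathsf t_i^*\mathsf c_i^*=\mathsf c_{i+1}^*\mathsf t_i^*$, $\mathsf t_i^*\mathsf c_j^*=\mathsf c_j^*\mathsf t_i^*$ ($j\ne i,i+1$), $\mathsf t_i\mathsf c_j^*=\mathsf c_j^*\mathsf t_i$, $\mathsf t_i^*\mathsf c_j=\mathsf c_j\mathsf t_i^*$. (6) $\mathsf c_r\mathsf e=\mathsf c_1^*\mathsf e$, $\mathsf e\mathsf c_r=\mathsf e\mathsf c_1^*$, $\mathsf c_j\mathsf e=\mathsf e\mathsf c_j$ ($j\ne r$), $\mathsf c_j^*\mathsf e=\mathsf e\mathsf c_j^*$ ($j\ne1$), $\mathsf e\mathsf c_r\mathsf e=0$. *)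

theory Defs
  imports
    "HOL-Algebra.QuotRing"
    "HOL-Computational_Algebra.Fraction_Field"
    "HOL-Computational_Algebra.Polynomial"
    "HOL-Library.Poly_Mapping"
    "HOL-Library.Function_Algebras"
begin

type_synonym kq = "complex poly fract"

definition qq :: kq where "qq = Fraction_Field.Fract [:0, 1:] 1"

definition xi :: kq where "xi = qq - inverse qq"

definition sg :: "nat \<Rightarrow> kq" where "sg d = (-1) ^ d"

text \<open>
  Words form a monoid under concatenation, so \<open>'x list \<Rightarrow>\<^sub>0 kq\<close> with the library's convolution
  product is the free associative unital algebra on \<open>'x\<close>.
\<close>

instantiation list :: (type) monoid_add
begin
definition zero_list :: "'a list" where "zero_list = []"
definition plus_list :: "'a list \<Rightarrow> 'a list \<Rightarrow> 'a list" where "plus_list = append"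
instance by standard (auto simp: zero_list_def plus_list_def)
end

type_synonym 'x falg = "'x list \<Rightarrow>\<^sub>0 kq"

definition gen :: "'x \<Rightarrow> 'x falg" where "gen x = Poly_Mapping.single [x] 1"

definition scal :: "kq \<Rightarrow> 'x falg" where "scal c = Poly_Mapping.single [] c"

definition free_alg :: "'x set \<Rightarrow> 'x falg ring" where
  "free_alg X = \<lparr>carrier = {f. Poly_Mapping.keys f \<subseteq> lists X},
     monoid.mult = (*), one = 1, zero = 0, add = (+)\<rparr>"

text \<open>A presentation consists of a set \<open>X\<close> of generators and a set \<open>R\<close> of relations \<open>lhs = rhs\<close>.\<close>

definition pres_ideal :: "'x set \<Rightarrow> ('x falg \<times> 'x falg) set \<Rightarrow> 'x falg set" where
  "pres_ideal X R = Idl\<^bsub>free_alg X\<^esub> {a - b | a b. (a, b) \<in> R}"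

definition pres_alg :: "'x set \<Rightarrow> ('x falg \<times> 'x falg) set \<Rightarrow> 'x falg set ring" where
  "pres_alg X R = free_alg X Quot pres_ideal X R"

definition pres_class :: "'x set \<Rightarrow> ('x falg \<times> 'x falg) set \<Rightarrow> 'x falg \<Rightarrow> 'x falg set" where
  "pres_class X R a = pres_ideal X R +>\<^bsub>free_alg X\<^esub> a"

text \<open>Parities are natural numbers, read modulo 2; \<open>p\<close> gives the parities of the generators.\<close>

definition word_par :: "('x \<Rightarrow> nat) \<Rightarrow> 'x list \<Rightarrow> nat" where
  "word_par p w = sum_list (map p w)"

definition homog :: "'x set \<Rightarrow> ('x falg \<times> 'x falg) set \<Rightarrow> ('x \<Rightarrow> nat) \<Rightarrow> nat \<Rightarrow> 'x falg set set" where
  "homog X R p d = pres_class X R `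
     {a \<in> carrier (free_alg X). \<forall>w \<in> Poly_Mapping.keys a. word_par p w mod 2 = d mod 2}"

text \<open>\<open>a \<mapsto> (-1)\<^bsup>d|a|\<^esup> a\<close> for homogeneous \<open>a\<close>, extended linearly.\<close>

definition twist :: "('x \<Rightarrow> nat) \<Rightarrow> nat \<Rightarrow> 'x falg \<Rightarrow> 'x falg" where
  "twist p d a = Poly_Mapping.mapp (\<lambda>w c. sg (d * word_par p w) * c) a"

text \<open>
  The standard basis of a \<open>k\<close>-fold tensor product of copies of \<open>V\<close> and of its dual is indexed by
  the words of length \<open>k\<close> in the letters \<open>\<pm>1, \<dots>, \<pm>n\<close>; \<open>v\<^sub>i\<close> and \<open>\<omega>\<^sub>i\<close> have the same index and
  the same parity. An operator is given by its matrix: \<open>M w w'\<close> is the coefficient of the basis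
  vector \<open>w\<close> in the image of the basis vector \<open>w'\<close>.
\<close>

definition idx :: "nat \<Rightarrow> int set" where
  "idx n = {- int n..int n} - {0}"

definition par :: "int \<Rightarrow> nat" where
  "par i = (if i < 0 then 1 else 0)"

definition wpar :: "int list \<Rightarrow> nat" where
  "wpar w = sum_list (map par w)"

definition words :: "nat \<Rightarrow> nat \<Rightarrow> int list set" where
  "words n k = {w. length w = k \<and> set w \<subseteq> idx n}"

type_synonym oper = "int list \<Rightarrow> int list \<Rightarrow> kq"

definition smul :: "kq \<Rightarrow> oper \<Rightarrow> oper" where
  "smul c M = (\<lambda>w w'. c * M w w')"

text \<open>Composition \<open>M N\<close>, where \<open>k\<close> is the number of tensor factors in between.\<close>

definition mm :: "nat \<Rightarrow> nat \<Rightarrow> oper \<Rightarrow> oper \<Rightarrow> oper" where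
  "mm n k M N = (\<lambda>w w'. \<Sum>v\<in>words n k. M w v * N v w')"

definition idm :: "nat \<Rightarrow> nat \<Rightarrow> oper" where
  "idm n k = (\<lambda>w w'. if w = w' \<and> w \<in> words n k then 1 else 0)"

definition End :: "nat \<Rightarrow> nat \<Rightarrow> oper ring" where
  "End n k = \<lparr>carrier = {M. \<forall>w w'. M w w' \<noteq> 0 \<longrightarrow> w \<in> words n k \<and> w' \<in> words n k},
     monoid.mult = mm n k, one = idm n k, zero = 0, add = (+)\<rparr>"

definition oper_par :: "nat \<Rightarrow> oper \<Rightarrow> bool" where
  "oper_par d M \<longleftrightarrow> (\<forall>w w'. M w w' \<noteq> 0 \<longrightarrow> (wpar w + wpar w') mod 2 = d mod 2)"

definition E :: "int \<Rightarrow> int \<Rightarrow> oper" where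
  "E i j = (\<lambda>w w'. if w = [i] \<and> w' = [j] then 1 else 0)"

text \<open>
  \<open>M \<otimes> N\<close> with \<open>M\<close> acting on the first \<open>k\<close> factors:
  \<open>(M \<otimes> N) (x \<otimes> y) = (-1)\<^bsup>|N||x|\<^esup> M x \<otimes> N y\<close>, the entry of \<open>N\<close> at \<open>(u, u')\<close> having
  parity \<open>|u| + |u'|\<close>.
\<close>

definition mten :: "nat \<Rightarrow> oper \<Rightarrow> oper \<Rightarrow> oper" where
  "mten k M N = (\<lambda>w w'.
     sg ((wpar (drop k w) + wpar (drop k w')) * wpar (take k w'))
       * M (take k w) (take k w') * N (drop k w) (drop k w'))"

abbreviation EE :: "int \<Rightarrow> int \<Rightarrow> int \<Rightarrow> int \<Rightarrow> oper" where
  "EE i j k l \<equiv> mten 1 (E i j) (E k l)"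

text \<open>\<open>id\<^bsup>\<otimes>a\<^esup> \<otimes> M \<otimes> id\<^bsup>\<otimes>b\<^esup>\<close> for \<open>M\<close> acting on \<open>k\<close> factors.\<close>

definition pad :: "nat \<Rightarrow> nat \<Rightarrow> nat \<Rightarrow> oper \<Rightarrow> nat \<Rightarrow> oper" where
  "pad n a k M b = mten a (idm n a) (mten k M (idm n b))"

text \<open>\<open>coef2 M i j k l\<close> is the coefficient of \<open>E\<^sub>i\<^sub>j \<otimes> E\<^sub>k\<^sub>l\<close> in \<open>M\<close>.\<close>

definition coef2 :: "oper \<Rightarrow> int \<Rightarrow> int \<Rightarrow> int \<Rightarrow> int \<Rightarrow> kq" where
  "coef2 M i j k l = sg ((par k + par l) * par j) * M [i, k] [j, l]"

definition strE :: "int \<Rightarrow> int \<Rightarrow> oper" where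
  "strE i j = smul (sg ((par i + par j) * par i)) (E j i)"

definition str1 :: "nat \<Rightarrow> oper \<Rightarrow> oper" where
  "str1 n M = (\<Sum>i\<in>idx n. \<Sum>j\<in>idx n. smul (M [i] [j]) (strE i j))"

definition str2 :: "nat \<Rightarrow> oper \<Rightarrow> oper" where
  "str2 n M = (\<Sum>i\<in>idx n. \<Sum>j\<in>idx n. \<Sum>k\<in>idx n. \<Sum>l\<in>idx n.
     smul (coef2 M i j k l) (mten 1 (strE i j) (strE k l)))"

definition S_op :: "nat \<Rightarrow> oper" where
  "S_op n =
     (\<Sum>i\<in>idx n. \<Sum>j\<in>idx n.
        smul (qq powi ((of_bool (i = j) + of_bool (i = - j)) * (1 - 2 * int (par j)))) (EE i i j j))
   + smul xi (\<Sum>i\<in>idx n. \<Sum>j\<in>{j \<in> idx n. i < j}.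
        smul (sg (par i)) (mten 1 (E j i + E (- j) (- i)) (E i j)))"

text \<open>The operators \<open>S\<^sub>i\<^sub>j\<close> in \<open>S = \<Sum> S\<^sub>i\<^sub>j \<otimes> E\<^sub>i\<^sub>j\<close>.\<close>

definition S_comp :: "nat \<Rightarrow> int \<Rightarrow> int \<Rightarrow> oper" where
  "S_comp n i j = (\<Sum>a\<in>idx n. \<Sum>b\<in>idx n. smul (coef2 (S_op n) a b i j) (E a b))"

definition P_op :: "nat \<Rightarrow> oper" where
  "P_op n = (\<Sum>i\<in>idx n. \<Sum>j\<in>idx n. smul (sg (par j)) (EE i j j i))"

definition Phi_op :: "nat \<Rightarrow> oper" where
  "Phi_op n = (\<Sum>i\<in>idx n. smul (sg (par i)) (E i (- i)))"

text \<open>The ground field is the tensor power with the empty word as its only basis element.\<close>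

definition cap_op :: "nat \<Rightarrow> oper" where
  "cap_op n = (\<lambda>w w'. if w' = [] \<and> (\<exists>i\<in>idx n. w = [i, i]) then 1 else 0)"

definition cup_op :: "nat \<Rightarrow> oper" where
  "cup_op n = (\<lambda>w w'. if w = [] \<and> (\<exists>i\<in>idx n. w' = [i, i])
     then sg (par (hd w')) * qq powi (2 * hd w' * (1 - 2 * int (par (hd w'))) - (2 * int n + 1))
     else 0)"

text \<open>
  \<open>A \<otimes> End(V\<^bsup>\<otimes>k\<^esup>)\<close> for a superalgebra \<open>A\<close>: \<open>M w w'\<close> is the coefficient in \<open>A\<close> of the matrix unit
  at \<open>(w, w')\<close>, and \<open>tw d\<close> is the map \<open>a \<mapsto> (-1)\<^bsup>d|a|\<^esup> a\<close> of \<open>A\<close>. The sign comes from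
  \<open>(a \<otimes> X) (b \<otimes> Y) = (-1)\<^bsup>|X||b|\<^esup> a b \<otimes> X Y\<close>.
\<close>

definition tens_End :: "'a ring \<Rightarrow> (nat \<Rightarrow> 'a \<Rightarrow> 'a) \<Rightarrow> nat \<Rightarrow> nat \<Rightarrow> (int list \<Rightarrow> int list \<Rightarrow> 'a) monoid" where
  "tens_End A tw n k = \<lparr>
     carrier = {M. \<forall>w w'. if w \<in> words n k \<and> w' \<in> words n k
                          then M w w' \<in> carrier A else M w w' = \<zero>\<^bsub>A\<^esub>},
     monoid.mult = (\<lambda>M N w w'. if w \<in> words n k \<and> w' \<in> words n k
        then \<Oplus>\<^bsub>A\<^esub>v\<in>words n k. M w v \<otimes>\<^bsub>A\<^esub> tw (wpar w + wpar v) (N v w') else \<zero>\<^bsub>A\<^esub>),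
     one = (\<lambda>w w'. if w = w' \<and> w \<in> words n k then \<one>\<^bsub>A\<^esub> else \<zero>\<^bsub>A\<^esub>)\<rparr>"

definition uq_gens :: "nat \<Rightarrow> (int \<times> int) set" where
  "uq_gens n = {(i, j). i \<in> idx n \<and> j \<in> idx n \<and> i \<le> j}"

definition uq_par :: "int \<times> int \<Rightarrow> nat" where
  "uq_par = (\<lambda>(i, j). par i + par j)"

text \<open>\<open>\<Sum> u\<^sub>i\<^sub>j \<otimes> L(E\<^sub>i\<^sub>j)\<close> over the free superalgebra, \<open>L\<close> being an embedding of tensor factors.\<close>

definition uq_mat :: "nat \<Rightarrow> (oper \<Rightarrow> oper) \<Rightarrow> int list \<Rightarrow> int list \<Rightarrow> (int \<times> int) falg" where
  "uq_mat n L = (\<lambda>w w'. \<Sum>(i, j)\<in>uq_gens n. scal (L (E i j) w w') * gen (i, j))"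

abbreviation uq_free2 :: "nat \<Rightarrow> (int list \<Rightarrow> int list \<Rightarrow> (int \<times> int) falg) monoid" where
  "uq_free2 n \<equiv> tens_End (free_alg (uq_gens n)) (twist uq_par) n 2"

abbreviation U12 :: "nat \<Rightarrow> int list \<Rightarrow> int list \<Rightarrow> (int \<times> int) falg" where
  "U12 n \<equiv> uq_mat n (\<lambda>M. mten 1 M (idm n 1))"

abbreviation U13 :: "nat \<Rightarrow> int list \<Rightarrow> int list \<Rightarrow> (int \<times> int) falg" where
  "U13 n \<equiv> uq_mat n (\<lambda>M. mten 1 (idm n 1) M)"

abbreviation S23 :: "nat \<Rightarrow> int list \<Rightarrow> int list \<Rightarrow> (int \<times> int) falg" where
  "S23 n \<equiv> (\<lambda>w w'. scal (S_op n w w'))"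

inductive_set uq_rels :: "nat \<Rightarrow> ((int \<times> int) falg \<times> (int \<times> int) falg) set" for n where
  diag: "i \<in> idx n \<Longrightarrow> (gen (i, i) * gen (- i, - i), 1) \<in> uq_rels n"
| rtt: "w \<in> words n 2 \<Longrightarrow> w' \<in> words n 2 \<Longrightarrow>
    ((U12 n \<otimes>\<^bsub>uq_free2 n\<^esub> U13 n \<otimes>\<^bsub>uq_free2 n\<^esub> S23 n) w w',
     (S23 n \<otimes>\<^bsub>uq_free2 n\<^esub> U13 n \<otimes>\<^bsub>uq_free2 n\<^esub> U12 n) w w') \<in> uq_rels n"

definition Uq :: "nat \<Rightarrow> (int \<times> int) falg set ring" where
  "Uq n = pres_alg (uq_gens n) (uq_rels n)"

abbreviation uq_class :: "nat \<Rightarrow> (int \<times> int) falg \<Rightarrow> (int \<times> int) falg set" where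
  "uq_class n \<equiv> pres_class (uq_gens n) (uq_rels n)"

text \<open>The element \<open>u\<^sub>i\<^sub>j\<close>, with \<open>u\<^sub>i\<^sub>j = 0\<close> for \<open>i > j\<close>.\<close>

definition uq_elt :: "nat \<Rightarrow> int \<Rightarrow> int \<Rightarrow> (int \<times> int) falg set" where
  "uq_elt n i j = uq_class n (if i \<le> j then gen (i, j) else 0)"

text \<open>The antipode sends \<open>u\<^sub>i\<^sub>j\<close> to the coefficient of \<open>E\<^sub>i\<^sub>j\<close> in the inverse of \<open>U\<close> in \<open>U\<^sub>q \<otimes> End(V)\<close>.\<close>

definition uq_antipode :: "nat \<Rightarrow> int \<Rightarrow> int \<Rightarrow> (int \<times> int) falg set" where
  "uq_antipode n i j =
     (inv\<^bsub>tens_End (Uq n) (\<lambda>d. image (twist uq_par d)) n 1\<^esub>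
        (\<lambda>w w'. uq_class n (uq_mat n (\<lambda>M. M) w w'))) [i] [j]"

text \<open>
  \<open>free_eval n k g\<close> is the algebra homomorphism from the free algebra with \<open>x \<mapsto> g x\<close>;
  \<open>induced n k g\<close> is the map it induces on cosets. The latter has a meaningful value only
  where the former is constant on the coset.
\<close>

definition free_eval :: "nat \<Rightarrow> nat \<Rightarrow> ('x \<Rightarrow> oper) \<Rightarrow> 'x falg \<Rightarrow> oper" where
  "free_eval n k g a = (\<Sum>w\<in>Poly_Mapping.keys a.
     smul (Poly_Mapping.lookup a w) (foldr (\<lambda>x M. mm n k (g x) M) w (idm n k)))"

definition induced :: "nat \<Rightarrow> nat \<Rightarrow> ('x \<Rightarrow> oper) \<Rightarrow> 'x falg set \<Rightarrow> oper" where
  "induced n k g X = the_elem (free_eval n k g ` X)"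

definition uq_triv :: "nat \<Rightarrow> (int \<times> int) falg set \<Rightarrow> oper" where
  "uq_triv n = induced n 0 (\<lambda>(i, j). if i = j then idm n 0 else 0)"

definition uq_vec :: "nat \<Rightarrow> (int \<times> int) falg set \<Rightarrow> oper" where
  "uq_vec n = induced n 1 (\<lambda>(i, j). S_comp n i j)"

text \<open>
  \<open>(u \<omega>\<^sub>a) (v\<^sub>b) = (-1)\<^bsup>|u||a|\<^esup> \<omega>\<^sub>a (antipode(u) v\<^sub>b)\<close> is the coefficient of \<open>\<omega>\<^sub>b\<close> in \<open>u \<omega>\<^sub>a\<close>; it is
  imposed for the generators \<open>u = u\<^sub>i\<^sub>j\<close>.
\<close>

definition uq_dual :: "nat \<Rightarrow> (int \<times> int) falg set \<Rightarrow> oper" where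
  "uq_dual n = induced n 1 (\<lambda>(i, j) b a.
     sg (uq_par (i, j) * wpar a) * uq_vec n (uq_antipode n i j) a b)"

text \<open>
  The tensor product of two modules: \<open>u\<^sub>i\<^sub>j\<close> acts by the image of
  \<open>\<Delta>(u\<^sub>i\<^sub>j) = \<Sum>\<^sub>l (-1)\<^bsup>(|i|+|l|)(|l|+|j|)\<^esup> u\<^sub>i\<^sub>l \<otimes> u\<^sub>l\<^sub>j\<close>.
\<close>

definition uq_tensor ::
  "nat \<Rightarrow> nat \<Rightarrow> ((int \<times> int) falg set \<Rightarrow> oper) \<Rightarrow> nat \<Rightarrow> ((int \<times> int) falg set \<Rightarrow> oper)
    \<Rightarrow> (int \<times> int) falg set \<Rightarrow> oper" where
  "uq_tensor n k f m g = induced n (k + m) (\<lambda>(i, j).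
     \<Sum>l\<in>idx n. smul (sg ((par i + par l) * (par l + par j)))
       (mten k (f (uq_elt n i l)) (g (uq_elt n l j))))"

fun uq_mixed :: "nat \<Rightarrow> nat \<Rightarrow> nat \<Rightarrow> (int \<times> int) falg set \<Rightarrow> oper" where
  "uq_mixed n 0 0 = uq_triv n"
| "uq_mixed n 0 (Suc s) = uq_tensor n 1 (uq_dual n) s (uq_mixed n 0 s)"
| "uq_mixed n (Suc r) s = uq_tensor n 1 (uq_vec n) (r + s) (uq_mixed n r s)"

datatype bc_gen = T nat | Ts nat | Ee | C nat | Cs nat

fun bc_par :: "bc_gen \<Rightarrow> nat" where
  "bc_par (C i) = 1"
| "bc_par (Cs i) = 1"
| "bc_par _ = 0"

definition bc_gens :: "nat \<Rightarrow> nat \<Rightarrow> bc_gen set" where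
  "bc_gens r s = T ` {1..<r} \<union> Ts ` {1..<s} \<union> C ` {1..r} \<union> Cs ` {1..s}
     \<union> (if 1 \<le> r \<and> 1 \<le> s then {Ee} else {})"

abbreviation "tt i \<equiv> gen (T i)"
abbreviation "ts i \<equiv> gen (Ts i)"
abbreviation "cc i \<equiv> gen (C i)"
abbreviation "cs i \<equiv> gen (Cs i)"
abbreviation "ee \<equiv> gen Ee"

text \<open>By the quadratic relation, \<open>t\<^sub>i\<close> is invertible with inverse \<open>t\<^sub>i - (q - q\<^sup>-\<^sup>1)\<close>.\<close>

abbreviation "tinv i \<equiv> tt i - scal xi"

text \<open>
  The superalgebra \<open>BC\<^sub>r\<^sub>,\<^sub>s(q)\<close> is the algebra presented by \<open>bc_gens r s\<close> and \<open>bc_rels r s\<close>, with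
  parities \<open>bc_par\<close>.
\<close>

inductive_set bc_rels :: "nat \<Rightarrow> nat \<Rightarrow> (bc_gen falg \<times> bc_gen falg) set" for r s where
  t_quad: "i \<in> {1..<r} \<Longrightarrow> (tt i * tt i - scal xi * tt i - 1, 0) \<in> bc_rels r s"
| t_braid: "i \<in> {1..<r} \<Longrightarrow> i + 1 \<in> {1..<r} \<Longrightarrow>
    (tt i * tt (i + 1) * tt i, tt (i + 1) * tt i * tt (i + 1)) \<in> bc_rels r s"
| t_comm: "i \<in> {1..<r} \<Longrightarrow> j \<in> {1..<r} \<Longrightarrow> \<bar>int i - int j\<bar> > 1 \<Longrightarrow>
    (tt i * tt j, tt j * tt i) \<in> bc_rels r s"
| ts_quad: "i \<in> {1..<s} \<Longrightarrow> (ts i * ts i - scal xi * ts i - 1, 0) \<in> bc_rels r s"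
| ts_braid: "i \<in> {1..<s} \<Longrightarrow> i + 1 \<in> {1..<s} \<Longrightarrow>
    (ts i * ts (i + 1) * ts i, ts (i + 1) * ts i * ts (i + 1)) \<in> bc_rels r s"
| ts_comm: "i \<in> {1..<s} \<Longrightarrow> j \<in> {1..<s} \<Longrightarrow> \<bar>int i - int j\<bar> > 1 \<Longrightarrow>
    (ts i * ts j, ts j * ts i) \<in> bc_rels r s"
| t_ts: "i \<in> {1..<r} \<Longrightarrow> j \<in> {1..<s} \<Longrightarrow> (tt i * ts j, ts j * tt i) \<in> bc_rels r s"
| e_e: "1 \<le> r \<Longrightarrow> 1 \<le> s \<Longrightarrow> (ee * ee, 0) \<in> bc_rels r s"
| e_t_e: "2 \<le> r \<Longrightarrow> 1 \<le> s \<Longrightarrow> (ee * tt (r - 1) * ee, ee) \<in> bc_rels r s"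
| e_t: "1 \<le> s \<Longrightarrow> j \<in> {1..<r} \<Longrightarrow> j \<noteq> r - 1 \<Longrightarrow> (ee * tt j, tt j * ee) \<in> bc_rels r s"
| e_ts_e: "1 \<le> r \<Longrightarrow> 2 \<le> s \<Longrightarrow> (ee * ts 1 * ee, ee) \<in> bc_rels r s"
| e_ts: "1 \<le> r \<Longrightarrow> j \<in> {1..<s} \<Longrightarrow> j \<noteq> 1 \<Longrightarrow> (ee * ts j, ts j * ee) \<in> bc_rels r s"
| e_long: "2 \<le> r \<Longrightarrow> 2 \<le> s \<Longrightarrow>
    (ee * tinv (r - 1) * ts 1 * ee * ts 1 * tinv (r - 1),
     tinv (r - 1) * ts 1 * ee * ts 1 * tinv (r - 1) * ee) \<in> bc_rels r s"
| c_sq: "i \<in> {1..r} \<Longrightarrow> (cc i * cc i, - 1) \<in> bc_rels r s"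
| c_c: "i \<in> {1..r} \<Longrightarrow> j \<in> {1..r} \<Longrightarrow> i \<noteq> j \<Longrightarrow> (cc i * cc j, - (cc j * cc i)) \<in> bc_rels r s"
| c_cs: "i \<in> {1..r} \<Longrightarrow> j \<in> {1..s} \<Longrightarrow> (cc i * cs j, - (cs j * cc i)) \<in> bc_rels r s"
| cs_sq: "i \<in> {1..s} \<Longrightarrow> (cs i * cs i, 1) \<in> bc_rels r s"
| cs_cs: "i \<in> {1..s} \<Longrightarrow> j \<in> {1..s} \<Longrightarrow> i \<noteq> j \<Longrightarrow> (cs i * cs j, - (cs j * cs i)) \<in> bc_rels r s"
| t_c: "i \<in> {1..<r} \<Longrightarrow> (tt i * cc i, cc (i + 1) * tt i) \<in> bc_rels r s"
| t_c': "i \<in> {1..<r} \<Longrightarrow> j \<in> {1..r} \<Longrightarrow> j \<noteq> i \<Longrightarrow> j \<noteq> i + 1 \<Longrightarrow>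
    (tt i * cc j, cc j * tt i) \<in> bc_rels r s"
| ts_cs: "i \<in> {1..<s} \<Longrightarrow> (ts i * cs i, cs (i + 1) * ts i) \<in> bc_rels r s"
| ts_cs': "i \<in> {1..<s} \<Longrightarrow> j \<in> {1..s} \<Longrightarrow> j \<noteq> i \<Longrightarrow> j \<noteq> i + 1 \<Longrightarrow>
    (ts i * cs j, cs j * ts i) \<in> bc_rels r s"
| t_cs: "i \<in> {1..<r} \<Longrightarrow> j \<in> {1..s} \<Longrightarrow> (tt i * cs j, cs j * tt i) \<in> bc_rels r s"
| ts_c: "i \<in> {1..<s} \<Longrightarrow> j \<in> {1..r} \<Longrightarrow> (ts i * cc j, cc j * ts i) \<in> bc_rels r s"
| c_e: "1 \<le> r \<Longrightarrow> 1 \<le> s \<Longrightarrow> (cc r * ee, cs 1 * ee) \<in> bc_rels r s"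
| e_c: "1 \<le> r \<Longrightarrow> 1 \<le> s \<Longrightarrow> (ee * cc r, ee * cs 1) \<in> bc_rels r s"
| c_e': "1 \<le> s \<Longrightarrow> j \<in> {1..r} \<Longrightarrow> j \<noteq> r \<Longrightarrow> (cc j * ee, ee * cc j) \<in> bc_rels r s"
| cs_e': "1 \<le> r \<Longrightarrow> j \<in> {1..s} \<Longrightarrow> j \<noteq> 1 \<Longrightarrow> (cs j * ee, ee * cs j) \<in> bc_rels r s"
| e_c_e: "1 \<le> r \<Longrightarrow> 1 \<le> s \<Longrightarrow> (ee * cc r * ee, 0) \<in> bc_rels r s"

abbreviation bc_class :: "nat \<Rightarrow> nat \<Rightarrow> bc_gen falg \<Rightarrow> bc_gen falg set" where
  "bc_class r s \<equiv> pres_class (bc_gens r s) (bc_rels r s)"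

text \<open>
  An action on the mixed tensor space, i.e. a homomorphism of superalgebras to its endomorphism
  superalgebra: a homomorphism of unital rings that is linear and preserves parities.
\<close>

definition superalg_action ::
  "'x set \<Rightarrow> ('x falg \<times> 'x falg) set \<Rightarrow> ('x \<Rightarrow> nat) \<Rightarrow> nat \<Rightarrow> nat \<Rightarrow> ('x falg set \<Rightarrow> oper) \<Rightarrow> bool" where
  "superalg_action X R p n k \<rho> \<longleftrightarrow>
     \<rho> \<in> ring_hom (pres_alg X R) (End n k) \<and>
     (\<forall>c. \<forall>a \<in> carrier (free_alg X).
        \<rho> (pres_class X R (scal c * a)) = smul c (\<rho> (pres_class X R a))) \<and>
     (\<forall>d. \<forall>x \<in> homog X R p d. oper_par d (\<rho> x))"

definition supercommuting ::
  "nat \<Rightarrow> nat \<Rightarrow> nat \<Rightarrow> (bc_gen falg set \<Rightarrow> oper) \<Rightarrow> bool" where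
  "supercommuting n r s \<rho> \<longleftrightarrow>
     (\<forall>a b. \<forall>x \<in> homog (bc_gens r s) (bc_rels r s) bc_par a.
        \<forall>u \<in> homog (uq_gens n) (uq_rels n) uq_par b.
          mm n (r + s) (\<rho> x) (uq_mixed n r s u)
            = smul (sg (a * b)) (mm n (r + s) (uq_mixed n r s u) (\<rho> x)))"

text \<open>
  The ideal generated by a set not contained in the ring would be everything, so it matters that
  the relations lie in the free algebras.
\<close>

lemma free_alg_closed:
  "0 \<in> carrier (free_alg X)" "1 \<in> carrier (free_alg X)" "scal c \<in> carrier (free_alg X)"
  "x \<in> X \<Longrightarrow> gen x \<in> carrier (free_alg X)"
  "f \<in> carrier (free_alg X) \<Longrightarrow> g \<in> carrier (free_alg X) \<Longrightarrow> f + g \<in> carrier (free_alg X)"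
  "f \<in> carrier (free_alg X) \<Longrightarrow> g \<in> carrier (free_alg X) \<Longrightarrow> f - g \<in> carrier (free_alg X)"
  "f \<in> carrier (free_alg X) \<Longrightarrow> - f \<in> carrier (free_alg X)"
  "f \<in> carrier (free_alg X) \<Longrightarrow> g \<in> carrier (free_alg X) \<Longrightarrow> f * g \<in> carrier (free_alg X)"
  "f \<in> carrier (free_alg X) \<Longrightarrow> twist p d f \<in> carrier (free_alg X)"
proof -
  show "1 \<in> carrier (free_alg X)"
    by (simp add: free_alg_def zero_list_def flip: single_one)
  show "f + g \<in> carrier (free_alg X)"
    if "f \<in> carrier (free_alg X)" "g \<in> carrier (free_alg X)"
    using that Poly_Mapping.keys_add[of f g] by (auto simp: free_alg_def)
  show "f - g \<in> carrier (free_alg X)"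
    if "f \<in> carrier (free_alg X)" "g \<in> carrier (free_alg X)"
    using that keys_diff[of f g] by (auto simp: free_alg_def)
  show "f * g \<in> carrier (free_alg X)"
    if "f \<in> carrier (free_alg X)" "g \<in> carrier (free_alg X)"
    using that keys_mult[of f g] by (fastforce simp: free_alg_def plus_list_def)
  show "twist p d f \<in> carrier (free_alg X)" if "f \<in> carrier (free_alg X)"
    using that keys_mapp_subset by (fastforce simp: free_alg_def twist_def)
qed (auto simp: free_alg_def scal_def gen_def)

lemma ring_free_alg: "ring (free_alg X)"
proof -
  have "\<exists>g \<in> carrier (free_alg X). g + f = 0" if "f \<in> carrier (free_alg X)" for f
    using free_alg_closed(7)[OF that] by (intro bexI[of _ "- f"]) auto
  then show ?thesis
    using free_alg_closed[where X = X]
    by unfold_locales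
      (auto simp: free_alg_def Units_def algebra_simps eq_neg_iff_add_eq_0)
qed

lemma bc_rels_closed:
  assumes "(a, b) \<in> bc_rels r s"
  shows "a \<in> carrier (free_alg (bc_gens r s)) \<and> b \<in> carrier (free_alg (bc_gens r s))"
  using assms by cases (auto intro!: free_alg_closed simp: bc_gens_def)

lemma uq_mat_closed: "uq_mat n L w w' \<in> carrier (free_alg (uq_gens n))"
proof -
  have *: "sum h A \<in> carrier (free_alg (uq_gens n))"
    if "A \<subseteq> uq_gens n" "\<And>x. x \<in> A \<Longrightarrow> h x \<in> carrier (free_alg (uq_gens n))" for A h
    using that by (induction A rule: infinite_finite_induct) (auto intro!: free_alg_closed)
  show ?thesis
    unfolding uq_mat_def by (rule *[OF subset_refl]) (auto intro!: free_alg_closed)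
qed

lemma uq_free2_closed:
  assumes "w \<in> words n 2" "w' \<in> words n 2"
    "\<And>v v'. v \<in> words n 2 \<Longrightarrow> v' \<in> words n 2 \<Longrightarrow> M v v' \<in> carrier (free_alg (uq_gens n))"
    "\<And>v v'. v \<in> words n 2 \<Longrightarrow> v' \<in> words n 2 \<Longrightarrow> N v v' \<in> carrier (free_alg (uq_gens n))"
  shows "(M \<otimes>\<^bsub>uq_free2 n\<^esub> N) w w' \<in> carrier (free_alg (uq_gens n))"
proof -
  interpret ring "free_alg (uq_gens n)" by (rule ring_free_alg)
  show ?thesis
    using assms by (auto simp: tens_End_def intro!: finsum_closed m_closed free_alg_closed(9))
qed

lemma uq_rels_closed:
  assumes "(a, b) \<in> uq_rels n"
  shows "a \<in> carrier (free_alg (uq_gens n)) \<and> b \<in> carrier (free_alg (uq_gens n))"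
  using assms
proof cases
  case (diag i)
  then show ?thesis
    by (auto intro!: free_alg_closed simp: uq_gens_def idx_def)
next
  case (rtt w w')
  then show ?thesis
    by (auto intro!: uq_free2_closed uq_mat_closed free_alg_closed)
qed

end

theory Submission
  imports Defs
begin

text \<open>
  The mixed tensor space and its two actions are given by explicit matrices, so the theorem has
  three parts of different nature.

  \<^item> The relations of the walled Brauer-Clifford superalgebra. Every relation concerns operators on at
    most four adjacent tensor factors, up to the rule that operators on disjoint sets of factors
    supercommute (\<open>place_supercommute\<close>). The braiding \<open>R = P S\<close> sends \<open>v\<^sub>a \<otimes> v\<^sub>b\<close> to a combination of
    \<open>v\<^sub>b \<otimes> v\<^sub>a\<close>, \<open>v\<^sub>a \<otimes> v\<^sub>b\<close> and \<open>v\<^bsub>-a\<^esub> \<otimes> v\<^bsub>-b\<^esub>\<close> (\<open>R_app\<close>), and its quadratic and braid relations follow by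
    comparing coefficients. The braiding of the dual factors is the same matrix rotated by a half turn
    (\<open>Rs_app\<close>). The exponents of \<open>q\<close> in the evaluation \<open>\<union>\<close> make its tail sums a geometric series
    (\<open>beta_tail\<close>). For this reason the partial quantum trace of \<open>R\<close> is the identity (\<open>R_trace\<close>), and a
    strand that crosses both legs of a cup can be pulled off it (\<open>cup_pull\<close>). These two facts give
    the relations that contain \<open>e\<close>; both sides of the long relation are equal to a nested
    pair of a cup and a cap (\<open>place_long\<close>).

  \<^item> Supercommutation. The matrix of operators by which the generators \<open>u\<^sub>i\<^sub>j\<close> act on a module is packed
    into one operator, which moves a vector strand across the module (\<open>hat\<close>). An operator supercommutes with
    all \<open>u\<^sub>i\<^sub>j\<close> if it slides through this crossing (\<open>hat_slides_supercommute\<close>). Since the coproduct is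
    matrix multiplication, the crossing of a tensor product is composed of the crossings of the
    factors (\<open>hat_tensor\<close>), which are \<open>R\<close> for \<open>V\<close> and a rotated inverse of \<open>R\<close> for its dual
    (\<open>hat_vector\<close>, \<open>hat_dual\<close>). An operator on one or two factors meets only its own part of the
    crossing (\<open>slides_crossing\<close>), and there it slides by a braid relation, by \<open>cup_pull\<close>, or
    by the relation between \<open>R\<close> and \<open>\<Phi>\<close> (\<open>local_slides\<close>).

  \<^item> The action of the quantum group. The defining relation with \<open>S\<close> follows from a
    braid relation of the crossing with \<open>R\<close> (\<open>rtt_relation\<close>), a form that is inherited by tensor
    products (\<open>rtt_join\<close>). For the dual module the antipode has to be found. The
    matrix \<open>U\<close> is triangular with invertible diagonal, so it has a two-sided inverse
    (\<open>uq_gen_inv\<close>), and on \<open>V\<close> this inverse becomes the inverse of \<open>S\<close> (\<open>antipode_vector_app\<close>).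
\<close>

section \<open>Matrices with super signs\<close>

lemma sg_eq: "sg d = (if even d then 1 else - 1)"
  by (simp add: sg_def)

lemma sg_0 [simp]: "sg 0 = 1"
  by (simp add: sg_def)

lemma sg_Suc [simp]: "sg (Suc d) = - sg d"
  by (simp add: sg_def)

lemma sg_add: "sg (a + b) = sg a * sg b"
  by (simp add: sg_def power_add)

lemma sg_square [simp]: "sg d * sg d = 1" "sg d * (sg d * x) = x"
  by (auto simp: sg_eq)

lemma sg_nonzero [simp]: "sg d \<noteq> 0"
  by (simp add: sg_eq)

lemma sg_mod_cong: "a mod 2 = b mod 2 \<Longrightarrow> sg a = sg b"
  by (metis even_iff_mod_2_eq_zero sg_eq)

lemma sg_even_mult: "even d \<Longrightarrow> sg (d * e) = 1"
  by (simp add: sg_eq)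

abbreviation Op :: "nat \<Rightarrow> nat \<Rightarrow> oper set" where
  "Op n k \<equiv> carrier (End n k)"

lemma Op_iff: "M \<in> Op n k \<longleftrightarrow> (\<forall>w w'. M w w' \<noteq> 0 \<longrightarrow> w \<in> words n k \<and> w' \<in> words n k)"
  by (simp add: End_def)

lemma OpI: "(\<And>w w'. M w w' \<noteq> 0 \<Longrightarrow> w \<in> words n k \<and> w' \<in> words n k) \<Longrightarrow> M \<in> Op n k"
  by (simp add: Op_iff)

lemma Op_outside:
  assumes "M \<in> Op n k"
  shows "w \<notin> words n k \<Longrightarrow> M w w' = 0" "w' \<notin> words n k \<Longrightarrow> M w w' = 0"
  using assms by (auto simp: Op_iff)

lemma Op_eqI:
  assumes "M \<in> Op n k" "N \<in> Op n k"
    and "\<And>w w'. w \<in> words n k \<Longrightarrow> w' \<in> words n k \<Longrightarrow> M w w' = N w w'"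
  shows "M = N"
proof (intro ext)
  fix w w' show "M w w' = N w w'"
    by (metis assms Op_outside)
qed

lemma finite_idx [simp]: "finite (idx n)"
  by (simp add: idx_def)

lemma uminus_in_idx [simp]: "- i \<in> idx n \<longleftrightarrow> i \<in> idx n"
  by (auto simp: idx_def)

lemma idx_nonzero: "i \<in> idx n \<Longrightarrow> i \<noteq> 0"
  by (auto simp: idx_def)

lemma finite_words [simp]: "finite (words n k)"
proof -
  have "words n k = {w. set w \<subseteq> idx n \<and> length w = k}"
    by (auto simp: words_def)
  then show ?thesis
    by (simp add: finite_lists_length_eq)
qed

lemma words_0 [simp]: "words n 0 = {[]}"
  by (auto simp: words_def)

lemma words_append:
  "length x = k \<Longrightarrow> x @ y \<in> words n (k + m) \<longleftrightarrow> x \<in> words n k \<and> y \<in> words n m"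
  by (auto simp: words_def)

lemma words_Cons: "i # x \<in> words n (Suc k) \<longleftrightarrow> i \<in> idx n \<and> x \<in> words n k"
  by (auto simp: words_def)

lemma length_words: "w \<in> words n k \<Longrightarrow> length w = k"
  by (simp add: words_def)

lemma words_splitE:
  assumes "w \<in> words n (k + m)"
  obtains x y where "w = x @ y" "x \<in> words n k" "y \<in> words n m"
proof -
  have "w = take k w @ drop k w" "length (take k w) = k"
    using assms by (auto simp: words_def)
  then show ?thesis
    using that assms words_append by metis
qed

lemma sum_words_append:
  "(\<Sum>w\<in>words n (k + m). f w) = (\<Sum>x\<in>words n k. \<Sum>y\<in>words n m. f (x @ y))"
proof -
  have "bij_betw (\<lambda>(x, y). x @ y) (words n k \<times> words n m) (words n (k + m))"
  proof (intro bij_betw_imageI inj_onI)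
    show "(\<lambda>(x, y). x @ y) ` (words n k \<times> words n m) = words n (k + m)"
    proof (intro equalityI subsetI)
      fix w assume "w \<in> words n (k + m)"
      then obtain x y where "w = x @ y" "x \<in> words n k" "y \<in> words n m"
        by (rule words_splitE)
      then show "w \<in> (\<lambda>(x, y). x @ y) ` (words n k \<times> words n m)"
        by blast
    qed (auto simp: words_append length_words)
  qed (use length_words in fastforce)
  then have "(\<Sum>w\<in>words n (k + m). f w)
      = (\<Sum>p\<in>words n k \<times> words n m. f ((\<lambda>(x, y). x @ y) p))"
    by (rule sum.reindex_bij_betw [symmetric])
  also have "\<dots> = (\<Sum>x\<in>words n k. \<Sum>y\<in>words n m. f (x @ y))"
    unfolding sum.cartesian_product by (rule sum.cong) auto
  finally show ?thesis .
qed

lemma words_1: "words n (Suc 0) = (\<lambda>i. [i]) ` idx n"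
  by (auto simp: words_def length_Suc_conv)

lemma sum_words_1: "(\<Sum>w\<in>words n (Suc 0). f w) = (\<Sum>i\<in>idx n. f [i])"
  unfolding words_1 by (subst sum.reindex) (auto simp: inj_on_def)

lemma sum_words_Suc: "(\<Sum>w\<in>words n (Suc k). f w) = (\<Sum>i\<in>idx n. \<Sum>y\<in>words n k. f (i # y))"
  using sum_words_append[of f n "Suc 0" k] by (simp add: sum_words_1)

lemma sum_words_snoc: "(\<Sum>w\<in>words n (Suc k). f w) = (\<Sum>y\<in>words n k. \<Sum>i\<in>idx n. f (y @ [i]))"
  using sum_words_append[of f n k "Suc 0"] by (simp add: sum_words_1)

lemma words_SucE:
  assumes "w \<in> words n (Suc k)"
  obtains i x where "w = i # x" "i \<in> idx n" "x \<in> words n k"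
  using assms by (cases w) (auto simp: words_def)

lemma words_snocE:
  assumes "w \<in> words n (Suc k)"
  obtains i x where "w = x @ [i]" "i \<in> idx n" "x \<in> words n k"
  using assms by (cases w rule: rev_cases) (auto simp: words_def)

lemma wpar_simps [simp]:
  "wpar [] = 0" "wpar (i # w) = par i + wpar w" "wpar (x @ y) = wpar x + wpar y"
  by (auto simp: wpar_def)

lemma par_uminus: "i \<noteq> 0 \<Longrightarrow> par (- i) = 1 - par i"
  by (auto simp: par_def)

lemma par_le_1: "par i \<le> 1"
  by (simp add: par_def)

subsection \<open>Composition\<close>

lemma mm_nonzeroE:
  assumes "mm n k M N w w' \<noteq> 0"
  obtains v where "M w v \<noteq> 0" "N v w' \<noteq> 0"
proof -
  have "\<exists>v. M w v \<noteq> 0 \<and> N v w' \<noteq> 0"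
  proof (rule ccontr)
    assume "\<not> ?thesis"
    then have "mm n k M N w w' = 0"
      unfolding mm_def by (intro sum.neutral ballI) auto
    then show False
      using assms by contradiction
  qed
  then show ?thesis
    using that by blast
qed

lemma mm_closed [simp]:
  assumes "M \<in> Op n k" "N \<in> Op n k"
  shows "mm n k M N \<in> Op n k"
proof (rule OpI)
  fix w w' assume "mm n k M N w w' \<noteq> 0"
  then obtain v where "M w v \<noteq> 0" "N v w' \<noteq> 0"
    by (rule mm_nonzeroE)
  then show "w \<in> words n k \<and> w' \<in> words n k"
    using assms unfolding Op_iff by blast
qed

lemma mm_assoc: "mm n k (mm n k A B) X = mm n k A (mm n k B X)"
proof (intro ext)
  fix w w'
  have "mm n k (mm n k A B) X w w' = (\<Sum>v\<in>words n k. \<Sum>u\<in>words n k. A w u * B u v * X v w')"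
    by (simp add: mm_def sum_distrib_right)
  also have "\<dots> = (\<Sum>u\<in>words n k. \<Sum>v\<in>words n k. A w u * B u v * X v w')"
    by (rule sum.swap)
  finally show "mm n k (mm n k A B) X w w' = mm n k A (mm n k B X) w w'"
    by (simp add: mm_def sum_distrib_left mult.assoc)
qed

lemma idm_closed [simp]: "idm n k \<in> Op n k"
  by (rule OpI) (auto simp: idm_def split: if_splits)

lemma idm_app: "idm n k w w' = of_bool (w = w' \<and> w \<in> words n k)"
  by (simp only: idm_def of_bool_def)

lemma mm_idm_left [simp]:
  assumes "M \<in> Op n k"
  shows "mm n k (idm n k) M = M"
proof (rule Op_eqI[OF mm_closed[OF idm_closed assms] assms])
  fix w w' assume "w \<in> words n k"
  have "mm n k (idm n k) M w w' = (\<Sum>v\<in>words n k. if w = v then M v w' else 0)"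
    unfolding mm_def idm_def by (rule sum.cong) auto
  then show "mm n k (idm n k) M w w' = M w w'"
    using \<open>w \<in> words n k\<close> by simp
qed

lemma mm_idm_right [simp]:
  assumes "M \<in> Op n k"
  shows "mm n k M (idm n k) = M"
proof (rule Op_eqI[OF mm_closed[OF assms idm_closed] assms])
  fix w w' assume "w' \<in> words n k"
  have "mm n k M (idm n k) w w' = (\<Sum>v\<in>words n k. if v = w' then M w v else 0)"
    unfolding mm_def idm_def by (rule sum.cong) auto
  then show "mm n k M (idm n k) w w' = M w w'"
    using \<open>w' \<in> words n k\<close> by simp
qed

lemma mm_add_left: "mm n k (A + B) X = mm n k A X + mm n k B X"
  by (intro ext) (simp add: mm_def algebra_simps sum.distrib)

lemma mm_add_right: "mm n k A (B + X) = mm n k A B + mm n k A X"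
  by (intro ext) (simp add: mm_def algebra_simps sum.distrib)

lemma mm_diff_left: "mm n k (A - B) X = mm n k A X - mm n k B X"
  by (intro ext) (simp add: mm_def algebra_simps sum_subtractf)

lemma mm_diff_right: "mm n k A (B - X) = mm n k A B - mm n k A X"
  by (intro ext) (simp add: mm_def algebra_simps sum_subtractf)

lemma mm_smul_left: "mm n k (smul c A) B = smul c (mm n k A B)"
  by (intro ext) (simp add: mm_def smul_def sum_distrib_left mult.assoc)

lemma mm_smul_right: "mm n k A (smul c B) = smul c (mm n k A B)"
  by (intro ext) (simp add: mm_def smul_def sum_distrib_left mult_ac)

lemma mm_zero [simp]: "mm n k 0 A = 0" "mm n k A 0 = 0"
  by (intro ext, simp add: mm_def)+

lemma sum_fun_app: "(\<Sum>x\<in>A. f x) w w' = (\<Sum>x\<in>A. f x w w')" for f :: "'a \<Rightarrow> oper"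
  by (induction A rule: infinite_finite_induct) auto

lemma mm_sum_left: "mm n k (sum f A) N = (\<Sum>x\<in>A. mm n k (f x) N)"
  by (intro ext) (simp only: mm_def sum_fun_app sum_distrib_right, rule sum.swap)

lemma mm_sum_right: "mm n k N (sum f A) = (\<Sum>x\<in>A. mm n k N (f x))"
  by (intro ext) (simp only: mm_def sum_fun_app sum_distrib_left, rule sum.swap)

lemma Op_add [simp]: "M \<in> Op n k \<Longrightarrow> N \<in> Op n k \<Longrightarrow> M + N \<in> Op n k"
  unfolding Op_iff by (metis add_0 plus_fun_apply)

lemma Op_diff [simp]: "M \<in> Op n k \<Longrightarrow> N \<in> Op n k \<Longrightarrow> M - N \<in> Op n k"
  unfolding Op_iff by (metis diff_zero minus_apply)

lemma Op_smul [simp]: "M \<in> Op n k \<Longrightarrow> smul c M \<in> Op n k"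
  by (auto simp: Op_iff smul_def)

lemma Op_zero [simp]: "0 \<in> Op n k"
  by (simp add: Op_iff)

lemma Op_sum: "(\<And>x. x \<in> A \<Longrightarrow> f x \<in> Op n k) \<Longrightarrow> sum f A \<in> Op n k"
  by (induction A rule: infinite_finite_induct) auto

lemma smul_simps:
  "smul c (smul d A) = smul (c * d) A" "smul 1 A = A" "smul 0 A = 0" "smul c 0 = 0"
  by (auto simp: smul_def fun_eq_iff)

lemma smul_sum: "smul c (sum f A) = (\<Sum>x\<in>A. smul c (f x))"
  by (intro ext) (simp only: smul_def sum_fun_app sum_distrib_left)

lemma End_simps [simp]:
  "monoid.mult (End n k) = mm n k" "one (End n k) = idm n k" "zero (End n k) = 0"
  "ring.add (End n k) = (+)"
  by (simp_all add: End_def)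

lemma ring_End: "ring (End n k)"
proof -
  have "\<exists>N \<in> Op n k. N + M = 0" if "M \<in> Op n k" for M
    by (rule bexI[of _ "0 - M"]) (use that Op_diff[OF Op_zero that] in \<open>simp_all add: fun_eq_iff\<close>)
  then have "abelian_group (End n k)"
    by (intro abelian_groupI) (simp_all add: add.assoc add.commute)
  moreover have "monoid (End n k)"
    by (rule monoidI) (simp_all add: mm_assoc)
  ultimately show ?thesis
    by (rule ringI) (simp_all add: mm_add_left mm_add_right)
qed

lemma oper_par_mm:
  assumes "oper_par d M" "oper_par e N"
  shows "oper_par (d + e) (mm n k M N)"
  unfolding oper_par_def
proof (intro allI impI)
  fix w w' assume "mm n k M N w w' \<noteq> 0"
  then obtain v where "M w v \<noteq> 0" "N v w' \<noteq> 0"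
    by (rule mm_nonzeroE)
  then have "(wpar w + wpar v) mod 2 = d mod 2" "(wpar v + wpar w') mod 2 = e mod 2"
    using assms by (auto simp: oper_par_def)
  then have "(wpar w + wpar v + (wpar v + wpar w')) mod 2 = (d + e) mod 2"
    by (rule mod_add_cong)
  moreover have "wpar w + wpar v + (wpar v + wpar w') = wpar w + wpar w' + 2 * wpar v"
    by simp
  ultimately show "(wpar w + wpar w') mod 2 = (d + e) mod 2"
    by simp
qed

lemma oper_par_idm [simp]: "oper_par 0 (idm n k)"
  by (auto simp: oper_par_def idm_def)

lemma oper_par_zero [simp]: "oper_par d 0"
  by (auto simp: oper_par_def)

lemma oper_par_add: "oper_par d M \<Longrightarrow> oper_par d N \<Longrightarrow> oper_par d (M + N)"
  by (auto simp: oper_par_def) (metis add_0)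

lemma oper_par_diff: "oper_par d M \<Longrightarrow> oper_par d N \<Longrightarrow> oper_par d (M - N)"
  by (auto simp: oper_par_def) (metis diff_zero diff_0 neg_equal_0_iff_equal)

lemma oper_par_smul: "oper_par d M \<Longrightarrow> oper_par d (smul c M)"
  by (auto simp: oper_par_def smul_def)

lemma oper_par_sum: "(\<And>x. x \<in> A \<Longrightarrow> oper_par d (f x)) \<Longrightarrow> oper_par d (sum f A)"
  by (induction A rule: infinite_finite_induct) (auto intro: oper_par_add)

lemma oper_par_cong: "oper_par d M \<Longrightarrow> d mod 2 = e mod 2 \<Longrightarrow> oper_par e M"
  by (simp add: oper_par_def)

lemma oper_par_odd_even: "oper_par 0 M \<Longrightarrow> M w w' \<noteq> 0 \<Longrightarrow> even (wpar w + wpar w')"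
  unfolding oper_par_def even_iff_mod_2_eq_zero by simp

subsection \<open>Tensor products\<close>

lemma mten_append:
  "length x = k \<Longrightarrow> length x' = k \<Longrightarrow>
    mten k M N (x @ y) (x' @ y') = sg ((wpar y + wpar y') * wpar x') * M x x' * N y y'"
  by (simp add: mten_def)

lemma mten_closed [simp]:
  assumes "M \<in> Op n k" "N \<in> Op n m"
  shows "mten k M N \<in> Op n (k + m)"
proof (rule OpI)
  fix w w' assume "mten k M N w w' \<noteq> 0"
  then have "take k w \<in> words n k" "take k w' \<in> words n k" "drop k w \<in> words n m" "drop k w' \<in> words n m"
    using assms by (auto simp: mten_def Op_iff)
  then show "w \<in> words n (k + m) \<and> w' \<in> words n (k + m)"
    by (metis append_take_drop_id length_words words_append)
qed

lemma mten_eqI: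
  assumes "A \<in> Op n (k + m)" "B \<in> Op n (k + m)"
    and "\<And>x x' y y'. x \<in> words n k \<Longrightarrow> x' \<in> words n k \<Longrightarrow> y \<in> words n m \<Longrightarrow> y' \<in> words n m \<Longrightarrow>
      A (x @ y) (x' @ y') = B (x @ y) (x' @ y')"
  shows "A = B"
  by (rule Op_eqI[OF assms(1,2)]) (metis assms(3) words_splitE)

text \<open>
  In the graded interchange law \<open>(A \<otimes> B) (X \<otimes> D) = (-1)\<^bsup>|B||X|\<^esup> A X \<otimes> B D\<close> the sign \<open>c\<close> is only
  required to be the same for all pairs of nonzero entries of \<open>B\<close> and \<open>X\<close>. So the law covers an
  inhomogeneous factor when the other one is even.
\<close>

lemma mten_mm_gen:
  assumes "\<And>x x' y y'. B y y' \<noteq> 0 \<Longrightarrow> X x x' \<noteq> 0 \<Longrightarrow>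
    sg ((wpar y + wpar y') * (wpar x + wpar x')) = c"
    and AD: "A \<in> Op n k" "B \<in> Op n m" "X \<in> Op n k" "D \<in> Op n m"
  shows "mm n (k + m) (mten k A B) (mten k X D) = smul c (mten k (mm n k A X) (mm n m B D))"
proof (rule mten_eqI)
  fix x x' y y' assume w: "x \<in> words n k" "x' \<in> words n k" "y \<in> words n m" "y' \<in> words n m"
  have *: "sg ((wpar y + wpar v) * wpar u) * A x u * B y v * (sg ((wpar v + wpar y') * wpar x') * X u x' * D v y')
     = c * sg ((wpar y + wpar y') * wpar x') * (A x u * X u x') * (B y v * D v y')" for u v
  proof (cases "B y v = 0 \<or> X u x' = 0")
    case False
    then have "c = sg ((wpar y + wpar v) * (wpar u + wpar x'))"
      using assms(1) by auto
    moreover have "sg ((wpar y + wpar v) * wpar u) * sg ((wpar v + wpar y') * wpar x')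
      = sg ((wpar y + wpar v) * (wpar u + wpar x')) * sg ((wpar y + wpar y') * wpar x')"
      by (auto simp: sg_eq)
    moreover have "sg ((wpar y + wpar v) * wpar u) * A x u * B y v * (sg ((wpar v + wpar y') * wpar x') * X u x' * D v y')
      = (sg ((wpar y + wpar v) * wpar u) * sg ((wpar v + wpar y') * wpar x')) * (A x u * X u x') * (B y v * D v y')"
      by (simp only: mult_ac)
    ultimately show ?thesis
      by simp
  qed auto
  have "mm n (k + m) (mten k A B) (mten k X D) (x @ y) (x' @ y')
    = (\<Sum>u\<in>words n k. \<Sum>v\<in>words n m. sg ((wpar y + wpar v) * wpar u) * A x u * B y v
        * (sg ((wpar v + wpar y') * wpar x') * X u x' * D v y'))"
    using w by (simp add: mm_def sum_words_append mten_append length_words cong: sum.cong)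
  also have "\<dots> = (\<Sum>u\<in>words n k. \<Sum>v\<in>words n m.
      c * sg ((wpar y + wpar y') * wpar x') * ((A x u * X u x') * (B y v * D v y')))"
    by (intro sum.cong refl) (subst *, simp only: mult.assoc)
  also have "\<dots> = c * sg ((wpar y + wpar y') * wpar x') * (mm n k A X x x' * mm n m B D y y')"
    unfolding mm_def sum_product by (simp only: sum_distrib_left)
  finally show "mm n (k + m) (mten k A B) (mten k X D) (x @ y) (x' @ y')
     = smul c (mten k (mm n k A X) (mm n m B D)) (x @ y) (x' @ y')"
    using w by (simp add: mten_append length_words smul_def mult.assoc)
qed (use AD in auto)

lemma mten_mm_super:
  assumes "oper_par d B" "oper_par e X" "A \<in> Op n k" "B \<in> Op n m" "X \<in> Op n k" "D \<in> Op n m"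
  shows "mm n (k + m) (mten k A B) (mten k X D) = smul (sg (d * e)) (mten k (mm n k A X) (mm n m B D))"
proof (rule mten_mm_gen)
  fix x x' y y' assume "B y y' \<noteq> 0" "X x x' \<noteq> 0"
  then have "(wpar y + wpar y') mod 2 = d mod 2" "(wpar x + wpar x') mod 2 = e mod 2"
    using assms(1,2) by (auto simp: oper_par_def)
  then have "((wpar y + wpar y') * (wpar x + wpar x')) mod 2 = (d * e) mod 2"
    by (metis mod_mult_cong)
  then show "sg ((wpar y + wpar y') * (wpar x + wpar x')) = sg (d * e)"
    by (rule sg_mod_cong)
qed (use assms in auto)

lemma mten_mm:
  assumes "oper_par 0 B \<or> oper_par 0 X" "A \<in> Op n k" "B \<in> Op n m" "X \<in> Op n k" "D \<in> Op n m"
  shows "mm n (k + m) (mten k A B) (mten k X D) = mten k (mm n k A X) (mm n m B D)"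
proof -
  have "mm n (k + m) (mten k A B) (mten k X D) = smul 1 (mten k (mm n k A X) (mm n m B D))"
  proof (rule mten_mm_gen)
    fix x x' y y' assume "B y y' \<noteq> 0" "X x x' \<noteq> 0"
    then show "sg ((wpar y + wpar y') * (wpar x + wpar x')) = 1"
      using assms(1) oper_par_odd_even by (metis sg_even_mult mult.commute)
  qed (use assms in auto)
  then show ?thesis
    by (simp add: smul_simps)
qed

lemma mten_assoc:
  assumes "A \<in> Op n a" "B \<in> Op n b" "X \<in> Op n c"
  shows "mten a A (mten b B X) = mten (a + b) (mten a A B) X"
proof (rule mten_eqI[where k = a and m = "b + c" and n = n])
  show "mten a A (mten b B X) \<in> Op n (a + (b + c))"
    using assms by simp
  show "mten (a + b) (mten a A B) X \<in> Op n (a + (b + c))"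
    using mten_closed[OF mten_closed[OF assms(1,2)] assms(3)] by (simp add: add.assoc)
next
  fix x x' y y' assume w: "x \<in> words n a" "x' \<in> words n a" "y \<in> words n (b + c)" "y' \<in> words n (b + c)"
  obtain u v where y: "y = u @ v" "u \<in> words n b" "v \<in> words n c"
    using w(3) by (rule words_splitE)
  obtain u' v' where y': "y' = u' @ v'" "u' \<in> words n b" "v' \<in> words n c"
    using w(4) by (rule words_splitE)
  have "mten (a + b) (mten a A B) X (x @ y) (x' @ y')
    = sg ((wpar v + wpar v') * (wpar x' + wpar u')) * (sg ((wpar u + wpar u') * wpar x') * A x x' * B u u') * X v v'"
    using w y y' mten_append[of "x @ u" "a + b" "x' @ u'" "mten a A B" X v v']
    by (simp add: mten_append length_words)
  moreover have "mten a A (mten b B X) (x @ y) (x' @ y')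
    = sg ((wpar u + wpar v + wpar u' + wpar v') * wpar x') * A x x' * (sg ((wpar v + wpar v') * wpar u') * B u u' * X v v')"
    using w y y' by (simp add: mten_append length_words add_ac)
  moreover have "sg ((wpar u + wpar v + wpar u' + wpar v') * wpar x') * sg ((wpar v + wpar v') * wpar u')
    = sg ((wpar v + wpar v') * (wpar x' + wpar u')) * sg ((wpar u + wpar u') * wpar x')"
    by (auto simp: sg_eq)
  moreover have "s1 * a * (s2 * b * c) = (s1 * s2) * (a * b * c)"
    and "s1 * (s2 * a * b) * c = (s1 * s2) * (a * b * c)" for s1 s2 a b c :: kq
    by (simp_all only: mult_ac)
  ultimately show "mten a A (mten b B X) (x @ y) (x' @ y') = mten (a + b) (mten a A B) X (x @ y) (x' @ y')"
    by simp
qed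

lemma mten_idm: "mten a (idm n a) (idm n b) = idm n (a + b)"
proof (rule mten_eqI)
  fix x x' y y' assume "x \<in> words n a" "x' \<in> words n a" "y \<in> words n b" "y' \<in> words n b"
  then show "mten a (idm n a) (idm n b) (x @ y) (x' @ y') = idm n (a + b) (x @ y) (x' @ y')"
    by (auto simp: mten_append length_words idm_app words_append sg_eq)
qed auto

lemma oper_par_mten:
  assumes "oper_par d M" "oper_par e N"
  shows "oper_par (d + e) (mten k M N)"
  unfolding oper_par_def
proof (intro allI impI)
  fix w w' assume "mten k M N w w' \<noteq> 0"
  then have "(wpar (take k w) + wpar (take k w')) mod 2 = d mod 2"
    "(wpar (drop k w) + wpar (drop k w')) mod 2 = e mod 2"
    using assms by (auto simp: mten_def oper_par_def)
  then have "(wpar (take k w) + wpar (take k w') + (wpar (drop k w) + wpar (drop k w'))) mod 2 = (d + e) mod 2"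
    by (rule mod_add_cong)
  moreover have "wpar (take k w) + wpar (take k w') + (wpar (drop k w) + wpar (drop k w')) = wpar w + wpar w'"
    using wpar_simps(3)[of "take k w" "drop k w"] wpar_simps(3)[of "take k w'" "drop k w'"]
    unfolding append_take_drop_id by linarith
  ultimately show "(wpar w + wpar w') mod 2 = (d + e) mod 2"
    by simp
qed

lemma mten_add_left: "mten k (A + B) X = mten k A X + mten k B X"
  and mten_add_right: "mten k A (B + X) = mten k A B + mten k A X"
  and mten_diff_left: "mten k (A - B) X = mten k A X - mten k B X"
  and mten_diff_right: "mten k A (B - X) = mten k A B - mten k A X"
  and mten_smul_left: "mten k (smul c A) B = smul c (mten k A B)"
  and mten_smul_right: "mten k A (smul c B) = smul c (mten k A B)"
  by (auto simp: mten_def smul_def fun_eq_iff algebra_simps)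

lemma mten_0_idm: "M \<in> Op n k \<Longrightarrow> mten 0 (idm n 0) M = M"
  by (auto simp: mten_def idm_def fun_eq_iff)

lemma mten_idm_0:
  assumes "M \<in> Op n k"
  shows "mten k M (idm n 0) = M"
proof (rule mten_eqI[where n = n and k = k and m = 0])
  show "mten k M (idm n 0) \<in> Op n (k + 0)" "M \<in> Op n (k + 0)"
    using assms mten_closed[OF assms idm_closed[of n 0]] by auto
qed (auto simp: mten_def length_words idm_app)

subsection \<open>Operators on adjacent tensor factors\<close>

lemma pad_closed [simp]: "M \<in> Op n k \<Longrightarrow> pad n a k M b \<in> Op n (a + (k + b))"
  unfolding pad_def by simp

lemma pad_closed' : "M \<in> Op n k \<Longrightarrow> m = a + k + b \<Longrightarrow> pad n a k M b \<in> Op n m"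
  using pad_closed[of M n k a b] by (simp add: add.assoc)

lemma pad_0_0: "M \<in> Op n k \<Longrightarrow> pad n 0 k M 0 = M"
  by (simp add: pad_def mten_0_idm mten_idm_0)

lemma pad_idm: "pad n a k (idm n k) b = idm n (a + (k + b))"
  by (simp add: pad_def mten_idm)

lemma pad_smul: "pad n a k (smul c M) b = smul c (pad n a k M b)"
  and pad_diff: "pad n a k (M - N) b = pad n a k M b - pad n a k N b"
  and pad_add: "pad n a k (M + N) b = pad n a k M b + pad n a k N b"
  by (simp_all add: pad_def mten_smul_left mten_smul_right mten_diff_left mten_diff_right
      mten_add_left mten_add_right)

lemma pad_zero: "pad n a k 0 b = 0"
  by (auto simp: pad_def mten_def fun_eq_iff)

lemma oper_par_pad: "oper_par d M \<Longrightarrow> oper_par d (pad n a k M b)"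
  unfolding pad_def by (metis add.right_neutral add_0 oper_par_idm oper_par_mten)

lemma pad_mm:
  assumes "M \<in> Op n k" "N \<in> Op n k" "m = a + k + b"
  shows "mm n m (pad n a k M b) (pad n a k N b) = pad n a k (mm n k M N) b"
  using assms by (simp add: pad_def mten_mm add.assoc)

lemma pad_pad:
  assumes "M \<in> Op n k" "m = c + k + d"
  shows "pad n a m (pad n c k M d) b = pad n (a + c) k M (d + b)"
proof -
  have "pad n a m (pad n c k M d) b
    = mten a (idm n a) (mten (c + (k + d)) (mten c (idm n c) (mten k M (idm n d))) (idm n b))"
    using assms by (simp add: pad_def add.assoc)
  also have "\<dots> = mten a (idm n a) (mten c (idm n c) (mten (k + d) (mten k M (idm n d)) (idm n b)))"
    using assms mten_assoc[of "idm n c" n c "mten k M (idm n d)" "k + d" "idm n b" b] by simp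
  also have "\<dots> = mten a (idm n a) (mten c (idm n c) (mten k M (idm n (d + b))))"
    using assms mten_assoc[of M n k "idm n d" d "idm n b" b] by (simp add: mten_idm)
  also have "\<dots> = pad n (a + c) k M (d + b)"
    using assms mten_assoc[of "idm n a" n a "idm n c" c "mten k M (idm n (d + b))" "k + (d + b)"]
    by (simp add: pad_def mten_idm)
  finally show ?thesis .
qed

text \<open>\<open>A \<otimes> 1\<close> and \<open>1 \<otimes> B\<close> supercommute, both products being \<open>\<plusminus> A \<otimes> B\<close>.\<close>

lemma mten_supercommute:
  assumes "oper_par d A" "oper_par e B" "A \<in> Op n k" "B \<in> Op n m"
  shows "mm n (k + m) (mten k A (idm n m)) (mten k (idm n k) B) = mten k A B"
    and "mm n (k + m) (mten k (idm n k) B) (mten k A (idm n m)) = smul (sg (d * e)) (mten k A B)"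
  using assms mten_mm_super[of e B d A "idm n k" n k m "idm n m"]
  by (auto simp: mten_mm mult.commute)

lemma pad_supercommute:
  assumes "oper_par d M" "oper_par e N" "M \<in> Op n k" "N \<in> Op n l" "m = a + k + c + l + b"
  shows "mm n m (pad n a k M (c + l + b)) (pad n (a + k + c) l N b)
    = smul (sg (d * e)) (mm n m (pad n (a + k + c) l N b) (pad n a k M (c + l + b)))"
proof -
  define A where "A = pad n a k M 0"
  define B where "B = pad n c l N b"
  have A: "A \<in> Op n (a + k)" "oper_par d A" and B: "B \<in> Op n (c + l + b)" "oper_par e B"
    using assms by (auto simp: A_def B_def intro: pad_closed' oper_par_pad)
  have "pad n a k M (c + l + b) = mten (a + k) A (idm n (c + l + b))"
    using pad_pad[of M n k "a + k" a 0 0 "c + l + b"] assms mten_0_idm[OF mten_closed[OF A(1) idm_closed[of n "c + l + b"]]]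
    by (simp add: A_def pad_def[of n 0 _ "mten _ _ _"] pad_def[of n 0 "a + k"])
  moreover have "pad n (a + k + c) l N b = mten (a + k) (idm n (a + k)) B"
    using pad_pad[of N n l "c + l + b" c b "a + k" 0] assms
    by (simp add: B_def pad_def[of n "a + k" "c + l + b"] mten_idm_0 pad_closed')
  ultimately show ?thesis
    using mten_supercommute[OF A(2) B(2) A(1) B(1)] assms(5)
    by (simp add: add.assoc smul_simps)
qed

lemma pad_app:
  assumes "x \<in> words n a" "x' \<in> words n a" "length u = k" "length u' = k" "y \<in> words n b" "y' \<in> words n b"
  shows "pad n a k M b (x @ u @ y) (x' @ u' @ y')
    = of_bool (x = x' \<and> y = y') * sg ((wpar u + wpar u') * wpar x) * M u u'"
proof -
  have *: "pad n a k M b (x @ u @ y) (x' @ u' @ y')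
    = sg ((wpar u + wpar y + (wpar u' + wpar y')) * wpar x') * idm n a x x'
      * (sg ((wpar y + wpar y') * wpar u') * M u u' * idm n b y y')"
    using assms by (simp add: pad_def mten_append length_words)
  show ?thesis
  proof (cases "x = x' \<and> y = y'")
    case True
    moreover have "sg ((wpar u + wpar y + (wpar u' + wpar y)) * wpar x) = sg ((wpar u + wpar u') * wpar x)"
      by (auto simp: sg_eq)
    moreover have "sg ((wpar y + wpar y) * wpar u') = 1"
      by (simp add: sg_even_mult)
    ultimately show ?thesis
      using assms * by (simp add: idm_app)
  qed (use * in \<open>auto simp: idm_app\<close>)
qed

lemma pad_app_even:
  assumes "oper_par 0 M" "x \<in> words n a" "x' \<in> words n a" "length u = k" "length u' = k"
    "y \<in> words n b" "y' \<in> words n b"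
  shows "pad n a k M b (x @ u @ y) (x' @ u' @ y') = of_bool (x = x' \<and> y = y') * M u u'"
proof (cases "M u u' = 0")
  case False
  then show ?thesis
    using oper_par_odd_even[OF assms(1) False] pad_app[OF assms(2-), of M] by (simp add: sg_even_mult del: even_add)
qed (use pad_app[OF assms(2-), of M] in simp)

section \<open>Representations of algebras given by generators and relations\<close>

definition word_op :: "nat \<Rightarrow> nat \<Rightarrow> ('x \<Rightarrow> oper) \<Rightarrow> 'x list \<Rightarrow> oper" where
  "word_op n k g w = foldr (\<lambda>x M. mm n k (g x) M) w (idm n k)"

lemma word_op_simps [simp]:
  "word_op n k g [] = idm n k" "word_op n k g (x # w) = mm n k (g x) (word_op n k g w)"
  by (simp_all add: word_op_def)

lemma free_eval_word_op:
  "free_eval n k g a = (\<Sum>w\<in>Poly_Mapping.keys a. smul (Poly_Mapping.lookup a w) (word_op n k g w))"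
  by (simp only: free_eval_def word_op_def)

lemma word_op_closed: "(\<And>x. x \<in> X \<Longrightarrow> g x \<in> Op n k) \<Longrightarrow> w \<in> lists X \<Longrightarrow> word_op n k g w \<in> Op n k"
  by (induction w) auto

lemma word_op_append:
  assumes "\<And>x. x \<in> X \<Longrightarrow> g x \<in> Op n k" "w \<in> lists X" "v \<in> lists X"
  shows "word_op n k g (w @ v) = mm n k (word_op n k g w) (word_op n k g v)"
  using assms(2)
proof (induction w)
  case Nil
  then show ?case
    using word_op_closed[OF assms(1,3)] by simp
qed (simp add: mm_assoc)

lemma in_free_alg: "a \<in> carrier (free_alg X) \<longleftrightarrow> Poly_Mapping.keys a \<subseteq> lists X"
  by (simp add: free_alg_def)

lemma free_alg_simps [simp]:
  "monoid.mult (free_alg X) = (*)" "one (free_alg X) = 1" "zero (free_alg X) = 0"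
  "ring.add (free_alg X) = (+)"
  by (simp_all add: free_alg_def)

lemma falg_monomials: "a = (\<Sum>w\<in>Poly_Mapping.keys a. Poly_Mapping.single w (Poly_Mapping.lookup a w))"
proof (rule poly_mapping_eqI)
  fix v
  have "(\<Sum>w\<in>Poly_Mapping.keys a. Poly_Mapping.lookup (Poly_Mapping.single w (Poly_Mapping.lookup a w)) v)
    = (\<Sum>w\<in>Poly_Mapping.keys a. if w = v then Poly_Mapping.lookup a w else 0)"
    by (rule sum.cong) (auto simp: lookup_single)
  also have "\<dots> = Poly_Mapping.lookup a v"
    by (simp add: in_keys_iff)
  finally show "Poly_Mapping.lookup a v
    = Poly_Mapping.lookup (\<Sum>w\<in>Poly_Mapping.keys a. Poly_Mapping.single w (Poly_Mapping.lookup a w)) v"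
    by (simp add: lookup_sum)
qed

lemma free_eval_superset:
  assumes "finite K" "Poly_Mapping.keys a \<subseteq> K"
  shows "free_eval n k g a = (\<Sum>w\<in>K. smul (Poly_Mapping.lookup a w) (word_op n k g w))"
  unfolding free_eval_word_op
  by (rule sum.mono_neutral_left) (use assms in \<open>auto simp: in_keys_iff smul_simps\<close>)

lemma free_eval_0 [simp]: "free_eval n k g 0 = 0"
  by (simp add: free_eval_word_op)

lemma free_eval_single: "free_eval n k g (Poly_Mapping.single w c) = smul c (word_op n k g w)"
  by (subst free_eval_superset[of "{w}"]) auto

lemma free_eval_add: "free_eval n k g (a + b) = free_eval n k g a + free_eval n k g b"
proof -
  define K where "K = Poly_Mapping.keys a \<union> Poly_Mapping.keys b"
  have K: "finite K" "Poly_Mapping.keys a \<subseteq> K" "Poly_Mapping.keys b \<subseteq> K" "Poly_Mapping.keys (a + b) \<subseteq> K"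
    using Poly_Mapping.keys_add[of a b] by (auto simp: K_def)
  have "smul (Poly_Mapping.lookup (a + b) w) (word_op n k g w)
    = smul (Poly_Mapping.lookup a w) (word_op n k g w) + smul (Poly_Mapping.lookup b w) (word_op n k g w)" for w
    by (simp add: smul_def lookup_add fun_eq_iff algebra_simps)
  then show ?thesis
    using K by (simp only: free_eval_superset[of K] sum.distrib)
qed

lemma free_eval_sum: "free_eval n k g (sum f A) = (\<Sum>x\<in>A. free_eval n k g (f x))"
  by (induction A rule: infinite_finite_induct) (simp_all only: sum.infinite sum.empty sum.insert free_eval_0 free_eval_add not_False_eq_True)

lemma free_eval_diff: "free_eval n k g (a - b) = free_eval n k g a - free_eval n k g b"
  using free_eval_add[of n k g "a - b" b] by (simp add: algebra_simps)

lemma free_eval_closed: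
  assumes "\<And>x. x \<in> X \<Longrightarrow> g x \<in> Op n k" "a \<in> carrier (free_alg X)"
  shows "free_eval n k g a \<in> Op n k"
  unfolding free_eval_word_op
  using assms(2) by (intro Op_sum Op_smul word_op_closed[OF assms(1)]) (auto simp: in_free_alg)

lemma free_eval_mult:
  assumes "\<And>x. x \<in> X \<Longrightarrow> g x \<in> Op n k" "a \<in> carrier (free_alg X)" "b \<in> carrier (free_alg X)"
  shows "free_eval n k g (a * b) = mm n k (free_eval n k g a) (free_eval n k g b)"
proof -
  have *: "free_eval n k g (Poly_Mapping.single w c * Poly_Mapping.single v d)
    = mm n k (smul c (word_op n k g w)) (smul d (word_op n k g v))"
    if "w \<in> Poly_Mapping.keys a" "v \<in> Poly_Mapping.keys b" for w v c d
  proof -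
    have "word_op n k g (w @ v) = mm n k (word_op n k g w) (word_op n k g v)"
      by (rule word_op_append[OF assms(1)]) (use that assms(2,3) in \<open>auto simp: in_free_alg\<close>)
    then show ?thesis
      by (simp add: mult_single free_eval_single plus_list_def mm_smul_left mm_smul_right smul_simps mult_ac)
  qed
  have "free_eval n k g (a * b) = free_eval n k g
     ((\<Sum>w\<in>Poly_Mapping.keys a. Poly_Mapping.single w (Poly_Mapping.lookup a w))
      * (\<Sum>v\<in>Poly_Mapping.keys b. Poly_Mapping.single v (Poly_Mapping.lookup b v)))"
    by (simp only: falg_monomials[symmetric])
  also have "\<dots> = (\<Sum>w\<in>Poly_Mapping.keys a. \<Sum>v\<in>Poly_Mapping.keys b.
     mm n k (smul (Poly_Mapping.lookup a w) (word_op n k g w)) (smul (Poly_Mapping.lookup b v) (word_op n k g v)))"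
    unfolding sum_product free_eval_sum by (intro sum.cong refl *)
  also have "\<dots> = mm n k (free_eval n k g a) (free_eval n k g b)"
    unfolding free_eval_word_op mm_sum_left mm_sum_right by (rule sum.swap)
  finally show ?thesis .
qed

lemma free_eval_scal: "free_eval n k g (scal c) = smul c (idm n k)"
  by (simp add: scal_def free_eval_single)

lemma free_eval_1: "free_eval n k g 1 = idm n k"
  using free_eval_scal[of n k g 1] by (simp add: scal_def smul_simps single_one[symmetric] zero_list_def)

lemma free_eval_gen: "g x \<in> Op n k \<Longrightarrow> free_eval n k g (gen x) = g x"
  by (simp add: gen_def free_eval_single smul_simps)

lemma free_eval_cong:
  assumes "\<And>x. x \<in> X \<Longrightarrow> g x = h x" "a \<in> carrier (free_alg X)"
  shows "free_eval n k g a = free_eval n k h a"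
proof -
  have *: "word_op n k g w = word_op n k h w" if "w \<in> lists X" for w
    using that by (induction w) (use assms(1) in auto)
  show ?thesis
    unfolding free_eval_word_op
  proof (intro sum.cong refl)
    fix w assume "w \<in> Poly_Mapping.keys a"
    then have "w \<in> lists X"
      using assms(2) unfolding in_free_alg by blast
    then show "smul (Poly_Mapping.lookup a w) (word_op n k g w) = smul (Poly_Mapping.lookup a w) (word_op n k h w)"
      by (simp only: *)
  qed
qed

lemma free_eval_hom:
  assumes "\<And>x. x \<in> X \<Longrightarrow> g x \<in> Op n k"
  shows "ring_hom_ring (free_alg X) (End n k) (free_eval n k g)"
  by (rule ring_hom_ringI[OF ring_free_alg ring_End])
    (simp_all add: free_eval_closed[OF assms] free_eval_mult[OF assms] free_eval_add free_eval_1)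

text \<open>
  Relations outside of the free algebra would not generate an ideal of it, so they are required to
  lie in it.
\<close>

locale presentation =
  fixes X :: "'x set" and R :: "('x falg \<times> 'x falg) set"
  assumes rels_closed: "(a, b) \<in> R \<Longrightarrow> a \<in> carrier (free_alg X) \<and> b \<in> carrier (free_alg X)"
begin

sublocale ring "free_alg X"
  by (rule ring_free_alg)

lemma rel_differences: "{a - b | a b. (a, b) \<in> R} \<subseteq> carrier (free_alg X)"
  using rels_closed free_alg_closed(6) by fast

sublocale rel: ideal "pres_ideal X R" "free_alg X"
  unfolding pres_ideal_def by (rule genideal_ideal[OF rel_differences])

lemma pres_class_hom: "pres_class X R \<in> ring_hom (free_alg X) (pres_alg X R)"
proof -
  have "pres_class X R = a_r_coset (free_alg X) (pres_ideal X R)"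
    by (simp add: pres_class_def fun_eq_iff)
  then show ?thesis
    using rel.rcos_ring_hom by (simp add: pres_alg_def)
qed

lemma ring_pres_alg: "ring (pres_alg X R)"
  unfolding pres_alg_def by (rule rel.quotient_is_ring)

lemma in_pres_class: "b \<in> pres_class X R a \<longleftrightarrow> b - a \<in> pres_ideal X R"
proof
  assume "b - a \<in> pres_ideal X R"
  then have "(b - a) + a \<in> pres_class X R a"
    unfolding pres_class_def a_r_coset_def r_coset_def by force
  then show "b \<in> pres_class X R a"
    by simp
qed (auto simp: pres_class_def a_r_coset_def r_coset_def)

lemma carrier_pres_alg: "carrier (pres_alg X R) = pres_class X R ` carrier (free_alg X)"
  by (auto simp: pres_alg_def FactRing_def A_RCOSETS_defs pres_class_def a_r_coset_def)

lemma pres_class_eqI: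
  assumes "a \<in> carrier (free_alg X)" "b \<in> carrier (free_alg X)" "a - b \<in> pres_ideal X R"
  shows "pres_class X R a = pres_class X R b"
proof -
  have "a \<in> pres_class X R b"
    using assms(3) by (simp add: in_pres_class)
  then show ?thesis
    using rel.a_repr_independence' assms(2) unfolding pres_class_def by metis
qed

lemma pres_class_rel:
  assumes "(a, b) \<in> R"
  shows "pres_class X R a = pres_class X R b"
proof (rule pres_class_eqI)
  show "a - b \<in> pres_ideal X R"
    unfolding pres_ideal_def using genideal_self[OF rel_differences] assms by blast
qed (use rels_closed[OF assms] in auto)

lemma pres_class_self: "a \<in> pres_class X R a"
  by (simp add: in_pres_class rel.zero_closed[simplified])

end

text \<open>
  The kernel of the evaluation homomorphism is an ideal. So it contains the ideal of relations as
  soon as it contains the relations, and the evaluation is constant on the cosets.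
\<close>

locale representation = presentation X R for X :: "'x set" and R :: "('x falg \<times> 'x falg) set" +
  fixes n k :: nat and g :: "'x \<Rightarrow> oper"
  assumes gens_closed: "x \<in> X \<Longrightarrow> g x \<in> Op n k"
    and rels_hold: "(a, b) \<in> R \<Longrightarrow> free_eval n k g a = free_eval n k g b"
begin

lemma eval_hom: "ring_hom_ring (free_alg X) (End n k) (free_eval n k g)"
  by (rule free_eval_hom) (rule gens_closed)

lemma eval_closed: "a \<in> carrier (free_alg X) \<Longrightarrow> free_eval n k g a \<in> Op n k"
  by (rule free_eval_closed[OF gens_closed])

lemma eval_mult:
  "a \<in> carrier (free_alg X) \<Longrightarrow> b \<in> carrier (free_alg X) \<Longrightarrow>
    free_eval n k g (a * b) = mm n k (free_eval n k g a) (free_eval n k g b)"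
  by (rule free_eval_mult[OF gens_closed])

lemma free_eval_ideal:
  assumes "a \<in> pres_ideal X R"
  shows "free_eval n k g a = 0"
proof -
  have "{a - b | a b. (a, b) \<in> R} \<subseteq> a_kernel (free_alg X) (End n k) (free_eval n k g)"
    using rel_differences rels_hold by (auto simp: a_kernel_def' free_eval_diff)
  then have "pres_ideal X R \<subseteq> a_kernel (free_alg X) (End n k) (free_eval n k g)"
    unfolding pres_ideal_def by (intro genideal_minimal ring_hom_ring.kernel_is_ideal[OF eval_hom])
  then show ?thesis
    using assms by (auto simp: a_kernel_def')
qed

lemma induced_class [simp]: "induced n k g (pres_class X R a) = free_eval n k g a"
proof -
  have "free_eval n k g b = free_eval n k g a" if "b \<in> pres_class X R a" for b
    using free_eval_ideal[of "b - a"] that by (simp add: in_pres_class free_eval_diff)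
  then have "free_eval n k g ` pres_class X R a = {free_eval n k g a}"
    using pres_class_self[of a] by blast
  then show ?thesis
    by (simp add: induced_def)
qed

lemma induced_hom: "induced n k g \<in> ring_hom (pres_alg X R) (End n k)"
proof -
  have hom: "pres_class X R (a * b) = pres_class X R a \<otimes>\<^bsub>pres_alg X R\<^esub> pres_class X R b"
    "pres_class X R (a + b) = pres_class X R a \<oplus>\<^bsub>pres_alg X R\<^esub> pres_class X R b"
    if "a \<in> carrier (free_alg X)" "b \<in> carrier (free_alg X)" for a b
    using ring_hom_mult[OF pres_class_hom that] ring_hom_add[OF pres_class_hom that] by simp_all
  show ?thesis
  proof (rule ring_hom_memI)
    fix x y assume "x \<in> carrier (pres_alg X R)" "y \<in> carrier (pres_alg X R)"
    then obtain a b where ab: "x = pres_class X R a" "y = pres_class X R b"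
      "a \<in> carrier (free_alg X)" "b \<in> carrier (free_alg X)"
      by (auto simp: carrier_pres_alg)
    show "induced n k g (x \<otimes>\<^bsub>pres_alg X R\<^esub> y) = induced n k g x \<otimes>\<^bsub>End n k\<^esub> induced n k g y"
      using ab by (simp add: eval_mult flip: hom)
    show "induced n k g (x \<oplus>\<^bsub>pres_alg X R\<^esub> y) = induced n k g x \<oplus>\<^bsub>End n k\<^esub> induced n k g y"
      using ab by (simp add: free_eval_add flip: hom)
  next
    fix x assume "x \<in> carrier (pres_alg X R)"
    then show "induced n k g x \<in> Op n k"
      by (auto simp: carrier_pres_alg eval_closed)
  next
    have "pres_class X R 1 = \<one>\<^bsub>pres_alg X R\<^esub>"
      using ring_hom_one[OF pres_class_hom] by simp
    then show "induced n k g \<one>\<^bsub>pres_alg X R\<^esub> = \<one>\<^bsub>End n k\<^esub>"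
      by (simp add: free_eval_1 flip: \<open>pres_class X R 1 = _\<close>)
  qed
qed

end

lemma oper_par_word_op:
  assumes "\<And>x. x \<in> X \<Longrightarrow> oper_par (p x) (g x)" "w \<in> lists X"
  shows "oper_par (word_par p w) (word_op n k g w)"
  using assms(2) by (induction w) (auto simp: word_par_def intro: oper_par_mm assms(1))

lemma (in representation) superalg_action_induced:
  assumes "\<And>x. x \<in> X \<Longrightarrow> oper_par (p x) (g x)"
  shows "superalg_action X R p n k (induced n k g)"
  unfolding superalg_action_def
proof (intro conjI allI ballI induced_hom)
  fix c a assume "a \<in> carrier (free_alg X)"
  then show "induced n k g (pres_class X R (scal c * a)) = smul c (induced n k g (pres_class X R a))"
    by (simp add: eval_mult eval_closed free_alg_closed free_eval_scal mm_smul_left)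
next
  fix d x assume "x \<in> homog X R p d"
  then obtain a where a: "x = pres_class X R a" "Poly_Mapping.keys a \<subseteq> lists X"
    "\<And>w. w \<in> Poly_Mapping.keys a \<Longrightarrow> word_par p w mod 2 = d mod 2"
    by (auto simp: homog_def in_free_alg)
  show "oper_par d (induced n k g x)"
    unfolding a(1) induced_class free_eval_word_op
    by (intro oper_par_sum oper_par_smul oper_par_cong[OF oper_par_word_op[of X p g]] assms a(3))
      (use a(2) in auto)
qed

text \<open>Supercommutation with \<open>M\<close> passes from generators to words, the signs being multiplicative.\<close>

lemma supercommute_word_op:
  assumes "\<And>y. y \<in> Y \<Longrightarrow> h y \<in> Op n k" "M \<in> Op n k"
    and "\<And>y. y \<in> Y \<Longrightarrow> mm n k M (h y) = smul (sg (d * p y)) (mm n k (h y) M)" "v \<in> lists Y"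
  shows "mm n k M (word_op n k h v) = smul (sg (d * word_par p v)) (mm n k (word_op n k h v) M)"
  using assms(4)
proof (induction v)
  case Nil
  then show ?case
    using assms(2) by (simp add: word_par_def smul_simps)
next
  case (Cons y v)
  have "mm n k M (word_op n k h (y # v)) = mm n k (mm n k M (h y)) (word_op n k h v)"
    by (simp add: mm_assoc)
  also have "\<dots> = smul (sg (d * p y)) (mm n k (h y) (mm n k M (word_op n k h v)))"
    using Cons.hyps assms(3) by (simp add: mm_assoc mm_smul_left)
  also have "\<dots> = smul (sg (d * word_par p (y # v))) (mm n k (word_op n k h (y # v)) M)"
    using Cons by (simp add: mm_assoc mm_smul_right smul_simps word_par_def sg_add algebra_simps)
  finally show ?case .
qed

lemma supercommute_free_eval:
  assumes g: "\<And>x. x \<in> X \<Longrightarrow> g x \<in> Op n k" and h: "\<And>y. y \<in> Y \<Longrightarrow> h y \<in> Op n k"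
    and gh: "\<And>x y. x \<in> X \<Longrightarrow> y \<in> Y \<Longrightarrow> mm n k (g x) (h y) = smul (sg (p x * p' y)) (mm n k (h y) (g x))"
    and a: "a \<in> carrier (free_alg X)" "\<And>w. w \<in> Poly_Mapping.keys a \<Longrightarrow> word_par p w mod 2 = d mod 2"
    and b: "b \<in> carrier (free_alg Y)" "\<And>v. v \<in> Poly_Mapping.keys b \<Longrightarrow> word_par p' v mod 2 = e mod 2"
  shows "mm n k (free_eval n k g a) (free_eval n k h b)
    = smul (sg (d * e)) (mm n k (free_eval n k h b) (free_eval n k g a))"
proof -
  have words: "mm n k (word_op n k g w) (word_op n k h v)
    = smul (sg (d * e)) (mm n k (word_op n k h v) (word_op n k g w))"
    if "w \<in> Poly_Mapping.keys a" "v \<in> Poly_Mapping.keys b" for w v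
  proof -
    have w: "w \<in> lists X" and v: "v \<in> lists Y"
      using that a(1) b(1) by (auto simp: in_free_alg)
    have "mm n k (h y) (word_op n k g w) = smul (sg (p' y * word_par p w)) (mm n k (word_op n k g w) (h y))"
      if "y \<in> Y" for y
      by (rule supercommute_word_op[OF g h[OF that] _ w])
        (simp_all add: gh that smul_simps mult.commute)
    then have "mm n k (word_op n k g w) (h y) = smul (sg (word_par p w * p' y)) (mm n k (h y) (word_op n k g w))"
      if "y \<in> Y" for y
      using that by (simp add: smul_simps mult.commute)
    from supercommute_word_op[OF h word_op_closed[OF g w] this v]
    have "mm n k (word_op n k g w) (word_op n k h v)
      = smul (sg (word_par p w * word_par p' v)) (mm n k (word_op n k h v) (word_op n k g w))"
      by simp
    moreover have "sg (word_par p w * word_par p' v) = sg (d * e)"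
      by (intro sg_mod_cong mod_mult_cong a(2) b(2) that)
    ultimately show ?thesis
      by simp
  qed
  have expand: "mm n k (free_eval n k f c) (free_eval n k f' c')
    = (\<Sum>w\<in>Poly_Mapping.keys c. \<Sum>v\<in>Poly_Mapping.keys c'.
        smul (Poly_Mapping.lookup c w * Poly_Mapping.lookup c' v) (mm n k (word_op n k f w) (word_op n k f' v)))"
    for f :: "'y \<Rightarrow> oper" and f' :: "'z \<Rightarrow> oper" and c c'
  proof -
    have "mm n k (smul s A) (smul t B) = smul (s * t) (mm n k A B)" for s t A B
      by (simp add: mm_smul_left mm_smul_right smul_simps mult.commute)
    moreover have "mm n k (free_eval n k f c) (free_eval n k f' c')
      = (\<Sum>w\<in>Poly_Mapping.keys c. mm n k (smul (Poly_Mapping.lookup c w) (word_op n k f w)) (free_eval n k f' c'))"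
      unfolding free_eval_word_op[of n k f] by (rule mm_sum_left)
    ultimately show ?thesis
      by (simp only: free_eval_word_op[of n k f'] mm_sum_right)
  qed
  have "mm n k (free_eval n k g a) (free_eval n k h b)
    = (\<Sum>v\<in>Poly_Mapping.keys b. \<Sum>w\<in>Poly_Mapping.keys a.
        smul (Poly_Mapping.lookup a w * Poly_Mapping.lookup b v) (mm n k (word_op n k g w) (word_op n k h v)))"
    unfolding expand by (rule sum.swap)
  also have "\<dots> = (\<Sum>v\<in>Poly_Mapping.keys b. \<Sum>w\<in>Poly_Mapping.keys a.
        smul (sg (d * e)) (smul (Poly_Mapping.lookup b v * Poly_Mapping.lookup a w)
          (mm n k (word_op n k h v) (word_op n k g w))))"
    by (intro sum.cong refl) (simp add: words smul_simps mult_ac)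
  also have "\<dots> = smul (sg (d * e)) (mm n k (free_eval n k h b) (free_eval n k g a))"
    unfolding expand smul_sum ..
  finally show ?thesis .
qed

lemma lookup_twist:
  "Poly_Mapping.lookup (twist p d a) w = sg (d * word_par p w) * Poly_Mapping.lookup a w"
  by (auto simp: twist_def lookup_mapp when_def in_keys_iff)

lemma keys_twist: "Poly_Mapping.keys (twist p d a) = Poly_Mapping.keys a"
  by (auto simp: in_keys_iff lookup_twist)

text \<open>The parity involution of the algebra becomes conjugation with the parity operator.\<close>

lemma free_eval_twist:
  assumes "\<And>x. x \<in> X \<Longrightarrow> oper_par (p x) (g x)" "a \<in> carrier (free_alg X)"
  shows "free_eval n k g (twist p d a) w w' = sg (d * (wpar w + wpar w')) * free_eval n k g a w w'"
proof -
  have "sg (d * word_par p v) * word_op n k g v w w' = sg (d * (wpar w + wpar w')) * word_op n k g v w w'"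
    if "v \<in> Poly_Mapping.keys a" for v
  proof (cases "word_op n k g v w w' = 0")
    case False
    have "v \<in> lists X"
      using that assms(2) by (auto simp: in_free_alg)
    then have "(wpar w + wpar w') mod 2 = word_par p v mod 2"
      using oper_par_word_op[of X p g v n k] assms(1) False by (auto simp: oper_par_def)
    then have "sg (d * (wpar w + wpar w')) = sg (d * word_par p v)"
      by (intro sg_mod_cong mod_mult_cong refl)
    then show ?thesis
      by simp
  qed auto
  then show ?thesis
    unfolding free_eval_word_op keys_twist sum_fun_app sum_distrib_left
    by (intro sum.cong) (auto simp: lookup_twist smul_def mult_ac)
qed

section \<open>Entries of operators on two and three factors\<close>

declare One_nat_def [simp del]

lemma sg_1 [simp]: "sg 1 = - 1"
  by (simp add: sg_def)

lemma sum_single: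
  assumes "finite A" "a \<in> A" "\<And>i. i \<in> A \<Longrightarrow> i \<noteq> a \<Longrightarrow> f i = 0"
  shows "sum f A = f a"
proof -
  have "sum f A = sum f {a}"
    by (rule sum.mono_neutral_right) (use assms in auto)
  then show ?thesis
    by simp
qed

lemma sum2_single:
  assumes "finite A" "\<And>i. i \<in> A \<Longrightarrow> finite (B i)"
    and "\<And>i j. i \<in> A \<Longrightarrow> j \<in> B i \<Longrightarrow> i \<noteq> a \<or> j \<noteq> b \<Longrightarrow> f i j = 0"
  shows "(\<Sum>i\<in>A. \<Sum>j\<in>B i. f i j) = (if a \<in> A \<and> b \<in> B a then f a b else 0)"
proof -
  have inner: "(\<Sum>j\<in>B i. f i j) = (if i = a \<and> b \<in> B a then f a b else 0)" if "i \<in> A" for i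
  proof (cases "i = a \<and> b \<in> B a")
    case True
    then show ?thesis
      using assms(3)[OF that] that assms(2) by (simp add: sum_single[of _ b])
  next
    case False
    then show ?thesis
      using assms(3)[OF that] by (auto intro!: sum.neutral)
  qed
  show ?thesis
  proof (cases "a \<in> A")
    case True
    then show ?thesis
      using assms(1) by (simp add: inner sum_single[of _ a] cong: sum.cong)
  next
    case False
    then show ?thesis
      by (auto intro!: sum.neutral simp: inner)
  qed
qed

lemma sum2_pick:
  fixes F :: "'a \<Rightarrow> 'a \<Rightarrow> 'c :: comm_semiring_1"
  assumes "finite A" "x \<in> A" "y \<in> A"
  shows "(\<Sum>u\<in>A. \<Sum>v\<in>A. F u v * (of_bool (u = x \<and> v = y) * c)) = c * F x y"
proof -
  have "(\<Sum>u\<in>A. \<Sum>v\<in>A. F u v * (of_bool (u = x \<and> v = y) * c))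
    = (\<Sum>u\<in>A. if u = x then (\<Sum>v\<in>A. if v = y then F x y * c else 0) else 0)"
    by (intro sum.cong refl) (auto intro!: sum.cong)
  also have "\<dots> = F x y * c"
    using assms by simp
  finally show ?thesis
    by (simp only: mult.commute)
qed

lemma words_2: "[a, b] \<in> words n 2 \<longleftrightarrow> a \<in> idx n \<and> b \<in> idx n"
  and words_3: "[a, b, c] \<in> words n 3 \<longleftrightarrow> a \<in> idx n \<and> b \<in> idx n \<and> c \<in> idx n"
  and words_4: "[a, b, c, d] \<in> words n 4 \<longleftrightarrow> a \<in> idx n \<and> b \<in> idx n \<and> c \<in> idx n \<and> d \<in> idx n"
  and words_1': "[a] \<in> words n 1 \<longleftrightarrow> a \<in> idx n"
  by (auto simp: words_def)

lemma sum_words_2: "(\<Sum>w\<in>words n 2. f w) = (\<Sum>a\<in>idx n. \<Sum>b\<in>idx n. f [a, b])"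
  by (simp add: numeral_2_eq_2 sum_words_Suc)

lemma words_1E:
  assumes "w \<in> words n 1"
  obtains a where "w = [a]" "a \<in> idx n"
  using assms by (auto simp: words_1 One_nat_def)

lemma words_2E:
  assumes "w \<in> words n 2"
  obtains a b where "w = [a, b]" "a \<in> idx n" "b \<in> idx n"
proof -
  have "w \<in> words n (Suc 1)"
    using assms by (simp add: numeral_2_eq_2 One_nat_def)
  then show ?thesis
    by (elim words_SucE words_1E) (use that in auto)
qed

lemma words_3E:
  assumes "w \<in> words n 3"
  obtains a b c where "w = [a, b, c]" "a \<in> idx n" "b \<in> idx n" "c \<in> idx n"
proof -
  have "3 = Suc 2"
    by simp
  then have "w \<in> words n (Suc 2)"
    using assms by (simp only:)
  then show ?thesis
    by (elim words_SucE words_2E) (use that in auto)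
qed

lemma words_4E:
  assumes "w \<in> words n 4"
  obtains a b c d where "w = [a, b, c, d]" "a \<in> idx n" "b \<in> idx n" "c \<in> idx n" "d \<in> idx n"
proof -
  have "4 = Suc 3"
    by simp
  then have "w \<in> words n (Suc 3)"
    using assms by (simp only:)
  then show ?thesis
    by (elim words_SucE words_3E) (use that in auto)
qed

lemma Op2_eqI:
  assumes "M \<in> Op n 2" "N \<in> Op n 2"
    and "\<And>x y a b. x \<in> idx n \<Longrightarrow> y \<in> idx n \<Longrightarrow> a \<in> idx n \<Longrightarrow> b \<in> idx n \<Longrightarrow> M [x, y] [a, b] = N [x, y] [a, b]"
  shows "M = N"
  by (rule Op_eqI[OF assms(1,2)]) (auto elim!: words_2E intro: assms(3))

lemma Op3_eqI:
  assumes "M \<in> Op n 3" "N \<in> Op n 3"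
    and "\<And>x y z a b c. x \<in> idx n \<Longrightarrow> y \<in> idx n \<Longrightarrow> z \<in> idx n \<Longrightarrow> a \<in> idx n \<Longrightarrow> b \<in> idx n \<Longrightarrow> c \<in> idx n \<Longrightarrow>
      M [x, y, z] [a, b, c] = N [x, y, z] [a, b, c]"
  shows "M = N"
  by (rule Op_eqI[OF assms(1,2)]) (auto elim!: words_3E intro: assms(3))

lemma Op4_eqI:
  assumes "M \<in> Op n 4" "N \<in> Op n 4"
    and "\<And>x y z w a b c d. x \<in> idx n \<Longrightarrow> y \<in> idx n \<Longrightarrow> z \<in> idx n \<Longrightarrow> w \<in> idx n \<Longrightarrow>
      a \<in> idx n \<Longrightarrow> b \<in> idx n \<Longrightarrow> c \<in> idx n \<Longrightarrow> d \<in> idx n \<Longrightarrow>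
      M [x, y, z, w] [a, b, c, d] = N [x, y, z, w] [a, b, c, d]"
  shows "M = N"
  by (rule Op_eqI[OF assms(1,2)]) (auto elim!: words_4E intro: assms(3))

lemma mm_pad_right:
  assumes "x \<in> words n a" "c \<in> words n k" "y \<in> words n b" "m = a + (k + b)"
  shows "mm n m N (pad n a k M b) w (x @ c @ y)
    = (\<Sum>u\<in>words n k. sg ((wpar u + wpar c) * wpar x) * N w (x @ u @ y) * M u c)"
proof -
  have "mm n m N (pad n a k M b) w (x @ c @ y)
    = (\<Sum>x'\<in>words n a. \<Sum>u\<in>words n k. \<Sum>y'\<in>words n b.
        N w (x' @ u @ y') * (of_bool (x' = x \<and> y' = y) * sg ((wpar u + wpar c) * wpar x') * M u c))"
    unfolding mm_def assms(4) sum_words_append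
    by (intro sum.cong refl, subst pad_app[where b = b]) (use assms in \<open>auto simp: length_words\<close>)
  also have "\<dots> = (\<Sum>u\<in>words n k. \<Sum>y'\<in>words n b.
        N w (x @ u @ y') * (of_bool (x = x \<and> y' = y) * sg ((wpar u + wpar c) * wpar x) * M u c))"
    by (rule sum_single) (use assms in auto)
  also have "\<dots> = (\<Sum>u\<in>words n k. N w (x @ u @ y) * (of_bool (x = x \<and> y = y) * sg ((wpar u + wpar c) * wpar x) * M u c))"
    by (intro sum.cong refl sum_single) (use assms in auto)
  finally show ?thesis
    by (simp add: mult_ac)
qed

lemma mm_pad_left:
  assumes "x \<in> words n a" "c \<in> words n k" "y \<in> words n b" "m = a + (k + b)"
  shows "mm n m (pad n a k M b) N (x @ c @ y) w
    = (\<Sum>u\<in>words n k. sg ((wpar c + wpar u) * wpar x) * M c u * N (x @ u @ y) w)"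
proof -
  have "mm n m (pad n a k M b) N (x @ c @ y) w
    = (\<Sum>x'\<in>words n a. \<Sum>u\<in>words n k. \<Sum>y'\<in>words n b.
        (of_bool (x = x' \<and> y = y') * sg ((wpar c + wpar u) * wpar x) * M c u) * N (x' @ u @ y') w)"
    unfolding mm_def assms(4) sum_words_append
    by (intro sum.cong refl, subst pad_app[where b = b]) (use assms in \<open>auto simp: length_words\<close>)
  also have "\<dots> = (\<Sum>u\<in>words n k. \<Sum>y'\<in>words n b.
        (of_bool (x = x \<and> y = y') * sg ((wpar c + wpar u) * wpar x) * M c u) * N (x @ u @ y') w)"
    by (rule sum_single) (use assms in auto)
  also have "\<dots> = (\<Sum>u\<in>words n k.
        (of_bool (x = x \<and> y = y) * sg ((wpar c + wpar u) * wpar x) * M c u) * N (x @ u @ y) w)"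
    by (intro sum.cong refl sum_single) (use assms in auto)
  finally show ?thesis
    by (simp add: mult_ac)
qed

lemma even_sg_entry:
  assumes "oper_par 0 M"
  shows "sg ((par x + par y + (par a + par b)) * d) * (z * M [x, y] [a, b]) = z * M [x, y] [a, b]"
proof (cases "M [x, y] [a, b] = 0")
  case False
  then show ?thesis
    using oper_par_odd_even[OF assms False] by (simp add: sg_even_mult del: even_add)
qed simp

text \<open>
  Even operators on two adjacent factors act without signs. The following are the entries of
  words of length one and three in such operators.
\<close>

lemma mm_pad_12:
  assumes "oper_par 0 M" "a \<in> idx n" "b \<in> idx n" "c \<in> idx n"
  shows "mm n 3 N (pad n 0 2 M 1) w [a, b, c] = (\<Sum>u\<in>idx n. \<Sum>v\<in>idx n. N w [u, v, c] * M [u, v] [a, b])"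
  using mm_pad_right[of "[]" n 0 "[a, b]" 2 "[c]" 1 3 N M w] assms
  by (simp add: words_2 words_1' sum_words_2)

lemma mm_pad_23:
  assumes "oper_par 0 M" "a \<in> idx n" "b \<in> idx n" "c \<in> idx n"
  shows "mm n 3 N (pad n 1 2 M 0) w [a, b, c] = (\<Sum>u\<in>idx n. \<Sum>v\<in>idx n. N w [a, u, v] * M [u, v] [b, c])"
  using mm_pad_right[of "[a]" n 1 "[b, c]" 2 "[]" 0 3 N M w] assms
  by (simp add: words_2 words_1' sum_words_2 mult.assoc even_sg_entry)

lemma pad_12:
  assumes "oper_par 0 M" "x \<in> idx n" "y \<in> idx n" "z \<in> idx n" "a \<in> idx n" "b \<in> idx n" "c \<in> idx n"
  shows "pad n 0 2 M 1 [x, y, z] [a, b, c] = of_bool (z = c) * M [x, y] [a, b]"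
  using pad_app_even[OF assms(1), of "[]" n 0 "[]" "[x, y]" 2 "[a, b]" "[z]" 1 "[c]"] assms
  by (simp add: words_1')

lemma pad_23:
  assumes "oper_par 0 M" "x \<in> idx n" "y \<in> idx n" "z \<in> idx n" "a \<in> idx n" "b \<in> idx n" "c \<in> idx n"
  shows "pad n 1 2 M 0 [x, y, z] [a, b, c] = of_bool (x = a) * M [y, z] [b, c]"
  using pad_app_even[OF assms(1), of "[x]" n 1 "[a]" "[y, z]" 2 "[b, c]" "[]" 0 "[]"] assms
  by (simp add: words_1')

lemma triple_12_23_12:
  assumes "oper_par 0 A" "oper_par 0 B" "oper_par 0 M"
    and "x \<in> idx n" "y \<in> idx n" "z \<in> idx n" "a \<in> idx n" "b \<in> idx n" "c \<in> idx n"
  shows "mm n 3 (pad n 0 2 A 1) (mm n 3 (pad n 1 2 B 0) (pad n 0 2 M 1)) [x, y, z] [a, b, c]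
    = (\<Sum>u\<in>idx n. \<Sum>v\<in>idx n. \<Sum>m\<in>idx n. A [x, y] [u, m] * B [m, z] [v, c] * M [u, v] [a, b])"
proof -
  have "(\<Sum>p\<in>idx n. \<Sum>r\<in>idx n. pad n 0 2 A 1 [x, y, z] [u, p, r] * B [p, r] [v, c])
    = (\<Sum>m\<in>idx n. A [x, y] [u, m] * B [m, z] [v, c])" if "u \<in> idx n" for u v
  proof (intro sum.cong refl)
    fix p assume p: "p \<in> idx n"
    have "(\<Sum>r\<in>idx n. pad n 0 2 A 1 [x, y, z] [u, p, r] * B [p, r] [v, c])
      = pad n 0 2 A 1 [x, y, z] [u, p, z] * B [p, z] [v, c]"
      by (rule sum_single) (use assms that p in \<open>auto simp: pad_12[OF assms(1)]\<close>)
    then show "(\<Sum>r\<in>idx n. pad n 0 2 A 1 [x, y, z] [u, p, r] * B [p, r] [v, c]) = A [x, y] [u, p] * B [p, z] [v, c]"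
      using assms that p by (simp add: pad_12[OF assms(1)])
  qed
  then show ?thesis
    using assms by (simp add: mm_assoc[symmetric] mm_pad_12 mm_pad_23 sum_distrib_right)
qed

lemma triple_23_12_23:
  assumes "oper_par 0 A" "oper_par 0 B" "oper_par 0 M"
    and "x \<in> idx n" "y \<in> idx n" "z \<in> idx n" "a \<in> idx n" "b \<in> idx n" "c \<in> idx n"
  shows "mm n 3 (pad n 1 2 A 0) (mm n 3 (pad n 0 2 B 1) (pad n 1 2 M 0)) [x, y, z] [a, b, c]
    = (\<Sum>u\<in>idx n. \<Sum>v\<in>idx n. \<Sum>m\<in>idx n. A [y, z] [m, v] * B [x, m] [a, u] * M [u, v] [b, c])"
proof -
  have "(\<Sum>p\<in>idx n. \<Sum>r\<in>idx n. pad n 1 2 A 0 [x, y, z] [p, r, v] * B [p, r] [a, u])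
    = (\<Sum>m\<in>idx n. A [y, z] [m, v] * B [x, m] [a, u])" if "v \<in> idx n" for u v
  proof -
    have "(\<Sum>p\<in>idx n. \<Sum>r\<in>idx n. pad n 1 2 A 0 [x, y, z] [p, r, v] * B [p, r] [a, u])
      = (\<Sum>r\<in>idx n. pad n 1 2 A 0 [x, y, z] [x, r, v] * B [x, r] [a, u])"
      by (rule sum_single) (use assms that in \<open>auto simp: pad_23[OF assms(1)]\<close>)
    also have "\<dots> = (\<Sum>m\<in>idx n. A [y, z] [m, v] * B [x, m] [a, u])"
      using assms that by (intro sum.cong) (auto simp: pad_23[OF assms(1)])
    finally show ?thesis .
  qed
  then show ?thesis
    using assms by (simp add: mm_assoc[symmetric] mm_pad_12 mm_pad_23 sum_distrib_right)
qed

lemma even2I: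
  assumes "M \<in> Op n 2"
    and "\<And>x y a b. x \<in> idx n \<Longrightarrow> y \<in> idx n \<Longrightarrow> a \<in> idx n \<Longrightarrow> b \<in> idx n \<Longrightarrow> M [x, y] [a, b] \<noteq> 0 \<Longrightarrow>
      even (par x + par y + par a + par b)"
  shows "oper_par 0 M"
  unfolding oper_par_def
proof (intro allI impI)
  fix w w' assume nz: "M w w' \<noteq> 0"
  then have "w \<in> words n 2" "w' \<in> words n 2"
    using assms(1) by (auto simp: Op_iff)
  then obtain x y a b where *: "w = [x, y]" "w' = [a, b]" "x \<in> idx n" "y \<in> idx n" "a \<in> idx n" "b \<in> idx n"
    by (elim words_2E)
  then have "even (par x + par y + par a + par b)"
    using nz assms(2) by blast
  then show "(wpar w + wpar w') mod 2 = 0 mod 2"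
    using * by (simp add: add_ac even_iff_mod_2_eq_zero del: even_add)
qed

section \<open>The braiding of the vector representation\<close>

lemma qq_nonzero [simp]: "qq \<noteq> 0"
  by (simp add: qq_def Zero_fract_def eq_fract)

lemma E_closed: "i \<in> idx n \<Longrightarrow> j \<in> idx n \<Longrightarrow> E i j \<in> Op n 1"
  by (rule OpI) (auto simp: E_def words_1' split: if_splits)

lemma EE_closed: "i \<in> idx n \<Longrightarrow> j \<in> idx n \<Longrightarrow> k \<in> idx n \<Longrightarrow> l \<in> idx n \<Longrightarrow> EE i j k l \<in> Op n 2"
  using mten_closed[OF E_closed E_closed] by simp

lemma EE_app:
  "EE i j k l [x, y] [a, b] = of_bool (x = i \<and> a = j \<and> y = k \<and> b = l) * sg ((par k + par l) * par j)"
  by (auto simp: mten_def E_def One_nat_def)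

lemma Op2_sum: "(\<And>i j. i \<in> A \<Longrightarrow> j \<in> B i \<Longrightarrow> f i j \<in> Op n k) \<Longrightarrow> (\<Sum>i\<in>A. \<Sum>j\<in>B i. f i j) \<in> Op n k"
  by (intro Op_sum) auto

lemma P_closed: "P_op n \<in> Op n 2"
  unfolding P_op_def by (intro Op2_sum Op_smul EE_closed) auto

lemma S_closed: "S_op n \<in> Op n 2"
  unfolding S_op_def mten_add_left by (intro Op_add Op_smul Op2_sum EE_closed) auto

lemma P_app:
  assumes "x \<in> idx n" "y \<in> idx n" "a \<in> idx n" "b \<in> idx n"
  shows "P_op n [x, y] [a, b] = of_bool (x = b \<and> y = a) * sg (par a * par b)"
proof -
  have "P_op n [x, y] [a, b] = (\<Sum>i\<in>idx n. \<Sum>j\<in>idx n. sg (par j) * EE i j j i [x, y] [a, b])"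
    by (simp only: P_op_def sum_fun_app smul_def)
  also have "\<dots> = sg (par a) * EE b a a b [x, y] [a, b]"
    by (subst sum2_single[where a = b and b = a]) (use assms in \<open>auto simp: EE_app\<close>)
  finally show ?thesis
    by (auto simp: EE_app sg_eq)
qed

lemma S_app:
  assumes "x \<in> idx n" "y \<in> idx n" "a \<in> idx n" "b \<in> idx n"
  shows "S_op n [x, y] [a, b]
    = of_bool (x = a \<and> y = b) * qq powi ((of_bool (a = b) + of_bool (a = - b)) * (1 - 2 * int (par b)))
    + of_bool (x = b \<and> y = a \<and> a < b) * (xi * sg (par a * par b))
    + of_bool (x = - b \<and> y = - a \<and> 0 < a + b) * (- xi * sg (par a * par b + par a))"
proof -
  let ?c = "\<lambda>i j. qq powi ((of_bool (i = j) + of_bool (i = - j)) * (1 - 2 * int (par j)))"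
  have "(\<Sum>i\<in>idx n. \<Sum>j\<in>idx n. ?c i j * EE i i j j [x, y] [a, b]) = ?c a b * EE a a b b [x, y] [a, b]"
    by (subst sum2_single[where a = a and b = b]) (use assms in \<open>auto simp: EE_app\<close>)
  moreover have "(\<Sum>i\<in>idx n. \<Sum>j\<in>{j \<in> idx n. i < j}. sg (par i) * (EE j i i j [x, y] [a, b] + EE (- j) (- i) i j [x, y] [a, b]))
    = (if y < b then sg (par y) * (EE b y y b [x, y] [a, b] + EE (- b) (- y) y b [x, y] [a, b]) else 0)"
    by (subst sum2_single[where a = y and b = b]) (use assms in \<open>auto simp: EE_app\<close>)
  ultimately have "S_op n [x, y] [a, b] = ?c a b * EE a a b b [x, y] [a, b]
    + xi * (if y < b then sg (par y) * (EE b y y b [x, y] [a, b] + EE (- b) (- y) y b [x, y] [a, b]) else 0)"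
    by (simp only: S_op_def mten_add_left sum_fun_app smul_def plus_fun_apply)
  moreover have "- y = a \<longleftrightarrow> y = - a"
    by auto
  ultimately show ?thesis
    using assms[THEN idx_nonzero] by (auto simp: EE_app sg_eq par_def)
qed

definition R_op :: "nat \<Rightarrow> oper" where
  "R_op n = mm n 2 (P_op n) (S_op n)"

text \<open>
  The coefficient of the graded flip in the braiding.
\<close>

definition flip_c :: "int \<Rightarrow> int \<Rightarrow> kq" where
  "flip_c a b = sg (par a * par b) * qq powi ((of_bool (a = b) + of_bool (a = - b)) * (1 - 2 * int (par b)))"

lemma R_closed [simp]: "R_op n \<in> Op n 2"
  unfolding R_op_def by (rule mm_closed[OF P_closed S_closed])

lemma mm_P_left:
  assumes "x \<in> idx n" "y \<in> idx n"
  shows "mm n 2 (P_op n) N [x, y] w = sg (par x * par y) * N [y, x] w"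
proof -
  have "mm n 2 (P_op n) N [x, y] w = (\<Sum>u\<in>idx n. \<Sum>v\<in>idx n. P_op n [x, y] [u, v] * N [u, v] w)"
    by (simp only: mm_def sum_words_2)
  also have "\<dots> = P_op n [x, y] [y, x] * N [y, x] w"
    by (subst sum2_single[where a = y and b = x]) (use assms in \<open>auto simp: P_app\<close>)
  finally show ?thesis
    using assms by (simp add: P_app mult.commute)
qed

text \<open>
  The vector \<open>v\<^sub>a \<otimes> v\<^sub>b\<close> goes to a multiple of \<open>v\<^sub>b \<otimes> v\<^sub>a\<close>, plus \<open>\<xi> v\<^sub>a \<otimes> v\<^sub>b\<close> if \<open>a < b\<close>, plus
  \<open>\<plusminus> \<xi> v\<^bsub>-a\<^esub> \<otimes> v\<^bsub>-b\<^esub>\<close> if \<open>a + b > 0\<close>.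
\<close>

lemma R_app:
  assumes "x \<in> idx n" "y \<in> idx n" "a \<in> idx n" "b \<in> idx n"
  shows "R_op n [x, y] [a, b] = of_bool (x = b \<and> y = a) * flip_c a b
    + of_bool (x = a \<and> y = b) * (if a < b then xi else 0)
    + of_bool (x = - a \<and> y = - b) * (if 0 < a + b then xi * sg (par b) else 0)"
  unfolding R_op_def
  using assms[THEN idx_nonzero]
  by (auto simp: mm_P_left S_app assms flip_c_def sg_eq par_def)

lemma R_row:
  assumes "a \<in> idx n" "b \<in> idx n"
  shows "(\<Sum>u\<in>idx n. \<Sum>v\<in>idx n. F u v * R_op n [u, v] [a, b])
    = flip_c a b * F b a + (if a < b then xi else 0) * F a b
      + (if 0 < a + b then xi * sg (par b) else 0) * F (- a) (- b)"
proof -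
  have "(\<Sum>u\<in>idx n. \<Sum>v\<in>idx n. F u v * R_op n [u, v] [a, b])
    = (\<Sum>u\<in>idx n. \<Sum>v\<in>idx n. F u v * (of_bool (u = b \<and> v = a) * flip_c a b)
      + F u v * (of_bool (u = a \<and> v = b) * (if a < b then xi else 0))
      + F u v * (of_bool (u = - a \<and> v = - b) * (if 0 < a + b then xi * sg (par b) else 0)))"
  proof (intro sum.cong refl)
    fix u v assume "u \<in> idx n" "v \<in> idx n"
    note R = R_app[OF this assms]
    show "F u v * R_op n [u, v] [a, b] = F u v * (of_bool (u = b \<and> v = a) * flip_c a b)
      + F u v * (of_bool (u = a \<and> v = b) * (if a < b then xi else 0))
      + F u v * (of_bool (u = - a \<and> v = - b) * (if 0 < a + b then xi * sg (par b) else 0))"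
      unfolding R distrib_left by (rule refl)
  qed
  also have "\<dots> = flip_c a b * F b a + (if a < b then xi else 0) * F a b
      + (if 0 < a + b then xi * sg (par b) else 0) * F (- a) (- b)"
    unfolding sum.distrib by (intro arg_cong2[where f = "(+)"] sum2_pick) (simp_all add: assms)
  finally show ?thesis .
qed

lemma R_even [simp]: "oper_par 0 (R_op n)"
proof (rule even2I[OF R_closed])
  fix x y a b assume *: "x \<in> idx n" "y \<in> idx n" "a \<in> idx n" "b \<in> idx n" "R_op n [x, y] [a, b] \<noteq> 0"
  have "R_op n [x, y] [a, b] = 0"
    if "\<not> (x = b \<and> y = a)" "\<not> (x = a \<and> y = b)" "\<not> (x = - a \<and> y = - b)"
    unfolding R_app[OF *(1-4)] using that by (simp only: of_bool_eq mult_zero_left add_0 simp_thms)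
  then have "x = b \<and> y = a \<or> x = a \<and> y = b \<or> x = - a \<and> y = - b"
    using *(5) by argo
  moreover have "par (- a) + par a = 1" "par (- b) + par b = 1"
    using *(3,4)[THEN idx_nonzero] by (simp_all add: par_def)
  ultimately have "par x + par y + par a + par b = 2 * (par a + par b) \<or> par x + par y + par a + par b = 2"
    by (elim disjE conjE) (simp_all only: mult_2, linarith+)
  then show "even (par x + par y + par a + par b)"
    by (elim disjE) (simp_all only: dvd_triv_left dvd_refl)
qed

lemma flip_c_cases:
  assumes "a \<noteq> 0" "b \<noteq> 0"
  shows "flip_c a b = (if a = b then (if 0 < a then qq else - inverse qq)
    else if a = - b then (if 0 < b then qq else inverse qq)
    else if a < 0 \<and> b < 0 then - 1 else 1)"
  using assms by (auto simp: flip_c_def par_def power_int_minus)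

lemma sg_par_cases: "0 < a \<Longrightarrow> sg (par a) = 1" "a < 0 \<Longrightarrow> sg (par a) = - 1"
  by (auto simp: par_def)

lemma qq_cancel: "qq * (inverse qq * z) = z" "inverse qq * (qq * z) = z" "qq * inverse qq = 1" "inverse qq * qq = 1"
  by (simp_all add: field_simps)

lemma signed_order_cases:
  fixes a b :: int
  assumes "a \<noteq> 0" "b \<noteq> 0"
  obtains "a = b" "0 < b" | "a = b" "b < 0" | "a = - b" "0 < b" | "a = - b" "b < 0"
  | "0 < a" "0 < b" "a < b" | "0 < a" "0 < b" "b < a"
  | "0 < a" "b < 0" "a < - b" | "0 < a" "b < 0" "- b < a"
  | "a < 0" "0 < b" "- a < b" | "a < 0" "0 < b" "b < - a"
  | "a < 0" "b < 0" "a < b" | "a < 0" "b < 0" "b < a"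
proof -
  have "(a = b \<and> 0 < b) \<or> (a = b \<and> b < 0) \<or> (a = - b \<and> 0 < b) \<or> (a = - b \<and> b < 0)
    \<or> (0 < a \<and> 0 < b \<and> a < b) \<or> (0 < a \<and> 0 < b \<and> b < a)
    \<or> (0 < a \<and> b < 0 \<and> a < - b) \<or> (0 < a \<and> b < 0 \<and> - b < a)
    \<or> (a < 0 \<and> 0 < b \<and> - a < b) \<or> (a < 0 \<and> 0 < b \<and> b < - a)
    \<or> (a < 0 \<and> b < 0 \<and> a < b) \<or> (a < 0 \<and> b < 0 \<and> b < a)"
    using assms by (smt (verit))
  then show ?thesis
    by (elim disjE conjE) (rule that; assumption)+
qed

lemma R_quad: "mm n 2 (R_op n) (R_op n) = smul xi (R_op n) + idm n 2"
proof (rule Op2_eqI)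
  fix x y a b assume *: "x \<in> idx n" "y \<in> idx n" "a \<in> idx n" "b \<in> idx n"
  have "mm n 2 (R_op n) (R_op n) [x, y] [a, b]
    = flip_c a b * R_op n [x, y] [b, a] + (if a < b then xi else 0) * R_op n [x, y] [a, b]
      + (if 0 < a + b then xi * sg (par b) else 0) * R_op n [x, y] [- a, - b]"
    unfolding mm_def sum_words_2 by (rule R_row[OF *(3,4)])
  also have "\<dots> = xi * R_op n [x, y] [a, b] + of_bool (x = a \<and> y = b)"
    using *
    by (cases rule: signed_order_cases[OF *(3,4)[THEN idx_nonzero]])
      (simp_all add: R_app flip_c_cases idx_nonzero sg_par_cases xi_def algebra_simps qq_cancel)
  finally show "mm n 2 (R_op n) (R_op n) [x, y] [a, b] = (smul xi (R_op n) + idm n 2) [x, y] [a, b]"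
    using * by (simp add: smul_def idm_app words_2)
qed (intro mm_closed Op_add Op_smul R_closed idm_closed)+


text \<open>
  The braid relation is an identity between two operators applied to a row vector, i.e. to a
  function of three indices; this is how the operator of the first two factors acts on it.
\<close>

definition row_12 :: "(int \<Rightarrow> int \<Rightarrow> int \<Rightarrow> kq) \<Rightarrow> int \<Rightarrow> int \<Rightarrow> int \<Rightarrow> kq" where
  "row_12 F a b c = flip_c a b * F b a c + (if a < b then xi else 0) * F a b c
    + (if 0 < a + b then xi * sg (par b) else 0) * F (- a) (- b) c"

definition row_23 :: "(int \<Rightarrow> int \<Rightarrow> int \<Rightarrow> kq) \<Rightarrow> int \<Rightarrow> int \<Rightarrow> int \<Rightarrow> kq" where
  "row_23 F a b c = flip_c b c * F a c b + (if b < c then xi else 0) * F a b c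
    + (if 0 < b + c then xi * sg (par c) else 0) * F a (- b) (- c)"

lemma row_cong:
  assumes "\<And>a b c. a \<in> idx n \<Longrightarrow> b \<in> idx n \<Longrightarrow> c \<in> idx n \<Longrightarrow> F a b c = G a b c"
    and "a \<in> idx n" "b \<in> idx n" "c \<in> idx n"
  shows "row_12 F a b c = row_12 G a b c" "row_23 F a b c = row_23 G a b c"
  by (simp_all only: row_12_def row_23_def assms uminus_in_idx)

lemma mm_R_row:
  assumes "a \<in> idx n" "b \<in> idx n" "c \<in> idx n"
  shows "mm n 3 N (pad n 0 2 (R_op n) 1) w [a, b, c] = row_12 (\<lambda>a b c. N w [a, b, c]) a b c"
    and "mm n 3 N (pad n 1 2 (R_op n) 0) w [a, b, c] = row_23 (\<lambda>a b c. N w [a, b, c]) a b c"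
  by (simp_all only: mm_pad_12[OF R_even assms] mm_pad_23[OF R_even assms] row_12_def row_23_def
      R_row[OF assms(1,2)] R_row[OF assms(2,3)])

text \<open>Only the signs and the relative order of \<open>\<bar>a\<bar>\<close>, \<open>\<bar>b\<bar>\<close>, \<open>\<bar>c\<bar>\<close> matter.\<close>

lemma braid_row:
  assumes "a \<noteq> 0" "b \<noteq> 0" "c \<noteq> 0"
  shows "row_12 (row_23 (row_12 F)) a b c = row_23 (row_12 (row_23 F)) a b c"
  by (cases rule: signed_order_cases[OF assms(1,2)]; cases rule: signed_order_cases[OF assms(2,3)];
      cases rule: signed_order_cases[OF assms(1,3)];
      (linarith | simp add: row_12_def row_23_def flip_c_cases sg_par_cases algebra_simps xi_def qq_cancel))

lemma pad_closed_3 [simp]: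
  "M \<in> Op n 2 \<Longrightarrow> pad n 0 2 M 1 \<in> Op n 3" "M \<in> Op n 2 \<Longrightarrow> pad n 1 2 M 0 \<in> Op n 3"
  by (simp_all add: pad_closed')

lemma R_braid:
  "mm n 3 (pad n 0 2 (R_op n) 1) (mm n 3 (pad n 1 2 (R_op n) 0) (pad n 0 2 (R_op n) 1))
   = mm n 3 (pad n 1 2 (R_op n) 0) (mm n 3 (pad n 0 2 (R_op n) 1) (pad n 1 2 (R_op n) 0))"
  (is "mm n 3 ?A (mm n 3 ?B ?A) = mm n 3 ?B (mm n 3 ?A ?B)")
proof (rule Op3_eqI)
  fix x y z a b c assume abc: "a \<in> idx n" "b \<in> idx n" "c \<in> idx n"
  define F where "F = (\<lambda>a b c. idm n 3 [x, y, z] [a, b, c])"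
  have 1: "?A [x, y, z] [a, b, c] = row_12 F a b c" "?B [x, y, z] [a, b, c] = row_23 F a b c"
    if "a \<in> idx n" "b \<in> idx n" "c \<in> idx n" for a b c
    using mm_R_row[OF that, of "idm n 3" "[x, y, z]"] by (simp_all add: F_def)
  have 2: "mm n 3 ?A ?B [x, y, z] [a, b, c] = row_23 (row_12 F) a b c"
    "mm n 3 ?B ?A [x, y, z] [a, b, c] = row_12 (row_23 F) a b c"
    if "a \<in> idx n" "b \<in> idx n" "c \<in> idx n" for a b c
    unfolding mm_R_row[OF that] by (rule row_cong[OF 1(1) that] row_cong[OF 1(2) that]; assumption)+
  have 3: "mm n 3 (mm n 3 ?A ?B) ?A [x, y, z] [a, b, c] = row_12 (row_23 (row_12 F)) a b c"
    "mm n 3 (mm n 3 ?B ?A) ?B [x, y, z] [a, b, c] = row_23 (row_12 (row_23 F)) a b c"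
    unfolding mm_R_row[OF abc] by (rule row_cong[OF 2(1) abc] row_cong[OF 2(2) abc]; assumption)+
  show "mm n 3 ?A (mm n 3 ?B ?A) [x, y, z] [a, b, c] = mm n 3 ?B (mm n 3 ?A ?B) [x, y, z] [a, b, c]"
    unfolding mm_assoc[symmetric] 3 by (rule braid_row[OF abc[THEN idx_nonzero]])
qed simp_all

text \<open>
  In a group the braid relation \<open>r s r = s r s\<close> is equivalent to \<open>r\<^sup>-\<^sup>1 s\<^sup>-\<^sup>1 r = s r\<^sup>-\<^sup>1 s\<^sup>-\<^sup>1\<close>.
\<close>

lemma braid_inverse:
  assumes cl: "r \<in> Op n m" "s \<in> Op n m" "i \<in> Op n m" "j \<in> Op n m"
    and braid: "mm n m r (mm n m s r) = mm n m s (mm n m r s)"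
    and inv: "mm n m r i = idm n m" "mm n m i r = idm n m" "mm n m s j = idm n m" "mm n m j s = idm n m"
  shows "mm n m i (mm n m j r) = mm n m s (mm n m i j)"
proof -
  have cancel: "mm n m x (mm n m y z) = z" if "mm n m x y = idm n m" "z \<in> Op n m" for x y z
    using that by (simp flip: mm_assoc)
  have "r = mm n m r (mm n m s (mm n m r (mm n m i j)))"
    using cl inv by (simp add: cancel)
  also have "\<dots> = mm n m s (mm n m r (mm n m s (mm n m i j)))"
    using arg_cong[OF braid, of "\<lambda>z. mm n m z (mm n m i j)"] by (simp only: mm_assoc)
  finally have "mm n m i (mm n m j r) = mm n m i (mm n m j (mm n m s (mm n m r (mm n m s (mm n m i j)))))"
    by simp
  also have "\<dots> = mm n m s (mm n m i j)"
    using cl inv by (simp add: cancel)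
  finally show ?thesis .
qed

definition R_inv :: "nat \<Rightarrow> oper" where
  "R_inv n = R_op n - smul xi (idm n 2)"

lemma R_inv_closed [simp]: "R_inv n \<in> Op n 2"
  by (simp add: R_inv_def)

lemma R_inv_even [simp]: "oper_par 0 (R_inv n)"
  unfolding R_inv_def by (intro oper_par_diff oper_par_smul) simp_all

lemma R_inverse: "mm n 2 (R_op n) (R_inv n) = idm n 2" "mm n 2 (R_inv n) (R_op n) = idm n 2"
  by (simp_all add: R_inv_def mm_diff_left mm_diff_right mm_smul_left mm_smul_right R_quad)

lemma pad3_inverse:
  assumes "M \<in> Op n 2" "N \<in> Op n 2" "mm n 2 M N = idm n 2"
  shows "mm n 3 (pad n 0 2 M 1) (pad n 0 2 N 1) = idm n 3" "mm n 3 (pad n 1 2 M 0) (pad n 1 2 N 0) = idm n 3"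
  using assms pad_idm[of n 0 2 1] pad_idm[of n 1 2 0] by (simp_all add: pad_mm)

lemma R_braid_inv_12:
  "mm n 3 (pad n 0 2 (R_inv n) 1) (mm n 3 (pad n 1 2 (R_inv n) 0) (pad n 0 2 (R_op n) 1))
   = mm n 3 (pad n 1 2 (R_op n) 0) (mm n 3 (pad n 0 2 (R_inv n) 1) (pad n 1 2 (R_inv n) 0))"
  by (rule braid_inverse) (simp_all add: R_braid pad3_inverse R_inverse)

lemma R_braid_inv_23:
  "mm n 3 (pad n 1 2 (R_inv n) 0) (mm n 3 (pad n 0 2 (R_inv n) 1) (pad n 1 2 (R_op n) 0))
   = mm n 3 (pad n 0 2 (R_op n) 1) (mm n 3 (pad n 1 2 (R_inv n) 0) (pad n 0 2 (R_inv n) 1))"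
  by (rule braid_inverse) (simp_all add: R_braid pad3_inverse R_inverse)

section \<open>The odd operators and the transposed braiding\<close>

lemma E_app: "E i j [x] [a] = of_bool (x = i \<and> a = j)"
  by (simp add: E_def)

lemma Phi_closed [simp]: "Phi_op n \<in> Op n 1"
  unfolding Phi_op_def by (intro Op_sum Op_smul E_closed) auto

lemma Phi_app:
  assumes "x \<in> idx n" "a \<in> idx n"
  shows "Phi_op n [x] [a] = of_bool (x = - a) * sg (par x)"
proof -
  have "Phi_op n [x] [a] = (\<Sum>i\<in>idx n. sg (par i) * of_bool (x = i \<and> a = - i))"
    by (simp only: Phi_op_def sum_fun_app smul_def E_app)
  also have "\<dots> = sg (par x) * of_bool (x = x \<and> a = - x)"
    by (rule sum_single) (use assms in auto)
  finally show ?thesis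
    by auto
qed

lemma str1_app:
  assumes "x \<in> idx n" "a \<in> idx n"
  shows "str1 n M [x] [a] = M [a] [x] * sg ((par a + par x) * par a)"
proof -
  have "str1 n M [x] [a] = (\<Sum>i\<in>idx n. \<Sum>j\<in>idx n. M [i] [j] * (sg ((par i + par j) * par i) * of_bool (x = j \<and> a = i)))"
    by (simp only: str1_def strE_def sum_fun_app smul_def E_app)
  also have "\<dots> = M [a] [x] * (sg ((par a + par x) * par a) * of_bool (x = x \<and> a = a))"
    by (subst sum2_single[where a = a and b = x]) (use assms in auto)
  finally show ?thesis
    by simp
qed

lemma str1_closed [simp]: "str1 n M \<in> Op n 1"
  unfolding str1_def strE_def by (intro Op2_sum Op_smul E_closed) auto

definition PhiT_op :: "nat \<Rightarrow> oper" where
  "PhiT_op n = str1 n (Phi_op n)"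

lemma PhiT_closed [simp]: "PhiT_op n \<in> Op n 1"
  by (simp add: PhiT_op_def)

lemma PhiT_app:
  assumes "x \<in> idx n" "a \<in> idx n"
  shows "PhiT_op n [x] [a] = of_bool (x = - a)"
  using assms assms[THEN idx_nonzero] unfolding PhiT_op_def
  by (simp add: str1_app Phi_app par_def One_nat_def sg_eq)

lemma odd1I:
  assumes "M \<in> Op n 1" "\<And>x a. x \<in> idx n \<Longrightarrow> a \<in> idx n \<Longrightarrow> M [x] [a] \<noteq> 0 \<Longrightarrow> x = - a"
  shows "oper_par 1 M"
  unfolding oper_par_def
proof (intro allI impI)
  fix w w' assume nz: "M w w' \<noteq> 0"
  then have "w \<in> words n 1" "w' \<in> words n 1"
    using assms(1) by (auto simp: Op_iff)
  then obtain x a where *: "w = [x]" "w' = [a]" "x \<in> idx n" "a \<in> idx n"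
    by (elim words_1E)
  then have "x = - a" "a \<noteq> 0"
    using nz assms(2) idx_nonzero by blast+
  then show "(wpar w + wpar w') mod 2 = 1 mod 2"
    using * by (auto simp: par_def)
qed

lemma Phi_odd [simp]: "oper_par 1 (Phi_op n)"
  by (rule odd1I[OF Phi_closed]) (simp add: Phi_app)

lemma PhiT_odd [simp]: "oper_par 1 (PhiT_op n)"
  by (rule odd1I[OF PhiT_closed]) (simp add: PhiT_app)

lemma mm_pad1_right:
  assumes "a \<in> idx n" "b \<in> idx n"
  shows "mm n 2 N (pad n 0 1 M 1) w [a, b] = (\<Sum>i\<in>idx n. N w [i, b] * M [i] [a])"
    and "mm n 2 N (pad n 1 1 M 0) w [a, b] = (\<Sum>i\<in>idx n. sg ((par i + par b) * par a) * N w [a, i] * M [i] [b])"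
  using mm_pad_right[of "[]" n 0 "[a]" 1 "[b]" 1 2 N M w] mm_pad_right[of "[a]" n 1 "[b]" 1 "[]" 0 2 N M w] assms
  by (simp_all add: words_1' sum_words_1[unfolded One_nat_def[symmetric]])

lemma mm_pad1_left:
  assumes "x \<in> idx n" "y \<in> idx n"
  shows "mm n 2 (pad n 0 1 M 1) N [x, y] w = (\<Sum>i\<in>idx n. M [x] [i] * N [i, y] w)"
    and "mm n 2 (pad n 1 1 M 0) N [x, y] w = (\<Sum>i\<in>idx n. sg ((par y + par i) * par x) * M [y] [i] * N [x, i] w)"
  using mm_pad_left[of "[]" n 0 "[x]" 1 "[y]" 1 2 M N w] mm_pad_left[of "[x]" n 1 "[y]" 1 "[]" 0 2 M N w] assms
  by (simp_all add: words_1' sum_words_1[unfolded One_nat_def[symmetric]])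

lemma Phi_sums:
  assumes "a \<in> idx n"
  shows "(\<Sum>i\<in>idx n. F i * Phi_op n [i] [a]) = F (- a) * sg (par (- a))"
    and "(\<Sum>i\<in>idx n. Phi_op n [a] [i] * F i) = sg (par a) * F (- a)"
    and "(\<Sum>i\<in>idx n. F i * PhiT_op n [i] [a]) = F (- a)"
    and "(\<Sum>i\<in>idx n. PhiT_op n [a] [i] * F i) = F (- a)"
proof -
  have "(\<Sum>i\<in>idx n. F i * Phi_op n [i] [a]) = F (- a) * Phi_op n [- a] [a]"
    by (rule sum_single) (use assms in \<open>auto simp: Phi_app\<close>)
  then show "(\<Sum>i\<in>idx n. F i * Phi_op n [i] [a]) = F (- a) * sg (par (- a))"
    using assms by (simp add: Phi_app)
  have "(\<Sum>i\<in>idx n. Phi_op n [a] [i] * F i) = Phi_op n [a] [- a] * F (- a)"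
    by (rule sum_single) (use assms in \<open>auto simp: Phi_app\<close>)
  then show "(\<Sum>i\<in>idx n. Phi_op n [a] [i] * F i) = sg (par a) * F (- a)"
    using assms by (simp add: Phi_app)
  have "(\<Sum>i\<in>idx n. F i * PhiT_op n [i] [a]) = F (- a) * PhiT_op n [- a] [a]"
    by (rule sum_single) (use assms in \<open>auto simp: PhiT_app\<close>)
  then show "(\<Sum>i\<in>idx n. F i * PhiT_op n [i] [a]) = F (- a)"
    using assms by (simp add: PhiT_app)
  have "(\<Sum>i\<in>idx n. PhiT_op n [a] [i] * F i) = PhiT_op n [a] [- a] * F (- a)"
    by (rule sum_single) (use assms in \<open>auto simp: PhiT_app\<close>)
  then show "(\<Sum>i\<in>idx n. PhiT_op n [a] [i] * F i) = F (- a)"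
    using assms by (simp add: PhiT_app)
qed

lemma sg_par_uminus: "a \<noteq> 0 \<Longrightarrow> sg (par (- a)) = - sg (par a)"
  by (auto simp: par_def)

lemma sg_par_sum_uminus: "a \<noteq> 0 \<Longrightarrow> sg ((par a + par (- a)) * d) = sg d" "a \<noteq> 0 \<Longrightarrow> sg ((par (- a) + par a) * d) = sg d"
  by (auto simp: par_def)

lemma flip_c_uminus:
  assumes "a \<noteq> 0" "b \<noteq> 0"
  shows "flip_c (- a) b = sg (par b) * flip_c a b"
  using assms by (auto simp: flip_c_cases sg_par_cases)

text \<open>
  This is the relation between the braiding and \<open>\<Phi>\<close> in terms of entries: the sign of the first
  input index moves to the second output index.
\<close>

lemma R_reflect:
  assumes "x \<in> idx n" "y \<in> idx n" "a \<in> idx n" "b \<in> idx n"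
  shows "sg (par (- a)) * R_op n [x, y] [- a, b] = sg (par x) * sg (par y) * R_op n [x, - y] [a, b]"
proof -
  have nz: "a \<noteq> 0" "b \<noteq> 0" "x \<noteq> 0" "y \<noteq> 0"
    using assms idx_nonzero by auto
  have *: "R_op n [x, y] [- a, b] = of_bool (x = b \<and> y = - a) * flip_c (- a) b
    + of_bool (x = - a \<and> y = b) * (if - a < b then xi else 0)
    + of_bool (x = a \<and> y = - b) * (if a < b then xi * sg (par b) else 0)"
    using R_app[of x n y "- a" b] assms by simp
  have **: "R_op n [x, - y] [a, b] = of_bool (x = b \<and> y = - a) * flip_c a b
    + of_bool (x = a \<and> y = - b) * (if a < b then xi else 0)
    + of_bool (x = - a \<and> y = b) * (if - a < b then xi * sg (par b) else 0)"
    using R_app[of x n "- y" a b] assms by (auto simp: equation_minus_iff)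
  consider "x = b \<and> y = - a" | "\<not> (x = b \<and> y = - a)" "x = - a \<and> y = b" | "\<not> (x = b \<and> y = - a)" "\<not> (x = - a \<and> y = b)" "x = a \<and> y = - b"
    | "\<not> (x = b \<and> y = - a)" "\<not> (x = - a \<and> y = b)" "\<not> (x = a \<and> y = - b)"
    by blast
  then show ?thesis
  proof cases
    case 1
    then show ?thesis
      unfolding * ** using nz by (auto simp: flip_c_uminus sg_par_uminus)
  next
    case 2
    then show ?thesis
      unfolding * ** using nz by (auto simp: flip_c_uminus sg_par_uminus)
  next
    case 3
    then show ?thesis
      unfolding * ** using nz by (auto simp: flip_c_uminus sg_par_uminus)
  next
    case 4
    then show ?thesis
      unfolding * ** by (simp only: of_bool_eq simp_thms mult_zero_left mult_zero_right add_0)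
  qed
qed

lemma pad_closed_2 [simp]:
  "M \<in> Op n 1 \<Longrightarrow> pad n 0 1 M 1 \<in> Op n 2" "M \<in> Op n 1 \<Longrightarrow> pad n 1 1 M 0 \<in> Op n 2"
  by (simp_all add: pad_closed')

text \<open>The braiding is not symmetric in its two strands: only this one intertwining relation holds.\<close>

lemma R_Phi: "mm n 2 (R_op n) (pad n 0 1 (Phi_op n) 1) = mm n 2 (pad n 1 1 (Phi_op n) 0) (R_op n)"
proof (rule Op2_eqI)
  fix x y a b assume *: "x \<in> idx n" "y \<in> idx n" "a \<in> idx n" "b \<in> idx n"
  have "mm n 2 (pad n 1 1 (Phi_op n) 0) (R_op n) [x, y] [a, b]
    = (\<Sum>i\<in>idx n. Phi_op n [y] [i] * (sg ((par y + par i) * par x) * R_op n [x, i] [a, b]))"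
    by (simp add: mm_pad1_left(2)[OF *(1,2)] mult_ac)
  also have "\<dots> = sg (par y) * (sg (par x) * R_op n [x, - y] [a, b])"
    using * idx_nonzero[OF *(2)] by (simp only: Phi_sums sg_par_sum_uminus not_False_eq_True)
  also have "\<dots> = R_op n [x, y] [- a, b] * sg (par (- a))"
    using R_reflect[OF *] by (simp only: mult_ac)
  also have "\<dots> = mm n 2 (R_op n) (pad n 0 1 (Phi_op n) 1) [x, y] [a, b]"
    unfolding mm_pad1_right(1)[OF *(3,4)] by (rule Phi_sums(1)[OF *(3), symmetric])
  finally show "mm n 2 (R_op n) (pad n 0 1 (Phi_op n) 1) [x, y] [a, b]
    = mm n 2 (pad n 1 1 (Phi_op n) 0) (R_op n) [x, y] [a, b]"
    by (rule sym)
qed simp_all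

lemma R_Phi_inv: "mm n 2 (R_inv n) (pad n 1 1 (Phi_op n) 0) = mm n 2 (pad n 0 1 (Phi_op n) 1) (R_inv n)"
proof -
  have "mm n 2 (R_inv n) (pad n 1 1 (Phi_op n) 0)
    = mm n 2 (R_inv n) (mm n 2 (mm n 2 (pad n 1 1 (Phi_op n) 0) (R_op n)) (R_inv n))"
    by (simp add: mm_assoc R_inverse)
  also have "\<dots> = mm n 2 (mm n 2 (R_inv n) (R_op n)) (mm n 2 (pad n 0 1 (Phi_op n) 1) (R_inv n))"
    by (simp only: R_Phi[symmetric] mm_assoc)
  finally show ?thesis
    by (simp add: R_inverse)
qed

lemma strE_app: "strE i j [x] [a] = of_bool (x = j \<and> a = i) * sg ((par i + par j) * par i)"
  by (simp add: strE_def smul_def E_app)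

lemma mten_app_1_1: "mten 1 A B [x, y] [a, b] = sg ((par y + par b) * par a) * A [x] [a] * B [y] [b]"
  by (simp add: mten_def One_nat_def)

lemma str2_app:
  assumes "x \<in> idx n" "y \<in> idx n" "a \<in> idx n" "b \<in> idx n" "oper_par 0 M"
  shows "str2 n M [x, y] [a, b] = sg ((par a + par x) * (par x + par b)) * M [a, b] [x, y]"
proof -
  define f where "f i j k l = coef2 M i j k l * mten 1 (strE i j) (strE k l) [x, y] [a, b]" for i j k l
  have f0: "f i j k l = 0" if "i \<noteq> a \<or> j \<noteq> x \<or> k \<noteq> b \<or> l \<noteq> y" for i j k l
    using that by (auto simp: f_def mten_app_1_1 strE_app)
  have "str2 n M [x, y] [a, b] = (\<Sum>i\<in>idx n. \<Sum>j\<in>idx n. \<Sum>k\<in>idx n. \<Sum>l\<in>idx n. f i j k l)"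
    by (simp only: str2_def sum_fun_app smul_def f_def)
  also have "\<dots> = (\<Sum>k\<in>idx n. \<Sum>l\<in>idx n. f a x k l)"
  proof -
    have "(\<Sum>i\<in>idx n. \<Sum>j\<in>idx n. \<Sum>k\<in>idx n. \<Sum>l\<in>idx n. f i j k l)
      = (\<Sum>j\<in>idx n. \<Sum>k\<in>idx n. \<Sum>l\<in>idx n. f a j k l)"
      by (rule sum_single) (simp_all add: assms f0)
    also have "\<dots> = (\<Sum>k\<in>idx n. \<Sum>l\<in>idx n. f a x k l)"
      by (rule sum_single) (simp_all add: assms f0)
    finally show ?thesis .
  qed
  also have "\<dots> = (\<Sum>l\<in>idx n. f a x b l)"
    by (rule sum_single) (simp_all add: assms f0)
  also have "\<dots> = f a x b y"
    by (rule sum_single) (simp_all add: assms f0)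
  also have "\<dots> = sg ((par a + par x) * (par x + par b)) * M [a, b] [x, y]"
  proof (cases "M [a, b] [x, y] = 0")
    case False
    then have "even (par a + par b + (par x + par y))"
      using oper_par_odd_even[OF assms(5) False] by simp
    then have "sg ((par b + par y) * par x) * (sg ((par y + par b) * par a) * sg ((par a + par x) * par a) * sg ((par b + par y) * par b))
      = sg ((par a + par x) * (par x + par b))"
      by (auto simp: sg_eq)
    then show ?thesis
      by (simp add: f_def coef2_def mten_app_1_1 strE_app mult_ac)
  qed (simp add: f_def coef2_def)
  finally show ?thesis .
qed

lemma strE_closed: "i \<in> idx n \<Longrightarrow> j \<in> idx n \<Longrightarrow> strE i j \<in> Op n 1"
  unfolding strE_def by (intro Op_smul E_closed)

lemma str2_closed [simp]: "str2 n M \<in> Op n 2"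
proof -
  have "mten 1 (strE i j) (strE k l) \<in> Op n 2"
    if "i \<in> idx n" "j \<in> idx n" "k \<in> idx n" "l \<in> idx n" for i j k l
    using mten_closed[OF strE_closed strE_closed, of i n j k l] that by simp
  then show ?thesis
    unfolding str2_def by (intro Op_sum Op_smul) auto
qed

lemma P_even: "oper_par 0 (P_op n)"
proof (rule even2I[OF P_closed])
  fix x y a b assume *: "x \<in> idx n" "y \<in> idx n" "a \<in> idx n" "b \<in> idx n" "P_op n [x, y] [a, b] \<noteq> 0"
  then have "x = b \<and> y = a"
    by (cases "x = b \<and> y = a") (simp_all add: P_app)
  then have "par x + par y + par a + par b = 2 * (par a + par b)"
    by simp
  then show "even (par x + par y + par a + par b)"
    by (simp only: dvd_triv_left)
qed

lemma P_square: "mm n 2 (P_op n) (P_op n) = idm n 2"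
  by (rule Op2_eqI) (auto simp: P_closed mm_P_left P_app idm_app words_2 mult.commute)

lemma S_eq_P_R: "S_op n = mm n 2 (P_op n) (R_op n)"
  by (simp add: R_op_def P_square S_closed flip: mm_assoc)

lemma S_even: "oper_par 0 (S_op n)"
  unfolding S_eq_P_R using oper_par_mm[OF P_even R_even] by simp

lemma str2_P: "str2 n (P_op n) = P_op n"
proof (rule Op2_eqI)
  fix x y a b assume *: "x \<in> idx n" "y \<in> idx n" "a \<in> idx n" "b \<in> idx n"
  show "str2 n (P_op n) [x, y] [a, b] = P_op n [x, y] [a, b]"
  proof (cases "x = b \<and> y = a")
    case True
    moreover have "sg ((par a + par b) * (par b + par b)) = 1"
      by (simp add: sg_eq)
    ultimately show ?thesis
      unfolding str2_app[OF * P_even] using * by (simp add: P_app mult.commute)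
  next
    case False
    then show ?thesis
      unfolding str2_app[OF * P_even] using * by (auto simp: P_app)
  qed
qed (simp_all add: P_closed)

definition Rs_op :: "nat \<Rightarrow> oper" where
  "Rs_op n = mm n 2 (str2 n (P_op n)) (str2 n (S_op n))"

lemma Rs_closed [simp]: "Rs_op n \<in> Op n 2"
  by (simp add: Rs_op_def)

text \<open>
  The braiding of the dual strands is the braiding of the vector representation rotated by a half
  turn: inputs and outputs are exchanged and both are read backwards. This carries the relations
  between the \<open>t\<^sub>i\<close> to the relations between the \<open>t\<^sub>i\<^sup>*\<close>.
\<close>

lemma Rs_app:
  assumes "x \<in> idx n" "y \<in> idx n" "a \<in> idx n" "b \<in> idx n"
  shows "Rs_op n [x, y] [a, b] = R_op n [b, a] [y, x]"
proof -
  have "Rs_op n [x, y] [a, b] = sg (par x * par y) * (sg ((par a + par y) * (par y + par b)) * S_op n [a, b] [y, x])"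
    using assms by (simp add: Rs_op_def str2_P mm_P_left str2_app[OF _ _ _ _ S_even])
  moreover have "R_op n [b, a] [y, x] = sg (par b * par a) * S_op n [a, b] [y, x]"
    using assms by (simp add: R_op_def mm_P_left)
  moreover have "sg (par x * par y) * sg ((par a + par y) * (par y + par b)) = sg (par b * par a)"
    if "S_op n [a, b] [y, x] \<noteq> 0"
  proof -
    have "even (par a + par b + (par y + par x))"
      using oper_par_odd_even[OF S_even that] by simp
    then show ?thesis
      by (auto simp: sg_eq)
  qed
  ultimately show ?thesis
    by (cases "S_op n [a, b] [y, x] = 0") (simp_all flip: mult.assoc)
qed

lemma Rs_even [simp]: "oper_par 0 (Rs_op n)"
proof (rule even2I[OF Rs_closed])
  fix x y a b assume *: "x \<in> idx n" "y \<in> idx n" "a \<in> idx n" "b \<in> idx n" "Rs_op n [x, y] [a, b] \<noteq> 0"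
  then have "R_op n [b, a] [y, x] \<noteq> 0"
    by (simp add: Rs_app)
  from oper_par_odd_even[OF R_even this] show "even (par x + par y + par a + par b)"
    by (simp add: add_ac del: even_add)
qed

lemma Rs_quad: "mm n 2 (Rs_op n) (Rs_op n) = smul xi (Rs_op n) + idm n 2"
proof (rule Op2_eqI)
  fix x y a b assume *: "x \<in> idx n" "y \<in> idx n" "a \<in> idx n" "b \<in> idx n"
  have "mm n 2 (Rs_op n) (Rs_op n) [x, y] [a, b]
    = (\<Sum>u\<in>idx n. \<Sum>v\<in>idx n. R_op n [v, u] [y, x] * R_op n [b, a] [v, u])"
    unfolding mm_def sum_words_2 by (intro sum.cong refl) (simp add: Rs_app *)
  also have "\<dots> = (\<Sum>v\<in>idx n. \<Sum>u\<in>idx n. R_op n [b, a] [v, u] * R_op n [v, u] [y, x])"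
    by (subst sum.swap) (simp only: mult.commute)
  also have "\<dots> = mm n 2 (R_op n) (R_op n) [b, a] [y, x]"
    by (simp only: mm_def sum_words_2)
  also have "\<dots> = xi * Rs_op n [x, y] [a, b] + idm n 2 [b, a] [y, x]"
    by (simp add: R_quad smul_def Rs_app *)
  finally show "mm n 2 (Rs_op n) (Rs_op n) [x, y] [a, b] = (smul xi (Rs_op n) + idm n 2) [x, y] [a, b]"
    using * by (auto simp: smul_def idm_app words_2)
qed (intro mm_closed Op_add Op_smul Rs_closed idm_closed)+

lemma Rs_braid:
  "mm n 3 (pad n 0 2 (Rs_op n) 1) (mm n 3 (pad n 1 2 (Rs_op n) 0) (pad n 0 2 (Rs_op n) 1))
   = mm n 3 (pad n 1 2 (Rs_op n) 0) (mm n 3 (pad n 0 2 (Rs_op n) 1) (pad n 1 2 (Rs_op n) 0))"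
proof (rule Op3_eqI)
  fix x y z a b c
  assume *: "x \<in> idx n" "y \<in> idx n" "z \<in> idx n" "a \<in> idx n" "b \<in> idx n" "c \<in> idx n"
  have rot: "(\<Sum>u\<in>idx n. \<Sum>v\<in>idx n. \<Sum>m\<in>idx n. f u v m) = (\<Sum>m\<in>idx n. \<Sum>u\<in>idx n. \<Sum>v\<in>idx n. f u v m)"
    for f :: "int \<Rightarrow> int \<Rightarrow> int \<Rightarrow> kq"
  proof -
    have "(\<Sum>u\<in>idx n. \<Sum>v\<in>idx n. \<Sum>m\<in>idx n. f u v m) = (\<Sum>u\<in>idx n. \<Sum>m\<in>idx n. \<Sum>v\<in>idx n. f u v m)"
      by (intro sum.cong refl sum.swap)
    also have "\<dots> = (\<Sum>m\<in>idx n. \<Sum>u\<in>idx n. \<Sum>v\<in>idx n. f u v m)"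
      by (rule sum.swap)
    finally show ?thesis .
  qed
  have "mm n 3 (pad n 0 2 (Rs_op n) 1) (mm n 3 (pad n 1 2 (Rs_op n) 0) (pad n 0 2 (Rs_op n) 1)) [x, y, z] [a, b, c]
    = (\<Sum>u\<in>idx n. \<Sum>v\<in>idx n. \<Sum>m\<in>idx n. R_op n [m, u] [y, x] * R_op n [c, v] [z, m] * R_op n [b, a] [v, u])"
    unfolding triple_12_23_12[OF Rs_even Rs_even Rs_even *]
    by (intro sum.cong refl) (simp add: Rs_app *)
  also have "\<dots> = (\<Sum>m\<in>idx n. \<Sum>u\<in>idx n. \<Sum>v\<in>idx n. R_op n [b, a] [v, u] * R_op n [c, v] [z, m] * R_op n [m, u] [y, x])"
    by (rule trans[OF rot]) (intro sum.cong refl, simp only: mult_ac)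
  also have "\<dots> = mm n 3 (pad n 1 2 (R_op n) 0) (mm n 3 (pad n 0 2 (R_op n) 1) (pad n 1 2 (R_op n) 0)) [c, b, a] [z, y, x]"
    by (rule triple_23_12_23[OF R_even R_even R_even *(6,5,4,3,2,1), symmetric])
  also have "\<dots> = (\<Sum>u\<in>idx n. \<Sum>v\<in>idx n. \<Sum>m\<in>idx n. R_op n [c, b] [u, m] * R_op n [m, a] [v, x] * R_op n [u, v] [z, y])"
    unfolding R_braid[symmetric] by (rule triple_12_23_12[OF R_even R_even R_even *(6,5,4,3,2,1)])
  also have "\<dots> = (\<Sum>m\<in>idx n. \<Sum>u\<in>idx n. \<Sum>v\<in>idx n. R_op n [u, v] [z, y] * R_op n [m, a] [v, x] * R_op n [c, b] [u, m])"
    by (rule trans[OF rot]) (intro sum.cong refl, simp only: mult_ac)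
  also have "\<dots> = mm n 3 (pad n 1 2 (Rs_op n) 0) (mm n 3 (pad n 0 2 (Rs_op n) 1) (pad n 1 2 (Rs_op n) 0)) [x, y, z] [a, b, c]"
    unfolding triple_23_12_23[OF Rs_even Rs_even Rs_even *]
    by (intro sum.cong refl) (simp add: Rs_app *)
  finally show "mm n 3 (pad n 0 2 (Rs_op n) 1) (mm n 3 (pad n 1 2 (Rs_op n) 0) (pad n 0 2 (Rs_op n) 1)) [x, y, z] [a, b, c]
    = mm n 3 (pad n 1 2 (Rs_op n) 0) (mm n 3 (pad n 0 2 (Rs_op n) 1) (pad n 1 2 (Rs_op n) 0)) [x, y, z] [a, b, c]" .
qed simp_all

section \<open>Evaluation and coevaluation\<close>

text \<open>
  The scalar \<open>\<union>(v\<^sub>i \<otimes> \<omega>\<^sub>i)\<close>.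
\<close>

definition beta :: "nat \<Rightarrow> int \<Rightarrow> kq" where
  "beta n i = sg (par i) * qq powi (2 * i * (1 - 2 * int (par i)) - (2 * int n + 1))"

lemma beta_pos: "0 < i \<Longrightarrow> beta n i = qq powi (2 * i - 2 * int n - 1)"
  by (simp add: beta_def par_def algebra_simps)

lemma beta_uminus: "i \<noteq> 0 \<Longrightarrow> beta n (- i) = - beta n i"
  by (auto simp: beta_def par_def)

lemma flip_c_diag: "a \<noteq> 0 \<Longrightarrow> flip_c a a = (if 0 < a then qq else - inverse qq)"
  by (simp add: flip_c_cases)

lemma beta_sum_symmetric:
  assumes "finite A" "\<And>i. - i \<in> A \<longleftrightarrow> i \<in> A" "0 \<notin> A"
  shows "sum (beta n) A = 0"
proof -
  have A: "A = {i \<in> A. 0 < i} \<union> {i \<in> A. i < 0}"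
    using assms(3) linorder_less_linear[of 0] by blast
  have "sum (beta n) {i \<in> A. i < 0} = (\<Sum>i\<in>{i \<in> A. 0 < i}. beta n (- i))"
    by (rule sum.reindex_bij_witness[of _ uminus uminus]) (use assms(2) in auto)
  also have "\<dots> = - sum (beta n) {i \<in> A. 0 < i}"
    unfolding sum_negf[symmetric] by (rule sum.cong) (auto simp: beta_uminus)
  finally have "sum (beta n) ({i \<in> A. 0 < i} \<union> {i \<in> A. i < 0}) = 0"
    using assms(1) by (subst sum.union_disjoint) auto
  then show ?thesis
    using A by simp
qed

lemma beta_tail_pos:
  assumes "m \<le> int n" "0 \<le> m"
  shows "xi * (\<Sum>i\<in>{m<..int n}. beta n i) = 1 - qq powi (2 * m - 2 * int n)"
  using assms
proof (induction m rule: int_le_induct)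
  case base
  then show ?case
    by simp
next
  case (step i)
  have "{i - 1<..int n} = insert i {i<..int n}"
    using step by auto
  then have "xi * (\<Sum>j\<in>{i - 1<..int n}. beta n j) = xi * beta n i + (1 - qq powi (2 * i - 2 * int n))"
    using step by (simp add: distrib_left)
  also have "xi * beta n i = qq powi (2 * i - 2 * int n) - qq powi (2 * (i - 1) - 2 * int n)"
  proof -
    define z where "z = qq powi (2 * (i - 1) - 2 * int n)"
    have "2 * i - 2 * int n - 1 = (2 * (i - 1) - 2 * int n) + 1" "2 * i - 2 * int n = (2 * (i - 1) - 2 * int n) + 1 + 1"
      by simp_all
    then have "qq powi (2 * i - 2 * int n - 1) = z * qq" "qq powi (2 * i - 2 * int n) = z * qq * qq"
      unfolding z_def by (simp_all only: power_int_add_1 qq_nonzero not_False_eq_True simp_thms)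
    then show ?thesis
      using step.prems unfolding z_def[symmetric] by (simp add: beta_pos xi_def algebra_simps qq_cancel)
  qed
  finally show ?case
    by simp
qed

lemma beta_diag_pos: "0 < m \<Longrightarrow> beta n m * qq = qq powi (2 * m - 2 * int n)"
  using power_int_add_1[of qq "2 * m - 2 * int n - 1"] by (simp add: beta_pos)

text \<open>
  For positive \<open>m\<close> this is a geometric series. The weights of \<open>i\<close> and \<open>-i\<close> cancel, so a sum from a
  negative \<open>m\<close> reduces to the positive case.
\<close>

lemma beta_tail:
  assumes "m \<in> idx n"
  shows "xi * (\<Sum>i\<in>{i \<in> idx n. m < i}. beta n i) = 1 - beta n m * flip_c m m"
proof -
  have pos: "xi * (\<Sum>i\<in>{i \<in> idx n. p < i}. beta n i) = 1 - beta n p * qq" if "p \<in> idx n" "0 < p" for p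
  proof -
    have "{i \<in> idx n. p < i} = {p<..int n}"
      using that by (auto simp: idx_def)
    then show ?thesis
      using that beta_tail_pos[of p n] by (simp add: beta_diag_pos idx_def)
  qed
  show ?thesis
  proof (cases "0 < m")
    case True
    then show ?thesis
      using pos assms by (simp add: flip_c_diag)
  next
    case False
    then have m: "m < 0"
      using idx_nonzero[OF assms] by simp
    \<comment> \<open>The indices between \<open>m\<close> and \<open>- m\<close> cancel in pairs.\<close>
    have "sum (beta n) {i \<in> idx n. m < i \<and> i < - m} = 0"
      by (rule beta_sum_symmetric) (auto dest: idx_nonzero)
    moreover have "{i \<in> idx n. m < i} = {i \<in> idx n. m < i \<and> i < - m} \<union> insert (- m) {i \<in> idx n. - m < i}"
      using assms m by auto
    moreover have "sum (beta n) ({i \<in> idx n. m < i \<and> i < - m} \<union> insert (- m) {i \<in> idx n. - m < i})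
      = sum (beta n) {i \<in> idx n. m < i \<and> i < - m} + sum (beta n) (insert (- m) {i \<in> idx n. - m < i})"
      by (rule sum.union_disjoint) auto
    moreover have "sum (beta n) (insert (- m) {i \<in> idx n. - m < i}) = beta n (- m) + sum (beta n) {i \<in> idx n. - m < i}"
      by (rule sum.insert) auto
    ultimately have "sum (beta n) {i \<in> idx n. m < i} = beta n (- m) + sum (beta n) {i \<in> idx n. - m < i}"
      by simp
    then have "xi * sum (beta n) {i \<in> idx n. m < i} = xi * beta n (- m) + (1 - beta n (- m) * qq)"
      using pos[of "- m"] assms m by (simp add: distrib_left)
    then show ?thesis
      using m by (simp add: beta_uminus flip_c_diag xi_def algebra_simps)
  qed
qed

text \<open>
  The diagonal term of the braiding and the terms with \<open>i > a\<close> add up to one by the geometric series.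
  In pictures, a curl in a strand can be straightened.
\<close>

lemma R_trace:
  assumes "a \<in> idx n" "b \<in> idx n"
  shows "(\<Sum>i\<in>idx n. beta n i * R_op n [a, i] [b, i]) = of_bool (a = b)"
proof -
  have R: "R_op n [a, i] [b, i] = of_bool (a = b) * (of_bool (i = a) * flip_c a a + (if a < i then xi else 0))"
    if "i \<in> idx n" for i
    using idx_nonzero[OF that] by (auto simp: R_app[OF assms(1) that assms(2) that])
  show ?thesis
  proof (cases "a = b")
    case False
    then show ?thesis
      by (auto intro!: sum.neutral simp: R)
  next
    case True
    have "(\<Sum>i\<in>idx n. beta n i * R_op n [a, i] [b, i])
      = (\<Sum>i\<in>idx n. beta n i * (of_bool (i = a) * flip_c a a)) + (\<Sum>i\<in>idx n. if a < i then xi * beta n i else 0)"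
      unfolding sum.distrib[symmetric] by (intro sum.cong refl) (simp add: R[unfolded True] True algebra_simps)
    also have "(\<Sum>i\<in>idx n. beta n i * (of_bool (i = a) * flip_c a a)) = beta n a * (of_bool (a = a) * flip_c a a)"
      by (rule sum_single) (use assms in auto)
    also have "(\<Sum>i\<in>idx n. if a < i then xi * beta n i else 0) = xi * (\<Sum>i\<in>{i \<in> idx n. a < i}. beta n i)"
      by (simp add: sum_distrib_left flip: sum.inter_filter)
    finally show ?thesis
      by (simp add: beta_tail[OF assms(1)] True[symmetric])
  qed
qed

lemma flip_c_pair: "a \<noteq> 0 \<Longrightarrow> b \<noteq> 0 \<Longrightarrow> flip_c a b * flip_c b a = (if b = a then 1 + xi * flip_c a a else 1)"
  by (auto simp: flip_c_cases xi_def algebra_simps qq_cancel)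

lemma flip_c_antidiag: "a \<noteq> 0 \<Longrightarrow> flip_c a (- a) * sg (par a) = flip_c a a - xi"
  by (auto simp: flip_c_cases xi_def par_def)

lemma R_partial_row:
  assumes "k \<in> idx n" "b \<in> idx n" "a \<in> idx n"
  shows "(\<Sum>i\<in>idx n. F i * R_op n [k, b] [a, i])
    = of_bool (b = a) * (flip_c a k * F k) + of_bool (k = a) * ((if a < b then xi else 0) * F b)
      + of_bool (k = - a) * ((if b < a then xi * sg (par (- b)) else 0) * F (- b))"
proof -
  have split: "F i * R_op n [k, b] [a, i] = F i * (of_bool (k = i \<and> b = a) * flip_c a i)
    + F i * (of_bool (k = a \<and> b = i) * (if a < i then xi else 0))
    + F i * (of_bool (k = - a \<and> b = - i) * (if 0 < a + i then xi * sg (par i) else 0))" if "i \<in> idx n" for i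
    unfolding R_app[OF assms that] distrib_left by (rule refl)
  have "(\<Sum>i\<in>idx n. F i * (of_bool (k = i \<and> b = a) * flip_c a i)) = F k * (of_bool (k = k \<and> b = a) * flip_c a k)"
    by (rule sum_single) (use assms in auto)
  moreover have "(\<Sum>i\<in>idx n. F i * (of_bool (k = a \<and> b = i) * (if a < i then xi else 0)))
    = F b * (of_bool (k = a \<and> b = b) * (if a < b then xi else 0))"
    by (rule sum_single) (use assms in auto)
  moreover have "(\<Sum>i\<in>idx n. F i * (of_bool (k = - a \<and> b = - i) * (if 0 < a + i then xi * sg (par i) else 0)))
    = F (- b) * (of_bool (k = - a \<and> b = - (- b)) * (if 0 < a + - b then xi * sg (par (- b)) else 0))"
    by (rule sum_single) (use assms in auto)
  ultimately have "(\<Sum>i\<in>idx n. F i * R_op n [k, b] [a, i])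
    = F k * (of_bool (k = k \<and> b = a) * flip_c a k) + F b * (of_bool (k = a \<and> b = b) * (if a < b then xi else 0))
     + F (- b) * (of_bool (k = - a \<and> b = - (- b)) * (if 0 < a + - b then xi * sg (par (- b)) else 0))"
    by (simp only: split sum.distrib cong: sum.cong)
  also have "\<dots> = of_bool (b = a) * (flip_c a k * F k) + of_bool (k = a) * ((if a < b then xi else 0) * F b)
      + of_bool (k = - a) * ((if b < a then xi * sg (par (- b)) else 0) * F (- b))"
    by (simp only: minus_minus simp_thms mult_ac) (simp only: diff_conv_add_uminus[symmetric] diff_gt_0_iff_gt mult_ac)
  finally show ?thesis .
qed

text \<open>
  With \<open>R\<^sup>-\<^sup>1 = R - \<xi>\<close> in place of one factor this is \<open>cup_pull\<close>; the second summand is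
  \<open>\<xi>\<close> times a partial trace of the other factor. The proof adds up the contributions of the three
  terms of the braiding.
\<close>

lemma R_double_trace:
  assumes "a' \<in> idx n" "j \<in> idx n" "k \<in> idx n" "a \<in> idx n"
  shows "(\<Sum>i\<in>idx n. \<Sum>b\<in>idx n. beta n b * R_op n [a', i] [j, b] * R_op n [k, b] [a, i])
    = of_bool (a = a' \<and> k = j) * beta n a + xi * of_bool (a' = j \<and> k = a)"
proof -
  have nz: "a' \<noteq> 0" "j \<noteq> 0" "k \<noteq> 0" "a \<noteq> 0"
    using assms idx_nonzero by auto
  define fl where "fl = flip_c a a"
  define s where "s m = (\<Sum>b\<in>{b \<in> idx n. m < b}. beta n b)" for m
  have s: "xi * s m = 1 - beta n m * flip_c m m" if "m \<in> idx n" for m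
    unfolding s_def by (rule beta_tail[OF that])
  have s_sum: "(\<Sum>b\<in>idx n. if m < b then c * beta n b else 0) = c * s m" for m c
    by (simp add: s_def sum_distrib_left flip: sum.inter_filter)
  have "(\<Sum>i\<in>idx n. \<Sum>b\<in>idx n. beta n b * R_op n [a', i] [j, b] * R_op n [k, b] [a, i])
    = (\<Sum>b\<in>idx n. \<Sum>i\<in>idx n. beta n b * R_op n [a', i] [j, b] * R_op n [k, b] [a, i])"
    by (rule sum.swap)
  also have "\<dots> = (\<Sum>b\<in>idx n. of_bool (b = a) * (flip_c a k * (beta n b * R_op n [a', k] [j, b])))
      + (\<Sum>b\<in>idx n. of_bool (k = a) * ((if a < b then xi else 0) * (beta n b * R_op n [a', b] [j, b])))
      + (\<Sum>b\<in>idx n. of_bool (k = - a) * ((if b < a then xi * sg (par (- b)) else 0) * (beta n b * R_op n [a', - b] [j, b])))"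
    unfolding sum.distrib[symmetric] by (intro sum.cong refl R_partial_row assms)
  also have "(\<Sum>b\<in>idx n. of_bool (b = a) * (flip_c a k * (beta n b * R_op n [a', k] [j, b])))
      = of_bool (a = a) * (flip_c a k * (beta n a * R_op n [a', k] [j, a]))"
    by (rule sum_single) (use assms in auto)
  also have "(\<Sum>b\<in>idx n. of_bool (k = a) * ((if a < b then xi else 0) * (beta n b * R_op n [a', b] [j, b])))
      = of_bool (a' = j \<and> k = a) * (xi * (if a < j then 1 else 1 - beta n a * fl))"
  proof -
    have R: "R_op n [a', b] [j, b] = of_bool (a' = j) * (of_bool (b = j) * flip_c j j + (if j < b then xi else 0))"
      if "b \<in> idx n" for b
      using idx_nonzero[OF that] by (auto simp: R_app[OF assms(1) that assms(2) that])
    have "(\<Sum>b\<in>idx n. of_bool (k = a) * ((if a < b then xi else 0) * (beta n b * R_op n [a', b] [j, b])))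
      = (\<Sum>b\<in>idx n. of_bool (a' = j \<and> k = a) * xi *
          (of_bool (b = j) * (if a < j then beta n j * flip_c j j else 0) + (if max a j < b then xi * beta n b else 0)))"
      by (intro sum.cong refl) (auto simp: R)
    also have "\<dots> = of_bool (a' = j \<and> k = a) * xi *
          ((\<Sum>b\<in>idx n. of_bool (b = j) * (if a < j then beta n j * flip_c j j else 0)) + xi * s (max a j))"
      unfolding sum_distrib_left[symmetric] sum.distrib s_sum ..
    also have "(\<Sum>b\<in>idx n. of_bool (b = j) * (if a < j then beta n j * flip_c j j else 0))
      = of_bool (j = j) * (if a < j then beta n j * flip_c j j else 0)"
      by (rule sum_single) (use assms in auto)
    also have "xi * s (max a j) = 1 - (if a < j then beta n j * flip_c j j else beta n a * fl)"
      using s[OF assms(2)] s[OF assms(4)] by (simp add: max_def fl_def)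
    finally show ?thesis
      by (simp add: mult.assoc)
  qed
  also have "(\<Sum>b\<in>idx n. of_bool (k = - a) * ((if b < a then xi * sg (par (- b)) else 0) * (beta n b * R_op n [a', - b] [j, b])))
      = of_bool (a' = - j \<and> k = - a) * (if 0 < j + a then xi * beta n a * (xi - fl) else 0)"
  proof -
    have R: "R_op n [a', - b] [j, b] = of_bool (a' = - j) * (of_bool (b = - j) * flip_c j (- j) + (if - j < b then xi * sg (par b) else 0))"
      if "b \<in> idx n" for b
    proof -
      have "a' = b \<and> - b = j \<longleftrightarrow> a' = - j \<and> b = - j" "0 < j + b \<longleftrightarrow> - j < b"
        by auto
      then show ?thesis
        using idx_nonzero[OF that] R_app[of a' n "- b" j b] assms that by auto
    qed
    have sgb: "sg (par (- b)) * sg (par b) = - 1" if "b \<in> idx n" for b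
      using idx_nonzero[OF that] by (simp add: sg_par_uminus)
    have "(\<Sum>b\<in>idx n. of_bool (k = - a) * ((if b < a then xi * sg (par (- b)) else 0) * (beta n b * R_op n [a', - b] [j, b])))
      = (\<Sum>b\<in>idx n. of_bool (a' = - j \<and> k = - a) * xi *
          (of_bool (b = - j) * (if - j < a then beta n (- j) * sg (par j) * flip_c j (- j) else 0)
            - (if - j < b \<and> b < a then xi * beta n b else 0)))"
    proof (intro sum.cong refl)
      fix b assume b: "b \<in> idx n"
      have "(if b < a then xi * sg (par (- b)) else 0) * (beta n b * (of_bool (b = - j) * flip_c j (- j) + (if - j < b then xi * sg (par b) else 0)))
        = xi * (of_bool (b = - j) * (if - j < a then beta n (- j) * sg (par j) * flip_c j (- j) else 0)
            - (if - j < b \<and> b < a then xi * beta n b else 0))"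
        using sgb[OF b] by (cases "b = - j") (auto simp: mult_ac)
      then show "of_bool (k = - a) * ((if b < a then xi * sg (par (- b)) else 0) * (beta n b * R_op n [a', - b] [j, b]))
        = of_bool (a' = - j \<and> k = - a) * xi *
          (of_bool (b = - j) * (if - j < a then beta n (- j) * sg (par j) * flip_c j (- j) else 0)
            - (if - j < b \<and> b < a then xi * beta n b else 0))"
        unfolding R[OF b] by (cases "a' = - j"; cases "k = - a") (simp_all add: mult.assoc)
    qed
    also have "\<dots> = of_bool (a' = - j \<and> k = - a) * xi *
          ((\<Sum>b\<in>idx n. of_bool (b = - j) * (if - j < a then beta n (- j) * sg (par j) * flip_c j (- j) else 0))
           - (\<Sum>b\<in>idx n. if - j < b \<and> b < a then xi * beta n b else 0))"
      unfolding sum_distrib_left[symmetric] sum_subtractf ..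
    also have "(\<Sum>b\<in>idx n. of_bool (b = - j) * (if - j < a then beta n (- j) * sg (par j) * flip_c j (- j) else 0))
      = of_bool (- j = - j) * (if - j < a then beta n (- j) * sg (par j) * flip_c j (- j) else 0)"
      by (rule sum_single) (use assms in auto)
    also have "(\<Sum>b\<in>idx n. if - j < b \<and> b < a then xi * beta n b else 0)
      = (if - j < a then (1 - beta n (- j) * flip_c (- j) (- j)) - (1 - beta n a * fl) - xi * beta n a else 0)"
    proof (cases "- j < a")
      case False
      then show ?thesis
        by (auto intro!: sum.neutral)
    next
      case True
      have "{b \<in> idx n. - j < b} = {b \<in> idx n. - j < b \<and> b < a} \<union> insert a {b \<in> idx n. a < b}"
        using True assms by auto
      then have "s (- j) = (\<Sum>b\<in>{b \<in> idx n. - j < b \<and> b < a}. beta n b) + (beta n a + s a)"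
      proof -
      have "sum (beta n) ({b \<in> idx n. - j < b \<and> b < a} \<union> insert a {b \<in> idx n. a < b})
        = sum (beta n) {b \<in> idx n. - j < b \<and> b < a} + sum (beta n) (insert a {b \<in> idx n. a < b})"
        by (rule sum.union_disjoint) auto
      moreover have "sum (beta n) (insert a {b \<in> idx n. a < b}) = beta n a + s a"
        unfolding s_def by (rule sum.insert) auto
      ultimately show ?thesis
        using \<open>{b \<in> idx n. - j < b} = _\<close> unfolding s_def by argo
    qed
      then have "xi * s (- j) = xi * (\<Sum>b\<in>{b \<in> idx n. - j < b \<and> b < a}. beta n b) + xi * beta n a + xi * s a"
        by (simp only: distrib_left add.assoc)
      then have "xi * (\<Sum>b\<in>{b \<in> idx n. - j < b \<and> b < a}. beta n b)
        = (1 - beta n (- j) * flip_c (- j) (- j)) - (1 - beta n a * fl) - xi * beta n a"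
        using s[of "- j"] s[OF assms(4)] assms(2) by (simp add: fl_def algebra_simps)
      then show ?thesis
        using True by (simp add: sum_distrib_left flip: sum.inter_filter)
    qed
    also have "beta n (- j) * sg (par j) * flip_c j (- j) = - (beta n (- j) * flip_c (- j) (- j))"
      using nz by (auto simp: flip_c_cases par_def)
    finally show ?thesis
      by (auto simp: algebra_simps)
  qed
  finally have total: "(\<Sum>i\<in>idx n. \<Sum>b\<in>idx n. beta n b * R_op n [a', i] [j, b] * R_op n [k, b] [a, i])
    = flip_c a k * (beta n a * R_op n [a', k] [j, a])
      + of_bool (a' = j \<and> k = a) * (xi * (if a < j then 1 else 1 - beta n a * fl))
      + of_bool (a' = - j \<and> k = - a) * (if 0 < j + a then xi * beta n a * (xi - fl) else 0)"
    by simp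
  have "flip_c a k * (beta n a * R_op n [a', k] [j, a])
    = of_bool (a = a' \<and> k = j) * (beta n a * (if j = a then 1 + xi * fl else 1))
    + of_bool (a' = j \<and> k = a) * (if j < a then beta n a * fl * xi else 0)
    + of_bool (a' = - j \<and> k = - a) * (if 0 < j + a then beta n a * xi * (fl - xi) else 0)"
  proof -
    have "of_bool (a' = a \<and> k = j) * (flip_c a k * flip_c j a) = (of_bool (a = a' \<and> k = j) * (if j = a then 1 + xi * fl else 1) :: kq)"
      using flip_c_pair[OF nz(4,2)] by (auto simp: fl_def)
    moreover have "of_bool (a' = j \<and> k = a) * flip_c a k = of_bool (a' = j \<and> k = a) * fl"
      by (auto simp: fl_def)
    moreover have "of_bool (a' = - j \<and> k = - a) * (flip_c a k * sg (par a)) = of_bool (a' = - j \<and> k = - a) * (fl - xi)"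
      using flip_c_antidiag[OF nz(4)] by (auto simp: fl_def)
    moreover have "flip_c a k * (beta n a * R_op n [a', k] [j, a])
      = beta n a * (of_bool (a' = a \<and> k = j) * (flip_c a k * flip_c j a))
        + (if j < a then beta n a * (of_bool (a' = j \<and> k = a) * flip_c a k) * xi else 0)
        + (if 0 < j + a then beta n a * xi * (of_bool (a' = - j \<and> k = - a) * (flip_c a k * sg (par a))) else 0)"
      unfolding R_app[OF assms(1,3,2,4)] by (simp add: algebra_simps)
    ultimately show ?thesis
      by (simp only:) (simp add: mult_ac)
  qed
  then show ?thesis
    unfolding total by (cases "a < j"; cases "j = a"; cases "0 < j + a") (auto simp: algebra_simps)
qed

lemma R_inv_app:
  assumes "x \<in> idx n" "y \<in> idx n"
  shows "R_inv n [x, y] [a, b] = R_op n [x, y] [a, b] - xi * of_bool (x = a \<and> y = b)"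
  using assms by (auto simp: R_inv_def smul_def idm_app words_2)

text \<open>
  In terms of pictures: a strand that crosses both legs of a cup, over the one and under the other,
  can be pulled off the cup.
\<close>

lemma cup_pull:
  assumes "a' \<in> idx n" "j \<in> idx n" "k \<in> idx n" "a \<in> idx n"
  shows "(\<Sum>i\<in>idx n. \<Sum>b\<in>idx n. beta n b * R_inv n [a', i] [j, b] * R_op n [k, b] [a, i]) = of_bool (a = a' \<and> k = j) * beta n a"
    and "(\<Sum>i\<in>idx n. \<Sum>b\<in>idx n. beta n b * R_op n [a', i] [j, b] * R_inv n [k, b] [a, i]) = of_bool (a = a' \<and> k = j) * beta n a"
proof -
  have "(\<Sum>i\<in>idx n. \<Sum>b\<in>idx n. beta n b * R_inv n [a', i] [j, b] * R_op n [k, b] [a, i])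
    = (\<Sum>i\<in>idx n. \<Sum>b\<in>idx n. beta n b * R_op n [a', i] [j, b] * R_op n [k, b] [a, i])
      - (\<Sum>i\<in>idx n. \<Sum>b\<in>idx n. xi * of_bool (a' = j) * (of_bool (i = b) * (beta n b * R_op n [k, b] [a, i])))"
    unfolding sum_subtractf[symmetric] by (intro sum.cong refl) (auto simp: R_inv_app assms algebra_simps)
  also have "(\<Sum>i\<in>idx n. \<Sum>b\<in>idx n. xi * of_bool (a' = j) * (of_bool (i = b) * (beta n b * R_op n [k, b] [a, i])))
    = (\<Sum>i\<in>idx n. xi * of_bool (a' = j) * (of_bool (i = i) * (beta n i * R_op n [k, i] [a, i])))"
    by (intro sum.cong refl sum_single) auto
  also have "\<dots> = xi * of_bool (a' = j) * (\<Sum>i\<in>idx n. beta n i * R_op n [k, i] [a, i])"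
    by (simp add: sum_distrib_left)
  finally show "(\<Sum>i\<in>idx n. \<Sum>b\<in>idx n. beta n b * R_inv n [a', i] [j, b] * R_op n [k, b] [a, i]) = of_bool (a = a' \<and> k = j) * beta n a"
    unfolding R_double_trace[OF assms] R_trace[OF assms(3,4)] by (simp add: of_bool_conj mult_ac)
  have "(\<Sum>i\<in>idx n. \<Sum>b\<in>idx n. beta n b * R_op n [a', i] [j, b] * R_inv n [k, b] [a, i])
    = (\<Sum>i\<in>idx n. \<Sum>b\<in>idx n. beta n b * R_op n [a', i] [j, b] * R_op n [k, b] [a, i])
      - (\<Sum>i\<in>idx n. \<Sum>b\<in>idx n. xi * of_bool (k = a) * (of_bool (i = b) * (beta n b * R_op n [a', i] [j, b])))"
    unfolding sum_subtractf[symmetric] by (intro sum.cong refl) (auto simp: R_inv_app assms algebra_simps)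
  also have "(\<Sum>i\<in>idx n. \<Sum>b\<in>idx n. xi * of_bool (k = a) * (of_bool (i = b) * (beta n b * R_op n [a', i] [j, b])))
    = (\<Sum>i\<in>idx n. xi * of_bool (k = a) * (of_bool (i = i) * (beta n i * R_op n [a', i] [j, i])))"
    by (intro sum.cong refl sum_single) auto
  also have "\<dots> = xi * of_bool (k = a) * (\<Sum>i\<in>idx n. beta n i * R_op n [a', i] [j, i])"
    by (simp add: sum_distrib_left)
  finally show "(\<Sum>i\<in>idx n. \<Sum>b\<in>idx n. beta n b * R_op n [a', i] [j, b] * R_inv n [k, b] [a, i]) = of_bool (a = a' \<and> k = j) * beta n a"
    unfolding R_double_trace[OF assms] R_trace[OF assms(1,2)] by (simp add: of_bool_conj mult_ac)
qed

definition e_op :: "nat \<Rightarrow> oper" where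
  "e_op n = mm n 0 (cap_op n) (cup_op n)"

lemma e_op_eq: "e_op n w w' = cap_op n w [] * cup_op n [] w'"
  by (simp add: e_op_def mm_def)

lemma e_closed [simp]: "e_op n \<in> Op n 2"
  by (rule OpI) (auto simp: e_op_eq cap_op_def cup_op_def words_2 split: if_splits)

lemma e_app:
  assumes "x \<in> idx n" "y \<in> idx n" "a \<in> idx n" "b \<in> idx n"
  shows "e_op n [x, y] [a, b] = of_bool (x = y) * (of_bool (a = b) * beta n b)"
  using assms by (auto simp: e_op_eq cap_op_def cup_op_def beta_def)

lemma e_even [simp]: "oper_par 0 (e_op n)"
proof (rule even2I[OF e_closed])
  fix x y a b assume *: "x \<in> idx n" "y \<in> idx n" "a \<in> idx n" "b \<in> idx n" "e_op n [x, y] [a, b] \<noteq> 0"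
  then have "x = y \<and> a = b"
    by (cases "x = y"; cases "a = b") (simp_all add: e_app)
  then have "par x + par y + par a + par b = 2 * (par x + par a)"
    by simp
  then show "even (par x + par y + par a + par b)"
    by (simp only: dvd_triv_left)
qed

lemma beta_sum: "sum (beta n) (idx n) = 0"
  by (rule beta_sum_symmetric) (auto dest: idx_nonzero)

lemma e_square: "mm n 2 (e_op n) (e_op n) = 0"
proof (rule Op2_eqI)
  fix x y a b assume *: "x \<in> idx n" "y \<in> idx n" "a \<in> idx n" "b \<in> idx n"
  have "mm n 2 (e_op n) (e_op n) [x, y] [a, b]
    = (\<Sum>u\<in>idx n. \<Sum>v\<in>idx n. of_bool (u = v) * (of_bool (x = y \<and> a = b) * beta n b * beta n u))"
    unfolding mm_def sum_words_2 by (intro sum.cong refl) (auto simp: e_app *)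
  also have "\<dots> = (\<Sum>u\<in>idx n. of_bool (u = u) * (of_bool (x = y \<and> a = b) * beta n b * beta n u))"
    by (intro sum.cong refl sum_single) auto
  also have "\<dots> = of_bool (x = y \<and> a = b) * beta n b * sum (beta n) (idx n)"
    by (simp add: sum_distrib_left)
  finally show "mm n 2 (e_op n) (e_op n) [x, y] [a, b] = 0 [x, y] [a, b]"
    by (simp add: beta_sum)
qed simp_all

lemma sum3_diag:
  assumes "finite A" "\<And>u v m. u \<in> A \<Longrightarrow> v \<in> A \<Longrightarrow> m \<in> A \<Longrightarrow> v \<noteq> u \<or> m \<noteq> u \<Longrightarrow> f u v m = 0"
  shows "(\<Sum>u\<in>A. \<Sum>v\<in>A. \<Sum>m\<in>A. f u v m) = (\<Sum>u\<in>A. f u u u)"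
proof (intro sum.cong refl)
  fix u assume u: "u \<in> A"
  have "(\<Sum>v\<in>A. \<Sum>m\<in>A. f u v m) = (\<Sum>m\<in>A. f u u m)"
    by (rule sum_single) (auto intro!: sum.neutral assms u)
  also have "\<dots> = f u u u"
    by (rule sum_single) (auto intro!: assms u)
  finally show "(\<Sum>v\<in>A. \<Sum>m\<in>A. f u v m) = f u u u" .
qed

lemma e_R_e: "mm n 3 (pad n 1 2 (e_op n) 0) (mm n 3 (pad n 0 2 (R_op n) 1) (pad n 1 2 (e_op n) 0)) = pad n 1 2 (e_op n) 0"
proof (rule Op3_eqI)
  fix x y z a b c
  assume *: "x \<in> idx n" "y \<in> idx n" "z \<in> idx n" "a \<in> idx n" "b \<in> idx n" "c \<in> idx n"
  have "mm n 3 (pad n 1 2 (e_op n) 0) (mm n 3 (pad n 0 2 (R_op n) 1) (pad n 1 2 (e_op n) 0)) [x, y, z] [a, b, c]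
    = (\<Sum>u\<in>idx n. e_op n [y, z] [u, u] * R_op n [x, u] [a, u] * e_op n [u, u] [b, c])"
    unfolding triple_23_12_23[OF e_even R_even e_even *] by (rule sum3_diag) (auto simp: e_app *)
  also have "\<dots> = e_op n [y, z] [b, c] * (\<Sum>u\<in>idx n. beta n u * R_op n [x, u] [a, u])"
    unfolding sum_distrib_left by (intro sum.cong refl) (simp add: e_app *)
  also have "\<dots> = pad n 1 2 (e_op n) 0 [x, y, z] [a, b, c]"
    by (simp add: R_trace pad_23 *)
  finally show "mm n 3 (pad n 1 2 (e_op n) 0) (mm n 3 (pad n 0 2 (R_op n) 1) (pad n 1 2 (e_op n) 0)) [x, y, z] [a, b, c]
    = pad n 1 2 (e_op n) 0 [x, y, z] [a, b, c]" .
qed simp_all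

lemma e_Rs_e: "mm n 3 (pad n 0 2 (e_op n) 1) (mm n 3 (pad n 1 2 (Rs_op n) 0) (pad n 0 2 (e_op n) 1)) = pad n 0 2 (e_op n) 1"
proof (rule Op3_eqI)
  fix x y z a b c
  assume *: "x \<in> idx n" "y \<in> idx n" "z \<in> idx n" "a \<in> idx n" "b \<in> idx n" "c \<in> idx n"
  have "mm n 3 (pad n 0 2 (e_op n) 1) (mm n 3 (pad n 1 2 (Rs_op n) 0) (pad n 0 2 (e_op n) 1)) [x, y, z] [a, b, c]
    = (\<Sum>u\<in>idx n. e_op n [x, y] [u, u] * Rs_op n [u, z] [u, c] * e_op n [u, u] [a, b])"
    unfolding triple_12_23_12[OF e_even Rs_even e_even *] by (rule sum3_diag) (auto simp: e_app *)
  also have "\<dots> = e_op n [x, y] [a, b] * (\<Sum>u\<in>idx n. beta n u * R_op n [c, u] [z, u])"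
    unfolding sum_distrib_left by (intro sum.cong refl) (simp add: e_app Rs_app *)
  also have "\<dots> = pad n 0 2 (e_op n) 1 [x, y, z] [a, b, c]"
    by (auto simp: R_trace pad_12 *)
  finally show "mm n 3 (pad n 0 2 (e_op n) 1) (mm n 3 (pad n 1 2 (Rs_op n) 0) (pad n 0 2 (e_op n) 1)) [x, y, z] [a, b, c]
    = pad n 0 2 (e_op n) 1 [x, y, z] [a, b, c]" .
qed simp_all

subsection \<open>The nested cup and cap\<close>

text \<open>
  A cap and a cup between the outer pair of factors, around a cap and a cup between the inner pair.
\<close>

definition nest_op :: "nat \<Rightarrow> oper" where
  "nest_op n = (\<lambda>w w'. if w \<in> words n 4 \<and> w' \<in> words n 4
     then of_bool (w ! 0 = w ! 3 \<and> w ! 1 = w ! 2) * (of_bool (w' ! 0 = w' ! 3 \<and> w' ! 1 = w' ! 2) * (beta n (w' ! 0) * beta n (w' ! 1)))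
     else 0)"

lemma nest_closed [simp]: "nest_op n \<in> Op n 4"
  by (rule OpI) (auto simp: nest_op_def split: if_splits)

lemma nest_app:
  assumes "x \<in> idx n" "y \<in> idx n" "z \<in> idx n" "w \<in> idx n" "a \<in> idx n" "b \<in> idx n" "c \<in> idx n" "d \<in> idx n"
  shows "nest_op n [x, y, z, w] [a, b, c, d]
    = of_bool (x = w \<and> y = z) * (of_bool (a = d \<and> b = c) * (beta n a * beta n b))"
  using assms by (simp add: nest_op_def words_4 nth_Cons')

text \<open>
  The two crossings of the long relation: an inverse braiding of the vector factors next to a
  braiding of the dual factors.
\<close>

definition cross_op :: "nat \<Rightarrow> oper" where
  "cross_op n = mten 2 (R_inv n) (Rs_op n)"

lemma cross_closed [simp]: "cross_op n \<in> Op n 4"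
  using mten_closed[of "R_inv n" n 2 "Rs_op n" 2] by (simp add: cross_op_def)

lemma cross_app:
  assumes "x \<in> idx n" "y \<in> idx n" "z \<in> idx n" "w \<in> idx n" "a \<in> idx n" "b \<in> idx n" "c \<in> idx n" "d \<in> idx n"
  shows "cross_op n [x, y, z, w] [a, b, c, d] = R_inv n [x, y] [a, b] * R_op n [d, c] [w, z]"
proof -
  have "cross_op n [x, y, z, w] [a, b, c, d]
    = sg ((par z + par w + (par c + par d)) * (par a + par b)) * (R_inv n [x, y] [a, b] * Rs_op n [z, w] [c, d])"
    using mten_append[of "[x, y]" 2 "[a, b]" "R_inv n" "Rs_op n" "[z, w]" "[c, d]"]
    by (simp add: cross_op_def mult.assoc)
  also have "\<dots> = R_inv n [x, y] [a, b] * Rs_op n [z, w] [c, d]"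
    by (rule even_sg_entry[OF Rs_even])
  finally show ?thesis
    by (simp only: Rs_app assms)
qed

lemma sum_words_4:
  "(\<Sum>w\<in>words n 4. f w) = (\<Sum>a\<in>idx n. \<Sum>b\<in>idx n. \<Sum>c\<in>idx n. \<Sum>d\<in>idx n. f [a, b, c, d])"
  using sum_words_append[of f n 2 2] by (simp add: sum_words_2)

lemma sum4_nested:
  assumes "finite A" "\<And>a b c d. a \<in> A \<Longrightarrow> b \<in> A \<Longrightarrow> c \<in> A \<Longrightarrow> d \<in> A \<Longrightarrow> c \<noteq> b \<or> d \<noteq> a \<Longrightarrow> f a b c d = 0"
  shows "(\<Sum>a\<in>A. \<Sum>b\<in>A. \<Sum>c\<in>A. \<Sum>d\<in>A. f a b c d) = (\<Sum>a\<in>A. \<Sum>b\<in>A. f a b b a)"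
proof (intro sum.cong refl)
  fix a b assume ab: "a \<in> A" "b \<in> A"
  have "(\<Sum>c\<in>A. \<Sum>d\<in>A. f a b c d) = (\<Sum>d\<in>A. f a b b d)"
    by (rule sum_single) (auto intro!: sum.neutral assms ab)
  also have "\<dots> = f a b b a"
    by (rule sum_single) (auto intro!: assms ab)
  finally show "(\<Sum>c\<in>A. \<Sum>d\<in>A. f a b c d) = f a b b a" .
qed

text \<open>
  The braiding commutes with \<open>K \<otimes> K\<close> for the diagonal matrix \<open>K\<close> of the weights.
\<close>

lemma beta_R:
  assumes "x \<in> idx n" "y \<in> idx n" "a \<in> idx n" "b \<in> idx n"
  shows "beta n a * beta n b * R_op n [x, y] [a, b] = beta n x * beta n y * R_op n [x, y] [a, b]"
proof -
  consider "x = b \<and> y = a" | "x = a \<and> y = b" | "x = - a \<and> y = - b"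
    | "\<not> (x = b \<and> y = a)" "\<not> (x = a \<and> y = b)" "\<not> (x = - a \<and> y = - b)"
    by blast
  then show ?thesis
  proof cases
    case 4
    then have "R_op n [x, y] [a, b] = 0"
      unfolding R_app[OF assms] by (simp only: of_bool_eq mult_zero_left add_0 simp_thms)
    then show ?thesis
      by simp
  qed (use assms[THEN idx_nonzero] in \<open>simp_all add: beta_uminus\<close>)
qed

text \<open>
  The braiding of the dual factors is the rotated braiding of the vector factors, so it can be carried
  along the nested strands, where it cancels the inverse braiding.
\<close>

lemma nest_cross: "mm n 4 (nest_op n) (cross_op n) = nest_op n"
proof (rule Op4_eqI)
  fix x y z w a b c d
  assume *: "x \<in> idx n" "y \<in> idx n" "z \<in> idx n" "w \<in> idx n" "a \<in> idx n" "b \<in> idx n" "c \<in> idx n" "d \<in> idx n"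
  have "mm n 4 (nest_op n) (cross_op n) [x, y, z, w] [a, b, c, d]
    = (\<Sum>k\<in>idx n. \<Sum>l\<in>idx n. nest_op n [x, y, z, w] [k, l, l, k] * cross_op n [k, l, l, k] [a, b, c, d])"
    unfolding mm_def sum_words_4 by (rule sum4_nested) (auto simp: nest_app *)
  also have "\<dots> = (\<Sum>k\<in>idx n. \<Sum>l\<in>idx n. of_bool (x = w \<and> y = z) * (beta n d * beta n c) * (R_op n [d, c] [k, l] * R_inv n [k, l] [a, b]))"
  proof (intro sum.cong refl)
    fix k l assume kl: "k \<in> idx n" "l \<in> idx n"
    have "nest_op n [x, y, z, w] [k, l, l, k] * cross_op n [k, l, l, k] [a, b, c, d]
      = of_bool (x = w \<and> y = z) * (beta n k * beta n l * R_op n [d, c] [k, l]) * R_inv n [k, l] [a, b]"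
      by (simp add: nest_app cross_app * kl mult_ac)
    then show "nest_op n [x, y, z, w] [k, l, l, k] * cross_op n [k, l, l, k] [a, b, c, d]
      = of_bool (x = w \<and> y = z) * (beta n d * beta n c) * (R_op n [d, c] [k, l] * R_inv n [k, l] [a, b])"
      unfolding beta_R[OF *(8,7) kl] by (simp only: mult_ac)
  qed
  also have "\<dots> = of_bool (x = w \<and> y = z) * (beta n d * beta n c) * mm n 2 (R_op n) (R_inv n) [d, c] [a, b]"
    by (simp only: mm_def sum_words_2 sum_distrib_left)
  also have "\<dots> = nest_op n [x, y, z, w] [a, b, c, d]"
    unfolding R_inverse by (auto simp: idm_app words_2 nest_app *)
  finally show "mm n 4 (nest_op n) (cross_op n) [x, y, z, w] [a, b, c, d] = nest_op n [x, y, z, w] [a, b, c, d]" .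
qed simp_all

lemma cross_nest: "mm n 4 (cross_op n) (nest_op n) = nest_op n"
proof (rule Op4_eqI)
  fix x y z w a b c d
  assume *: "x \<in> idx n" "y \<in> idx n" "z \<in> idx n" "w \<in> idx n" "a \<in> idx n" "b \<in> idx n" "c \<in> idx n" "d \<in> idx n"
  have "mm n 4 (cross_op n) (nest_op n) [x, y, z, w] [a, b, c, d]
    = (\<Sum>k\<in>idx n. \<Sum>l\<in>idx n. cross_op n [x, y, z, w] [k, l, l, k] * nest_op n [k, l, l, k] [a, b, c, d])"
    unfolding mm_def sum_words_4 by (rule sum4_nested) (auto simp: nest_app *)
  also have "\<dots> = (\<Sum>k\<in>idx n. \<Sum>l\<in>idx n. of_bool (a = d \<and> b = c) * (beta n a * beta n b) * (R_inv n [x, y] [k, l] * R_op n [k, l] [w, z]))"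
    by (intro sum.cong refl) (simp add: nest_app cross_app *)
  also have "\<dots> = of_bool (a = d \<and> b = c) * (beta n a * beta n b) * mm n 2 (R_inv n) (R_op n) [x, y] [w, z]"
    by (simp only: mm_def sum_words_2 sum_distrib_left)
  also have "\<dots> = nest_op n [x, y, z, w] [a, b, c, d]"
    unfolding R_inverse by (auto simp: idm_app words_2 nest_app *)
  finally show "mm n 4 (cross_op n) (nest_op n) [x, y, z, w] [a, b, c, d] = nest_op n [x, y, z, w] [a, b, c, d]" .
qed simp_all

lemma pad_closed_4 [simp]:
  "M \<in> Op n 2 \<Longrightarrow> pad n 1 2 M 1 \<in> Op n 4" "M \<in> Op n 2 \<Longrightarrow> pad n 0 2 M 2 \<in> Op n 4" "M \<in> Op n 2 \<Longrightarrow> pad n 2 2 M 0 \<in> Op n 4"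
  by (simp_all add: pad_closed')

lemma sum2_diag:
  assumes "finite A" "\<And>u v. u \<in> A \<Longrightarrow> v \<in> A \<Longrightarrow> v \<noteq> u \<Longrightarrow> f u v = 0"
  shows "(\<Sum>u\<in>A. \<Sum>v\<in>A. f u v) = (\<Sum>u\<in>A. f u u)"
  by (intro sum.cong refl sum_single) (use assms in auto)

text \<open>
  The middle factors are contracted on both sides, and then the two crossings cancel.
\<close>

lemma e_cross_e: "mm n 4 (pad n 1 2 (e_op n) 1) (mm n 4 (cross_op n) (pad n 1 2 (e_op n) 1)) = nest_op n"
proof (rule Op4_eqI)
  fix x y z w a b c d
  assume *: "x \<in> idx n" "y \<in> idx n" "z \<in> idx n" "w \<in> idx n" "a \<in> idx n" "b \<in> idx n" "c \<in> idx n" "d \<in> idx n"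
  have right: "mm n 4 N (pad n 1 2 (e_op n) 1) v [a, b, c, d] = of_bool (b = c) * beta n c * (\<Sum>i\<in>idx n. N v [a, i, i, d])" for N v
  proof -
    have "mm n 4 N (pad n 1 2 (e_op n) 1) v [a, b, c, d] = (\<Sum>u\<in>idx n. \<Sum>t\<in>idx n. N v [a, u, t, d] * e_op n [u, t] [b, c])"
      using mm_pad_right[of "[a]" n 1 "[b, c]" 2 "[d]" 1 4 N "e_op n" v] *
      by (simp add: words_2 words_1' sum_words_2 mult.assoc even_sg_entry)
    also have "\<dots> = (\<Sum>u\<in>idx n. N v [a, u, u, d] * e_op n [u, u] [b, c])"
      by (rule sum2_diag) (auto simp: e_app *)
    finally show ?thesis
      by (simp add: e_app * sum_distrib_left mult_ac)
  qed
  have left: "mm n 4 (pad n 1 2 (e_op n) 1) N [x, y, z, w] v = of_bool (y = z) * (\<Sum>u\<in>idx n. beta n u * N [x, u, u, w] v)" for N v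
  proof -
    have sign: "sg ((par y + par z + (par u + par t)) * par x) * e_op n [y, z] [u, t] * r = e_op n [y, z] [u, t] * r" for u t r
      using even_sg_entry[OF e_even, of y z u t "par x" r n] by (simp only: mult_ac)
    have "mm n 4 (pad n 1 2 (e_op n) 1) N [x, y, z, w] v = (\<Sum>u\<in>idx n. \<Sum>t\<in>idx n. e_op n [y, z] [u, t] * N [x, u, t, w] v)"
      using mm_pad_left[of "[x]" n 1 "[y, z]" 2 "[w]" 1 4 "e_op n" N v] *
      by (simp add: words_2 words_1' sum_words_2 sign)
    also have "\<dots> = (\<Sum>u\<in>idx n. e_op n [y, z] [u, u] * N [x, u, u, w] v)"
      by (rule sum2_diag) (auto simp: e_app *)
    finally show ?thesis
      by (simp add: e_app * sum_distrib_left mult_ac)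
  qed
  have "mm n 4 (pad n 1 2 (e_op n) 1) (mm n 4 (cross_op n) (pad n 1 2 (e_op n) 1)) [x, y, z, w] [a, b, c, d]
    = of_bool (y = z) * (\<Sum>u\<in>idx n. beta n u * (of_bool (b = c) * beta n c * (\<Sum>i\<in>idx n. cross_op n [x, u, u, w] [a, i, i, d])))"
    by (simp only: left right)
  also have "\<dots> = of_bool (y = z) * (of_bool (b = c) * beta n c) *
      (\<Sum>u\<in>idx n. \<Sum>i\<in>idx n. beta n u * R_op n [d, i] [w, u] * R_inv n [x, u] [a, i])"
    unfolding sum_distrib_left by (intro sum.cong refl) (simp add: cross_app * mult_ac)
  also have "(\<Sum>u\<in>idx n. \<Sum>i\<in>idx n. beta n u * R_op n [d, i] [w, u] * R_inv n [x, u] [a, i])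
    = of_bool (a = d \<and> x = w) * beta n a"
    by (subst sum.swap) (rule cup_pull(2)[OF *(8,4,1,5)])
  finally show "mm n 4 (pad n 1 2 (e_op n) 1) (mm n 4 (cross_op n) (pad n 1 2 (e_op n) 1)) [x, y, z, w] [a, b, c, d]
    = nest_op n [x, y, z, w] [a, b, c, d]"
    by (auto simp: nest_app * mult_ac)
qed simp_all

lemma cross_eq_pads:
  "mm n 4 (pad n 0 2 (R_inv n) 2) (pad n 2 2 (Rs_op n) 0) = cross_op n"
  "mm n 4 (pad n 2 2 (Rs_op n) 0) (pad n 0 2 (R_inv n) 2) = cross_op n"
proof -
  have "pad n 0 2 (R_inv n) 2 = mten 2 (R_inv n) (idm n 2)" "pad n 2 2 (Rs_op n) 0 = mten 2 (idm n 2) (Rs_op n)"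
    using mten_0_idm[OF mten_closed[OF R_inv_closed idm_closed[of n 2]]]
    by (simp_all add: pad_def mten_idm_0)
  then show "mm n 4 (pad n 0 2 (R_inv n) 2) (pad n 2 2 (Rs_op n) 0) = cross_op n"
    "mm n 4 (pad n 2 2 (Rs_op n) 0) (pad n 0 2 (R_inv n) 2) = cross_op n"
    using mten_supercommute[OF R_inv_even Rs_even R_inv_closed Rs_closed, of n]
    by (simp_all add: cross_op_def smul_simps)
qed

subsection \<open>Odd operators next to a cup or cap\<close>

lemma Phi_square: "mm n 1 (Phi_op n) (Phi_op n) = smul (- 1) (idm n 1)"
proof (rule Op_eqI)
  fix w w' assume "w \<in> words n 1" "w' \<in> words n 1"
  then obtain x a where *: "w = [x]" "w' = [a]" "x \<in> idx n" "a \<in> idx n"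
    by (elim words_1E)
  have "mm n 1 (Phi_op n) (Phi_op n) [x] [a] = (\<Sum>i\<in>idx n. Phi_op n [x] [i] * Phi_op n [i] [a])"
    by (simp only: mm_def sum_words_1[unfolded One_nat_def[symmetric]])
  also have "\<dots> = sg (par x) * Phi_op n [- x] [a]"
    by (rule Phi_sums(2)[OF *(3)])
  also have "\<dots> = smul (- 1) (idm n 1) [x] [a]"
    using idx_nonzero[OF *(4)] by (auto simp: Phi_app * smul_def idm_app words_1' sg_par_uminus)
  finally show "mm n 1 (Phi_op n) (Phi_op n) w w' = smul (- 1) (idm n 1) w w'"
    by (simp only: *)
qed simp_all

lemma PhiT_square: "mm n 1 (PhiT_op n) (PhiT_op n) = idm n 1"
proof (rule Op_eqI)
  fix w w' assume "w \<in> words n 1" "w' \<in> words n 1"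
  then obtain x a where *: "w = [x]" "w' = [a]" "x \<in> idx n" "a \<in> idx n"
    by (elim words_1E)
  have "mm n 1 (PhiT_op n) (PhiT_op n) [x] [a] = (\<Sum>i\<in>idx n. PhiT_op n [x] [i] * PhiT_op n [i] [a])"
    by (simp only: mm_def sum_words_1[unfolded One_nat_def[symmetric]])
  also have "\<dots> = PhiT_op n [- x] [a]"
    by (rule Phi_sums(4)[OF *(3)])
  also have "\<dots> = idm n 1 [x] [a]"
    by (auto simp: PhiT_app * idm_app words_1')
  finally show "mm n 1 (PhiT_op n) (PhiT_op n) w w' = idm n 1 w w'"
    by (simp only: *)
qed simp_all

lemma mm_odd_left:
  assumes "x \<in> idx n" "y \<in> idx n"
  shows "mm n 2 (pad n 0 1 (Phi_op n) 1) N [x, y] w = sg (par x) * N [- x, y] w"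
    and "mm n 2 (pad n 1 1 (PhiT_op n) 0) N [x, y] w = sg (par x) * N [x, - y] w"
    and "mm n 2 (pad n 0 1 (PhiT_op n) 1) N [x, y] w = N [- x, y] w"
proof -
  show "mm n 2 (pad n 0 1 (Phi_op n) 1) N [x, y] w = sg (par x) * N [- x, y] w"
    unfolding mm_pad1_left(1)[OF assms] by (rule Phi_sums(2)[OF assms(1)])
  show "mm n 2 (pad n 0 1 (PhiT_op n) 1) N [x, y] w = N [- x, y] w"
    unfolding mm_pad1_left(1)[OF assms] by (rule Phi_sums(4)[OF assms(1)])
  have "mm n 2 (pad n 1 1 (PhiT_op n) 0) N [x, y] w = (\<Sum>i\<in>idx n. PhiT_op n [y] [i] * (sg ((par y + par i) * par x) * N [x, i] w))"
    by (simp add: mm_pad1_left(2)[OF assms] mult_ac)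
  also have "\<dots> = sg ((par y + par (- y)) * par x) * N [x, - y] w"
    by (rule Phi_sums(4)[OF assms(2)])
  finally show "mm n 2 (pad n 1 1 (PhiT_op n) 0) N [x, y] w = sg (par x) * N [x, - y] w"
    using idx_nonzero[OF assms(2)] by (simp add: sg_par_sum_uminus)
qed

lemma mm_odd_right:
  assumes "a \<in> idx n" "b \<in> idx n"
  shows "mm n 2 N (pad n 0 1 (Phi_op n) 1) w [a, b] = N w [- a, b] * sg (par (- a))"
    and "mm n 2 N (pad n 1 1 (PhiT_op n) 0) w [a, b] = sg (par a) * N w [a, - b]"
    and "mm n 2 N (pad n 0 1 (PhiT_op n) 1) w [a, b] = N w [- a, b]"
proof -
  show "mm n 2 N (pad n 0 1 (Phi_op n) 1) w [a, b] = N w [- a, b] * sg (par (- a))"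
    unfolding mm_pad1_right(1)[OF assms] by (rule Phi_sums(1)[OF assms(1)])
  show "mm n 2 N (pad n 0 1 (PhiT_op n) 1) w [a, b] = N w [- a, b]"
    unfolding mm_pad1_right(1)[OF assms] by (rule Phi_sums(3)[OF assms(1)])
  have "mm n 2 N (pad n 1 1 (PhiT_op n) 0) w [a, b] = sg ((par (- b) + par b) * par a) * N w [a, - b]"
    unfolding mm_pad1_right(2)[OF assms] by (rule Phi_sums(3)[OF assms(2)])
  then show "mm n 2 N (pad n 1 1 (PhiT_op n) 0) w [a, b] = sg (par a) * N w [a, - b]"
    using idx_nonzero[OF assms(2)] by (simp add: sg_par_sum_uminus)
qed

lemma Phi_e: "mm n 2 (pad n 0 1 (Phi_op n) 1) (e_op n) = mm n 2 (pad n 1 1 (PhiT_op n) 0) (e_op n)"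
  by (rule Op2_eqI[where n = n]) (auto simp: mm_odd_left e_app)

lemma e_Phi: "mm n 2 (e_op n) (pad n 0 1 (Phi_op n) 1) = mm n 2 (e_op n) (pad n 1 1 (PhiT_op n) 0)"
proof (rule Op2_eqI)
  fix x y a b assume *: "x \<in> idx n" "y \<in> idx n" "a \<in> idx n" "b \<in> idx n"
  then show "mm n 2 (e_op n) (pad n 0 1 (Phi_op n) 1) [x, y] [a, b] = mm n 2 (e_op n) (pad n 1 1 (PhiT_op n) 0) [x, y] [a, b]"
    using idx_nonzero[OF *(3)] idx_nonzero[OF *(4)]
    by (cases "b = - a") (auto simp: mm_odd_right e_app sg_par_uminus beta_uminus)
qed simp_all

lemma e_Phi_e: "mm n 2 (e_op n) (mm n 2 (pad n 0 1 (Phi_op n) 1) (e_op n)) = 0"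
proof (rule Op2_eqI)
  fix x y a b assume *: "x \<in> idx n" "y \<in> idx n" "a \<in> idx n" "b \<in> idx n"
  have z: "e_op n [x, y] [u, v] * mm n 2 (pad n 0 1 (Phi_op n) 1) (e_op n) [u, v] [a, b] = 0"
    if "u \<in> idx n" "v \<in> idx n" for u v
    using idx_nonzero[OF that(1)] idx_nonzero[OF that(2)] by (cases "u = v") (auto simp: mm_odd_left e_app * that)
  then show "mm n 2 (e_op n) (mm n 2 (pad n 0 1 (Phi_op n) 1) (e_op n)) [x, y] [a, b] = 0 [x, y] [a, b]"
    unfolding mm_def[of n 2 "e_op n"] sum_words_2 zero_fun_apply by (intro sum.neutral ballI z)
qed simp_all

text \<open>
  An entry can be nonzero for one parity only, so its sign needs to be right for this parity only.
\<close>

lemma sign_by_parity: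
  fixes k h :: kq
  assumes "k = - (sg d * h)" "k \<noteq> 0 \<Longrightarrow> even (Suc (d + e))"
  shows "k = sg e * h"
proof (cases "k = 0")
  case True
  then show ?thesis
    using assms(1) by simp
next
  case False
  then have "sg e = - sg d"
    using assms(2) by (auto simp: sg_eq)
  then show ?thesis
    using assms(1) by simp
qed

lemma Rs_PhiT: "mm n 2 (Rs_op n) (pad n 0 1 (PhiT_op n) 1) = mm n 2 (pad n 1 1 (PhiT_op n) 0) (Rs_op n)"
proof (rule Op2_eqI)
  fix x y a b assume *: "x \<in> idx n" "y \<in> idx n" "a \<in> idx n" "b \<in> idx n"
  have "R_op n [b, - a] [y, x] = sg (par x) * R_op n [b, a] [- y, x]"
  proof (rule sign_by_parity)
    have "- sg (par y) * R_op n [b, a] [- y, x] = sg (par b) * sg (par a) * R_op n [b, - a] [y, x]"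
      using R_reflect[OF *(4,3,2,1)] idx_nonzero[OF *(2)] by (simp only: sg_par_uminus not_False_eq_True)
    then show "R_op n [b, - a] [y, x] = - (sg (par a + par b + par y) * R_op n [b, a] [- y, x])"
      by (auto simp: sg_eq split: if_splits)
    assume "R_op n [b, - a] [y, x] \<noteq> 0"
    from oper_par_odd_even[OF R_even this] have "even (par b + par (- a) + (par y + par x))"
      by simp
    moreover have "par (- a) = Suc 0 - par a" "par a \<le> Suc 0"
      using par_uminus[OF idx_nonzero[OF *(3)]] par_le_1[of a] by (simp_all add: One_nat_def)
    ultimately show "even (Suc (par a + par b + par y + par x))"
      by (cases "par a") auto
  qed
  then show "mm n 2 (Rs_op n) (pad n 0 1 (PhiT_op n) 1) [x, y] [a, b] = mm n 2 (pad n 1 1 (PhiT_op n) 0) (Rs_op n) [x, y] [a, b]"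
    using * by (simp add: mm_odd_left mm_odd_right Rs_app)
qed simp_all

section \<open>The crossing of a dual strand with a vector strand\<close>

text \<open>
  The quantum group acts on the dual of the vector representation through the antipode, so this
  crossing is a quarter turn of the inverse braiding.
\<close>

definition W_op :: "nat \<Rightarrow> oper" where
  "W_op n = (\<lambda>w w'. if w \<in> words n 2 \<and> w' \<in> words n 2 then R_inv n [w' ! 0, w ! 0] [w' ! 1, w ! 1] else 0)"

lemma W_closed [simp]: "W_op n \<in> Op n 2"
  by (rule OpI) (auto simp: W_op_def split: if_splits)

lemma W_app:
  assumes "x \<in> idx n" "y \<in> idx n" "a \<in> idx n" "b \<in> idx n"
  shows "W_op n [x, y] [a, b] = R_inv n [a, x] [b, y]"
  using assms by (simp add: W_op_def words_2 nth_Cons')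

lemma W_even [simp]: "oper_par 0 (W_op n)"
proof (rule even2I[OF W_closed])
  fix x y a b assume *: "x \<in> idx n" "y \<in> idx n" "a \<in> idx n" "b \<in> idx n" "W_op n [x, y] [a, b] \<noteq> 0"
  then have "R_inv n [a, x] [b, y] \<noteq> 0"
    by (simp add: W_app)
  from oper_par_odd_even[OF R_inv_even this] show "even (par x + par y + par a + par b)"
    by (simp add: add_ac del: even_add)
qed

lemma sum3_rotate:
  "(\<Sum>u\<in>A. \<Sum>v\<in>A. \<Sum>m\<in>A. f u v m) = (\<Sum>v\<in>A. \<Sum>m\<in>A. \<Sum>u\<in>A. f u v m)"
proof -
  have "(\<Sum>u\<in>A. \<Sum>v\<in>A. \<Sum>m\<in>A. f u v m) = (\<Sum>v\<in>A. \<Sum>u\<in>A. \<Sum>m\<in>A. f u v m)"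
    by (rule sum.swap)
  also have "\<dots> = (\<Sum>v\<in>A. \<Sum>m\<in>A. \<Sum>u\<in>A. f u v m)"
    by (intro sum.cong refl sum.swap)
  finally show ?thesis .
qed

lemma Rs_slides:
  "mm n 3 (pad n 1 2 (Rs_op n) 0) (mm n 3 (pad n 0 2 (W_op n) 1) (pad n 1 2 (W_op n) 0))
   = mm n 3 (pad n 0 2 (W_op n) 1) (mm n 3 (pad n 1 2 (W_op n) 0) (pad n 0 2 (Rs_op n) 1))"
proof (rule Op3_eqI)
  fix x y z a b c
  assume *: "x \<in> idx n" "y \<in> idx n" "z \<in> idx n" "a \<in> idx n" "b \<in> idx n" "c \<in> idx n"
  have "mm n 3 (pad n 1 2 (Rs_op n) 0) (mm n 3 (pad n 0 2 (W_op n) 1) (pad n 1 2 (W_op n) 0)) [x, y, z] [a, b, c]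
    = (\<Sum>u\<in>idx n. \<Sum>v\<in>idx n. \<Sum>m\<in>idx n. R_op n [v, m] [z, y] * R_inv n [a, x] [u, m] * R_inv n [b, u] [c, v])"
    unfolding triple_23_12_23[OF Rs_even W_even W_even *] by (intro sum.cong refl) (simp add: Rs_app W_app *)
  also have "\<dots> = (\<Sum>v\<in>idx n. \<Sum>m\<in>idx n. \<Sum>u\<in>idx n. R_inv n [a, x] [u, m] * R_inv n [b, u] [c, v] * R_op n [v, m] [z, y])"
    by (rule trans[OF sum3_rotate]) (intro sum.cong refl, simp only: mult_ac)
  also have "\<dots> = mm n 3 (pad n 1 2 (R_inv n) 0) (mm n 3 (pad n 0 2 (R_inv n) 1) (pad n 1 2 (R_op n) 0)) [b, a, x] [c, z, y]"
    by (rule triple_23_12_23[OF R_inv_even R_inv_even R_even *(5,4,1,6,3,2), symmetric])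
  also have "\<dots> = (\<Sum>v\<in>idx n. \<Sum>m\<in>idx n. \<Sum>u\<in>idx n. R_op n [b, a] [v, u] * R_inv n [u, x] [m, y] * R_inv n [v, m] [c, z])"
    unfolding R_braid_inv_23 by (rule triple_12_23_12[OF R_even R_inv_even R_inv_even *(5,4,1,6,3,2)])
  also have "\<dots> = (\<Sum>u\<in>idx n. \<Sum>v\<in>idx n. \<Sum>m\<in>idx n. R_inv n [u, x] [m, y] * R_inv n [v, m] [c, z] * R_op n [b, a] [v, u])"
    by (rule trans[OF sum3_rotate[symmetric]]) (intro sum.cong refl, simp only: mult_ac)
  also have "\<dots> = mm n 3 (pad n 0 2 (W_op n) 1) (mm n 3 (pad n 1 2 (W_op n) 0) (pad n 0 2 (Rs_op n) 1)) [x, y, z] [a, b, c]"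
    unfolding triple_12_23_12[OF W_even W_even Rs_even *] by (intro sum.cong refl) (simp add: Rs_app W_app *)
  finally show "mm n 3 (pad n 1 2 (Rs_op n) 0) (mm n 3 (pad n 0 2 (W_op n) 1) (pad n 1 2 (W_op n) 0)) [x, y, z] [a, b, c]
    = mm n 3 (pad n 0 2 (W_op n) 1) (mm n 3 (pad n 1 2 (W_op n) 0) (pad n 0 2 (Rs_op n) 1)) [x, y, z] [a, b, c]" .
qed simp_all

lemma R_slides_W:
  "mm n 3 (pad n 0 2 (R_op n) 1) (mm n 3 (pad n 1 2 (W_op n) 0) (pad n 0 2 (W_op n) 1))
   = mm n 3 (pad n 1 2 (W_op n) 0) (mm n 3 (pad n 0 2 (W_op n) 1) (pad n 1 2 (R_op n) 0))"
proof (rule Op3_eqI)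
  fix x y z a b c
  assume *: "x \<in> idx n" "y \<in> idx n" "z \<in> idx n" "a \<in> idx n" "b \<in> idx n" "c \<in> idx n"
  have "mm n 3 (pad n 0 2 (R_op n) 1) (mm n 3 (pad n 1 2 (W_op n) 0) (pad n 0 2 (W_op n) 1)) [x, y, z] [a, b, c]
    = (\<Sum>u\<in>idx n. \<Sum>v\<in>idx n. \<Sum>m\<in>idx n. R_op n [x, y] [u, m] * R_inv n [v, m] [c, z] * R_inv n [a, u] [b, v])"
    unfolding triple_12_23_12[OF R_even W_even W_even *] by (intro sum.cong refl) (simp add: W_app *)
  also have "\<dots> = (\<Sum>v\<in>idx n. \<Sum>m\<in>idx n. \<Sum>u\<in>idx n. R_op n [x, y] [u, m] * R_inv n [a, u] [b, v] * R_inv n [v, m] [c, z])"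
    by (rule trans[OF sum3_rotate]) (intro sum.cong refl, simp only: mult_ac)
  also have "\<dots> = mm n 3 (pad n 1 2 (R_op n) 0) (mm n 3 (pad n 0 2 (R_inv n) 1) (pad n 1 2 (R_inv n) 0)) [a, x, y] [b, c, z]"
    by (rule triple_23_12_23[OF R_even R_inv_even R_inv_even *(4,1,2,5,6,3), symmetric])
  also have "\<dots> = (\<Sum>u\<in>idx n. \<Sum>v\<in>idx n. \<Sum>m\<in>idx n. R_inv n [a, x] [u, m] * R_inv n [m, y] [v, z] * R_op n [u, v] [b, c])"
    unfolding R_braid_inv_12[symmetric] by (rule triple_12_23_12[OF R_inv_even R_inv_even R_even *(4,1,2,5,6,3)])
  also have "\<dots> = mm n 3 (pad n 1 2 (W_op n) 0) (mm n 3 (pad n 0 2 (W_op n) 1) (pad n 1 2 (R_op n) 0)) [x, y, z] [a, b, c]"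
    unfolding triple_23_12_23[OF W_even W_even R_even *] by (intro sum.cong refl) (simp add: W_app * mult_ac)
  finally show "mm n 3 (pad n 0 2 (R_op n) 1) (mm n 3 (pad n 1 2 (W_op n) 0) (pad n 0 2 (W_op n) 1)) [x, y, z] [a, b, c]
    = mm n 3 (pad n 1 2 (W_op n) 0) (mm n 3 (pad n 0 2 (W_op n) 1) (pad n 1 2 (R_op n) 0)) [x, y, z] [a, b, c]" .
qed simp_all

lemma e_slides:
  "mm n 3 (pad n 1 2 (e_op n) 0) (mm n 3 (pad n 0 2 (R_op n) 1) (pad n 1 2 (W_op n) 0))
   = mm n 3 (pad n 0 2 (R_op n) 1) (mm n 3 (pad n 1 2 (W_op n) 0) (pad n 0 2 (e_op n) 1))"
proof (rule Op3_eqI)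
  fix x y z a b c
  assume *: "x \<in> idx n" "y \<in> idx n" "z \<in> idx n" "a \<in> idx n" "b \<in> idx n" "c \<in> idx n"
  have "mm n 3 (pad n 1 2 (e_op n) 0) (mm n 3 (pad n 0 2 (R_op n) 1) (pad n 1 2 (W_op n) 0)) [x, y, z] [a, b, c]
    = (\<Sum>u\<in>idx n. \<Sum>v\<in>idx n. \<Sum>m\<in>idx n. e_op n [y, z] [m, v] * R_op n [x, m] [a, u] * W_op n [u, v] [b, c])"
    by (rule triple_23_12_23[OF e_even R_even W_even *])
  also have "\<dots> = (\<Sum>u\<in>idx n. \<Sum>v\<in>idx n. e_op n [y, z] [v, v] * R_op n [x, v] [a, u] * W_op n [u, v] [b, c])"
    by (intro sum.cong refl sum_single) (auto simp: e_app *)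
  also have "\<dots> = of_bool (y = z) * (\<Sum>u\<in>idx n. \<Sum>v\<in>idx n. beta n v * R_inv n [b, u] [c, v] * R_op n [x, v] [a, u])"
    unfolding sum_distrib_left by (intro sum.cong refl) (simp add: e_app W_app * mult_ac)
  also have "\<dots> = of_bool (y = z) * (of_bool (a = b \<and> x = c) * beta n a)"
    unfolding cup_pull(1)[OF *(5,6,1,4)] ..
  also have "\<dots> = of_bool (a = b) * beta n b * mm n 2 (R_op n) (R_inv n) [x, y] [c, z]"
    unfolding R_inverse by (auto simp: idm_app words_2 *)
  also have "\<dots> = (\<Sum>u\<in>idx n. \<Sum>m\<in>idx n. R_op n [x, y] [u, m] * W_op n [m, z] [u, c] * e_op n [u, u] [a, b])"
    unfolding mm_def sum_words_2 sum_distrib_left by (intro sum.cong refl) (simp add: e_app W_app * mult_ac)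
  also have "\<dots> = (\<Sum>u\<in>idx n. \<Sum>v\<in>idx n. \<Sum>m\<in>idx n. R_op n [x, y] [u, m] * W_op n [m, z] [v, c] * e_op n [u, v] [a, b])"
    by (intro sum.cong refl sum_single[symmetric]) (auto intro!: sum.neutral simp: e_app *)
  also have "\<dots> = mm n 3 (pad n 0 2 (R_op n) 1) (mm n 3 (pad n 1 2 (W_op n) 0) (pad n 0 2 (e_op n) 1)) [x, y, z] [a, b, c]"
    by (rule triple_12_23_12[OF R_even W_even e_even *, symmetric])
  finally show "mm n 3 (pad n 1 2 (e_op n) 0) (mm n 3 (pad n 0 2 (R_op n) 1) (pad n 1 2 (W_op n) 0)) [x, y, z] [a, b, c]
    = mm n 3 (pad n 0 2 (R_op n) 1) (mm n 3 (pad n 1 2 (W_op n) 0) (pad n 0 2 (e_op n) 1)) [x, y, z] [a, b, c]" .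
qed simp_all

lemma PhiT_slides: "mm n 2 (pad n 1 1 (PhiT_op n) 0) (W_op n) = mm n 2 (W_op n) (pad n 0 1 (PhiT_op n) 1)"
proof (rule Op2_eqI)
  fix x y a b assume *: "x \<in> idx n" "y \<in> idx n" "a \<in> idx n" "b \<in> idx n"
  have "mm n 2 (R_inv n) (pad n 1 1 (Phi_op n) 0) [a, x] [b, y] = sg (par b) * (R_inv n [a, x] [b, - y] * sg (par (- y)))"
  proof -
    have "mm n 2 (R_inv n) (pad n 1 1 (Phi_op n) 0) [a, x] [b, y]
      = sg ((par (- y) + par y) * par b) * R_inv n [a, x] [b, - y] * sg (par (- y))"
      unfolding mm_pad1_right(2)[OF *(4,2)] by (rule Phi_sums(1)[OF *(2)])
    then show ?thesis
      using idx_nonzero[OF *(2)] by (simp add: sg_par_sum_uminus)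
  qed
  then have eq: "sg (par b) * (R_inv n [a, x] [b, - y] * sg (par (- y))) = sg (par a) * R_inv n [- a, x] [b, y]"
    unfolding R_Phi_inv using * by (simp add: mm_odd_left)
  have "R_inv n [- a, x] [b, y] = sg (par x) * R_inv n [a, x] [b, - y]"
  proof (rule sign_by_parity)
    have "sg (par b) * (R_inv n [a, x] [b, - y] * - sg (par y)) = sg (par a) * R_inv n [- a, x] [b, y]"
      using eq idx_nonzero[OF *(2)] by (simp only: sg_par_uminus not_False_eq_True)
    then show "R_inv n [- a, x] [b, y] = - (sg (par a + par b + par y) * R_inv n [a, x] [b, - y])"
      by (auto simp: sg_eq split: if_splits)
    assume "R_inv n [- a, x] [b, y] \<noteq> 0"
    from oper_par_odd_even[OF R_inv_even this] have "even (par (- a) + par x + (par b + par y))"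
      by simp
    moreover have "par (- a) = Suc 0 - par a" "par a \<le> Suc 0"
      using par_uminus[OF idx_nonzero[OF *(3)]] par_le_1[of a] by (simp_all add: One_nat_def)
    ultimately show "even (Suc (par a + par b + par y + par x))"
      by (cases "par a") auto
  qed
  then show "mm n 2 (pad n 1 1 (PhiT_op n) 0) (W_op n) [x, y] [a, b] = mm n 2 (W_op n) (pad n 0 1 (PhiT_op n) 1) [x, y] [a, b]"
    using * by (simp add: mm_odd_left mm_odd_right W_app)
qed simp_all

declare One_nat_def [simp del] plus_1_eq_Suc [simp del] add_2_eq_Suc [simp del] add_2_eq_Suc' [simp del]

section \<open>Moving a vector strand across a module\<close>

text \<open>
  An operator \<open>H\<close> on \<open>k + 1\<close> factors is read as a map \<open>X \<otimes> V \<rightarrow> V \<otimes> X\<close> that moves a vector strand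
  across \<open>X\<close>, the space of the remaining \<open>k\<close> factors. An operator \<open>g\<close> on \<open>X\<close> slides through \<open>H\<close> if
  it may be applied before or after.
\<close>

definition slides :: "nat \<Rightarrow> nat \<Rightarrow> oper \<Rightarrow> oper \<Rightarrow> bool" where
  "slides n k g H \<longleftrightarrow> mm n (k + 1) (pad n 1 k g 0) H = mm n (k + 1) H (pad n 0 k g 1)"

definition rtt :: "nat \<Rightarrow> nat \<Rightarrow> oper \<Rightarrow> bool" where
  "rtt n k H \<longleftrightarrow>
     mm n (k + 2) (pad n 0 2 (R_op n) k) (mm n (k + 2) (pad n 1 (k + 1) H 0) (pad n 0 (k + 1) H 1))
   = mm n (k + 2) (pad n 1 (k + 1) H 0) (mm n (k + 2) (pad n 0 (k + 1) H 1) (pad n k 2 (R_op n) 0))"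

definition strand :: "nat \<Rightarrow> bool \<Rightarrow> oper" where
  "strand n t = (if t then R_op n else W_op n)"

lemma strand_closed [simp]: "strand n t \<in> Op n 2"
  by (simp add: strand_def)

lemma strand_even [simp]: "oper_par 0 (strand n t)"
  by (simp add: strand_def)

text \<open>
  A vector strand crosses the first \<open>k\<close> factors by \<open>F\<close> and then the next \<open>l\<close> factors by \<open>H\<close>.
\<close>

definition join :: "nat \<Rightarrow> nat \<Rightarrow> oper \<Rightarrow> nat \<Rightarrow> oper \<Rightarrow> oper" where
  "join n k F l H = mm n (k + l + 1) (pad n 0 (k + 1) F l) (pad n k (l + 1) H 0)"

lemma join_closed:
  assumes "F \<in> Op n (k + 1)" "H \<in> Op n (l + 1)"
  shows "join n k F l H \<in> Op n (k + l + 1)"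
  unfolding join_def by (intro mm_closed pad_closed' assms) simp_all

lemma join_even: "oper_par 0 F \<Longrightarrow> oper_par 0 H \<Longrightarrow> oper_par 0 (join n k F l H)"
  unfolding join_def using oper_par_mm[OF oper_par_pad oper_par_pad] by fastforce

lemma join_assoc:
  assumes "F \<in> Op n (k + 1)" "G \<in> Op n (l + 1)" "H \<in> Op n (m + 1)"
  shows "join n (k + l) (join n k F l G) m H = join n k F (l + m) (join n l G m H)"
proof -
  have cl: "pad n 0 (k + 1) F l \<in> Op n (k + l + 1)" "pad n k (l + 1) G 0 \<in> Op n (k + l + 1)"
    "pad n 0 (l + 1) G m \<in> Op n (l + m + 1)" "pad n l (m + 1) H 0 \<in> Op n (l + m + 1)"
    using assms by (auto intro: pad_closed')
  have left: "pad n 0 (k + l + 1) (join n k F l G) m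
    = mm n (k + l + m + 1) (pad n 0 (k + 1) F (l + m)) (pad n k (l + 1) G m)"
    unfolding join_def
    by (subst pad_mm[OF cl(1,2), symmetric, where m = "k + l + m + 1"])
      (use assms in \<open>simp_all add: pad_pad[where m = "k + l + 1"]\<close>)
  have right: "pad n k (l + m + 1) (join n l G m H) 0
    = mm n (k + l + m + 1) (pad n k (l + 1) G m) (pad n (k + l) (m + 1) H 0)"
    unfolding join_def
    by (subst pad_mm[OF cl(3,4), symmetric, where m = "k + l + m + 1"])
      (use assms in \<open>simp_all add: pad_pad[where m = "l + m + 1"]\<close>)
  have "join n (k + l) (join n k F l G) m H
    = mm n (k + l + m + 1) (pad n 0 (k + l + 1) (join n k F l G) m) (pad n (k + l) (m + 1) H 0)"
    by (rule join_def)
  also have "\<dots> = mm n (k + (l + m) + 1) (pad n 0 (k + 1) F (l + m)) (pad n k (l + m + 1) (join n l G m H) 0)"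
    unfolding left right mm_assoc by (simp only: add.assoc)
  also have "\<dots> = join n k F (l + m) (join n l G m H)"
    by (rule join_def[symmetric])
  finally show ?thesis .
qed

lemma join_idm:
  assumes "H \<in> Op n (l + 1)"
  shows "join n 0 (idm n 1) l H = H" "join n l H 0 (idm n 1) = H"
proof -
  show "join n 0 (idm n 1) l H = H"
  proof -
    have "pad n 0 1 (idm n 1) l = idm n (l + 1)"
      using pad_idm[of n 0 1 l] by (simp only: add_0 add.commute[of 1 l])
    then show ?thesis
      using assms by (simp add: join_def pad_0_0)
  qed
  have "pad n l 1 (idm n 1) 0 = idm n (l + 1)"
    using pad_idm[of n l 1 0] by simp
  then show "join n l H 0 (idm n 1) = H"
    using assms by (simp add: join_def pad_0_0)
qed

lemma slides_join_right:
  assumes "slides n l g H" "oper_par d g" "oper_par 0 F" "g \<in> Op n l" "F \<in> Op n (k + 1)" "H \<in> Op n (l + 1)"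
  shows "slides n (k + l) (pad n k l g 0) (join n k F l H)"
proof -
  have cl: "pad n 1 l g 0 \<in> Op n (l + 1)" "pad n 0 l g 1 \<in> Op n (l + 1)"
    using assms by (auto intro: pad_closed')
  have "mm n (k + l + 1) (pad n 1 (k + l) (pad n k l g 0) 0) (join n k F l H)
    = mm n (k + l + 1) (mm n (k + l + 1) (pad n (k + 1) l g 0) (pad n 0 (k + 1) F l)) (pad n k (l + 1) H 0)"
    using assms by (simp add: join_def mm_assoc pad_pad add.commute[of 1 k])
  also have "mm n (k + l + 1) (pad n (k + 1) l g 0) (pad n 0 (k + 1) F l)
    = mm n (k + l + 1) (pad n 0 (k + 1) F l) (pad n (k + 1) l g 0)"
    using pad_supercommute[OF assms(3,2,5,4), of "k + l + 1" 0 0 0] by (simp add: smul_simps)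
  also have "mm n (k + l + 1) (mm n (k + l + 1) (pad n 0 (k + 1) F l) (pad n (k + 1) l g 0)) (pad n k (l + 1) H 0)
    = mm n (k + l + 1) (pad n 0 (k + 1) F l) (pad n k (l + 1) (mm n (l + 1) (pad n 1 l g 0) H) 0)"
    using assms cl by (simp add: mm_assoc pad_mm[symmetric, where m = "k + l + 1"] pad_pad)
  also have "\<dots> = mm n (k + l + 1) (join n k F l H) (pad n k l g 1)"
    using assms(1) unfolding slides_def join_def using assms cl
    by (simp add: mm_assoc pad_mm[symmetric, where m = "k + l + 1"] pad_pad)
  finally show ?thesis
    using assms by (simp add: slides_def pad_pad)
qed

lemma slides_join_left:
  assumes "slides n k g F" "oper_par d g" "oper_par 0 H" "g \<in> Op n k" "F \<in> Op n (k + 1)" "H \<in> Op n (l + 1)"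
  shows "slides n (k + l) (pad n 0 k g l) (join n k F l H)"
proof -
  have cl: "pad n 1 k g 0 \<in> Op n (k + 1)" "pad n 0 k g 1 \<in> Op n (k + 1)"
    using assms by (auto intro: pad_closed')
  have "mm n (k + l + 1) (pad n 1 (k + l) (pad n 0 k g l) 0) (join n k F l H)
    = mm n (k + l + 1) (pad n 0 (k + 1) (mm n (k + 1) (pad n 1 k g 0) F) l) (pad n k (l + 1) H 0)"
    using assms cl
    by (simp add: join_def mm_assoc[symmetric] pad_mm[symmetric, where m = "k + l + 1"] pad_pad)
  also have "\<dots> = mm n (k + l + 1) (pad n 0 (k + 1) F l) (mm n (k + l + 1) (pad n 0 k g (l + 1)) (pad n k (l + 1) H 0))"
    using assms(1) unfolding slides_def using assms cl
    by (simp add: mm_assoc pad_mm[symmetric, where m = "k + l + 1"] pad_pad add.commute)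
  also have "mm n (k + l + 1) (pad n 0 k g (l + 1)) (pad n k (l + 1) H 0)
    = mm n (k + l + 1) (pad n k (l + 1) H 0) (pad n 0 k g (l + 1))"
    using pad_supercommute[OF assms(2,3,4,6), of "k + l + 1" 0 0 0] by (simp add: smul_simps)
  finally show ?thesis
    using assms by (simp add: slides_def pad_pad join_def mm_assoc)
qed

text \<open>
  For a single strand \<open>F\<close> followed by \<open>H\<close>, the crossing of the two moving strands is carried first
  across \<open>F\<close> and then across \<open>H\<close>.
\<close>

lemma rtt_join:
  assumes F: "rtt n 1 F" "oper_par 0 F" "F \<in> Op n 2" and H: "rtt n k H" "oper_par 0 H" "H \<in> Op n (k + 1)"
  shows "rtt n (1 + k) (join n 1 F k H)"
proof -
  define m where "m = k + 3"
  define R12 R23 Re F12 F23 H1 H2 where "R12 = pad n 0 2 (R_op n) (k + 1)" and "R23 = pad n 1 2 (R_op n) k"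
    and "Re = pad n (k + 1) 2 (R_op n) 0" and "F12 = pad n 0 2 F (k + 1)" and "F23 = pad n 1 2 F k"
    and "H1 = pad n 1 (k + 1) H 1" and "H2 = pad n 2 (k + 1) H 0"
  note defs = m_def R12_def R23_def Re_def F12_def F23_def H1_def H2_def
  have cl: "pad n 0 2 F k \<in> Op n (k + 2)" "pad n 1 (k + 1) H 0 \<in> Op n (k + 2)" "pad n 0 (k + 1) H 1 \<in> Op n (k + 2)"
    "pad n k 2 (R_op n) 0 \<in> Op n (k + 2)" "pad n 0 2 (R_op n) k \<in> Op n (k + 2)"
    using F H by (auto intro: pad_closed')
  have join: "join n 1 F k H = mm n (k + 2) (pad n 0 2 F k) (pad n 1 (k + 1) H 0)"
  proof -
    have "1 + k + 1 = k + 2"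
      by simp
    then show ?thesis
      by (simp only: join_def one_add_one)
  qed
  have J1: "pad n 1 (k + 2) (join n 1 F k H) 0 = mm n m F23 H2"
    unfolding join using F H cl by (simp add: defs pad_mm[symmetric, where m = "k + 3"] pad_pad)
  have J0: "pad n 0 (k + 2) (join n 1 F k H) 1 = mm n m F12 H1"
    unfolding join using F H cl by (simp add: defs pad_mm[symmetric, where m = "k + 3"] pad_pad)
  have commute: "mm n m H2 F12 = mm n m F12 H2"
    using pad_supercommute[OF F(2) H(2) F(3) H(3), of m 0 0 0] by (simp add: defs smul_simps)
  have slideF: "mm n m R12 (mm n m F23 F12) = mm n m F23 (mm n m F12 R23)"
  proof -
    have "pad n 0 3 (mm n 3 (pad n 0 2 (R_op n) 1) (mm n 3 (pad n 1 2 F 0) (pad n 0 2 F 1))) k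
      = pad n 0 3 (mm n 3 (pad n 1 2 F 0) (mm n 3 (pad n 0 2 F 1) (pad n 1 2 (R_op n) 0))) k"
      using F(1) by (simp add: rtt_def)
    then show ?thesis
      using F(3) by (simp add: defs pad_mm[symmetric, where m = "k + 3"] pad_pad add.commute)
  qed
  have slideH: "mm n m R23 (mm n m H2 H1) = mm n m H2 (mm n m H1 Re)"
  proof -
    have "pad n 1 (k + 2) (mm n (k + 2) (pad n 0 2 (R_op n) k) (mm n (k + 2) (pad n 1 (k + 1) H 0) (pad n 0 (k + 1) H 1))) 0
      = pad n 1 (k + 2) (mm n (k + 2) (pad n 1 (k + 1) H 0) (mm n (k + 2) (pad n 0 (k + 1) H 1) (pad n k 2 (R_op n) 0))) 0"
      using H(1) by (simp add: rtt_def)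
    then show ?thesis
      using H(3) cl by (simp add: defs pad_mm[symmetric, where m = "k + 3"] pad_pad add.commute[of 1 k])
  qed
  have "mm n m R12 (mm n m (mm n m F23 H2) (mm n m F12 H1))
    = mm n m (mm n m R12 (mm n m F23 F12)) (mm n m H2 H1)"
    using commute by (simp add: mm_assoc) (simp flip: mm_assoc)
  also have "\<dots> = mm n m F23 (mm n m F12 (mm n m R23 (mm n m H2 H1)))"
    by (simp only: slideF mm_assoc)
  also have "\<dots> = mm n m F23 (mm n m (mm n m F12 H2) (mm n m H1 Re))"
    by (simp only: slideH mm_assoc)
  also have "\<dots> = mm n m (mm n m F23 H2) (mm n m (mm n m F12 H1) Re)"
    by (simp only: commute[symmetric] mm_assoc)
  finally have total: "mm n m R12 (mm n m (mm n m F23 H2) (mm n m F12 H1))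
    = mm n m (mm n m F23 H2) (mm n m (mm n m F12 H1) Re)" .
  have arith: "1 + k = k + 1" "k + 1 + 1 = k + 2" "k + 1 + 2 = k + 3"
    by simp_all
  show ?thesis
    using total unfolding rtt_def arith J0 J1 R12_def Re_def m_def .
qed

text \<open>The list records for each factor whether it is a copy of the vector representation.\<close>

primrec crossing :: "nat \<Rightarrow> bool list \<Rightarrow> oper" where
  "crossing n [] = idm n 1"
| "crossing n (t # ps) = join n 1 (strand n t) (length ps) (crossing n ps)"

lemma crossing_closed [simp]: "crossing n ps \<in> Op n (length ps + 1)"
proof (induction ps)
  case (Cons t ps)
  then show ?case
    using join_closed[of "strand n t" n 1 "crossing n ps" "length ps"]
    by (simp only: crossing.simps length_Cons Suc_eq_plus1_left one_add_one strand_closed simp_thms)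
qed simp

lemma crossing_even [simp]: "oper_par 0 (crossing n ps)"
  by (induction ps) (simp_all add: join_even)

lemma crossing_append: "crossing n (ps @ us) = join n (length ps) (crossing n ps) (length us) (crossing n us)"
proof (induction ps)
  case Nil
  then show ?case
    by (simp add: join_idm)
next
  case (Cons t ps)
  then show ?case
    using join_assoc[of "strand n t" n 1 "crossing n ps" "length ps" "crossing n us" "length us"]
    by (simp only: append_Cons crossing.simps length_append length_Cons Suc_eq_plus1_left one_add_one
        strand_closed crossing_closed simp_thms)
qed

text \<open>
  The elementary crossings on the other factors act on factors that are disjoint from those of \<open>g\<close>,
  and they are even.
\<close>

lemma slides_crossing:
  assumes "slides n k g (crossing n us)" "length us = k" "oper_par d g" "g \<in> Op n k"
    and "length ps = a" "length vs = b"
  shows "slides n (a + k + b) (pad n a k g b) (crossing n (ps @ us @ vs))"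
proof -
  have gb: "pad n 0 k g b \<in> Op n (k + b)" "oper_par d (pad n 0 k g b)"
    using assms by (auto intro: pad_closed' oper_par_pad)
  have "slides n (k + b) (pad n 0 k g b) (crossing n (us @ vs))"
    using slides_join_left[of n k g "crossing n us" d "crossing n vs" b] assms crossing_closed[of n us] crossing_closed[of n vs]
    by (simp add: crossing_append)
  then have "slides n (a + (k + b)) (pad n a (k + b) (pad n 0 k g b) 0) (crossing n (ps @ us @ vs))"
    using slides_join_right[of n "k + b" "pad n 0 k g b" "crossing n (us @ vs)" d "crossing n ps" a] assms gb
      crossing_closed[of n ps] crossing_closed[of n "us @ vs"]
    by (simp add: crossing_append[of n ps])
  then show ?thesis
    using assms by (simp add: pad_pad add.assoc)
qed

lemma crossing_1: "crossing n [t] = strand n t"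
  using join_idm(2)[of "strand n t" n 1] by simp

lemma crossing_2: "crossing n [s, t] = mm n 3 (pad n 0 2 (strand n s) 1) (pad n 1 2 (strand n t) 0)"
proof -
  have "length [t] = 1"
    by (simp add: One_nat_def)
  moreover have "(1 :: nat) + 1 + 1 = 3"
    by simp
  ultimately show ?thesis
    using crossing_1[of n t] by (simp only: crossing.simps(2)[of n s] join_def one_add_one)
qed

lemma local_slides:
  "slides n 2 (R_op n) (crossing n [True, True])" "slides n 2 (Rs_op n) (crossing n [False, False])"
  "slides n 2 (e_op n) (crossing n [True, False])"
  "slides n 1 (Phi_op n) (crossing n [True])" "slides n 1 (PhiT_op n) (crossing n [False])"
  unfolding slides_def crossing_1 crossing_2 strand_def
  by (simp_all add: mm_assoc R_braid Rs_slides e_slides R_Phi PhiT_slides)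

lemma rtt_strand: "rtt n 1 (strand n t)"
  by (simp add: rtt_def strand_def R_braid R_slides_W)

lemma rtt_idm: "rtt n 0 (idm n 1)"
proof -
  have "pad n 1 1 (idm n 1) 0 = idm n 2" "pad n 0 1 (idm n 1) 1 = idm n 2"
    using pad_idm[of n 1 1 0] pad_idm[of n 0 1 1] by (simp_all only: add_0 add_0_right one_add_one)
  then show ?thesis
    by (simp add: rtt_def pad_0_0)
qed

section \<open>Modules as crossings\<close>

text \<open>
  A family \<open>L i j\<close> of operators on \<open>k\<close> factors, thought of as the images of the generators \<open>u\<^sub>i\<^sub>j\<close>, is
  packed into one crossing: \<open>\<Sum> L i j \<otimes> E\<^sub>i\<^sub>j\<close> followed by the graded flip that moves the last factor
  to the front.
\<close>

definition hat :: "nat \<Rightarrow> nat \<Rightarrow> (int \<Rightarrow> int \<Rightarrow> oper) \<Rightarrow> oper" where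
  "hat n k L = (\<lambda>w w'. if w \<in> words n (Suc k) \<and> w' \<in> words n (Suc k)
     then sg (par (hd w) * wpar (tl w) + (par (hd w) + par (last w')) * wpar (butlast w'))
       * L (hd w) (last w') (tl w) (butlast w')
     else 0)"

lemma hat_closed [simp]: "hat n k L \<in> Op n (k + 1)"
  by (rule OpI) (auto simp: hat_def simp flip: Suc_eq_plus1 split: if_splits)

lemma words_snoc: "u @ [i] \<in> words n (Suc k) \<longleftrightarrow> i \<in> idx n \<and> u \<in> words n k"
  by (auto simp: words_def)

lemma hat_app:
  assumes "i \<in> idx n" "j \<in> idx n" "u \<in> words n k" "u' \<in> words n k"
  shows "hat n k L (i # u) (u' @ [j]) = sg (par i * wpar u + (par i + par j) * wpar u') * L i j u u'"
  using assms by (simp add: hat_def words_Cons words_snoc)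

lemma hat_eqI:
  assumes "H \<in> Op n (k + 1)"
    and "\<And>i j u u'. i \<in> idx n \<Longrightarrow> j \<in> idx n \<Longrightarrow> u \<in> words n k \<Longrightarrow> u' \<in> words n k \<Longrightarrow>
      hat n k L (i # u) (u' @ [j]) = H (i # u) (u' @ [j])"
  shows "hat n k L = H"
proof (rule Op_eqI[OF hat_closed assms(1)])
  fix w w' assume "w \<in> words n (k + 1)" "w' \<in> words n (k + 1)"
  then have "w \<in> words n (Suc k)" "w' \<in> words n (Suc k)"
    by (simp_all only: Suc_eq_plus1)
  then show "hat n k L w w' = H w w'"
    by (elim words_SucE[of w] words_snocE[of w']) (simp add: assms(2))
qed

text \<open>
  The defining relations for the images of the generators, the one with \<open>S\<close> being expressed by the
  crossing, together with their parities and the triangularity.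
\<close>

definition uq_module :: "nat \<Rightarrow> nat \<Rightarrow> (int \<Rightarrow> int \<Rightarrow> oper) \<Rightarrow> bool" where
  "uq_module n k L \<longleftrightarrow>
     (\<forall>i\<in>idx n. \<forall>j\<in>idx n. L i j \<in> Op n k \<and> oper_par (par i + par j) (L i j) \<and> (j < i \<longrightarrow> L i j = 0)) \<and>
     (\<forall>i\<in>idx n. mm n k (L i i) (L (- i) (- i)) = idm n k) \<and> rtt n k (hat n k L)"

lemma hat_even:
  assumes "\<And>i j. i \<in> idx n \<Longrightarrow> j \<in> idx n \<Longrightarrow> oper_par (par i + par j) (L i j)"
  shows "oper_par 0 (hat n k L)"
  unfolding oper_par_def
proof (intro allI impI)
  fix w w' assume nz: "hat n k L w w' \<noteq> 0"
  then have "w \<in> words n (Suc k)" "w' \<in> words n (Suc k)"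
    by (auto simp: hat_def split: if_splits)
  then obtain i u j u' where *: "w = i # u" "w' = u' @ [j]" "i \<in> idx n" "j \<in> idx n" "u \<in> words n k" "u' \<in> words n k"
    by (elim words_SucE[of w] words_snocE[of w'])
  then have "L i j u u' \<noteq> 0"
    using nz by (auto simp: hat_app)
  then have "(wpar u + wpar u') mod 2 = (par i + par j) mod 2"
    using assms[OF *(3,4)] by (auto simp: oper_par_def)
  then have "(wpar u + wpar u' + (par i + par j)) mod 2 = (par i + par j + (par i + par j)) mod 2"
    by (rule mod_add_cong) simp
  then show "(wpar w + wpar w') mod 2 = 0 mod 2"
    using *(1,2) by (simp add: add_ac)
qed

text \<open>
  Comparison of the entries that belong to the basis vectors \<open>v\<^sub>i\<close> and \<open>v\<^sub>j\<close> of the moving strand.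
\<close>

lemma hat_slides_supercommute:
  assumes "slides n k g (hat n k L)" "g \<in> Op n k" "oper_par d g"
    and "i \<in> idx n" "j \<in> idx n" "L i j \<in> Op n k" "oper_par (par i + par j) (L i j)"
  shows "mm n k g (L i j) = smul (sg (d * (par i + par j))) (mm n k (L i j) g)"
proof (rule Op_eqI)
  fix u u' assume u: "u \<in> words n k" "u' \<in> words n k"
  have "mm n (k + 1) (pad n 1 k g 0) (hat n k L) (i # u) (u' @ [j])
    = (\<Sum>v\<in>words n k. sg ((wpar u + wpar v) * par i) * g u v * (sg (par i * wpar v + (par i + par j) * wpar u') * L i j v u'))"
    using mm_pad_left[of "[i]" n 1 u k "[]" 0 "k + 1" g "hat n k L" "u' @ [j]"] assms u
    by (simp add: words_1' hat_app cong: sum.cong)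
  also have "\<dots> = sg (par i * wpar u + (par i + par j) * wpar u') * mm n k g (L i j) u u'"
  proof -
    have "sg ((wpar u + wpar v) * par i) * sg (par i * wpar v + (par i + par j) * wpar u')
      = sg (par i * wpar u + (par i + par j) * wpar u')" for v
      by (auto simp: sg_eq)
    moreover have "p * x * (r * y) = p * r * (x * y)" for p x r y :: kq
      by (simp only: mult_ac)
    ultimately show ?thesis
      unfolding mm_def sum_distrib_left by (intro sum.cong refl) simp
  qed
  finally have left: "mm n (k + 1) (pad n 1 k g 0) (hat n k L) (i # u) (u' @ [j])
    = sg (par i * wpar u + (par i + par j) * wpar u') * mm n k g (L i j) u u'" .
  have "mm n (k + 1) (hat n k L) (pad n 0 k g 1) (i # u) (u' @ [j])
    = (\<Sum>v\<in>words n k. sg (par i * wpar u + (par i + par j) * wpar v) * L i j u v * g v u')"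
    using mm_pad_right[of "[]" n 0 u' k "[j]" 1 "k + 1" "hat n k L" g "i # u"] assms u
    by (simp add: words_1' hat_app cong: sum.cong)
  also have "\<dots> = sg (par i * wpar u + (par i + par j) * wpar u') * (sg (d * (par i + par j)) * mm n k (L i j) g u u')"
    unfolding mm_def sum_distrib_left
  proof (intro sum.cong refl)
    fix v
    show "sg (par i * wpar u + (par i + par j) * wpar v) * L i j u v * g v u'
      = sg (par i * wpar u + (par i + par j) * wpar u') * (sg (d * (par i + par j)) * (L i j u v * g v u'))"
    proof (cases "g v u' = 0")
      case False
      then have "(wpar v + wpar u') mod 2 = d mod 2"
        using assms(3) by (auto simp: oper_par_def)
      then have "even (wpar v) \<longleftrightarrow> (even (wpar u') \<longleftrightarrow> even d)"
        by (metis even_add even_iff_mod_2_eq_zero)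
      then have "sg (par i * wpar u + (par i + par j) * wpar v)
        = sg (par i * wpar u + (par i + par j) * wpar u') * sg (d * (par i + par j))"
        by (auto simp: sg_eq)
      then show ?thesis
        by (simp add: mult_ac)
    qed simp
  qed
  finally have "mm n k g (L i j) u u' = sg (d * (par i + par j)) * mm n k (L i j) g u u'"
    using left assms(1) by (simp add: slides_def)
  then show "mm n k g (L i j) u u' = smul (sg (d * (par i + par j))) (mm n k (L i j) g) u u'"
    by (simp add: smul_def)
qed (use assms in simp_all)

subsection \<open>Tensor products\<close>

definition tensor_family :: "nat \<Rightarrow> nat \<Rightarrow> (int \<Rightarrow> int \<Rightarrow> oper) \<Rightarrow> (int \<Rightarrow> int \<Rightarrow> oper) \<Rightarrow> int \<Rightarrow> int \<Rightarrow> oper" where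
  "tensor_family n k F G i j = (\<Sum>l\<in>idx n. smul (sg ((par i + par l) * (par l + par j))) (mten k (F i l) (G l j)))"

text \<open>
  The index \<open>l\<close> in the coproduct is the label of the moving strand between the two factors.
\<close>

lemma hat_tensor:
  assumes F: "\<And>i j. i \<in> idx n \<Longrightarrow> j \<in> idx n \<Longrightarrow> F i j \<in> Op n a \<and> oper_par (par i + par j) (F i j)"
    and G: "\<And>i j. i \<in> idx n \<Longrightarrow> j \<in> idx n \<Longrightarrow> G i j \<in> Op n b \<and> oper_par (par i + par j) (G i j)"
  shows "hat n (a + b) (tensor_family n a F G) = join n a (hat n a F) b (hat n b G)"
proof (rule hat_eqI)
  show "join n a (hat n a F) b (hat n b G) \<in> Op n (a + b + 1)"
    by (intro join_closed hat_closed)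
next
  fix i j w w' assume ij: "i \<in> idx n" "j \<in> idx n" and w: "w \<in> words n (a + b)" "w' \<in> words n (a + b)"
  obtain u y where u: "w = u @ y" "u \<in> words n a" "y \<in> words n b"
    using w(1) by (rule words_splitE)
  obtain u' y' where u': "w' = u' @ y'" "u' \<in> words n a" "y' \<in> words n b"
    using w(2) by (rule words_splitE)
  have G_even: "oper_par 0 (hat n b G)"
    by (rule hat_even) (use G in blast)
  have "join n a (hat n a F) b (hat n b G) (i # w) (w' @ [j])
    = (\<Sum>c\<in>words n (a + 1). hat n a F (i # u) c * pad n a (b + 1) (hat n b G) 0 (c @ y) (u' @ (y' @ [j])))"
    using mm_pad_left[of "[]" n 0 "i # u" "a + 1" y b "a + b + 1" "hat n a F" "pad n a (b + 1) (hat n b G) 0" "u' @ (y' @ [j])"] ij u u'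
    by (simp add: join_def words_Cons[unfolded Suc_eq_plus1])
  also have "\<dots> = (\<Sum>v\<in>words n a. \<Sum>l\<in>idx n. of_bool (v = u') * (hat n a F (i # u) (v @ [l]) * hat n b G (l # y) (y' @ [j])))"
    unfolding sum_words_snoc[unfolded Suc_eq_plus1]
  proof (intro sum.cong refl)
    fix v l assume "v \<in> words n a" "l \<in> idx n"
    then show "hat n a F (i # u) (v @ [l]) * pad n a (b + 1) (hat n b G) 0 ((v @ [l]) @ y) (u' @ (y' @ [j]))
      = of_bool (v = u') * (hat n a F (i # u) (v @ [l]) * hat n b G (l # y) (y' @ [j]))"
      using pad_app_even[OF G_even, of v n a u' "l # y" "b + 1" "y' @ [j]" "[]" 0 "[]"] u u'
      by (simp add: length_words)
  qed
  also have "\<dots> = (\<Sum>l\<in>idx n. of_bool (u' = u') * (hat n a F (i # u) (u' @ [l]) * hat n b G (l # y) (y' @ [j])))"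
    by (rule sum_single) (use u' in \<open>auto intro!: sum.neutral\<close>)
  also have "\<dots> = (\<Sum>l\<in>idx n. sg (par i * (wpar u + wpar y) + (par i + par j) * (wpar u' + wpar y'))
      * (sg ((par i + par l) * (par l + par j)) * (sg ((wpar y + wpar y') * wpar u') * F i l u u' * G l j y y')))"
  proof (intro sum.cong refl)
    fix l assume l: "l \<in> idx n"
    have "sg (par i * wpar u + (par i + par l) * wpar u') * F i l u u' * (sg (par l * wpar y + (par l + par j) * wpar y') * G l j y y')
      = sg (par i * (wpar u + wpar y) + (par i + par j) * (wpar u' + wpar y'))
      * (sg ((par i + par l) * (par l + par j)) * (sg ((wpar y + wpar y') * wpar u') * F i l u u' * G l j y y'))"
    proof (cases "F i l u u' = 0 \<or> G l j y y' = 0")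
      case False
      then have "(wpar u + wpar u') mod 2 = (par i + par l) mod 2" "(wpar y + wpar y') mod 2 = (par l + par j) mod 2"
        using F[OF ij(1) l] G[OF l ij(2)] by (auto simp: oper_par_def)
      then have "even (wpar u + wpar u') \<longleftrightarrow> even (par i + par l)" "even (wpar y + wpar y') \<longleftrightarrow> even (par l + par j)"
        by (simp_all only: even_iff_mod_2_eq_zero)
      then have "sg (par i * wpar u + (par i + par l) * wpar u') * sg (par l * wpar y + (par l + par j) * wpar y')
        = sg (par i * (wpar u + wpar y) + (par i + par j) * (wpar u' + wpar y')) * sg ((par i + par l) * (par l + par j)) * sg ((wpar y + wpar y') * wpar u')"
        by (auto simp: sg_eq)
      moreover have "p * f * (r * g) = p * r * (f * g)" "x * (z * (t * f * g)) = x * z * t * (f * g)" for p f r g x z t :: kq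
        by (simp_all only: mult_ac)
      ultimately show ?thesis
        by simp
    qed auto
    then show "of_bool (u' = u') * (hat n a F (i # u) (u' @ [l]) * hat n b G (l # y) (y' @ [j]))
      = sg (par i * (wpar u + wpar y) + (par i + par j) * (wpar u' + wpar y'))
      * (sg ((par i + par l) * (par l + par j)) * (sg ((wpar y + wpar y') * wpar u') * F i l u u' * G l j y y'))"
      using ij l u u' by (simp add: hat_app)
  qed
  also have "\<dots> = hat n (a + b) (tensor_family n a F G) (i # w) (w' @ [j])"
    unfolding sum_distrib_left[symmetric] hat_app[OF ij w] using u u'
    by (simp add: tensor_family_def sum_fun_app smul_def mten_append length_words)
  finally show "hat n (a + b) (tensor_family n a F G) (i # w) (w' @ [j]) = join n a (hat n a F) b (hat n b G) (i # w) (w' @ [j])"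
    by (rule sym)
qed

lemma mten_zero: "mten k 0 M = 0" "mten k M 0 = 0"
  by (auto simp: mten_def fun_eq_iff)

lemma uq_module_tensor:
  assumes F: "uq_module n 1 F" and G: "uq_module n k G"
  shows "uq_module n (1 + k) (tensor_family n 1 F G)"
proof -
  have Fp: "F i j \<in> Op n 1" "oper_par (par i + par j) (F i j)" "j < i \<Longrightarrow> F i j = 0"
    if "i \<in> idx n" "j \<in> idx n" for i j
    using F that by (auto simp: uq_module_def)
  have Gp: "G i j \<in> Op n k" "oper_par (par i + par j) (G i j)" "j < i \<Longrightarrow> G i j = 0"
    if "i \<in> idx n" "j \<in> idx n" for i j
    using G that by (auto simp: uq_module_def)
  have diag: "tensor_family n 1 F G i i = mten 1 (F i i) (G i i)" if i: "i \<in> idx n" for i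
  proof -
    have "tensor_family n 1 F G i i = smul (sg ((par i + par i) * (par i + par i))) (mten 1 (F i i) (G i i))"
      unfolding tensor_family_def
    proof (rule sum_single)
      fix l assume l: "l \<in> idx n" "l \<noteq> i"
      then consider "l < i" | "i < l"
        by linarith
      then show "smul (sg ((par i + par l) * (par l + par i))) (mten 1 (F i l) (G l i)) = 0"
        by cases (simp_all add: Fp(3)[OF i l(1)] Gp(3)[OF l(1) i] mten_zero smul_simps)
    qed (use i in auto)
    then show ?thesis
      by (simp add: sg_even_mult smul_simps)
  qed
  show ?thesis
    unfolding uq_module_def
  proof (intro conjI ballI impI)
    fix i j assume ij: "i \<in> idx n" "j \<in> idx n"
    show "tensor_family n 1 F G i j \<in> Op n (1 + k)"
      unfolding tensor_family_def using ij by (intro Op_sum Op_smul mten_closed Fp Gp)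
    show "oper_par (par i + par j) (tensor_family n 1 F G i j)"
      unfolding tensor_family_def
    proof (intro oper_par_sum oper_par_smul)
      fix l assume l: "l \<in> idx n"
      have "par i + par l + (par l + par j) = par i + par j + 2 * par l"
        by simp
      then show "oper_par (par i + par j) (mten 1 (F i l) (G l j))"
        by (intro oper_par_cong[OF oper_par_mten[OF Fp(2)[OF ij(1) l] Gp(2)[OF l ij(2)]]])
          (simp only: mod_mult_self2)
    qed
    assume "j < i"
    then show "tensor_family n 1 F G i j = 0"
      unfolding tensor_family_def
    proof (intro sum.neutral ballI)
      fix l assume l: "l \<in> idx n"
      consider "l < i" | "j < l"
        using \<open>j < i\<close> by linarith
      then show "smul (sg ((par i + par l) * (par l + par j))) (mten 1 (F i l) (G l j)) = 0"
        by cases (simp_all add: Fp(3)[OF ij(1) l] Gp(3)[OF l ij(2)] mten_zero smul_simps)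
    qed
  next
    fix i assume i: "i \<in> idx n"
    have "oper_par 0 (G i i)"
      using Gp(2)[OF i i] by (rule oper_par_cong) simp
    then show "mm n (1 + k) (tensor_family n 1 F G i i) (tensor_family n 1 F G (- i) (- i)) = idm n (1 + k)"
      using i F G by (simp add: diag mten_mm Fp Gp uq_module_def mten_idm)
  next
    have "oper_par 0 (hat n 1 F)" "oper_par 0 (hat n k G)"
      by (rule hat_even; simp add: Fp Gp)+
    moreover have "rtt n 1 (hat n 1 F)" "rtt n k (hat n k G)"
      using F G by (simp_all add: uq_module_def)
    moreover have "hat n 1 F \<in> Op n 2" "hat n k G \<in> Op n (k + 1)"
      using hat_closed[of n 1 F] hat_closed[of n k G] by simp_all
    ultimately have "rtt n (1 + k) (join n 1 (hat n 1 F) k (hat n k G))"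
      by (intro rtt_join)
    then show "rtt n (1 + k) (hat n (1 + k) (tensor_family n 1 F G))"
      by (subst hat_tensor) (use Fp Gp in auto)
  qed
qed

subsection \<open>The trivial module, the vector module and its dual\<close>

lemma uq_module_trivial: "uq_module n 0 (\<lambda>i j. if i = j then idm n 0 else 0)"
proof -
  have "hat n 0 (\<lambda>i j. if i = j then idm n 0 else 0) = idm n 1"
  proof (rule hat_eqI)
    show "idm n 1 \<in> Op n (0 + 1)"
      by simp
  next
    fix i j u u' assume "i \<in> idx n" "j \<in> idx n" "u \<in> words n 0" "u' \<in> words n 0"
    then show "hat n 0 (\<lambda>i j. if i = j then idm n 0 else 0) (i # u) (u' @ [j]) = idm n 1 (i # u) (u' @ [j])"
      using hat_app[of i n j "[]" 0 "[]"] by (auto simp: idm_app words_1')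
  qed
  then show ?thesis
    by (auto simp: uq_module_def rtt_idm mult_2[symmetric] intro: oper_par_cong[OF oper_par_idm])
qed

lemma Op1_eqI:
  assumes "M \<in> Op n 1" "N \<in> Op n 1" "\<And>x a. x \<in> idx n \<Longrightarrow> a \<in> idx n \<Longrightarrow> M [x] [a] = N [x] [a]"
  shows "M = N"
  by (rule Op_eqI[OF assms(1,2)]) (auto elim!: words_1E intro: assms(3))

lemma oper_par1I:
  assumes "M \<in> Op n 1" "\<And>x a. x \<in> idx n \<Longrightarrow> a \<in> idx n \<Longrightarrow> M [x] [a] \<noteq> 0 \<Longrightarrow> even (par x + par a + d)"
  shows "oper_par d M"
  unfolding oper_par_def
proof (intro allI impI)
  fix w w' assume nz: "M w w' \<noteq> 0"
  then have "w \<in> words n 1" "w' \<in> words n 1"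
    using assms(1) by (auto simp: Op_iff)
  then obtain x a where *: "w = [x]" "w' = [a]" "x \<in> idx n" "a \<in> idx n"
    by (elim words_1E)
  then have "even (par x + par a + d)"
    using nz assms(2) by blast
  then have "even (par x + par a) \<longleftrightarrow> even d"
    by simp
  then show "(wpar w + wpar w') mod 2 = d mod 2"
    using * by (simp add: mod2_eq_if del: even_add)
qed

lemma S_comp_closed: "S_comp n i j \<in> Op n 1"
  unfolding S_comp_def by (intro Op2_sum Op_smul E_closed)

lemma S_comp_app:
  assumes "x \<in> idx n" "a \<in> idx n"
  shows "S_comp n i j [x] [a] = sg ((par i + par j) * par a) * S_op n [x, i] [a, j]"
proof -
  have "S_comp n i j [x] [a] = (\<Sum>c\<in>idx n. \<Sum>b\<in>idx n. coef2 (S_op n) c b i j * of_bool (x = c \<and> a = b))"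
    by (simp only: S_comp_def sum_fun_app smul_def E_app)
  also have "\<dots> = coef2 (S_op n) x a i j * of_bool (x = x \<and> a = a)"
    by (subst sum2_single[where a = x and b = a]) (use assms in auto)
  finally show ?thesis
    by (simp add: coef2_def)
qed

lemma hat_vector: "hat n 1 (S_comp n) = R_op n"
proof (rule hat_eqI)
  show "R_op n \<in> Op n (1 + 1)"
    by simp
next
  fix i j u u' assume ij: "i \<in> idx n" "j \<in> idx n" and u: "u \<in> words n 1" "u' \<in> words n 1"
  obtain a b where ab: "u = [a]" "u' = [b]" "a \<in> idx n" "b \<in> idx n"
    using u by (elim words_1E)
  have "hat n 1 (S_comp n) (i # [a]) ([b] @ [j])
    = sg (par i * par a + (par i + par j) * par b) * (sg ((par i + par j) * par b) * S_op n [a, i] [b, j])"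
    by (subst hat_app) (use ij ab in \<open>simp_all add: words_1' S_comp_app\<close>)
  also have "\<dots> = R_op n [i, a] [b, j]"
    using ij ab by (simp add: R_op_def mm_P_left sg_add mult_ac)
  finally show "hat n 1 (S_comp n) (i # u) (u' @ [j]) = R_op n (i # u) (u' @ [j])"
    by (simp add: ab)
qed

lemma uq_module_vector: "uq_module n 1 (S_comp n)"
  unfolding uq_module_def hat_vector
proof (intro conjI ballI impI)
  fix i j assume ij: "i \<in> idx n" "j \<in> idx n"
  show "S_comp n i j \<in> Op n 1"
    by (rule S_comp_closed)
  show "oper_par (par i + par j) (S_comp n i j)"
  proof (rule oper_par1I[OF S_comp_closed])
    fix x a assume xa: "x \<in> idx n" "a \<in> idx n" "S_comp n i j [x] [a] \<noteq> 0"
    then have "S_op n [x, i] [a, j] \<noteq> 0"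
      by (simp add: S_comp_app)
    from oper_par_odd_even[OF S_even this] show "even (par x + par a + (par i + par j))"
      by (simp add: add_ac del: even_add)
  qed
  assume "j < i"
  show "S_comp n i j = 0"
  proof (rule Op1_eqI[OF S_comp_closed Op_zero])
    fix x a assume xa: "x \<in> idx n" "a \<in> idx n"
    have "S_op n [x, i] [a, j] = 0"
      unfolding S_app[OF xa(1) ij(1) xa(2) ij(2)] using \<open>j < i\<close> by auto
    then show "S_comp n i j [x] [a] = 0 [x] [a]"
      using xa by (simp add: S_comp_app)
  qed
next
  fix i assume i: "i \<in> idx n"
  define c where "c i a = qq powi ((of_bool (a = i) + of_bool (a = - i)) * (1 - 2 * int (par i)))" for i a
  have diag: "S_comp n l l [x] [a] = of_bool (x = a) * c l a" if "l \<in> idx n" "x \<in> idx n" "a \<in> idx n" for l x a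
  proof -
    have "S_op n [x, l] [a, l] = of_bool (x = a) * c l a"
      using S_app[OF that(2,1,3,1)] by (auto simp: c_def)
    then show ?thesis
      using that by (simp add: S_comp_app sg_even_mult)
  qed
  have cc: "c i a * c (- i) a = 1" for a
    using idx_nonzero[OF i] by (auto simp: c_def par_def simp flip: power_int_add)
  show "mm n 1 (S_comp n i i) (S_comp n (- i) (- i)) = idm n 1"
  proof (rule Op1_eqI)
    fix x a assume xa: "x \<in> idx n" "a \<in> idx n"
    have "mm n 1 (S_comp n i i) (S_comp n (- i) (- i)) [x] [a]
      = (\<Sum>v\<in>idx n. S_comp n i i [x] [v] * S_comp n (- i) (- i) [v] [a])"
      by (simp only: mm_def sum_words_1[unfolded One_nat_def[symmetric]])
    also have "\<dots> = S_comp n i i [x] [x] * S_comp n (- i) (- i) [x] [a]"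
      by (rule sum_single) (use xa i in \<open>auto simp: diag\<close>)
    also have "\<dots> = idm n 1 [x] [a]"
      using xa i cc[of a] by (auto simp: diag idm_app words_1')
    finally show "mm n 1 (S_comp n i i) (S_comp n (- i) (- i)) [x] [a] = idm n 1 [x] [a]" .
  qed (simp_all add: S_comp_closed)
qed (rule rtt_strand[of n True, unfolded strand_def if_True])

text \<open>
  The images of the generators on the dual module, as computed from the antipode in
  \<open>antipode_vector_app\<close>; the roles of the two words are exchanged by transposition.
\<close>

definition dual_comp :: "nat \<Rightarrow> int \<Rightarrow> int \<Rightarrow> oper" where
  "dual_comp n i j = (\<lambda>w w'. if w \<in> words n 1 \<and> w' \<in> words n 1
     then sg ((par i + par j) * (wpar w + wpar w') + wpar w * par j) * R_inv n [hd w', i] [j, hd w] else 0)"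

lemma dual_comp_closed: "dual_comp n i j \<in> Op n 1"
  by (rule OpI) (auto simp: dual_comp_def split: if_splits)

lemma dual_comp_app:
  assumes "b \<in> idx n" "a \<in> idx n"
  shows "dual_comp n i j [b] [a] = sg ((par i + par j) * (par b + par a) + par b * par j) * R_inv n [a, i] [j, b]"
  using assms by (simp add: dual_comp_def words_1')

lemma hat_dual: "hat n 1 (dual_comp n) = W_op n"
proof (rule hat_eqI)
  show "W_op n \<in> Op n (1 + 1)"
    by simp
next
  fix i j u u' assume ij: "i \<in> idx n" "j \<in> idx n" and u: "u \<in> words n 1" "u' \<in> words n 1"
  obtain a b where ab: "u = [b]" "u' = [a]" "a \<in> idx n" "b \<in> idx n"
    using u by (elim words_1E)
  have "hat n 1 (dual_comp n) (i # [b]) ([a] @ [j])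
    = sg (par i * par b + (par i + par j) * par a) * (sg ((par i + par j) * (par b + par a) + par b * par j) * R_inv n [a, i] [j, b])"
    by (subst hat_app) (use ij ab in \<open>simp_all add: words_1' dual_comp_app\<close>)
  also have "\<dots> = R_inv n [a, i] [j, b]"
    by (auto simp: sg_eq)
  finally show "hat n 1 (dual_comp n) (i # u) (u' @ [j]) = W_op n (i # u) (u' @ [j])"
    using ij ab by (simp add: W_app)
qed

lemma uq_module_dual: "uq_module n 1 (dual_comp n)"
  unfolding uq_module_def hat_dual
proof (intro conjI ballI impI)
  fix i j assume ij: "i \<in> idx n" "j \<in> idx n"
  show "dual_comp n i j \<in> Op n 1"
    by (rule dual_comp_closed)
  show "oper_par (par i + par j) (dual_comp n i j)"
  proof (rule oper_par1I[OF dual_comp_closed])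
    fix b a assume ba: "b \<in> idx n" "a \<in> idx n" "dual_comp n i j [b] [a] \<noteq> 0"
    then have "R_inv n [a, i] [j, b] \<noteq> 0"
      by (simp add: dual_comp_app)
    from oper_par_odd_even[OF R_inv_even this] show "even (par b + par a + (par i + par j))"
      by (simp add: add_ac del: even_add)
  qed
  assume "j < i"
  show "dual_comp n i j = 0"
  proof (rule Op1_eqI[OF dual_comp_closed Op_zero])
    fix b a assume ba: "b \<in> idx n" "a \<in> idx n"
    have "R_op n [a, i] [j, b] = xi * of_bool (a = j \<and> i = b)"
      unfolding R_app[OF ba(2) ij(1) ij(2) ba(1)] using \<open>j < i\<close> by auto
    then show "dual_comp n i j [b] [a] = 0 [b] [a]"
      using ba ij by (simp add: dual_comp_app R_inv_app)
  qed
next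
  fix i assume i: "i \<in> idx n"
  define c where "c l b = sg (par b * par l) * (flip_c l b - of_bool (b = l) * xi)" for l b
  have diag: "dual_comp n l l [b] [a] = of_bool (b = a) * c l b" if "l \<in> idx n" "b \<in> idx n" "a \<in> idx n" for l b a
  proof -
    have "R_inv n [a, l] [l, b] = of_bool (b = a) * (flip_c l b - of_bool (b = l) * xi)"
      using R_app[OF that(3,1,1,2)] idx_nonzero[OF that(1)] that by (auto simp: R_inv_app)
    moreover have "sg ((par l + par l) * (par b + par a) + par b * par l) = sg (par b * par l)"
      by (simp add: sg_eq)
    ultimately show ?thesis
      using that by (simp add: dual_comp_app c_def)
  qed
  have cc: "c i b * c (- i) b = 1" if "b \<in> idx n" for b
  proof -
    have "i \<noteq> 0" "b \<noteq> 0" "- i \<noteq> 0"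
      using idx_nonzero i that by auto
    then show ?thesis
      by (auto simp: c_def flip_c_cases xi_def par_def algebra_simps qq_cancel)
  qed
  show "mm n 1 (dual_comp n i i) (dual_comp n (- i) (- i)) = idm n 1"
  proof (rule Op1_eqI)
    fix x a assume xa: "x \<in> idx n" "a \<in> idx n"
    have "mm n 1 (dual_comp n i i) (dual_comp n (- i) (- i)) [x] [a]
      = (\<Sum>v\<in>idx n. dual_comp n i i [x] [v] * dual_comp n (- i) (- i) [v] [a])"
      by (simp only: mm_def sum_words_1[unfolded One_nat_def[symmetric]])
    also have "\<dots> = dual_comp n i i [x] [x] * dual_comp n (- i) (- i) [x] [a]"
      by (rule sum_single) (use xa i in \<open>auto simp: diag\<close>)
    also have "\<dots> = idm n 1 [x] [a]"
      using xa i cc[of a] by (auto simp: diag idm_app words_1')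
    finally show "mm n 1 (dual_comp n i i) (dual_comp n (- i) (- i)) [x] [a] = idm n 1 [x] [a]" .
  qed (simp_all add: dual_comp_closed)
qed (rule rtt_strand[of n False, unfolded strand_def if_False])

section \<open>The defining relations of the quantum queer superalgebra\<close>

definition uq_gen :: "int \<Rightarrow> int \<Rightarrow> (int \<times> int) falg" where
  "uq_gen i j = (if i \<le> j then gen (i, j) else 0)"

abbreviation uq_eval :: "nat \<Rightarrow> nat \<Rightarrow> (int \<Rightarrow> int \<Rightarrow> oper) \<Rightarrow> (int \<times> int) falg \<Rightarrow> oper" where
  "uq_eval n k L \<equiv> free_eval n k (\<lambda>(i, j). L i j)"

lemma finite_uq_gens: "finite (uq_gens n)"
proof -
  have "uq_gens n \<subseteq> idx n \<times> idx n"
    by (auto simp: uq_gens_def)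
  then show ?thesis
    by (rule finite_subset) simp
qed

lemma uq_gen_closed: "i \<in> idx n \<Longrightarrow> j \<in> idx n \<Longrightarrow> uq_gen i j \<in> carrier (free_alg (uq_gens n))"
  by (auto simp: uq_gen_def uq_gens_def intro!: free_alg_closed)

lemma scal_simps: "scal 0 = 0" "scal 1 = 1"
  by (simp_all add: scal_def zero_list_def flip: single_one)

lemma uq_mat_single:
  assumes "i \<in> idx n" "j \<in> idx n" "\<And>i' j'. L (E i' j') w w' = (if i' = i \<and> j' = j then c else 0)"
  shows "uq_mat n L w w' = scal c * uq_gen i j"
proof -
  have "uq_mat n L w w' = (\<Sum>x\<in>uq_gens n. if x = (i, j) then scal c * gen x else 0)"
    unfolding uq_mat_def by (rule sum.cong) (auto simp: assms(3) scal_simps split: prod.splits)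
  also have "\<dots> = (if (i, j) \<in> uq_gens n then scal c * gen (i, j) else 0)"
    using finite_uq_gens by simp
  finally show ?thesis
    using assms(1,2) by (auto simp: uq_gens_def uq_gen_def)
qed

lemma uq_mat_zero: "(\<And>i' j'. L (E i' j') w w' = 0) \<Longrightarrow> uq_mat n L w w' = 0"
  unfolding uq_mat_def by (rule sum.neutral) (auto simp: scal_simps)

lemma U12_app:
  assumes "a \<in> idx n" "b \<in> idx n" "c \<in> idx n" "d \<in> idx n"
  shows "U12 n [a, c] [b, d] = (if c = d then uq_gen a b else 0)"
proof (cases "c = d")
  case True
  have "U12 n [a, c] [b, d] = scal 1 * uq_gen a b"
    by (rule uq_mat_single) (use assms True in \<open>auto simp: mten_app_1_1 E_app idm_app words_1' sg_even_mult\<close>)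
  then show ?thesis
    using True by (simp add: scal_simps)
next
  case False
  then show ?thesis
    by (auto intro!: uq_mat_zero simp: mten_app_1_1 idm_app)
qed

lemma U13_app:
  assumes "a \<in> idx n" "b \<in> idx n" "c \<in> idx n" "d \<in> idx n"
  shows "U13 n [a, c] [b, d] = (if a = b then scal (sg ((par c + par d) * par b)) * uq_gen c d else 0)"
proof (cases "a = b")
  case True
  have "U13 n [a, c] [b, d] = scal (sg ((par c + par d) * par b)) * uq_gen c d"
    by (rule uq_mat_single) (use assms True in \<open>auto simp: mten_app_1_1 E_app idm_app words_1'\<close>)
  then show ?thesis
    using True by simp
next
  case False
  then show ?thesis
    by (auto intro!: uq_mat_zero simp: mten_app_1_1 idm_app)
qed

lemma finsum_free_alg:
  assumes "finite A" "\<And>x. x \<in> A \<Longrightarrow> f x \<in> carrier (free_alg X)"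
  shows "finsum (free_alg X) f A = sum f A \<and> sum f A \<in> carrier (free_alg X)"
  using assms
proof (induction A rule: finite_induct)
  case empty
  interpret ring "free_alg X"
    by (rule ring_free_alg)
  show ?case
    using free_alg_closed(1)[of X] by simp
next
  case (insert x A)
  interpret ring "free_alg X"
    by (rule ring_free_alg)
  have "finsum (free_alg X) f (insert x A) = f x + finsum (free_alg X) f A"
    using insert by (subst finsum_insert) auto
  then show ?case
    using insert by (auto intro: free_alg_closed)
qed

text \<open>
  Conjugation with the parity operator; it is the image of \<open>twist\<close>.
\<close>

definition twisted :: "nat \<Rightarrow> oper \<Rightarrow> oper" where
  "twisted d M = (\<lambda>w w'. sg (d * (wpar w + wpar w')) * M w w')"

context
  fixes n k L
  assumes mod: "uq_module n k L"
begin

lemma module_props: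
  assumes "i \<in> idx n" "j \<in> idx n"
  shows "L i j \<in> Op n k" "oper_par (par i + par j) (L i j)" "j < i \<Longrightarrow> L i j = 0"
  using mod assms by (auto simp: uq_module_def)

lemma module_gens_closed: "x \<in> uq_gens n \<Longrightarrow> (\<lambda>(i, j). L i j) x \<in> Op n k"
  by (auto simp: uq_gens_def module_props)

lemma module_gens_par: "x \<in> uq_gens n \<Longrightarrow> oper_par (uq_par x) ((\<lambda>(i, j). L i j) x)"
  by (auto simp: uq_gens_def uq_par_def module_props)

lemma uq_eval_gen: "i \<in> idx n \<Longrightarrow> j \<in> idx n \<Longrightarrow> uq_eval n k L (uq_gen i j) = L i j"
  by (auto simp: uq_gen_def free_eval_gen module_props)

lemma uq_eval_twist:
  "a \<in> carrier (free_alg (uq_gens n)) \<Longrightarrow> uq_eval n k L (twist uq_par d a) = twisted d (uq_eval n k L a)"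
  using free_eval_twist[of "uq_gens n" uq_par "\<lambda>(i, j). L i j" a] module_gens_par by (simp add: twisted_def fun_eq_iff)

lemma twisted_smul: "twisted d (smul c M) = smul c (twisted d M)"
  by (simp add: twisted_def smul_def fun_eq_iff mult_ac)

lemma twisted_homogeneous:
  assumes "oper_par e M"
  shows "twisted d M = smul (sg (d * e)) M"
proof (intro ext)
  fix w w'
  show "twisted d M w w' = smul (sg (d * e)) M w w'"
  proof (cases "M w w' = 0")
    case False
    then have "(wpar w + wpar w') mod 2 = e mod 2"
      using assms by (auto simp: oper_par_def)
    then have "sg (d * (wpar w + wpar w')) = sg (d * e)"
      by (intro sg_mod_cong mod_mult_cong refl)
    then show ?thesis
      by (simp add: twisted_def smul_def)
  qed (simp add: twisted_def smul_def)
qed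

lemma uq_eval_mult:
  assumes "a \<in> carrier (free_alg (uq_gens n))" "b \<in> carrier (free_alg (uq_gens n))"
  shows "uq_eval n k L (a * b) = mm n k (uq_eval n k L a) (uq_eval n k L b)"
  by (rule free_eval_mult[where X = "uq_gens n"]) (rule module_gens_closed assms; assumption?)+

lemma uq_eval_closed: "a \<in> carrier (free_alg (uq_gens n)) \<Longrightarrow> uq_eval n k L a \<in> Op n k"
  by (rule free_eval_closed[where X = "uq_gens n"]) (rule module_gens_closed; assumption)

lemma uq_eval_prod:
  assumes "w \<in> words n 2" "w' \<in> words n 2"
    and M: "\<And>v v'. v \<in> words n 2 \<Longrightarrow> v' \<in> words n 2 \<Longrightarrow> M v v' \<in> carrier (free_alg (uq_gens n))"
    and N: "\<And>v v'. v \<in> words n 2 \<Longrightarrow> v' \<in> words n 2 \<Longrightarrow> N v v' \<in> carrier (free_alg (uq_gens n))"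
  shows "uq_eval n k L ((M \<otimes>\<^bsub>uq_free2 n\<^esub> N) w w')
    = (\<Sum>v\<in>words n 2. mm n k (uq_eval n k L (M w v)) (twisted (wpar w + wpar v) (uq_eval n k L (N v w'))))"
proof -
  have cl: "M w v * twist uq_par (wpar w + wpar v) (N v w') \<in> carrier (free_alg (uq_gens n))" if "v \<in> words n 2" for v
    by (intro free_alg_closed M N assms that)
  have prod: "(M \<otimes>\<^bsub>uq_free2 n\<^esub> N) w w' = (\<Sum>v\<in>words n 2. M w v * twist uq_par (wpar w + wpar v) (N v w'))"
    using assms(1,2) finsum_free_alg[OF finite_words, where f = "\<lambda>v. M w v * twist uq_par (wpar w + wpar v) (N v w')", OF cl]
    by (simp add: tens_End_def)
  have "uq_eval n k L ((M \<otimes>\<^bsub>uq_free2 n\<^esub> N) w w')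
    = (\<Sum>v\<in>words n 2. uq_eval n k L (M w v * twist uq_par (wpar w + wpar v) (N v w')))"
    unfolding prod by (rule free_eval_sum)
  also have "\<dots> = (\<Sum>v\<in>words n 2. mm n k (uq_eval n k L (M w v)) (twisted (wpar w + wpar v) (uq_eval n k L (N v w'))))"
  proof (intro sum.cong refl)
    fix v assume v: "v \<in> words n 2"
    show "uq_eval n k L (M w v * twist uq_par (wpar w + wpar v) (N v w'))
      = mm n k (uq_eval n k L (M w v)) (twisted (wpar w + wpar v) (uq_eval n k L (N v w')))"
      unfolding uq_eval_mult[OF M[OF assms(1) v] free_alg_closed(9)[OF N[OF v assms(2)]]]
        uq_eval_twist[OF N[OF v assms(2)]] by (rule refl)
  qed
  finally show ?thesis .
qed

lemma uq_eval_U12: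
  assumes "a \<in> idx n" "b \<in> idx n" "c \<in> idx n" "d \<in> idx n"
  shows "uq_eval n k L (U12 n [a, c] [b, d]) = smul (of_bool (c = d)) (L a b)"
  by (simp add: U12_app assms uq_eval_gen smul_simps)

lemma uq_eval_scal_mult:
  assumes "a \<in> carrier (free_alg (uq_gens n))"
  shows "uq_eval n k L (scal c * a) = smul c (uq_eval n k L a)"
  unfolding uq_eval_mult[OF free_alg_closed(3) assms] free_eval_scal mm_smul_left
  by (simp only: mm_idm_left uq_eval_closed assms)

lemma uq_eval_U13:
  assumes "a \<in> idx n" "b \<in> idx n" "c \<in> idx n" "d \<in> idx n"
  shows "uq_eval n k L (U13 n [a, c] [b, d]) = smul (of_bool (a = b) * sg ((par c + par d) * par b)) (L c d)"
  by (simp add: U13_app assms uq_eval_scal_mult uq_gen_closed uq_eval_gen smul_simps)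

lemma U_closed: "U12 n v v' \<in> carrier (free_alg (uq_gens n))" "U13 n v v' \<in> carrier (free_alg (uq_gens n))"
  "S23 n v v' \<in> carrier (free_alg (uq_gens n))"
  by (intro uq_mat_closed free_alg_closed)+

lemma rtt_left:
  assumes idx: "a \<in> idx n" "b \<in> idx n" "c \<in> idx n" "d \<in> idx n"
  shows "uq_eval n k L ((U12 n \<otimes>\<^bsub>uq_free2 n\<^esub> U13 n \<otimes>\<^bsub>uq_free2 n\<^esub> S23 n) [a, c] [b, d])
    = (\<Sum>x\<in>idx n. \<Sum>y\<in>idx n. smul (S_op n [x, y] [b, d] * sg (par a * (par c + par y))) (mm n k (L a x) (L c y)))"
proof -
  have U: "uq_eval n k L ((U12 n \<otimes>\<^bsub>uq_free2 n\<^esub> U13 n) [a, c] [x, y]) = smul (sg (par a * (par c + par y))) (mm n k (L a x) (L c y))"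
    if xy: "x \<in> idx n" "y \<in> idx n" for x y
  proof -
    define f where "f p r = mm n k (uq_eval n k L (U12 n [a, c] [p, r]))
      (twisted (par a + par c + (par p + par r)) (uq_eval n k L (U13 n [p, r] [x, y])))" for p r
    have f: "f p r = smul (of_bool (c = r)) (smul (of_bool (p = x) * sg ((par r + par y) * par x))
      (smul (sg ((par a + par c + (par p + par r)) * (par r + par y))) (mm n k (L a p) (L r y))))"
      if "p \<in> idx n" "r \<in> idx n" for p r
      by (simp add: f_def uq_eval_U12 uq_eval_U13 idx xy that twisted_smul twisted_homogeneous[OF module_props(2)] mm_smul_left mm_smul_right)
        (simp add: smul_simps mult_ac)
    have "uq_eval n k L ((U12 n \<otimes>\<^bsub>uq_free2 n\<^esub> U13 n) [a, c] [x, y]) = (\<Sum>p\<in>idx n. \<Sum>r\<in>idx n. f p r)"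
      by (subst uq_eval_prod) (use idx xy U_closed in \<open>simp_all add: words_2 sum_words_2 f_def\<close>)
    also have "\<dots> = f x c"
      by (subst sum2_single[where a = x and b = c]) (use idx xy in \<open>auto simp: f smul_simps\<close>)
    also have "\<dots> = smul (sg ((par c + par y) * par x) * sg ((par a + par c + (par x + par c)) * (par c + par y))) (mm n k (L a x) (L c y))"
      using idx xy by (simp add: f smul_simps)
    also have "sg ((par c + par y) * par x) * sg ((par a + par c + (par x + par c)) * (par c + par y)) = sg (par a * (par c + par y))"
      by (auto simp: sg_eq)
    finally show ?thesis .
  qed
  have "uq_eval n k L ((U12 n \<otimes>\<^bsub>uq_free2 n\<^esub> U13 n \<otimes>\<^bsub>uq_free2 n\<^esub> S23 n) [a, c] [b, d])
    = (\<Sum>x\<in>idx n. \<Sum>y\<in>idx n. mm n k (uq_eval n k L ((U12 n \<otimes>\<^bsub>uq_free2 n\<^esub> U13 n) [a, c] [x, y]))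
      (twisted (par a + par c + (par x + par y)) (uq_eval n k L (S23 n [x, y] [b, d]))))"
    by (subst uq_eval_prod) (use idx U_closed in \<open>auto simp: words_2 sum_words_2 intro!: uq_free2_closed\<close>)
  also have "\<dots> = (\<Sum>x\<in>idx n. \<Sum>y\<in>idx n. smul (S_op n [x, y] [b, d] * sg (par a * (par c + par y))) (mm n k (L a x) (L c y)))"
  proof (intro sum.cong refl)
    fix x y assume xy: "x \<in> idx n" "y \<in> idx n"
    have "mm n k (L a x) (L c y) \<in> Op n k"
      using idx xy by (simp add: module_props)
    then show "mm n k (uq_eval n k L ((U12 n \<otimes>\<^bsub>uq_free2 n\<^esub> U13 n) [a, c] [x, y]))
      (twisted (par a + par c + (par x + par y)) (uq_eval n k L (S23 n [x, y] [b, d])))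
      = smul (S_op n [x, y] [b, d] * sg (par a * (par c + par y))) (mm n k (L a x) (L c y))"
      by (simp add: U[OF xy] free_eval_scal twisted_smul twisted_homogeneous[OF oper_par_idm] mm_smul_left mm_smul_right smul_simps mult.commute)
  qed
  finally show ?thesis .
qed

lemma rtt_right:
  assumes idx: "a \<in> idx n" "b \<in> idx n" "c \<in> idx n" "d \<in> idx n"
  shows "uq_eval n k L ((S23 n \<otimes>\<^bsub>uq_free2 n\<^esub> U13 n \<otimes>\<^bsub>uq_free2 n\<^esub> U12 n) [a, c] [b, d])
    = (\<Sum>x\<in>idx n. \<Sum>y\<in>idx n. smul (S_op n [a, c] [x, y] * sg (par b * (par y + par d))) (mm n k (L y d) (L x b)))"
proof -
  have SU: "uq_eval n k L ((S23 n \<otimes>\<^bsub>uq_free2 n\<^esub> U13 n) [a, c] [x, z])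
    = (\<Sum>y\<in>idx n. smul (S_op n [a, c] [x, y] * sg ((par y + par z) * (par a + par c + par y))) (L y z))"
    if xz: "x \<in> idx n" "z \<in> idx n" for x z
  proof -
    define f where "f p y = mm n k (uq_eval n k L (S23 n [a, c] [p, y]))
      (twisted (par a + par c + (par p + par y)) (uq_eval n k L (U13 n [p, y] [x, z])))" for p y
    have f: "f p y = smul (of_bool (p = x)) (smul (S_op n [a, c] [p, y] * (sg ((par y + par z) * par x) * sg ((par a + par c + (par p + par y)) * (par y + par z)))) (L y z))"
      if "p \<in> idx n" "y \<in> idx n" for p y
      using module_props(1)[OF that(2) xz(2)]
      by (simp add: f_def uq_eval_U13 free_eval_scal idx xz that twisted_smul twisted_homogeneous[OF module_props(2)] mm_smul_left mm_smul_right smul_simps mult_ac)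
    have "uq_eval n k L ((S23 n \<otimes>\<^bsub>uq_free2 n\<^esub> U13 n) [a, c] [x, z]) = (\<Sum>p\<in>idx n. \<Sum>y\<in>idx n. f p y)"
      by (subst uq_eval_prod) (use idx xz U_closed in \<open>simp_all add: words_2 sum_words_2 f_def\<close>)
    also have "\<dots> = (\<Sum>y\<in>idx n. f x y)"
      by (rule sum_single) (use xz in \<open>auto intro!: sum.neutral simp: f smul_simps\<close>)
    also have "\<dots> = (\<Sum>y\<in>idx n. smul (S_op n [a, c] [x, y] * sg ((par y + par z) * (par a + par c + par y))) (L y z))"
    proof (intro sum.cong refl)
      fix y assume y: "y \<in> idx n"
      have "sg ((par y + par z) * par x) * sg ((par a + par c + (par x + par y)) * (par y + par z)) = sg ((par y + par z) * (par a + par c + par y))"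
        by (auto simp: sg_eq)
      then show "f x y = smul (S_op n [a, c] [x, y] * sg ((par y + par z) * (par a + par c + par y))) (L y z)"
        by (simp add: f xz y smul_simps)
    qed
    finally show ?thesis .
  qed
  define g where "g x r = mm n k (uq_eval n k L ((S23 n \<otimes>\<^bsub>uq_free2 n\<^esub> U13 n) [a, c] [x, r]))
      (twisted (par a + par c + (par x + par r)) (uq_eval n k L (U12 n [x, r] [b, d])))" for x r
  have g: "g x r = smul (of_bool (r = d)) (smul (sg ((par a + par c + (par x + par r)) * (par x + par b))) (mm n k (uq_eval n k L ((S23 n \<otimes>\<^bsub>uq_free2 n\<^esub> U13 n) [a, c] [x, r])) (L x b)))"
    if "x \<in> idx n" "r \<in> idx n" for x r
    by (simp add: g_def uq_eval_U12 idx that twisted_smul twisted_homogeneous[OF module_props(2)] mm_smul_right)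
  have "uq_eval n k L ((S23 n \<otimes>\<^bsub>uq_free2 n\<^esub> U13 n \<otimes>\<^bsub>uq_free2 n\<^esub> U12 n) [a, c] [b, d]) = (\<Sum>x\<in>idx n. \<Sum>r\<in>idx n. g x r)"
    by (subst uq_eval_prod) (use idx U_closed in \<open>auto simp: words_2 sum_words_2 g_def intro!: uq_free2_closed\<close>)
  also have "\<dots> = (\<Sum>x\<in>idx n. g x d)"
    by (intro sum.cong refl sum_single) (use idx in \<open>auto simp: g smul_simps\<close>)
  also have "\<dots> = (\<Sum>x\<in>idx n. \<Sum>y\<in>idx n. smul (S_op n [a, c] [x, y] * sg (par b * (par y + par d))) (mm n k (L y d) (L x b)))"
  proof (intro sum.cong refl)
    fix x assume x: "x \<in> idx n"
    have "g x d = (\<Sum>y\<in>idx n. smul (sg ((par a + par c + (par x + par d)) * (par x + par b)))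
      (smul (S_op n [a, c] [x, y] * sg ((par y + par d) * (par a + par c + par y))) (mm n k (L y d) (L x b))))"
      using x idx by (simp add: g SU mm_sum_left mm_smul_left smul_sum smul_simps)
    also have "\<dots> = (\<Sum>y\<in>idx n. smul (S_op n [a, c] [x, y] * sg (par b * (par y + par d))) (mm n k (L y d) (L x b)))"
    proof (intro sum.cong refl)
      fix y
      have "sg ((par a + par c + (par x + par d)) * (par x + par b)) * (S_op n [a, c] [x, y] * sg ((par y + par d) * (par a + par c + par y)))
        = S_op n [a, c] [x, y] * sg (par b * (par y + par d))"
      proof (cases "S_op n [a, c] [x, y] = 0")
        case False
        then have "even (par a + par c + (par x + par y))"
          using oper_par_odd_even[OF S_even False] by simp
        then have "sg ((par a + par c + (par x + par d)) * (par x + par b)) * sg ((par y + par d) * (par a + par c + par y)) = sg (par b * (par y + par d))"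
          by (auto simp: sg_eq)
        then show ?thesis
          by (simp add: mult_ac)
      qed simp
      then show "smul (sg ((par a + par c + (par x + par d)) * (par x + par b)))
        (smul (S_op n [a, c] [x, y] * sg ((par y + par d) * (par a + par c + par y))) (mm n k (L y d) (L x b)))
        = smul (S_op n [a, c] [x, y] * sg (par b * (par y + par d))) (mm n k (L y d) (L x b))"
        by (simp only: smul_simps)
    qed
    finally show "g x d = (\<Sum>y\<in>idx n. smul (S_op n [a, c] [x, y] * sg (par b * (par y + par d))) (mm n k (L y d) (L x b)))" .
  qed
  finally show ?thesis .
qed

end

text \<open>
  Two moving strands enter with the labels \<open>b\<close>, \<open>d\<close> and leave with \<open>x\<close>, \<open>y\<close>. The strand from \<open>b\<close> to
  \<open>x\<close> crosses first.
\<close>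

lemma hat_hat:
  assumes L: "\<And>i j. i \<in> idx n \<Longrightarrow> j \<in> idx n \<Longrightarrow> oper_par (par i + par j) (L i j)"
    and idx: "x \<in> idx n" "y \<in> idx n" "b \<in> idx n" "d \<in> idx n" and u: "u \<in> words n k" "u' \<in> words n k"
  shows "mm n (k + 2) (pad n 1 (k + 1) (hat n k L) 0) (pad n 0 (k + 1) (hat n k L) 1) (x # y # u) (u' @ [b, d])
    = sg (par y * wpar u + (par x + par y + par d) * (wpar u + par y + par d) + (par x + par b) * wpar u')
      * mm n k (L y d) (L x b) u u'"
proof -
  let ?H = "hat n k L"
  have H_even: "oper_par 0 ?H"
    by (rule hat_even) (rule L)
  have "mm n (k + 2) (pad n 1 (k + 1) ?H 0) (pad n 0 (k + 1) ?H 1) (x # y # u) (u' @ [b, d])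
    = (\<Sum>c\<in>words n (k + 1). sg ((par y + wpar u + wpar c) * par x) * ?H (y # u) c * pad n 0 (k + 1) ?H 1 (x # c) (u' @ [b, d]))"
    using mm_pad_left[of "[x]" n 1 "y # u" "k + 1" "[]" 0 "k + 2" ?H "pad n 0 (k + 1) ?H 1" "u' @ [b, d]"] idx u
    by (simp add: words_1' words_Cons[unfolded Suc_eq_plus1])
  also have "\<dots> = (\<Sum>v\<in>words n k. \<Sum>l\<in>idx n. of_bool (l = d)
      * (sg ((par y + wpar u + (wpar v + par l)) * par x) * ?H (y # u) (v @ [l]) * ?H (x # v) (u' @ [b])))"
    unfolding sum_words_snoc[unfolded Suc_eq_plus1]
  proof (intro sum.cong refl)
    fix v l assume vl: "v \<in> words n k" "l \<in> idx n"
    have "pad n 0 (k + 1) ?H 1 (x # v @ [l]) (u' @ [b, d]) = of_bool (l = d) * ?H (x # v) (u' @ [b])"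
      using pad_app_even[OF H_even, of "[]" n 0 "[]" "x # v" "k + 1" "u' @ [b]" "[l]" 1 "[d]"] vl idx u
      by (simp add: words_1' length_words)
    then show "sg ((par y + wpar u + wpar (v @ [l])) * par x) * ?H (y # u) (v @ [l]) * pad n 0 (k + 1) ?H 1 (x # v @ [l]) (u' @ [b, d])
      = of_bool (l = d) * (sg ((par y + wpar u + (wpar v + par l)) * par x) * ?H (y # u) (v @ [l]) * ?H (x # v) (u' @ [b]))"
      by simp
  qed
  also have "\<dots> = (\<Sum>v\<in>words n k. of_bool (d = d)
      * (sg ((par y + wpar u + (wpar v + par d)) * par x) * ?H (y # u) (v @ [d]) * ?H (x # v) (u' @ [b])))"
    by (intro sum.cong refl sum_single) (use idx in auto)
  also have "\<dots> = (\<Sum>v\<in>words n k. sg (par y * wpar u + (par x + par y + par d) * (wpar u + par y + par d) + (par x + par b) * wpar u')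
      * (L y d u v * L x b v u'))"
  proof (intro sum.cong refl)
    fix v assume v: "v \<in> words n k"
    show "of_bool (d = d) * (sg ((par y + wpar u + (wpar v + par d)) * par x) * ?H (y # u) (v @ [d]) * ?H (x # v) (u' @ [b]))
      = sg (par y * wpar u + (par x + par y + par d) * (wpar u + par y + par d) + (par x + par b) * wpar u') * (L y d u v * L x b v u')"
    proof (cases "L y d u v = 0")
      case False
      then have "(wpar u + wpar v) mod 2 = (par y + par d) mod 2"
        using L[OF idx(2,4)] by (auto simp: oper_par_def)
      then have "even (wpar u + wpar v) \<longleftrightarrow> even (par y + par d)"
        by (simp only: even_iff_mod_2_eq_zero)
      then have signs: "sg ((par y + wpar u + (wpar v + par d)) * par x) * sg (par y * wpar u + (par y + par d) * wpar v) * sg (par x * wpar v + (par x + par b) * wpar u')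
        = sg (par y * wpar u + (par x + par y + par d) * (wpar u + par y + par d) + (par x + par b) * wpar u')"
        by (auto simp: sg_eq)
      have "p * (r * f) * (t * g) = p * r * t * (f * g)" for p r f t g :: kq
        by (simp only: mult_ac)
      then show ?thesis
        by (simp only: hat_app idx u v signs of_bool_eq mult_1 simp_thms)
    qed (use idx u v in \<open>simp add: hat_app\<close>)
  qed
  finally show ?thesis
    by (simp only: mm_def sum_distrib_left)
qed

lemma rtt_sign_left:
  assumes "even (a + c + (x + y))" "even (u + v) \<longleftrightarrow> even (y + d + (x + b))"
  shows "sg (y * u + (x + y + d) * (u + y + d) + (x + b) * v)
    = sg ((d + b) * u + a + c + b + d + a * c) * sg (c * a) * sg (b * (y + d))"
proof -
  have "even v \<longleftrightarrow> even (u + y + d + x + b)" "even a \<longleftrightarrow> even (c + x + y)"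
    using assms by auto
  then show ?thesis
    by (cases "even x"; cases "even y"; cases "even c"; cases "even u"; cases "even b"; cases "even d"; simp add: sg_eq)
qed

lemma rtt_sign_right:
  assumes "even (x + y + (b + d))" "even (u + v) \<longleftrightarrow> even (c + y + (a + x))"
  shows "sg (c * u + (a + c + y) * (u + c + y) + (a + x) * v)
    = sg ((d + b) * u + a + c + b + d + a * c) * sg (y * x) * sg (c * (a + x))"
proof -
  have "even v \<longleftrightarrow> even (u + c + y + a + x)" "even d \<longleftrightarrow> even (x + y + b)"
    using assms by auto
  then show ?thesis
    by (cases "even x"; cases "even y"; cases "even c"; cases "even u"; cases "even b"; cases "even a"; simp add: sg_eq)
qed

text \<open>
  Up to the common sign \<open>K\<close> both sides are entries of the two sides of the relation for the crossing.
\<close>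

lemma rtt_relation:
  assumes mod: "uq_module n k L" and idx: "a \<in> idx n" "b \<in> idx n" "c \<in> idx n" "d \<in> idx n"
  shows "(\<Sum>x\<in>idx n. \<Sum>y\<in>idx n. smul (S_op n [x, y] [b, d] * sg (par c * (par a + par y))) (mm n k (L c x) (L a y)))
    = (\<Sum>x\<in>idx n. \<Sum>y\<in>idx n. smul (S_op n [c, a] [x, y] * sg (par b * (par y + par d))) (mm n k (L y d) (L x b)))"
    (is "?left = ?right")
proof -
  have L: "L i j \<in> Op n k" "oper_par (par i + par j) (L i j)" if "i \<in> idx n" "j \<in> idx n" for i j
    using mod that by (auto simp: uq_module_def)
  define N where "N = mm n (k + 2) (pad n 1 (k + 1) (hat n k L) 0) (pad n 0 (k + 1) (hat n k L) 1)"
  have NN: "N (x # y # u) (u' @ [p, q]) = sg (par y * wpar u + (par x + par y + par q) * (wpar u + par y + par q)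
      + (par x + par p) * wpar u') * mm n k (L y q) (L x p) u u'"
    if "x \<in> idx n" "y \<in> idx n" "p \<in> idx n" "q \<in> idx n" "u \<in> words n k" "u' \<in> words n k" for x y p q u u'
    unfolding N_def by (rule hat_hat) (use that L(2) in auto)
  have rtt: "mm n (k + 2) (pad n 0 2 (R_op n) k) N = mm n (k + 2) N (pad n k 2 (R_op n) 0)"
    using mod by (simp add: uq_module_def rtt_def N_def mm_assoc)
  have S: "S_op n [p, q] w = sg (par p * par q) * R_op n [q, p] w" if "p \<in> idx n" "q \<in> idx n" for p q w
    using that by (simp add: S_eq_P_R mm_P_left)
  show ?thesis
  proof (rule Op_eqI)
    show "?left \<in> Op n k" "?right \<in> Op n k"
      using idx L by (intro Op_sum Op_smul mm_closed; simp)+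
    fix u u' assume u: "u \<in> words n k" "u' \<in> words n k"
    define K where "K = sg ((par d + par b) * wpar u + par a + par c + par b + par d + par a * par c)"
    have "mm n (k + 2) (pad n 0 2 (R_op n) k) N (a # c # u) (u' @ [b, d])
      = (\<Sum>x\<in>idx n. \<Sum>y\<in>idx n. R_op n [a, c] [x, y] * N (x # y # u) (u' @ [b, d]))"
      using mm_pad_left[of "[]" n 0 "[a, c]" 2 u k "k + 2" "R_op n" N "u' @ [b, d]"] idx u
      by (simp add: words_2 sum_words_2)
    also have "\<dots> = (\<Sum>x\<in>idx n. \<Sum>y\<in>idx n. K * (S_op n [c, a] [x, y] * sg (par b * (par y + par d)) * mm n k (L y d) (L x b) u u'))"
    proof (intro sum.cong refl)
      fix x y assume xy: "x \<in> idx n" "y \<in> idx n"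
      show "R_op n [a, c] [x, y] * N (x # y # u) (u' @ [b, d])
        = K * (S_op n [c, a] [x, y] * sg (par b * (par y + par d)) * mm n k (L y d) (L x b) u u')"
      proof (cases "R_op n [a, c] [x, y] = 0 \<or> mm n k (L y d) (L x b) u u' = 0")
        case True
        then show ?thesis
          unfolding NN[OF xy idx(2,4) u] S[OF idx(3,1)] by auto
      next
        case False
        have "even (par a + par c + (par x + par y))"
          using oper_par_odd_even[OF R_even, of n "[a, c]" "[x, y]"] False by simp
        moreover have "(wpar u + wpar u') mod 2 = (par y + par d + (par x + par b)) mod 2"
          using oper_par_mm[OF L(2)[OF xy(2) idx(4)] L(2)[OF xy(1) idx(2)], of n k] False by (auto simp: oper_par_def)
        then have "even (wpar u + wpar u') \<longleftrightarrow> even (par y + par d + (par x + par b))"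
          by (simp only: even_iff_mod_2_eq_zero)
        ultimately have "sg (par y * wpar u + (par x + par y + par d) * (wpar u + par y + par d) + (par x + par b) * wpar u')
          = K * sg (par c * par a) * sg (par b * (par y + par d))"
          unfolding K_def by (rule rtt_sign_left)
        then show ?thesis
          unfolding NN[OF xy idx(2,4) u] S[OF idx(3,1)] by (simp only: mult_ac)
      qed
    qed
    finally have left: "mm n (k + 2) (pad n 0 2 (R_op n) k) N (a # c # u) (u' @ [b, d]) = K * ?right u u'"
      by (simp only: sum_fun_app smul_def sum_distrib_left)
    have "mm n (k + 2) N (pad n k 2 (R_op n) 0) (a # c # u) (u' @ [b, d])
      = (\<Sum>x\<in>idx n. \<Sum>y\<in>idx n. N (a # c # u) (u' @ [x, y]) * R_op n [x, y] [b, d])"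
      using mm_pad_right[of u' n k "[b, d]" 2 "[]" 0 "k + 2" N "R_op n" "a # c # u"] idx u
      by (simp add: words_2 sum_words_2 mult.assoc even_sg_entry[OF R_even])
    also have "\<dots> = (\<Sum>x\<in>idx n. \<Sum>y\<in>idx n. K * (S_op n [y, x] [b, d] * sg (par c * (par a + par x)) * mm n k (L c y) (L a x) u u'))"
    proof (intro sum.cong refl)
      fix x y assume xy: "x \<in> idx n" "y \<in> idx n"
      show "N (a # c # u) (u' @ [x, y]) * R_op n [x, y] [b, d]
        = K * (S_op n [y, x] [b, d] * sg (par c * (par a + par x)) * mm n k (L c y) (L a x) u u')"
      proof (cases "R_op n [x, y] [b, d] = 0 \<or> mm n k (L c y) (L a x) u u' = 0")
        case True
        then show ?thesis
          unfolding NN[OF idx(1,3) xy u] S[OF xy(2,1)] by auto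
      next
        case False
        have "even (par x + par y + (par b + par d))"
          using oper_par_odd_even[OF R_even, of n "[x, y]" "[b, d]"] False by simp
        moreover have "(wpar u + wpar u') mod 2 = (par c + par y + (par a + par x)) mod 2"
          using oper_par_mm[OF L(2)[OF idx(3) xy(2)] L(2)[OF idx(1) xy(1)], of n k] False by (auto simp: oper_par_def)
        then have "even (wpar u + wpar u') \<longleftrightarrow> even (par c + par y + (par a + par x))"
          by (simp only: even_iff_mod_2_eq_zero)
        ultimately have "sg (par c * wpar u + (par a + par c + par y) * (wpar u + par c + par y) + (par a + par x) * wpar u')
          = K * sg (par y * par x) * sg (par c * (par a + par x))"
          unfolding K_def by (rule rtt_sign_right)
        then show ?thesis
          unfolding NN[OF idx(1,3) xy u] S[OF xy(2,1)] by (simp only: mult_ac)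
      qed
    qed
    also have "\<dots> = (\<Sum>x\<in>idx n. \<Sum>y\<in>idx n. K * (S_op n [x, y] [b, d] * sg (par c * (par a + par y)) * mm n k (L c x) (L a y) u u'))"
      by (rule sum.swap)
    finally have right: "mm n (k + 2) N (pad n k 2 (R_op n) 0) (a # c # u) (u' @ [b, d]) = K * ?left u u'"
      by (simp only: sum_fun_app smul_def sum_distrib_left)
    have "K * ?left u u' = K * ?right u u'"
      using left right rtt by argo
    moreover have "K \<noteq> 0"
      by (simp add: K_def)
    ultimately show "?left u u' = ?right u u'"
      by simp
  qed
qed

lemma presentation_Uq: "presentation (uq_gens n) (uq_rels n)"
  by (rule presentation.intro) (rule uq_rels_closed)

lemma module_representation:
  assumes mod: "uq_module n k L"
  shows "representation (uq_gens n) (uq_rels n) n k (\<lambda>(i, j). L i j)"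
proof (rule representation.intro[OF presentation_Uq], rule representation_axioms.intro)
  show "x \<in> uq_gens n \<Longrightarrow> (\<lambda>(i, j). L i j) x \<in> Op n k" for x
    by (rule module_gens_closed[OF mod])
  show "uq_eval n k L p = uq_eval n k L q" if "(p, q) \<in> uq_rels n" for p q
    using that
  proof cases
    case (diag i)
    have "uq_eval n k L (uq_gen i i * uq_gen (- i) (- i)) = mm n k (L i i) (L (- i) (- i))"
      using diag(3) by (simp add: uq_eval_mult[OF mod] uq_gen_closed uq_eval_gen[OF mod])
    then show ?thesis
      using mod diag by (simp add: uq_gen_def uq_module_def free_eval_1)
  next
    case (rtt w w')
    obtain c a b d where *: "w = [c, a]" "w' = [b, d]" "a \<in> idx n" "b \<in> idx n" "c \<in> idx n" "d \<in> idx n"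
      using rtt(3,4) by (elim words_2E)
    show ?thesis
      unfolding rtt(1,2) *(1,2) rtt_left[OF mod *(5,4,3,6)] rtt_right[OF mod *(5,4,3,6)]
      by (rule rtt_relation[OF mod *(3-6)])
  qed
qed

lemma induced_module:
  assumes "uq_module n k L"
  shows "induced n k (\<lambda>(i, j). L i j) (uq_class n a) = uq_eval n k L a"
  by (rule representation.induced_class[OF module_representation[OF assms]])

lemma uq_vec_class: "uq_vec n (uq_class n a) = uq_eval n 1 (S_comp n) a"
  unfolding uq_vec_def by (rule induced_module[OF uq_module_vector])

section \<open>The antipode\<close>

lemma twist_single: "twist p d (Poly_Mapping.single w c) = Poly_Mapping.single w (sg (d * word_par p w) * c)"
  by (rule poly_mapping_eqI) (auto simp: lookup_twist lookup_single when_def)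

lemma twist_add: "twist p d (a + b) = twist p d a + twist p d b"
  by (rule poly_mapping_eqI) (simp add: lookup_twist lookup_add distrib_left)

lemma twist_0 [simp]: "twist p d 0 = 0"
  by (rule poly_mapping_eqI) (simp add: lookup_twist)

lemma twist_sum: "twist p d (sum f A) = (\<Sum>x\<in>A. twist p d (f x))"
  by (induction A rule: infinite_finite_induct) (simp_all add: twist_add)

lemma twist_mult: "twist p d (a * b) = twist p d a * twist p d b"
proof -
  have single: "twist p d (Poly_Mapping.single w c * Poly_Mapping.single v e)
    = twist p d (Poly_Mapping.single w c) * twist p d (Poly_Mapping.single v e)" for w v c e
    by (simp add: mult_single twist_single plus_list_def word_par_def sg_add distrib_left mult_ac)
  have "twist p d (a * b) = twist p d ((\<Sum>w\<in>Poly_Mapping.keys a. Poly_Mapping.single w (Poly_Mapping.lookup a w))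
      * (\<Sum>v\<in>Poly_Mapping.keys b. Poly_Mapping.single v (Poly_Mapping.lookup b v)))"
    by (simp only: falg_monomials[symmetric])
  also have "\<dots> = (\<Sum>w\<in>Poly_Mapping.keys a. twist p d (Poly_Mapping.single w (Poly_Mapping.lookup a w)))
      * (\<Sum>v\<in>Poly_Mapping.keys b. twist p d (Poly_Mapping.single v (Poly_Mapping.lookup b v)))"
    by (simp only: sum_product twist_sum single)
  also have "\<dots> = twist p d a * twist p d b"
    by (simp only: twist_sum[symmetric] falg_monomials[symmetric])
  finally show ?thesis .
qed

lemma twist_twist: "twist p d (twist p e a) = twist p (d + e) a"
  by (rule poly_mapping_eqI) (simp add: lookup_twist distrib_right sg_add mult.assoc)

lemma twist_mod_2:
  assumes "d mod 2 = e mod 2"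
  shows "twist p d a = twist p e a"
proof (rule poly_mapping_eqI)
  fix w
  have "sg (d * word_par p w) = sg (e * word_par p w)"
    by (intro sg_mod_cong mod_mult_cong refl assms)
  then show "Poly_Mapping.lookup (twist p d a) w = Poly_Mapping.lookup (twist p e a) w"
    by (simp only: lookup_twist)
qed

lemma twist_even: "even d \<Longrightarrow> twist p d a = a"
  by (rule poly_mapping_eqI) (simp add: lookup_twist sg_even_mult)

lemma twist_scal: "twist p d (scal c) = scal c"
  by (simp add: scal_def twist_single word_par_def)

lemma twist_diff: "twist p d (a - b) = twist p d a - twist p d b"
  by (rule poly_mapping_eqI) (simp add: lookup_twist lookup_minus right_diff_distrib)

lemma scal_mult: "scal c * scal d = scal (c * d)"
  by (simp add: scal_def mult_single plus_list_def)

lemma scal_commute: "a * scal c = scal c * a"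
proof -
  have single: "Poly_Mapping.single w d * scal c = scal c * Poly_Mapping.single w d" for w d
    by (simp add: scal_def mult_single plus_list_def mult.commute)
  have "(\<Sum>w\<in>Poly_Mapping.keys a. Poly_Mapping.single w (Poly_Mapping.lookup a w)) * scal c
    = scal c * (\<Sum>w\<in>Poly_Mapping.keys a. Poly_Mapping.single w (Poly_Mapping.lookup a w))"
    unfolding sum_distrib_left sum_distrib_right by (intro sum.cong refl single)
  then show ?thesis
    by (simp only: falg_monomials[symmetric])
qed

lemma scal_mult_scal: "(scal c * a) * (scal d * b) = scal (c * d) * (a * b)"
  using scal_commute[of a d] by (simp only: mult.assoc[symmetric] scal_mult[symmetric]) (simp only: mult.assoc)

lemma scal_mult_inner: "scal c * (a * (scal d * b)) = scal (c * d) * (a * b)"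
  using scal_mult_scal[of c a d b] by (simp only: mult.assoc)

text \<open>
  The relations are homogeneous, so the parity involution descends to the quantum queer
  superalgebra.
\<close>

definition graded_entries :: "nat \<Rightarrow> (int list \<Rightarrow> int list \<Rightarrow> (int \<times> int) falg) \<Rightarrow> bool" where
  "graded_entries n M \<longleftrightarrow> (\<forall>w\<in>words n 2. \<forall>w'\<in>words n 2. M w w' \<in> carrier (free_alg (uq_gens n)) \<and>
     (\<forall>d. twist uq_par d (M w w') = scal (sg (d * (wpar w + wpar w'))) * M w w'))"

lemma twist_uq_gen: "twist uq_par d (uq_gen i j) = scal (sg (d * (par i + par j))) * uq_gen i j"
  by (simp add: uq_gen_def gen_def twist_single word_par_def uq_par_def scal_def mult_single plus_list_def)

lemma graded_U12: "graded_entries n (U12 n)"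
  unfolding graded_entries_def
proof (intro ballI conjI allI)
  fix w w' d assume "w \<in> words n 2" "w' \<in> words n 2"
  then obtain a c b e where *: "w = [a, c]" "w' = [b, e]" "a \<in> idx n" "c \<in> idx n" "b \<in> idx n" "e \<in> idx n"
    by (elim words_2E)
  have "sg (d * (par a + par c + (par b + par c))) = sg (d * (par a + par b))"
    by (auto simp: sg_eq)
  then show "twist uq_par d (U12 n w w') = scal (sg (d * (wpar w + wpar w'))) * U12 n w w'"
    using * by (auto simp: U12_app twist_uq_gen)
qed (rule uq_mat_closed)

lemma graded_U13: "graded_entries n (U13 n)"
  unfolding graded_entries_def
proof (intro ballI conjI allI)
  fix w w' d assume "w \<in> words n 2" "w' \<in> words n 2"
  then obtain a c b e where *: "w = [a, c]" "w' = [b, e]" "a \<in> idx n" "c \<in> idx n" "b \<in> idx n" "e \<in> idx n"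
    by (elim words_2E)
  have "sg (d * (par b + par c + (par b + par e))) = sg (d * (par c + par e))"
    by (auto simp: sg_eq)
  moreover have "scal r * (scal t * x) = scal t * (scal r * x)" for r t and x :: "(int \<times> int) falg"
    by (simp only: mult.assoc[symmetric] scal_mult mult.commute[of r])
  ultimately show "twist uq_par d (U13 n w w') = scal (sg (d * (wpar w + wpar w'))) * U13 n w w'"
    using * by (auto simp: U13_app twist_mult twist_scal twist_uq_gen)
qed (rule uq_mat_closed)

lemma graded_S23: "graded_entries n (S23 n)"
  unfolding graded_entries_def
proof (intro ballI conjI allI)
  fix w w' d
  show "twist uq_par d (S23 n w w') = scal (sg (d * (wpar w + wpar w'))) * S23 n w w'"
  proof (cases "S_op n w w' = 0")
    case False
    have "sg (d * (wpar w + wpar w')) = 1"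
      using sg_even_mult[OF oper_par_odd_even[OF S_even False]] by (simp only: mult.commute)
    then show ?thesis
      by (simp add: twist_scal scal_simps)
  qed (simp add: scal_simps)
qed (rule free_alg_closed)

lemma graded_prod:
  assumes M: "graded_entries n M" and N: "graded_entries n N"
  shows "graded_entries n (M \<otimes>\<^bsub>uq_free2 n\<^esub> N)"
  unfolding graded_entries_def
proof (intro ballI conjI allI)
  fix w w' d assume w: "w \<in> words n 2" "w' \<in> words n 2"
  have cl: "M w v * twist uq_par (wpar w + wpar v) (N v w') \<in> carrier (free_alg (uq_gens n))" if "v \<in> words n 2" for v
    using M N w that by (auto simp: graded_entries_def intro!: free_alg_closed)
  have prod: "(M \<otimes>\<^bsub>uq_free2 n\<^esub> N) w w' = (\<Sum>v\<in>words n 2. M w v * twist uq_par (wpar w + wpar v) (N v w'))"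
    using w finsum_free_alg[OF finite_words, where f = "\<lambda>v. M w v * twist uq_par (wpar w + wpar v) (N v w')", OF cl]
    by (simp add: tens_End_def)
  show "(M \<otimes>\<^bsub>uq_free2 n\<^esub> N) w w' \<in> carrier (free_alg (uq_gens n))"
    unfolding prod using finsum_free_alg[OF finite_words, where f = "\<lambda>v. M w v * twist uq_par (wpar w + wpar v) (N v w')", OF cl] by simp
  have "twist uq_par d (M w v * twist uq_par (wpar w + wpar v) (N v w'))
    = scal (sg (d * (wpar w + wpar w'))) * (M w v * twist uq_par (wpar w + wpar v) (N v w'))" if v: "v \<in> words n 2" for v
  proof -
    have MN: "twist uq_par e (M w v) = scal (sg (e * (wpar w + wpar v))) * M w v"
      "twist uq_par e (N v w') = scal (sg (e * (wpar v + wpar w'))) * N v w'" for e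
      using M N w v by (auto simp: graded_entries_def)
    have s: "sg (d * (wpar w + wpar v)) * sg ((d + (wpar w + wpar v)) * (wpar v + wpar w'))
      = sg (d * (wpar w + wpar w')) * sg ((wpar w + wpar v) * (wpar v + wpar w'))"
      by (auto simp: sg_eq)
    show ?thesis
      unfolding twist_mult twist_twist unfolding MN scal_mult_scal[of _ _ _ "N v w'"] scal_mult_inner[of _ "M w v"] s
      by (rule refl)
  qed
  then show "twist uq_par d ((M \<otimes>\<^bsub>uq_free2 n\<^esub> N) w w') = scal (sg (d * (wpar w + wpar w'))) * (M \<otimes>\<^bsub>uq_free2 n\<^esub> N) w w'"
    unfolding prod twist_sum sum_distrib_left by (intro sum.cong refl)
qed

lemma twist_rel:
  assumes "(a, b) \<in> uq_rels n"
  obtains c where "twist uq_par d (a - b) = scal c * (a - b)"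
  using assms
proof cases
  case (diag i)
  have "sg (d * (par i + par i)) = 1" "sg (d * (par (- i) + par (- i))) = 1"
    by (simp_all add: sg_eq)
  then have "twist uq_par d (uq_gen i i * uq_gen (- i) (- i)) = uq_gen i i * uq_gen (- i) (- i)"
    by (simp add: twist_mult twist_uq_gen scal_simps)
  then have "twist uq_par d (a - b) = scal 1 * (a - b)"
    using diag twist_scal[of uq_par d 1] by (simp add: twist_diff uq_gen_def scal_simps)
  then show ?thesis
    by (rule that)
next
  case (rtt w w')
  have "graded_entries n (U12 n \<otimes>\<^bsub>uq_free2 n\<^esub> U13 n \<otimes>\<^bsub>uq_free2 n\<^esub> S23 n)"
    "graded_entries n (S23 n \<otimes>\<^bsub>uq_free2 n\<^esub> U13 n \<otimes>\<^bsub>uq_free2 n\<^esub> U12 n)"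
    by (intro graded_prod graded_U12 graded_U13 graded_S23)+
  then have "twist uq_par d (a - b) = scal (sg (d * (wpar w + wpar w'))) * (a - b)"
    using rtt by (simp add: twist_diff graded_entries_def right_diff_distrib)
  then show ?thesis
    by (rule that)
qed

lemma twist_ideal:
  assumes "a \<in> pres_ideal (uq_gens n) (uq_rels n)"
  shows "twist uq_par d a \<in> pres_ideal (uq_gens n) (uq_rels n)"
proof -
  interpret presentation "uq_gens n" "uq_rels n"
    by (rule presentation_Uq)
  let ?I = "pres_ideal (uq_gens n) (uq_rels n)" and ?F = "free_alg (uq_gens n)"
  define J where "J = {a \<in> carrier ?F. twist uq_par d a \<in> ?I}"
  have Iring: "x \<in> ?I \<Longrightarrow> y \<in> ?I \<Longrightarrow> x + y \<in> ?I" "x \<in> ?I \<Longrightarrow> z \<in> carrier ?F \<Longrightarrow> z * x \<in> ?I"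
    "x \<in> ?I \<Longrightarrow> z \<in> carrier ?F \<Longrightarrow> x * z \<in> ?I" "0 \<in> ?I" for x y z
    using rel.a_closed[of x y] rel.I_l_closed[of x z] rel.I_r_closed[of x z] rel.zero_closed by simp_all
  have "ideal J ?F"
  proof (rule idealI[OF ring_free_alg])
    show "subgroup J (add_monoid ?F)"
    proof (rule add.subgroupI)
      show "J \<subseteq> carrier ?F" "J \<noteq> {}"
        using Iring(4) free_alg_closed(1)[of "uq_gens n"] by (auto simp: J_def)
      fix x assume x: "x \<in> J"
      then have "\<ominus>\<^bsub>?F\<^esub> x = - x"
        using free_alg_closed(7)[of x "uq_gens n"] by (intro minus_equality) (auto simp: J_def)
      moreover have "- x \<in> J"
        using x Iring(2)[of "twist uq_par d x" "- 1"] free_alg_closed(7)[of x "uq_gens n"]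
          free_alg_closed(7)[OF free_alg_closed(2)[of "uq_gens n"]] twist_diff[of uq_par d 0 x]
        by (simp add: J_def)
      ultimately show "\<ominus>\<^bsub>?F\<^esub> x \<in> J"
        by simp
    next
      fix x y assume "x \<in> J" "y \<in> J"
      then show "x \<oplus>\<^bsub>?F\<^esub> y \<in> J"
        using Iring(1) free_alg_closed(5) by (auto simp: J_def twist_add)
    qed
    fix x z assume "x \<in> J" "z \<in> carrier ?F"
    then show "z \<otimes>\<^bsub>?F\<^esub> x \<in> J" "x \<otimes>\<^bsub>?F\<^esub> z \<in> J"
      using Iring(2)[of "twist uq_par d x" "twist uq_par d z"] Iring(3)[of "twist uq_par d x" "twist uq_par d z"]
        free_alg_closed(8)[of z "uq_gens n" x] free_alg_closed(8)[of x "uq_gens n" z] free_alg_closed(9)[of z "uq_gens n" uq_par d]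
      by (auto simp: J_def twist_mult)
  qed
  moreover have "{a - b | a b. (a, b) \<in> uq_rels n} \<subseteq> J"
  proof clarify
    fix a b assume ab: "(a, b) \<in> uq_rels n"
    obtain c where "twist uq_par d (a - b) = scal c * (a - b)"
      using ab by (rule twist_rel)
    moreover have "a - b \<in> ?I"
      unfolding pres_ideal_def using genideal_self[OF rel_differences] ab by blast
    ultimately show "a - b \<in> J"
      using Iring(2) free_alg_closed(3) rel_differences ab by (auto simp: J_def)
  qed
  ultimately have "?I \<subseteq> J"
    unfolding pres_ideal_def by (intro genideal_minimal)
  then show ?thesis
    using assms by (auto simp: J_def)
qed

lemma twist_class:
  "image (twist uq_par d) (uq_class n a) = uq_class n (twist uq_par d a)"
proof -
  interpret presentation "uq_gens n" "uq_rels n"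
    by (rule presentation_Uq)
  show ?thesis
  proof (intro equalityI subsetI)
    fix y assume "y \<in> image (twist uq_par d) (uq_class n a)"
    then obtain b where "y = twist uq_par d b" "b - a \<in> pres_ideal (uq_gens n) (uq_rels n)"
      by (auto simp: in_pres_class)
    then show "y \<in> uq_class n (twist uq_par d a)"
      using twist_ideal[of "b - a" n d] by (simp add: in_pres_class twist_diff)
  next
    fix y assume "y \<in> uq_class n (twist uq_par d a)"
    then have "twist uq_par d (y - twist uq_par d a) \<in> pres_ideal (uq_gens n) (uq_rels n)"
      by (intro twist_ideal) (simp add: in_pres_class)
    moreover have "twist uq_par d (twist uq_par d x) = x" for x
      by (simp add: twist_twist twist_even)
    ultimately have "twist uq_par d y \<in> uq_class n a" "y = twist uq_par d (twist uq_par d y)"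
      by (simp_all add: in_pres_class twist_diff)
    then show "y \<in> image (twist uq_par d) (uq_class n a)"
      by blast
  qed
qed

text \<open>
  Equality in the quantum queer superalgebra, in terms of representatives, so that the ring identities
  of the free algebra can be used.
\<close>

definition uq_cong :: "nat \<Rightarrow> (int \<times> int) falg \<Rightarrow> (int \<times> int) falg \<Rightarrow> bool" where
  "uq_cong n a b \<longleftrightarrow> a - b \<in> pres_ideal (uq_gens n) (uq_rels n)"

text \<open>
  The product of \<open>\<Sum> M\<^sub>i\<^sub>j \<otimes> E\<^sub>i\<^sub>j\<close> and \<open>\<Sum> N\<^sub>i\<^sub>j \<otimes> E\<^sub>i\<^sub>j\<close> over the free algebra.
\<close>

definition uq_mult :: "nat \<Rightarrow> (int \<Rightarrow> int \<Rightarrow> (int \<times> int) falg) \<Rightarrow> (int \<Rightarrow> int \<Rightarrow> (int \<times> int) falg) \<Rightarrow> int \<Rightarrow> int \<Rightarrow> (int \<times> int) falg" where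
  "uq_mult n M N i j = (\<Sum>v\<in>idx n. M i v * twist uq_par (par i + par v) (N v j))"

lemma free_alg_sum_closed: "(\<And>x. x \<in> A \<Longrightarrow> f x \<in> carrier (free_alg X)) \<Longrightarrow> sum f A \<in> carrier (free_alg X)"
  by (induction A rule: infinite_finite_induct) (auto intro!: free_alg_closed)

context
  fixes n :: nat
begin

interpretation presentation "uq_gens n" "uq_rels n"
  by (rule presentation_Uq)

abbreviation (input) "uq_I \<equiv> pres_ideal (uq_gens n) (uq_rels n)"
abbreviation (input) "uq_F \<equiv> carrier (free_alg (uq_gens n))"

lemma uq_ideal:
  "0 \<in> uq_I" "a \<in> uq_I \<Longrightarrow> b \<in> uq_I \<Longrightarrow> a + b \<in> uq_I"
  "a \<in> uq_I \<Longrightarrow> c \<in> uq_F \<Longrightarrow> c * a \<in> uq_I" "a \<in> uq_I \<Longrightarrow> c \<in> uq_F \<Longrightarrow> a * c \<in> uq_I"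
  using rel.a_closed[of a b] rel.I_l_closed[of a c] rel.I_r_closed[of a c] rel.zero_closed by simp_all

lemma uq_ideal_minus: "a \<in> uq_I \<Longrightarrow> - a \<in> uq_I"
  using uq_ideal(3)[of a "- 1"] free_alg_closed(7)[OF free_alg_closed(2)[of "uq_gens n"]] by simp

lemma uq_cong_refl [simp]: "uq_cong n a a"
  by (simp add: uq_cong_def uq_ideal)

lemma uq_cong_sym: "uq_cong n a b \<Longrightarrow> uq_cong n b a"
  unfolding uq_cong_def using uq_ideal_minus[of "a - b"] by simp

lemma uq_cong_trans: "uq_cong n a b \<Longrightarrow> uq_cong n b c \<Longrightarrow> uq_cong n a c"
  unfolding uq_cong_def using uq_ideal(2)[of "a - b" "b - c"] by simp

lemma uq_cong_class:
  "a \<in> uq_F \<Longrightarrow> b \<in> uq_F \<Longrightarrow> uq_class n a = uq_class n b \<longleftrightarrow> uq_cong n a b"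
  using pres_class_eqI[of a b] pres_class_self[of a] by (auto simp: uq_cong_def in_pres_class)

lemma uq_cong_sum: "(\<And>x. x \<in> A \<Longrightarrow> uq_cong n (f x) (g x)) \<Longrightarrow> uq_cong n (sum f A) (sum g A)"
proof (induction A rule: infinite_finite_induct)
  case (insert x A)
  then have "uq_cong n (f x) (g x)" "uq_cong n (sum f A) (sum g A)"
    by auto
  then have "f x - g x + (sum f A - sum g A) \<in> uq_I"
    unfolding uq_cong_def by (rule uq_ideal(2))
  then show ?case
    using insert(1,2) by (simp add: uq_cong_def algebra_simps)
qed auto

lemma uq_cong_mult_left: "uq_cong n a b \<Longrightarrow> c \<in> uq_F \<Longrightarrow> uq_cong n (c * a) (c * b)"
  unfolding uq_cong_def using uq_ideal(3)[of "a - b" c] by (simp add: right_diff_distrib)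

lemma uq_cong_mult_right: "uq_cong n a b \<Longrightarrow> c \<in> uq_F \<Longrightarrow> uq_cong n (a * c) (b * c)"
  unfolding uq_cong_def using uq_ideal(4)[of "a - b" c] by (simp add: left_diff_distrib)

lemma uq_cong_twist: "uq_cong n a b \<Longrightarrow> uq_cong n (twist uq_par d a) (twist uq_par d b)"
  unfolding uq_cong_def using twist_ideal[of "a - b" n d] by (simp add: twist_diff)

lemma uq_mult_closed:
  "(\<And>i j. i \<in> idx n \<Longrightarrow> j \<in> idx n \<Longrightarrow> M i j \<in> uq_F) \<Longrightarrow> (\<And>i j. i \<in> idx n \<Longrightarrow> j \<in> idx n \<Longrightarrow> N i j \<in> uq_F) \<Longrightarrow>
    i \<in> idx n \<Longrightarrow> j \<in> idx n \<Longrightarrow> uq_mult n M N i j \<in> uq_F"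
  unfolding uq_mult_def by (intro free_alg_sum_closed free_alg_closed(8,9))

lemma uq_mult_assoc: "uq_mult n (uq_mult n M N) K i j = uq_mult n M (uq_mult n N K) i j"
proof -
  have "uq_mult n (uq_mult n M N) K i j
    = (\<Sum>v\<in>idx n. \<Sum>u\<in>idx n. M i u * twist uq_par (par i + par u) (N u v) * twist uq_par (par i + par v) (K v j))"
    by (simp only: uq_mult_def sum_distrib_right)
  also have "\<dots> = (\<Sum>u\<in>idx n. \<Sum>v\<in>idx n. M i u * twist uq_par (par i + par u) (N u v) * twist uq_par (par i + par v) (K v j))"
    by (rule sum.swap)
  also have "\<dots> = (\<Sum>u\<in>idx n. \<Sum>v\<in>idx n. M i u * (twist uq_par (par i + par u) (N u v) * twist uq_par (par i + par u + (par u + par v)) (K v j)))"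
  proof (intro sum.cong refl)
    fix u v
    have "twist uq_par (par i + par v) (K v j) = twist uq_par (par i + par u + (par u + par v)) (K v j)"
      by (rule twist_mod_2) (auto simp: par_def)
    then show "M i u * twist uq_par (par i + par u) (N u v) * twist uq_par (par i + par v) (K v j)
      = M i u * (twist uq_par (par i + par u) (N u v) * twist uq_par (par i + par u + (par u + par v)) (K v j))"
      by (simp only: mult.assoc)
  qed
  also have "\<dots> = uq_mult n M (uq_mult n N K) i j"
    by (simp only: uq_mult_def twist_sum twist_mult twist_twist sum_distrib_left)
  finally show ?thesis .
qed

lemma uq_mult_cong:
  assumes "\<And>i j. i \<in> idx n \<Longrightarrow> j \<in> idx n \<Longrightarrow> uq_cong n (M i j) (M' i j)"
    and "\<And>i j. i \<in> idx n \<Longrightarrow> j \<in> idx n \<Longrightarrow> uq_cong n (N i j) (N' i j)"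
    and "\<And>i j. i \<in> idx n \<Longrightarrow> j \<in> idx n \<Longrightarrow> M i j \<in> uq_F" "\<And>i j. i \<in> idx n \<Longrightarrow> j \<in> idx n \<Longrightarrow> N' i j \<in> uq_F"
    and "i \<in> idx n" "j \<in> idx n"
  shows "uq_cong n (uq_mult n M N i j) (uq_mult n M' N' i j)"
  unfolding uq_mult_def
proof (rule uq_cong_sum)
  fix v assume v: "v \<in> idx n"
  let ?d = "par i + par v"
  have "uq_cong n (M i v * twist uq_par ?d (N v j)) (M i v * twist uq_par ?d (N' v j))"
    using v assms by (intro uq_cong_mult_left uq_cong_twist)
  moreover have "uq_cong n (M i v * twist uq_par ?d (N' v j)) (M' i v * twist uq_par ?d (N' v j))"
    using v assms by (intro uq_cong_mult_right free_alg_closed(9))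
  ultimately show "uq_cong n (M i v * twist uq_par ?d (N v j)) (M' i v * twist uq_par ?d (N' v j))"
    by (rule uq_cong_trans)
qed

definition uq_one :: "int \<Rightarrow> int \<Rightarrow> (int \<times> int) falg" where
  "uq_one i j = (if i = j then 1 else 0)"

lemma uq_one_closed: "uq_one i j \<in> uq_F"
  by (simp add: uq_one_def free_alg_closed)

lemma uq_mult_one:
  assumes "i \<in> idx n" "j \<in> idx n"
  shows "uq_mult n M uq_one i j = M i j" "uq_mult n uq_one M i j = M i j"
proof -
  have t1: "twist uq_par d 1 = 1" for d
    using twist_scal[of uq_par d 1] by (simp add: scal_simps)
  have "uq_mult n M uq_one i j = M i j * twist uq_par (par i + par j) (uq_one j j)"
    unfolding uq_mult_def by (rule sum_single) (use assms in \<open>auto simp: uq_one_def\<close>)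
  then show "uq_mult n M uq_one i j = M i j"
    by (simp add: uq_one_def t1)
  have "uq_mult n uq_one M i j = uq_one i i * twist uq_par (par i + par i) (M i j)"
    unfolding uq_mult_def by (rule sum_single) (use assms in \<open>auto simp: uq_one_def\<close>)
  then show "uq_mult n uq_one M i j = M i j"
    by (simp add: uq_one_def twist_even)
qed

text \<open>
  An upper triangular matrix whose diagonal entries are invertible modulo the relations has a right
  inverse of the same kind, by back substitution; \<open>D i\<close> is a right inverse of the \<open>i\<close>th diagonal entry.
\<close>

function back_subst :: "(int \<Rightarrow> int \<Rightarrow> (int \<times> int) falg) \<Rightarrow> (int \<Rightarrow> (int \<times> int) falg) \<Rightarrow> int \<Rightarrow> int \<Rightarrow> (int \<times> int) falg" where
  "back_subst M D i j = (if i = j then D i else if i < j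
     then - (D i * (\<Sum>k\<in>{k \<in> idx n. i < k \<and> k \<le> j}. M i k * twist uq_par (par i + par k) (back_subst M D k j))) else 0)"
  by auto
termination
  by (relation "measure (\<lambda>(M, D, i, j). nat (j - i))") auto

declare back_subst.simps [simp del]

lemma back_subst_diag: "back_subst M D i i = D i" "j < i \<Longrightarrow> back_subst M D i j = 0"
  by (simp_all add: back_subst.simps)

lemma back_subst_closed:
  assumes "\<And>i j. i \<in> idx n \<Longrightarrow> j \<in> idx n \<Longrightarrow> M i j \<in> uq_F" "\<And>i. i \<in> idx n \<Longrightarrow> D i \<in> uq_F"
  shows "i \<in> idx n \<Longrightarrow> j \<in> idx n \<Longrightarrow> back_subst M D i j \<in> uq_F"
proof (induction "nat (j - i)" arbitrary: i rule: less_induct)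
  case less
  have "D i * (\<Sum>k\<in>{k \<in> idx n. i < k \<and> k \<le> j}. M i k * twist uq_par (par i + par k) (back_subst M D k j)) \<in> uq_F"
    by (intro free_alg_closed(8,9) free_alg_sum_closed assms) (use less in auto)
  then show ?case
    using less(2) assms(2) by (subst back_subst.simps) (auto intro: free_alg_closed)
qed

lemma back_subst_inverse:
  assumes M: "\<And>i j. i \<in> idx n \<Longrightarrow> j \<in> idx n \<Longrightarrow> M i j \<in> uq_F" and D: "\<And>i. i \<in> idx n \<Longrightarrow> D i \<in> uq_F"
    and tri: "\<And>i j. i \<in> idx n \<Longrightarrow> j \<in> idx n \<Longrightarrow> j < i \<Longrightarrow> M i j = 0"
    and diag: "\<And>i. i \<in> idx n \<Longrightarrow> uq_cong n (M i i * D i) 1"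
    and ij: "i \<in> idx n" "j \<in> idx n"
  shows "uq_cong n (uq_mult n M (back_subst M D) i j) (uq_one i j)"
proof -
  let ?X = "back_subst M D"
  let ?K = "{k \<in> idx n. i < k \<and> k \<le> j}"
  define Y where "Y = (\<Sum>k\<in>?K. M i k * twist uq_par (par i + par k) (?X k j))"
  have "uq_mult n M ?X i j = (\<Sum>k\<in>insert i ?K. M i k * twist uq_par (par i + par k) (?X k j))"
    unfolding uq_mult_def
  proof (rule sum.mono_neutral_right)
    show "\<forall>k\<in>idx n - insert i ?K. M i k * twist uq_par (par i + par k) (?X k j) = 0"
    proof
      fix k assume "k \<in> idx n - insert i ?K"
      then have "k \<in> idx n" "k < i \<or> j < k"
        by auto
      then show "M i k * twist uq_par (par i + par k) (?X k j) = 0"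
        using tri[OF ij(1)] by (auto simp: back_subst_diag)
    qed
  qed (use ij in auto)
  also have "\<dots> = M i i * ?X i j + Y"
    by (simp add: Y_def twist_even)
  finally have sum: "uq_mult n M ?X i j = M i i * ?X i j + Y" .
  have Y: "Y \<in> uq_F"
    unfolding Y_def by (intro free_alg_closed(8,9) free_alg_sum_closed M back_subst_closed D) (use ij in auto)
  consider "i = j" | "i < j" | "j < i"
    by linarith
  then show ?thesis
  proof cases
    case 1
    then have "Y = 0"
      unfolding Y_def by (intro sum.neutral) auto
    then show ?thesis
      using diag[OF ij(1)] 1 unfolding sum uq_one_def by (simp add: back_subst_diag)
  next
    case 2
    then have "?X i j = - (D i * Y)"
      by (subst back_subst.simps) (simp add: Y_def)
    then have "uq_mult n M ?X i j = - ((M i i * D i - 1) * Y)"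
      by (simp add: sum algebra_simps)
    moreover have "- ((M i i * D i - 1) * Y) \<in> uq_I"
      using diag[OF ij(1)] Y by (intro uq_ideal_minus uq_ideal(4)) (simp_all add: uq_cong_def)
    ultimately show ?thesis
      using 2 by (simp add: uq_cong_def uq_one_def)
  next
    case 3
    then have "Y = 0"
      unfolding Y_def by (intro sum.neutral) auto
    then show ?thesis
      using 3 by (simp add: sum back_subst_diag uq_one_def)
  qed
qed

definition uq_inv :: "int \<Rightarrow> int \<Rightarrow> (int \<times> int) falg" where
  "uq_inv = back_subst uq_gen (\<lambda>i. uq_gen (- i) (- i))"

lemma uq_inv_closed: "i \<in> idx n \<Longrightarrow> j \<in> idx n \<Longrightarrow> uq_inv i j \<in> uq_F"
  unfolding uq_inv_def by (rule back_subst_closed) (auto intro: uq_gen_closed)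

lemma uq_gen_diag: "i \<in> idx n \<Longrightarrow> uq_cong n (uq_gen i i * uq_gen (- i) (- i)) 1"
  using pres_class_rel[OF uq_rels.diag[of i n]] uq_cong_class[of "uq_gen i i * uq_gen (- i) (- i)" 1]
    uq_gen_closed[of i n i] uq_gen_closed[of "- i" n "- i"]
  by (simp add: uq_gen_def free_alg_closed)

text \<open>
  The right inverse is again triangular with invertible diagonal. So it has a right inverse too, which has to
  be congruent to \<open>U\<close>.
\<close>

lemma uq_gen_inv:
  assumes "i \<in> idx n" "j \<in> idx n"
  shows "uq_cong n (uq_mult n uq_gen uq_inv i j) (uq_one i j)" "uq_cong n (uq_mult n uq_inv uq_gen i j) (uq_one i j)"
proof -
  have right: "uq_cong n (uq_mult n uq_gen uq_inv i j) (uq_one i j)" if "i \<in> idx n" "j \<in> idx n" for i j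
    unfolding uq_inv_def
  proof (rule back_subst_inverse)
    show "uq_gen i j = 0" if "j < i" for i j
      using that by (simp add: uq_gen_def)
  qed (use that in \<open>auto intro: uq_gen_closed uq_gen_diag\<close>)
  define Z where "Z = back_subst uq_inv (\<lambda>i. uq_gen i i)"
  have Zc: "Z i j \<in> uq_F" if "i \<in> idx n" "j \<in> idx n" for i j
    unfolding Z_def by (rule back_subst_closed) (use that in \<open>auto intro: uq_gen_closed uq_inv_closed\<close>)
  have XZ: "uq_cong n (uq_mult n uq_inv Z i j) (uq_one i j)" if "i \<in> idx n" "j \<in> idx n" for i j
    unfolding Z_def
  proof (rule back_subst_inverse)
    show "uq_cong n (uq_inv i i * uq_gen i i) 1" if "i \<in> idx n" for i
      using uq_gen_diag[of "- i"] that by (simp add: uq_inv_def back_subst_diag)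
    show "uq_inv i j \<in> uq_F" if "i \<in> idx n" "j \<in> idx n" for i j
      using that by (rule uq_inv_closed)
    show "uq_inv i j = 0" if "j < i" for i j
      using that by (simp add: uq_inv_def back_subst_diag)
  qed (use that in \<open>auto intro: uq_gen_closed\<close>)
  have UZ: "uq_cong n (uq_gen i j) (Z i j)" if "i \<in> idx n" "j \<in> idx n" for i j
  proof -
    have "uq_cong n (uq_mult n uq_gen (uq_mult n uq_inv Z) i j) (uq_mult n uq_gen uq_one i j)"
      by (rule uq_mult_cong) (use that XZ in \<open>auto intro: uq_gen_closed uq_one_closed\<close>)
    moreover have "uq_cong n (uq_mult n (uq_mult n uq_gen uq_inv) Z i j) (uq_mult n uq_one Z i j)"
      by (rule uq_mult_cong) (use that right in \<open>auto intro: uq_gen_closed uq_inv_closed uq_mult_closed Zc\<close>)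
    ultimately show ?thesis
      using that by (auto simp: uq_mult_one uq_mult_assoc intro: uq_cong_trans uq_cong_sym)
  qed
  show "uq_cong n (uq_mult n uq_gen uq_inv i j) (uq_one i j)"
    using assms by (rule right)
  have "uq_cong n (uq_mult n uq_inv uq_gen i j) (uq_mult n uq_inv Z i j)"
    by (rule uq_mult_cong) (use assms UZ in \<open>auto intro: uq_inv_closed Zc\<close>)
  then show "uq_cong n (uq_mult n uq_inv uq_gen i j) (uq_one i j)"
    using XZ[OF assms] by (rule uq_cong_trans)
qed

lemma carrier_Uq: "carrier (Uq n) = uq_class n ` uq_F"
  by (simp add: Uq_def carrier_pres_alg)

lemma Uq_ops:
  "a \<in> uq_F \<Longrightarrow> b \<in> uq_F \<Longrightarrow> uq_class n a \<otimes>\<^bsub>Uq n\<^esub> uq_class n b = uq_class n (a * b)"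
  "a \<in> uq_F \<Longrightarrow> b \<in> uq_F \<Longrightarrow> uq_class n a \<oplus>\<^bsub>Uq n\<^esub> uq_class n b = uq_class n (a + b)"
  "\<one>\<^bsub>Uq n\<^esub> = uq_class n 1" "\<zero>\<^bsub>Uq n\<^esub> = uq_class n 0"
proof -
  show "a \<in> uq_F \<Longrightarrow> b \<in> uq_F \<Longrightarrow> uq_class n a \<otimes>\<^bsub>Uq n\<^esub> uq_class n b = uq_class n (a * b)"
    using ring_hom_mult[OF pres_class_hom, of a b] by (simp add: Uq_def)
  show "a \<in> uq_F \<Longrightarrow> b \<in> uq_F \<Longrightarrow> uq_class n a \<oplus>\<^bsub>Uq n\<^esub> uq_class n b = uq_class n (a + b)"
    using ring_hom_add[OF pres_class_hom, of a b] by (simp add: Uq_def)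
  show "\<one>\<^bsub>Uq n\<^esub> = uq_class n 1"
    using ring_hom_one[OF pres_class_hom] by (simp add: Uq_def)
  show "\<zero>\<^bsub>Uq n\<^esub> = uq_class n 0"
    using ring_hom_zero[OF pres_class_hom ring_free_alg ring_pres_alg] by (simp add: Uq_def)
qed

lemma finsum_Uq:
  assumes "finite A" "\<And>x. x \<in> A \<Longrightarrow> f x \<in> uq_F"
  shows "finsum (Uq n) (\<lambda>x. uq_class n (f x)) A = uq_class n (sum f A)"
  using assms
proof (induction A rule: finite_induct)
  case empty
  interpret Uq: ring "Uq n"
    unfolding Uq_def by (rule ring_pres_alg)
  show ?case
    by (simp add: Uq_ops)
next
  case (insert x A)
  interpret Uq: ring "Uq n"
    unfolding Uq_def by (rule ring_pres_alg)
  have "finsum (Uq n) (\<lambda>x. uq_class n (f x)) (insert x A) = uq_class n (f x) \<oplus>\<^bsub>Uq n\<^esub> finsum (Uq n) (\<lambda>x. uq_class n (f x)) A"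
    using insert by (intro Uq.finsum_insert) (auto simp: carrier_Uq)
  also have "finsum (Uq n) (\<lambda>x. uq_class n (f x)) A = uq_class n (sum f A)"
    using insert by auto
  also have "uq_class n (f x) \<oplus>\<^bsub>Uq n\<^esub> uq_class n (sum f A) = uq_class n (f x + sum f A)"
    using insert by (intro Uq_ops free_alg_sum_closed) auto
  finally show ?case
    using insert(1,2) by simp
qed

abbreviation (input) "Uq_End \<equiv> tens_End (Uq n) (\<lambda>d. image (twist uq_par d)) n 1"

text \<open>
  The zero outside of the words of length one is what \<open>tens_End\<close> demands of the elements of its carrier.
\<close>

definition class_mat :: "(int \<Rightarrow> int \<Rightarrow> (int \<times> int) falg) \<Rightarrow> int list \<Rightarrow> int list \<Rightarrow> (int \<times> int) falg set" where
  "class_mat M w w' = uq_class n (if w \<in> words n 1 \<and> w' \<in> words n 1 then M (hd w) (hd w') else 0)"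

lemma class_mat_app: "i \<in> idx n \<Longrightarrow> j \<in> idx n \<Longrightarrow> class_mat M [i] [j] = uq_class n (M i j)"
  by (simp add: class_mat_def words_1')

lemma class_mat_cong:
  assumes "\<And>i j. i \<in> idx n \<Longrightarrow> j \<in> idx n \<Longrightarrow> M i j \<in> uq_F \<and> N i j \<in> uq_F \<and> uq_cong n (M i j) (N i j)"
  shows "class_mat M = class_mat N"
proof (intro ext)
  fix w w'
  show "class_mat M w w' = class_mat N w w'"
  proof (cases "w \<in> words n 1 \<and> w' \<in> words n 1")
    case True
    then obtain i j where *: "w = [i]" "w' = [j]" "i \<in> idx n" "j \<in> idx n"
      by (auto elim!: words_1E)
    show ?thesis
      using assms[OF *(3,4)] True by (simp add: class_mat_def *(1,2) uq_cong_class)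
  qed (auto simp: class_mat_def)
qed

lemma class_mat_carrier: "(\<And>i j. i \<in> idx n \<Longrightarrow> j \<in> idx n \<Longrightarrow> M i j \<in> uq_F) \<Longrightarrow> class_mat M \<in> carrier Uq_End"
  by (auto simp: tens_End_def class_mat_def carrier_Uq Uq_ops words_1' elim!: words_1E)

lemma class_mat_mult:
  assumes M: "\<And>i j. i \<in> idx n \<Longrightarrow> j \<in> idx n \<Longrightarrow> M i j \<in> uq_F" and N: "\<And>i j. i \<in> idx n \<Longrightarrow> j \<in> idx n \<Longrightarrow> N i j \<in> uq_F"
  shows "class_mat M \<otimes>\<^bsub>Uq_End\<^esub> class_mat N = class_mat (uq_mult n M N)"
proof (intro ext)
  fix w w'
  show "(class_mat M \<otimes>\<^bsub>Uq_End\<^esub> class_mat N) w w' = class_mat (uq_mult n M N) w w'"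
  proof (cases "w \<in> words n 1 \<and> w' \<in> words n 1")
    case True
    then obtain i j where ij: "w = [i]" "w' = [j]" "i \<in> idx n" "j \<in> idx n"
      by (auto elim!: words_1E)
    have "(class_mat M \<otimes>\<^bsub>Uq_End\<^esub> class_mat N) w w'
      = finsum (Uq n) (\<lambda>v. class_mat M w v \<otimes>\<^bsub>Uq n\<^esub> image (twist uq_par (wpar w + wpar v)) (class_mat N v w')) (words n 1)"
      using True by (simp add: tens_End_def)
    also have "\<dots> = finsum (Uq n) (\<lambda>v. uq_class n (M i (hd v) * twist uq_par (par i + par (hd v)) (N (hd v) j))) (words n 1)"
    proof -
      interpret Uq: ring "Uq n"
        unfolding Uq_def by (rule ring_pres_alg)
      have entry: "class_mat M w v \<otimes>\<^bsub>Uq n\<^esub> image (twist uq_par (wpar w + wpar v)) (class_mat N v w')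
        = uq_class n (M i (hd v) * twist uq_par (par i + par (hd v)) (N (hd v) j))" if v: "v \<in> words n 1" for v
      proof -
        obtain l where l: "v = [l]" "l \<in> idx n"
          using v by (elim words_1E)
        show ?thesis
          using v True M[OF ij(3) l(2)] free_alg_closed(9)[OF N[OF l(2) ij(4)]]
          by (simp add: class_mat_def ij l twist_class Uq_ops)
      qed
      show ?thesis
      proof (rule Uq.finsum_cong')
        show "(\<lambda>v. uq_class n (M i (hd v) * twist uq_par (par i + par (hd v)) (N (hd v) j))) \<in> words n 1 \<rightarrow> carrier (Uq n)"
          using M[OF ij(3)] N[OF _ ij(4)] by (auto simp: carrier_Uq elim!: words_1E intro!: imageI free_alg_closed(8,9))
      qed (use entry in auto)
    qed
    also have "\<dots> = uq_class n (\<Sum>v\<in>words n 1. M i (hd v) * twist uq_par (par i + par (hd v)) (N (hd v) j))"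
      by (rule finsum_Uq) (use M[OF ij(3)] N[OF _ ij(4)] in \<open>auto elim!: words_1E intro!: free_alg_closed(8,9)\<close>)
    also have "(\<Sum>v\<in>words n 1. M i (hd v) * twist uq_par (par i + par (hd v)) (N (hd v) j)) = uq_mult n M N i j"
      unfolding uq_mult_def sum_words_1[unfolded One_nat_def[symmetric]] by simp
    finally show ?thesis
      unfolding ij(1,2) class_mat_app[OF ij(3,4)] .
  qed (auto simp: tens_End_def class_mat_def Uq_ops)
qed

lemma class_mat_one: "\<one>\<^bsub>Uq_End\<^esub> = class_mat uq_one"
  by (intro ext) (auto simp: tens_End_def class_mat_def uq_one_def Uq_ops words_1' elim!: words_1E)

lemma class_mat_eq_iff:
  assumes "\<And>i j. i \<in> idx n \<Longrightarrow> j \<in> idx n \<Longrightarrow> M i j \<in> uq_F" "\<And>i j. i \<in> idx n \<Longrightarrow> j \<in> idx n \<Longrightarrow> N i j \<in> uq_F"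
    and "class_mat M = class_mat N" and ij: "i \<in> idx n" "j \<in> idx n"
  shows "uq_cong n (M i j) (N i j)"
proof -
  have "class_mat M [i] [j] = class_mat N [i] [j]"
    by (simp only: assms(3))
  then show ?thesis
    using ij assms(1,2)[OF ij] by (simp add: class_mat_def words_1' uq_cong_class)
qed

text \<open>
  Representatives of the entries are chosen to apply the associativity of \<open>uq_mult\<close>.
\<close>

lemma class_mat_surj:
  assumes "y \<in> carrier Uq_End"
  obtains N where "\<And>i j. i \<in> idx n \<Longrightarrow> j \<in> idx n \<Longrightarrow> N i j \<in> uq_F" "y = class_mat N"
proof -
  have "\<forall>i j. \<exists>a. i \<in> idx n \<longrightarrow> j \<in> idx n \<longrightarrow> a \<in> uq_F \<and> y [i] [j] = uq_class n a"
  proof (intro allI)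
    fix i j
    show "\<exists>a. i \<in> idx n \<longrightarrow> j \<in> idx n \<longrightarrow> a \<in> uq_F \<and> y [i] [j] = uq_class n a"
    proof (cases "i \<in> idx n \<and> j \<in> idx n")
      case True
      then have "[i] \<in> words n 1" "[j] \<in> words n 1"
        by (simp_all add: words_1')
      then have "y [i] [j] \<in> carrier (Uq n)"
        using assms by (simp add: tens_End_def) 
      then show ?thesis
        by (auto simp: carrier_Uq)
    qed auto
  qed
  then obtain N where N: "\<And>i j. i \<in> idx n \<Longrightarrow> j \<in> idx n \<Longrightarrow> N i j \<in> uq_F \<and> y [i] [j] = uq_class n (N i j)"
    by metis
  have "y w w' = class_mat N w w'" for w w'
  proof (cases "w \<in> words n 1 \<and> w' \<in> words n 1")
    case True
    then obtain i j where *: "w = [i]" "w' = [j]" "i \<in> idx n" "j \<in> idx n"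
      by (auto elim!: words_1E)
    then show ?thesis
      using True N by (simp add: class_mat_def)
  next
    case False
    then show ?thesis
      using assms by (auto simp: tens_End_def class_mat_def Uq_ops)
  qed
  then show ?thesis
    using N that[of N] by blast
qed

lemma uq_antipode_class:
  assumes ij: "i \<in> idx n" "j \<in> idx n"
  shows "uq_antipode n i j = uq_class n (uq_inv i j)"
proof -
  have U: "(\<lambda>w w'. uq_class n (uq_mat n (\<lambda>M. M) w w')) = class_mat uq_gen"
  proof (intro ext)
    fix w w'
    show "uq_class n (uq_mat n (\<lambda>M. M) w w') = class_mat uq_gen w w'"
    proof (cases "w \<in> words n 1 \<and> w' \<in> words n 1")
      case True
      then obtain i j where *: "w = [i]" "w' = [j]" "i \<in> idx n" "j \<in> idx n"
        by (auto elim!: words_1E)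
      have "uq_mat n (\<lambda>M. M) [i] [j] = scal 1 * uq_gen i j"
        by (rule uq_mat_single) (use * in \<open>auto simp: E_app\<close>)
      then show ?thesis
        using True by (simp add: class_mat_def * scal_simps)
    next
      case False
      have "uq_mat n (\<lambda>M. M) w w' = 0"
        unfolding uq_mat_def
      proof (rule sum.neutral, rule ballI)
        fix x assume "x \<in> uq_gens n"
        then show "(case x of (i, j) \<Rightarrow> scal (E i j w w') * gen (i, j)) = 0"
          using False by (auto simp: uq_gens_def E_def words_1' scal_simps)
      qed
      then show ?thesis
        using False by (auto simp: class_mat_def)
    qed
  qed
  have gen_c: "uq_gen i j \<in> uq_F" if "i \<in> idx n" "j \<in> idx n" for i j
    using that by (rule uq_gen_closed)
  have "inv\<^bsub>Uq_End\<^esub> (class_mat uq_gen) = class_mat uq_inv"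
    unfolding m_inv_def
  proof (rule the_equality)
    have "class_mat (uq_mult n uq_gen uq_inv) = class_mat uq_one" "class_mat (uq_mult n uq_inv uq_gen) = class_mat uq_one"
      by (rule class_mat_cong; intro conjI uq_gen_inv uq_mult_closed uq_gen_closed uq_inv_closed uq_one_closed; assumption)+
    then show "class_mat uq_inv \<in> carrier Uq_End \<and> class_mat uq_gen \<otimes>\<^bsub>Uq_End\<^esub> class_mat uq_inv = \<one>\<^bsub>Uq_End\<^esub>
      \<and> class_mat uq_inv \<otimes>\<^bsub>Uq_End\<^esub> class_mat uq_gen = \<one>\<^bsub>Uq_End\<^esub>"
      using class_mat_mult[OF gen_c uq_inv_closed] class_mat_mult[OF uq_inv_closed gen_c] class_mat_carrier[OF uq_inv_closed]
      by (simp add: class_mat_one)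
  next
    fix y
    assume y: "y \<in> carrier Uq_End \<and> class_mat uq_gen \<otimes>\<^bsub>Uq_End\<^esub> y = \<one>\<^bsub>Uq_End\<^esub> \<and> y \<otimes>\<^bsub>Uq_End\<^esub> class_mat uq_gen = \<one>\<^bsub>Uq_End\<^esub>"
    obtain N where N: "\<And>i j. i \<in> idx n \<Longrightarrow> j \<in> idx n \<Longrightarrow> N i j \<in> uq_F" "y = class_mat N"
      using class_mat_surj y by blast
    have NU: "class_mat (uq_mult n N uq_gen) = class_mat uq_one"
      using y class_mat_mult[OF N(1) gen_c] by (simp add: N(2) class_mat_one)
    have NU': "uq_cong n (uq_mult n N uq_gen i j) (uq_one i j)" if "i \<in> idx n" "j \<in> idx n" for i j
      by (rule class_mat_eq_iff[OF _ _ NU that]) (intro uq_mult_closed uq_gen_closed N(1) uq_one_closed; assumption)+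
    have "class_mat N = class_mat uq_inv"
    proof (rule class_mat_cong)
      fix i j assume ij: "i \<in> idx n" "j \<in> idx n"
      have "uq_cong n (uq_mult n N (uq_mult n uq_gen uq_inv) i j) (uq_mult n N uq_one i j)"
        by (rule uq_mult_cong) (use ij in \<open>auto intro: N(1) uq_one_closed uq_gen_inv\<close>)
      moreover have "uq_cong n (uq_mult n (uq_mult n N uq_gen) uq_inv i j) (uq_mult n uq_one uq_inv i j)"
        by (rule uq_mult_cong) (use ij in \<open>auto intro: N(1) uq_inv_closed NU' uq_mult_closed uq_gen_closed\<close>)
      ultimately have "uq_cong n (N i j) (uq_inv i j)"
        using ij by (auto simp: uq_mult_one uq_mult_assoc intro: uq_cong_trans uq_cong_sym)
      then show "N i j \<in> uq_F \<and> uq_inv i j \<in> uq_F \<and> uq_cong n (N i j) (uq_inv i j)"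
        using ij N(1) uq_inv_closed by blast
    qed
    then show "y = class_mat uq_inv"
      by (simp only: N(2))
  qed
  then show ?thesis
    using ij unfolding uq_antipode_def U by (simp add: class_mat_def words_1')
qed

end

lemma S_R_inv_P: "mm n 2 (mm n 2 (R_inv n) (P_op n)) (S_op n) = idm n 2"
  unfolding mm_assoc R_op_def[symmetric] by (rule R_inverse(2))

lemma mm_P_right:
  assumes "M \<in> Op n 2" "x \<in> idx n" "y \<in> idx n" "a \<in> idx n" "b \<in> idx n"
  shows "mm n 2 M (P_op n) [x, y] [a, b] = sg (par a * par b) * M [x, y] [b, a]"
proof -
  have "mm n 2 M (P_op n) [x, y] [a, b] = (\<Sum>u\<in>idx n. \<Sum>v\<in>idx n. M [x, y] [u, v] * P_op n [u, v] [a, b])"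
    by (simp only: mm_def sum_words_2)
  also have "\<dots> = M [x, y] [b, a] * P_op n [b, a] [a, b]"
    by (subst sum2_single[where a = b and b = a]) (use assms in \<open>auto simp: P_app\<close>)
  finally show ?thesis
    using assms by (simp add: P_app mult.commute)
qed

text \<open>
  On the vector module the relation \<open>U U\<^sup>-\<^sup>1 = 1\<close> becomes \<open>S Y = 1\<close>, where the entries of \<open>Y\<close> are, up
  to signs, the matrix entries of the antipodes. So \<open>Y\<close> is the inverse of \<open>S\<close>.
\<close>

lemma antipode_vector_app:
  assumes idx: "v \<in> idx n" "j \<in> idx n" "c \<in> idx n" "b \<in> idx n"
  shows "uq_vec n (uq_antipode n v j) [c] [b] = sg (par v * par b) * R_inv n [c, v] [j, b]"
proof -
  define X where "X v j = uq_eval n 1 (S_comp n) (uq_inv n v j)" for v j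
  define Y where "Y = (\<lambda>w w'. if w \<in> words n 2 \<and> w' \<in> words n 2
    then sg (par (w ! 1) * par (w' ! 0)) * sg (par (w' ! 1) * par (w' ! 0)) * X (w ! 1) (w' ! 1) [w ! 0] [w' ! 0] else 0)"
  have Y: "Y [c, v] [b, j] = sg (par v * par b) * sg (par j * par b) * X v j [c] [b]"
    if "v \<in> idx n" "j \<in> idx n" "c \<in> idx n" "b \<in> idx n" for v j c b
    using that by (simp add: Y_def words_2)
  have Y_closed: "Y \<in> Op n 2"
    by (rule OpI) (auto simp: Y_def split: if_splits)
  have X_closed: "X v j \<in> Op n 1" if "v \<in> idx n" "j \<in> idx n" for v j
    unfolding X_def by (rule uq_eval_closed[OF uq_module_vector uq_inv_closed[OF that]])
  have prod: "(\<Sum>v\<in>idx n. mm n 1 (S_comp n i v) (twisted (par i + par v) (X v j))) = (if i = j then idm n 1 else 0)"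
    if "i \<in> idx n" "j \<in> idx n" for i j
  proof -
    have cl: "uq_mult n uq_gen (uq_inv n) i j \<in> carrier (free_alg (uq_gens n))"
      by (rule uq_mult_closed) (use that in \<open>auto intro: uq_gen_closed uq_inv_closed\<close>)
    have "uq_class n (uq_mult n uq_gen (uq_inv n) i j) = uq_class n (uq_one i j)"
      using uq_gen_inv(1)[OF that] uq_cong_class[OF cl uq_one_closed] by simp
    then have "uq_eval n 1 (S_comp n) (uq_mult n uq_gen (uq_inv n) i j) = uq_eval n 1 (S_comp n) (uq_one i j)"
      by (metis uq_vec_class)
    also have "uq_eval n 1 (S_comp n) (uq_mult n uq_gen (uq_inv n) i j)
      = (\<Sum>v\<in>idx n. uq_eval n 1 (S_comp n) (uq_gen i v * twist uq_par (par i + par v) (uq_inv n v j)))"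
      by (simp only: uq_mult_def free_eval_sum)
    also have "\<dots> = (\<Sum>v\<in>idx n. mm n 1 (S_comp n i v) (twisted (par i + par v) (X v j)))"
    proof (intro sum.cong refl)
      fix v assume v: "v \<in> idx n"
      show "uq_eval n 1 (S_comp n) (uq_gen i v * twist uq_par (par i + par v) (uq_inv n v j))
        = mm n 1 (S_comp n i v) (twisted (par i + par v) (X v j))"
        unfolding uq_eval_mult[OF uq_module_vector uq_gen_closed[OF that(1) v] free_alg_closed(9)[OF uq_inv_closed[OF v that(2)]]]
          uq_eval_gen[OF uq_module_vector that(1) v] uq_eval_twist[OF uq_module_vector uq_inv_closed[OF v that(2)]] X_def
        by (rule refl)
    qed
    also have "uq_eval n 1 (S_comp n) (uq_one i j) = (if i = j then idm n 1 else 0)"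
      by (simp add: uq_one_def free_eval_1)
    finally show ?thesis .
  qed
  have SY: "mm n 2 (S_op n) Y = idm n 2"
  proof (rule Op2_eqI)
    show "mm n 2 (S_op n) Y \<in> Op n 2"
      by (intro mm_closed S_closed Y_closed)
    fix a i b j assume aibj: "a \<in> idx n" "i \<in> idx n" "b \<in> idx n" "j \<in> idx n"
    have "mm n 2 (S_op n) Y [a, i] [b, j] = (\<Sum>c\<in>idx n. \<Sum>v\<in>idx n. S_op n [a, i] [c, v] * Y [c, v] [b, j])"
      by (simp only: mm_def sum_words_2)
    also have "\<dots> = (\<Sum>v\<in>idx n. \<Sum>c\<in>idx n. S_op n [a, i] [c, v] * Y [c, v] [b, j])"
      by (rule sum.swap)
    also have "\<dots> = (\<Sum>v\<in>idx n. sg (par i * par b + par j * par b) * mm n 1 (S_comp n i v) (twisted (par i + par v) (X v j)) [a] [b])"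
    proof (intro sum.cong refl)
      fix v assume v: "v \<in> idx n"
      have "mm n 1 (S_comp n i v) (twisted (par i + par v) (X v j)) [a] [b]
        = (\<Sum>c\<in>idx n. S_comp n i v [a] [c] * (sg ((par i + par v) * (par c + par b)) * X v j [c] [b]))"
        by (simp add: mm_def sum_words_1[unfolded One_nat_def[symmetric]] twisted_def)
      also have "\<dots> = (\<Sum>c\<in>idx n. sg (par i * par b + par j * par b) * (S_op n [a, i] [c, v] * Y [c, v] [b, j]))"
      proof (intro sum.cong refl)
        fix c assume c: "c \<in> idx n"
        have s: "sg ((par i + par v) * par c) * sg ((par i + par v) * (par c + par b))
          = sg (par i * par b + par j * par b) * (sg (par v * par b) * sg (par j * par b))"
          by (cases "even (par i)"; cases "even (par v)"; cases "even (par c)"; cases "even (par b)"; cases "even (par j)"; simp add: sg_eq)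
        have "S_comp n i v [a] [c] * (sg ((par i + par v) * (par c + par b)) * X v j [c] [b])
          = (sg ((par i + par v) * par c) * sg ((par i + par v) * (par c + par b))) * (S_op n [a, i] [c, v] * X v j [c] [b])"
          using S_comp_app[OF aibj(1) c] by (simp only: mult_ac)
        also have "\<dots> = sg (par i * par b + par j * par b) * (S_op n [a, i] [c, v] * Y [c, v] [b, j])"
          unfolding s Y[OF v aibj(4) c aibj(3)] by (simp only: mult_ac)
        finally show "S_comp n i v [a] [c] * (sg ((par i + par v) * (par c + par b)) * X v j [c] [b])
          = sg (par i * par b + par j * par b) * (S_op n [a, i] [c, v] * Y [c, v] [b, j])" .
      qed
      finally have "mm n 1 (S_comp n i v) (twisted (par i + par v) (X v j)) [a] [b]
        = sg (par i * par b + par j * par b) * (\<Sum>c\<in>idx n. S_op n [a, i] [c, v] * Y [c, v] [b, j])"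
        by (simp only: sum_distrib_left)
      then show "(\<Sum>c\<in>idx n. S_op n [a, i] [c, v] * Y [c, v] [b, j])
        = sg (par i * par b + par j * par b) * mm n 1 (S_comp n i v) (twisted (par i + par v) (X v j)) [a] [b]"
        by (simp add: sg_square flip: mult.assoc)
    qed
    also have "\<dots> = sg (par i * par b + par j * par b) * (if i = j then idm n 1 else 0) [a] [b]"
      unfolding prod[OF aibj(2,4), symmetric] sum_fun_app sum_distrib_left by (rule refl)
    also have "\<dots> = idm n 2 [a, i] [b, j]"
      using aibj by (auto simp: idm_app words_1' words_2 sg_eq)
    finally show "mm n 2 (S_op n) Y [a, i] [b, j] = idm n 2 [a, i] [b, j]" .
  qed simp
  have "mm n 2 (mm n 2 (R_inv n) (P_op n)) (mm n 2 (S_op n) Y) = mm n 2 (mm n 2 (mm n 2 (R_inv n) (P_op n)) (S_op n)) Y"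
    by (rule mm_assoc[symmetric])
  then have "Y = mm n 2 (R_inv n) (P_op n)"
    unfolding S_R_inv_P SY using Y_closed by (simp add: mm_closed P_closed)
  then have "Y [c, v] [b, j] = sg (par b * par j) * R_inv n [c, v] [j, b]"
    using mm_P_right[OF R_inv_closed, of c n v b j] idx by simp
  then have "sg (par j * par b) * (sg (par v * par b) * X v j [c] [b]) = sg (par j * par b) * R_inv n [c, v] [j, b]"
    unfolding Y[OF idx] mult.commute[of "par b" "par j"] by (simp only: mult_ac)
  then have XR: "sg (par v * par b) * X v j [c] [b] = R_inv n [c, v] [j, b]"
    by simp
  have "X v j [c] [b] = sg (par v * par b) * (sg (par v * par b) * X v j [c] [b])"
    by (simp add: sg_square flip: mult.assoc)
  then have "X v j [c] [b] = sg (par v * par b) * R_inv n [c, v] [j, b]"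
    unfolding XR .
  then show ?thesis
    using idx by (simp add: uq_antipode_class uq_vec_class X_def)
qed

lemma induced_cong:
  assumes "\<And>x. x \<in> X \<Longrightarrow> g x = h x" "A \<subseteq> carrier (free_alg X)"
  shows "induced n k g A = induced n k h A"
proof -
  have "free_eval n k g a = free_eval n k h a" if "a \<in> A" for a
    using free_eval_cong[of X g h a n k] assms that by blast
  then have "free_eval n k g ` A = free_eval n k h ` A"
    by (rule image_cong[OF refl])
  then show ?thesis
    by (simp add: induced_def)
qed

lemma uq_class_subset:
  assumes "a \<in> carrier (free_alg (uq_gens n))"
  shows "uq_class n a \<subseteq> carrier (free_alg (uq_gens n))"
proof
  interpret presentation "uq_gens n" "uq_rels n"
    by (rule presentation_Uq)
  fix b assume "b \<in> uq_class n a"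
  then have "b - a \<in> carrier (free_alg (uq_gens n))"
    unfolding in_pres_class using rel.a_subset by blast
  then show "b \<in> carrier (free_alg (uq_gens n))"
    using free_alg_closed(5)[OF _ assms, of "b - a"] by simp
qed

text \<open>
  Only the values of the map on the generators matter, because a coset of an element of the free algebra
  consists of such elements.
\<close>

lemma uq_induced_class:
  assumes "uq_module n k L" "a \<in> carrier (free_alg (uq_gens n))"
    and "\<And>i j. (i, j) \<in> uq_gens n \<Longrightarrow> g (i, j) = L i j"
  shows "induced n k g (uq_class n a) = uq_eval n k L a"
proof -
  have "induced n k g (uq_class n a) = induced n k (\<lambda>(i, j). L i j) (uq_class n a)"
    by (rule induced_cong[OF _ uq_class_subset[OF assms(2)]]) (use assms(3) in auto)
  then show ?thesis
    by (simp only: induced_module[OF assms(1)])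
qed

lemma uq_dual_class:
  assumes "a \<in> carrier (free_alg (uq_gens n))"
  shows "uq_dual n (uq_class n a) = uq_eval n 1 (dual_comp n) a"
  unfolding uq_dual_def
proof (rule uq_induced_class[OF uq_module_dual assms])
  fix i j assume "(i, j) \<in> uq_gens n"
  then have ij: "i \<in> idx n" "j \<in> idx n"
    by (auto simp: uq_gens_def)
  have cl: "uq_vec n (uq_antipode n i j) \<in> Op n 1"
    unfolding uq_antipode_class[OF ij] uq_vec_class by (rule uq_eval_closed[OF uq_module_vector uq_inv_closed[OF ij]])
  have "(\<lambda>b a. sg (uq_par (i, j) * wpar a) * uq_vec n (uq_antipode n i j) a b) = dual_comp n i j"
  proof (rule Op1_eqI)
    show "(\<lambda>b a. sg (uq_par (i, j) * wpar a) * uq_vec n (uq_antipode n i j) a b) \<in> Op n 1"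
      using cl by (auto simp: Op_iff)
    show "dual_comp n i j \<in> Op n 1"
      by (rule dual_comp_closed)
    fix b a assume ba: "b \<in> idx n" "a \<in> idx n"
    have "sg ((par i + par j) * par a) * sg (par i * par b) = sg ((par i + par j) * (par b + par a) + par b * par j)"
      by (cases "even (par i)"; cases "even (par j)"; cases "even (par a)"; cases "even (par b)"; simp add: sg_eq)
    then show "sg (uq_par (i, j) * wpar [a]) * uq_vec n (uq_antipode n i j) [a] [b] = dual_comp n i j [b] [a]"
      using antipode_vector_app[OF ij ba(2,1)] dual_comp_app[OF ba, of i j] by (simp add: uq_par_def flip: mult.assoc)
  qed
  then show "(\<lambda>(i, j) b a. sg (uq_par (i, j) * wpar a) * uq_vec n (uq_antipode n i j) a b) (i, j) = dual_comp n i j"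
    by simp
qed

section \<open>The mixed tensor space\<close>

text \<open>
  The images of the generators on the mixed tensor space.
\<close>

fun mixed_family :: "nat \<Rightarrow> nat \<Rightarrow> nat \<Rightarrow> int \<Rightarrow> int \<Rightarrow> oper" where
  "mixed_family n 0 0 = (\<lambda>i j. if i = j then idm n 0 else 0)"
| "mixed_family n 0 (Suc s) = tensor_family n 1 (dual_comp n) (mixed_family n 0 s)"
| "mixed_family n (Suc r) s = tensor_family n 1 (S_comp n) (mixed_family n r s)"

lemma uq_module_mixed: "uq_module n (r + s) (mixed_family n r s)"
proof (induction n r s rule: mixed_family.induct)
  case (1 n)
  then show ?case
    using uq_module_trivial by simp
next
  case (2 n s)
  then show ?case
    using uq_module_tensor[OF uq_module_dual] by (simp add: plus_1_eq_Suc)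
next
  case (3 n r s)
  then show ?case
    using uq_module_tensor[OF uq_module_vector] by (simp add: plus_1_eq_Suc)
qed

lemma hat_trivial: "hat n 0 (\<lambda>i j. if i = j then idm n 0 else 0) = idm n 1"
proof (rule hat_eqI)
  show "idm n 1 \<in> Op n (0 + 1)"
    by simp
next
  fix i j u u' assume "i \<in> idx n" "j \<in> idx n" "u \<in> words n 0" "u' \<in> words n 0"
  then show "hat n 0 (\<lambda>i j. if i = j then idm n 0 else 0) (i # u) (u' @ [j]) = idm n 1 (i # u) (u' @ [j])"
    using hat_app[of i n j "[]" 0 "[]"] by (auto simp: idm_app words_1')
qed

lemma module_tensor_hat:
  assumes "uq_module n a F" "uq_module n b G"
  shows "hat n (a + b) (tensor_family n a F G) = join n a (hat n a F) b (hat n b G)"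
  by (rule hat_tensor) (use assms in \<open>auto simp: uq_module_def\<close>)

lemma hat_mixed: "hat n (r + s) (mixed_family n r s) = crossing n (replicate r True @ replicate s False)"
proof (induction n r s rule: mixed_family.induct)
  case (1 n)
  have "hat n 0 (\<lambda>i j. if i = j then idm n 0 else 0) = idm n 1"
    by (rule hat_trivial)
  then show ?case
    by simp
next
  case (2 n s)
  have "hat n (1 + s) (tensor_family n 1 (dual_comp n) (mixed_family n 0 s))
    = join n 1 (hat n 1 (dual_comp n)) s (hat n s (mixed_family n 0 s))"
    using module_tensor_hat[OF uq_module_dual uq_module_mixed[of n 0 s]] by simp
  then show ?case
    using 2 by (simp add: hat_dual strand_def plus_1_eq_Suc)
next
  case (3 n r s)
  have "hat n (1 + (r + s)) (tensor_family n 1 (S_comp n) (mixed_family n r s))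
    = join n 1 (hat n 1 (S_comp n)) (r + s) (hat n (r + s) (mixed_family n r s))"
    using module_tensor_hat[OF uq_module_vector uq_module_mixed[of n r s]] by simp
  then show ?case
    using 3 by (simp add: hat_vector strand_def plus_1_eq_Suc)
qed

lemma uq_elt_gen: "uq_elt n i j = uq_class n (uq_gen i j)"
  by (simp add: uq_elt_def uq_gen_def)

lemma uq_tensor_class:
  assumes F: "uq_module n 1 F" "\<And>a. a \<in> carrier (free_alg (uq_gens n)) \<Longrightarrow> f (uq_class n a) = uq_eval n 1 F a"
    and G: "uq_module n k G" "\<And>a. a \<in> carrier (free_alg (uq_gens n)) \<Longrightarrow> g (uq_class n a) = uq_eval n k G a"
    and a: "a \<in> carrier (free_alg (uq_gens n))"
  shows "uq_tensor n 1 f k g (uq_class n a) = uq_eval n (1 + k) (tensor_family n 1 F G) a"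
  unfolding uq_tensor_def
proof (rule uq_induced_class[OF uq_module_tensor[OF F(1) G(1)] a])
  fix i j assume "(i, j) \<in> uq_gens n"
  then have ij: "i \<in> idx n" "j \<in> idx n"
    by (auto simp: uq_gens_def)
  have "f (uq_elt n i l) = F i l" "g (uq_elt n l j) = G l j" if l: "l \<in> idx n" for l
    unfolding uq_elt_gen F(2)[OF uq_gen_closed[OF ij(1) l]] G(2)[OF uq_gen_closed[OF l ij(2)]]
    by (rule uq_eval_gen[OF F(1) ij(1) l] uq_eval_gen[OF G(1) l ij(2)])+
  then show "(\<lambda>(i, j). \<Sum>l\<in>idx n. smul (sg ((par i + par l) * (par l + par j))) (mten 1 (f (uq_elt n i l)) (g (uq_elt n l j)))) (i, j)
    = tensor_family n 1 F G i j"
    by (simp add: tensor_family_def)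
qed

lemma uq_mixed_class:
  assumes "a \<in> carrier (free_alg (uq_gens n))"
  shows "uq_mixed n r s (uq_class n a) = uq_eval n (r + s) (mixed_family n r s) a"
  using assms
proof (induction n r s arbitrary: a rule: mixed_family.induct)
  case (1 n)
  then show ?case
    using induced_module[OF uq_module_trivial] by (simp add: uq_triv_def)
next
  case (2 n s)
  show ?case
    using uq_tensor_class[OF uq_module_dual uq_dual_class uq_module_mixed[of n 0 s, unfolded add_0] 2(1)[unfolded add_0] 2(2)] by (simp add: plus_1_eq_Suc)
next
  case (3 n r s)
  show ?case
    using uq_tensor_class[OF uq_module_vector uq_vec_class uq_module_mixed 3(1) 3(2)] by (simp add: plus_1_eq_Suc)
qed

section \<open>The action of the quantum walled Brauer-Clifford superalgebra\<close>

text \<open>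
  The number of all factors is the parameter here, so that products of operators on different
  factors have matching numbers of factors.
\<close>

definition place :: "nat \<Rightarrow> nat \<Rightarrow> nat \<Rightarrow> nat \<Rightarrow> oper \<Rightarrow> oper" where
  "place n m a k M = pad n a k M (m - a - k)"

lemma place_closed: "M \<in> Op n k \<Longrightarrow> a + k \<le> m \<Longrightarrow> place n m a k M \<in> Op n m"
  unfolding place_def by (rule pad_closed') auto

lemma oper_par_place: "oper_par d M \<Longrightarrow> oper_par d (place n m a k M)"
  unfolding place_def by (rule oper_par_pad)

lemma place_mm:
  "M \<in> Op n k \<Longrightarrow> N \<in> Op n k \<Longrightarrow> a + k \<le> m \<Longrightarrow> mm n m (place n m a k M) (place n m a k N) = place n m a k (mm n k M N)"
  unfolding place_def by (rule pad_mm) auto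

lemma place_idm: "a + k \<le> m \<Longrightarrow> place n m a k (idm n k) = idm n m"
  unfolding place_def pad_idm by simp

lemma place_place:
  assumes "M \<in> Op n k" "c + k \<le> l" "a + l \<le> m"
  shows "place n m a l (place n l c k M) = place n m (a + c) k M"
proof -
  have "pad n a l (pad n c k M (l - c - k)) (m - a - l) = pad n (a + c) k M (l - c - k + (m - a - l))"
    using assms by (intro pad_pad) auto
  moreover have "l - c - k + (m - a - l) = m - (a + c) - k"
    using assms by simp
  ultimately show ?thesis
    by (simp add: place_def)
qed

lemma place_supercommute:
  assumes "oper_par d M" "oper_par e N" "M \<in> Op n k" "N \<in> Op n l" "a + k \<le> m" "c + l \<le> m" "a + k \<le> c \<or> c + l \<le> a"
  shows "mm n m (place n m a k M) (place n m c l N) = smul (sg (d * e)) (mm n m (place n m c l N) (place n m a k M))"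
proof -
  have less: "mm n m (place n m a k M) (place n m c l N) = smul (sg (d * e)) (mm n m (place n m c l N) (place n m a k M))"
    if "oper_par d M" "oper_par e N" "M \<in> Op n k" "N \<in> Op n l" "c + l \<le> m" "a + k \<le> c" for d e M N k l a c
  proof -
    have "m - a - k = (c - a - k) + l + (m - c - l)" "a + k + (c - a - k) = c" "m = a + k + (c - a - k) + l + (m - c - l)"
      using that by auto
    then show ?thesis
      using pad_supercommute[OF that(1-4), of m a "c - a - k" "m - c - l"] by (simp add: place_def)
  qed
  show ?thesis
  proof (cases "a + k \<le> c")
    case False
    then have "mm n m (place n m c l N) (place n m a k M) = smul (sg (e * d)) (mm n m (place n m a k M) (place n m c l N))"
      using assms by (intro less) auto
    then show ?thesis
      by (simp add: smul_simps mult.commute[of e d])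
  qed (use assms in \<open>intro less, auto\<close>)
qed

lemma place_commute:
  assumes "oper_par 0 M" "oper_par e N" "M \<in> Op n k" "N \<in> Op n l" "a + k \<le> m" "c + l \<le> m" "a + k \<le> c \<or> c + l \<le> a"
  shows "mm n m (place n m a k M) (place n m c l N) = mm n m (place n m c l N) (place n m a k M)"
  using place_supercommute[OF assms] by (simp add: smul_simps sg_even_mult)

lemma place_anticommute:
  assumes "oper_par 1 M" "oper_par 1 N" "M \<in> Op n k" "N \<in> Op n l" "a + k \<le> m" "c + l \<le> m" "a + k \<le> c \<or> c + l \<le> a"
  shows "mm n m (place n m a k M) (place n m c l N) = smul (- 1) (mm n m (place n m c l N) (place n m a k M))"
  using place_supercommute[OF assms] by (simp add: sg_def)

lemma place_slides:
  assumes "slides n k g (crossing n us)" "oper_par d g" "g \<in> Op n k" "length us = k" "length ps = a" "a + k + length vs = m"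
  shows "slides n m (place n m a k g) (crossing n (ps @ us @ vs))"
proof -
  have "m - a - k = length vs"
    using assms by simp
  then show ?thesis
    using slides_crossing[OF assms(1,4,2,3,5) refl, of vs] assms(6) by (simp add: place_def)
qed

lemma replicate_split: "a + k \<le> r \<Longrightarrow> replicate r x = replicate a x @ replicate k x @ replicate (r - a - k) x"
  by (simp flip: replicate_add)

fun bc_op :: "nat \<Rightarrow> nat \<Rightarrow> nat \<Rightarrow> bc_gen \<Rightarrow> oper" where
  "bc_op n r s (T i) = place n (r + s) (i - 1) 2 (R_op n)"
| "bc_op n r s (C i) = place n (r + s) (i - 1) 1 (Phi_op n)"
| "bc_op n r s (Ts i) = place n (r + s) (r + i - 1) 2 (Rs_op n)"
| "bc_op n r s (Cs i) = place n (r + s) (r + i - 1) 1 (PhiT_op n)"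
| "bc_op n r s Ee = place n (r + s) (r - 1) 2 (e_op n)"

lemma bc_op_closed: "x \<in> bc_gens r s \<Longrightarrow> bc_op n r s x \<in> Op n (r + s)"
  by (auto simp: bc_gens_def split: if_splits intro!: place_closed)

lemma bc_op_par: "x \<in> bc_gens r s \<Longrightarrow> oper_par (bc_par x) (bc_op n r s x)"
  by (auto simp: bc_gens_def split: if_splits intro!: oper_par_place Phi_odd PhiT_odd R_even Rs_even e_even)

abbreviation bc_eval :: "nat \<Rightarrow> nat \<Rightarrow> nat \<Rightarrow> bc_gen falg \<Rightarrow> oper" where
  "bc_eval n r s \<equiv> free_eval n (r + s) (bc_op n r s)"

lemma bc_eval_mult:
  "a \<in> carrier (free_alg (bc_gens r s)) \<Longrightarrow> b \<in> carrier (free_alg (bc_gens r s)) \<Longrightarrow>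
    bc_eval n r s (a * b) = mm n (r + s) (bc_eval n r s a) (bc_eval n r s b)"
  by (rule free_eval_mult[OF bc_op_closed])

lemma bc_eval_gen: "x \<in> bc_gens r s \<Longrightarrow> bc_eval n r s (gen x) = bc_op n r s x"
  by (rule free_eval_gen[OF bc_op_closed])

lemma free_eval_minus: "free_eval n k g (- a) = smul (- 1) (free_eval n k g a)"
  using free_eval_diff[of n k g 0 a] by (simp add: smul_def fun_eq_iff)

lemma bc_gens_simps:
  "T i \<in> bc_gens r s \<longleftrightarrow> i \<in> {1..<r}" "Ts i \<in> bc_gens r s \<longleftrightarrow> i \<in> {1..<s}"
  "C i \<in> bc_gens r s \<longleftrightarrow> i \<in> {1..r}" "Cs i \<in> bc_gens r s \<longleftrightarrow> i \<in> {1..s}" "Ee \<in> bc_gens r s \<longleftrightarrow> 1 \<le> r \<and> 1 \<le> s"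
  by (auto simp: bc_gens_def)

lemma bc_eval_tinv:
  assumes "i \<in> {1..<r}"
  shows "bc_eval n r s (tinv i) = place n (r + s) (i - 1) 2 (R_inv n)"
proof -
  have "place n (r + s) (i - 1) 2 (R_inv n) = place n (r + s) (i - 1) 2 (R_op n) - smul xi (place n (r + s) (i - 1) 2 (idm n 2))"
    by (simp add: place_def R_inv_def pad_diff pad_smul)
  then show ?thesis
    using assms place_idm[of "i - 1" 2 "r + s" n]
    by (simp add: free_eval_diff free_eval_scal bc_eval_gen bc_gens_simps)
qed

context
  fixes n m :: nat
begin

abbreviation (input) "pl \<equiv> place n m"
abbreviation (input) "mul \<equiv> mm n m"

lemma place_quad:
  assumes "a + 2 \<le> m" "M \<in> Op n 2" "mm n 2 M M = smul xi M + idm n 2"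
  shows "mul (pl a 2 M) (pl a 2 M) = smul xi (pl a 2 M) + idm n m"
  using assms place_idm[of a 2 m n] by (simp add: place_mm) (simp add: place_def pad_add pad_smul)

text \<open>
  The operators in a relation are regarded as operators on a common interval of factors, on
  which the relation has been proved.
\<close>

lemma window_3:
  assumes "a + 3 \<le> m" "M \<in> Op n 2"
  shows "pl a 2 M = pl a 3 (pad n 0 2 M 1)" "pl (a + 1) 2 M = pl a 3 (pad n 1 2 M 0)"
  using assms place_place[of M n 2 0 3 a m] place_place[of M n 2 1 3 a m] by (simp_all add: place_def One_nat_def)

lemma window_4:
  assumes "a + 4 \<le> m" "M \<in> Op n 2"
  shows "pl a 2 M = pl a 4 (pad n 0 2 M 2)" "pl (a + 1) 2 M = pl a 4 (pad n 1 2 M 1)" "pl (a + 2) 2 M = pl a 4 (pad n 2 2 M 0)"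
  using assms place_place[of M n 2 0 4 a m] place_place[of M n 2 1 4 a m] place_place[of M n 2 2 4 a m]
  by (simp_all add: place_def One_nat_def)

lemma window_2:
  assumes "a + 2 \<le> m" "M \<in> Op n 1"
  shows "pl a 1 M = pl a 2 (pad n 0 1 M 1)" "pl (a + 1) 1 M = pl a 2 (pad n 1 1 M 0)"
  using assms place_place[of M n 1 0 2 a m] place_place[of M n 1 1 2 a m] by (simp_all add: place_def One_nat_def)

lemma pad1_closed: "M \<in> Op n 1 \<Longrightarrow> pad n 0 1 M 1 \<in> Op n 2" "M \<in> Op n 1 \<Longrightarrow> pad n 1 1 M 0 \<in> Op n 2"
  by (rule pad_closed'; simp)+

lemma pad2_closed: "M \<in> Op n 2 \<Longrightarrow> pad n 0 2 M 1 \<in> Op n 3" "M \<in> Op n 2 \<Longrightarrow> pad n 1 2 M 0 \<in> Op n 3"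
  by (rule pad_closed'; simp)+

lemma place_braid:
  assumes "a + 3 \<le> m" "M \<in> Op n 2"
    and "mm n 3 (pad n 0 2 M 1) (mm n 3 (pad n 1 2 M 0) (pad n 0 2 M 1)) = mm n 3 (pad n 1 2 M 0) (mm n 3 (pad n 0 2 M 1) (pad n 1 2 M 0))"
  shows "mul (pl a 2 M) (mul (pl (a + 1) 2 M) (pl a 2 M)) = mul (pl (a + 1) 2 M) (mul (pl a 2 M) (pl (a + 1) 2 M))"
  unfolding window_3[OF assms(1,2)] using assms by (simp add: place_mm pad2_closed mm_closed)

lemma place_R_Phi:
  assumes "a + 2 \<le> m"
  shows "mul (pl a 2 (R_op n)) (pl a 1 (Phi_op n)) = mul (pl (a + 1) 1 (Phi_op n)) (pl a 2 (R_op n))"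
    "mul (pl a 2 (Rs_op n)) (pl a 1 (PhiT_op n)) = mul (pl (a + 1) 1 (PhiT_op n)) (pl a 2 (Rs_op n))"
    "mul (pl a 1 (Phi_op n)) (pl a 2 (e_op n)) = mul (pl (a + 1) 1 (PhiT_op n)) (pl a 2 (e_op n))"
    "mul (pl a 2 (e_op n)) (pl a 1 (Phi_op n)) = mul (pl a 2 (e_op n)) (pl (a + 1) 1 (PhiT_op n))"
  unfolding window_2[OF assms Phi_closed] window_2[OF assms PhiT_closed]
  using assms by (simp_all add: place_mm pad1_closed mm_closed R_Phi Rs_PhiT Phi_e e_Phi)

lemma place_e_Phi_e:
  assumes "a + 2 \<le> m"
  shows "mul (pl a 2 (e_op n)) (mul (pl a 1 (Phi_op n)) (pl a 2 (e_op n))) = 0"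
proof -
  have "mul (pl a 2 (e_op n)) (mul (pl a 1 (Phi_op n)) (pl a 2 (e_op n)))
    = pl a 2 (mm n 2 (e_op n) (mm n 2 (pad n 0 1 (Phi_op n) 1) (e_op n)))"
    unfolding window_2(1)[OF assms Phi_closed] using assms by (simp add: place_mm pad1_closed mm_closed)
  then show ?thesis
    by (simp add: e_Phi_e place_def pad_zero)
qed

lemma place_e_e: "a + 2 \<le> m \<Longrightarrow> mul (pl a 2 (e_op n)) (pl a 2 (e_op n)) = 0"
  by (simp add: place_mm e_square) (simp add: place_def pad_zero)

lemma place_e_R_e:
  assumes "a + 3 \<le> m"
  shows "mul (pl (a + 1) 2 (e_op n)) (mul (pl a 2 (R_op n)) (pl (a + 1) 2 (e_op n))) = pl (a + 1) 2 (e_op n)"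
    "mul (pl a 2 (e_op n)) (mul (pl (a + 1) 2 (Rs_op n)) (pl a 2 (e_op n))) = pl a 2 (e_op n)"
  unfolding window_3[OF assms e_closed] window_3[OF assms R_closed] window_3[OF assms Rs_closed]
  using assms by (simp_all add: place_mm pad2_closed mm_closed e_R_e e_Rs_e)

text \<open>
  Contracted with \<open>e\<close>, the crossings become a nested cup and cap, which absorbs the remaining
  crossings. The two sides differ by the side on which they are absorbed.
\<close>

lemma place_long:
  assumes "a + 4 \<le> m"
  shows "mul (pl (a + 1) 2 (e_op n)) (mul (pl a 2 (R_inv n)) (mul (pl (a + 2) 2 (Rs_op n)) (mul (pl (a + 1) 2 (e_op n))
      (mul (pl (a + 2) 2 (Rs_op n)) (pl a 2 (R_inv n))))))
    = mul (pl a 2 (R_inv n)) (mul (pl (a + 2) 2 (Rs_op n)) (mul (pl (a + 1) 2 (e_op n))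
      (mul (pl (a + 2) 2 (Rs_op n)) (mul (pl a 2 (R_inv n)) (pl (a + 1) 2 (e_op n))))))"
proof -
  define A where "A = pad n 0 2 (R_inv n) 2"
  define B where "B = pad n 2 2 (Rs_op n) 0"
  define D where "D = pad n 1 2 (e_op n) 1"
  have closed: "A \<in> Op n 4" "B \<in> Op n 4" "D \<in> Op n 4"
    unfolding A_def B_def D_def by (rule pad_closed'; simp)+
  have AB: "mm n 4 A B = cross_op n" "mm n 4 B A = cross_op n"
    unfolding A_def B_def by (rule cross_eq_pads)+
  have DD: "mm n 4 D (mm n 4 (cross_op n) D) = nest_op n"
    unfolding D_def by (rule e_cross_e)
  have "mm n 4 D (mm n 4 A (mm n 4 B (mm n 4 D (mm n 4 B A)))) = mm n 4 (mm n 4 D (mm n 4 (mm n 4 A B) D)) (mm n 4 B A)"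
    by (simp only: mm_assoc)
  also have "\<dots> = nest_op n"
    by (simp only: AB DD nest_cross)
  finally have left: "mm n 4 D (mm n 4 A (mm n 4 B (mm n 4 D (mm n 4 B A)))) = nest_op n" .
  have "mm n 4 A (mm n 4 B (mm n 4 D (mm n 4 B (mm n 4 A D)))) = mm n 4 (mm n 4 A B) (mm n 4 D (mm n 4 (mm n 4 B A) D))"
    by (simp only: mm_assoc)
  also have "\<dots> = nest_op n"
    by (simp only: AB DD cross_nest)
  finally have right: "mm n 4 A (mm n 4 B (mm n 4 D (mm n 4 B (mm n 4 A D)))) = nest_op n" .
  show ?thesis
    unfolding window_4[OF assms e_closed] window_4[OF assms R_inv_closed] window_4[OF assms Rs_closed] A_def[symmetric] B_def[symmetric] D_def[symmetric]
    using assms closed by (simp add: place_mm mm_closed left right)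
qed

lemma place_squares:
  assumes "a + 1 \<le> m"
  shows "mul (pl a 1 (Phi_op n)) (pl a 1 (Phi_op n)) = smul (- 1) (idm n m)"
    "mul (pl a 1 (PhiT_op n)) (pl a 1 (PhiT_op n)) = idm n m"
  using assms place_idm[OF assms, of n]
  by (simp_all add: place_mm Phi_square PhiT_square) (simp add: place_def pad_smul)

end

lemma bc_relations:
  assumes "(x, y) \<in> bc_rels r s"
  shows "bc_eval n r s x = bc_eval n r s y"
proof -
  note eval = bc_eval_mult bc_eval_gen bc_eval_tinv bc_gens_simps free_eval_diff free_eval_minus free_eval_scal free_eval_1
    free_alg_closed mm_assoc mm_smul_left place_closed
  show ?thesis
    using assms
  proof cases
    case (t_quad i)
    then show ?thesis
      using place_quad[of "i - 1" "r + s" "R_op n", OF _ R_closed R_quad] by (simp add: eval)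
  next
    case (ts_quad i)
    then show ?thesis
      using place_quad[of "r + i - 1" "r + s" "Rs_op n", OF _ Rs_closed Rs_quad] by (simp add: eval)
  next
    case (t_braid i)
    then have "i - 1 + 1 = i"
      by simp
    then show ?thesis
      using place_braid[of "i - 1" "r + s" "R_op n", OF _ R_closed R_braid] t_braid by (simp add: eval)
  next
    case (ts_braid i)
    then have "r + i - 1 + 1 = r + i"
      by simp
    then show ?thesis
      using place_braid[of "r + i - 1" "r + s" "Rs_op n", OF _ Rs_closed Rs_braid] ts_braid by (simp add: eval)
  next
    case (t_comm i j)
    then have "i - 1 + 2 \<le> j - 1 \<or> j - 1 + 2 \<le> i - 1"
      by auto
    then show ?thesis
      using t_comm place_commute[OF R_even R_even R_closed R_closed, of "i - 1" "r + s" "j - 1" n] by (simp add: eval)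
  next
    case (ts_comm i j)
    then have "r + i - 1 + 2 \<le> r + j - 1 \<or> r + j - 1 + 2 \<le> r + i - 1"
      by auto
    then show ?thesis
      using ts_comm place_commute[OF Rs_even Rs_even Rs_closed Rs_closed, of "r + i - 1" "r + s" "r + j - 1" n] by (simp add: eval)
  next
    case (t_ts i j)
    then have "i - 1 + 2 \<le> r + j - 1"
      by auto
    then show ?thesis
      using t_ts place_commute[OF R_even Rs_even R_closed Rs_closed, of "i - 1" "r + s" "r + j - 1" n] by (simp add: eval)
  next
    case e_e
    then show ?thesis
      using place_e_e[of "r - 1" "r + s" n] by (simp add: eval)
  next
    case e_t_e
    then have "r - 2 + 1 = r - 1" "r - 1 - 1 = r - 2"
      by auto
    then show ?thesis
      using e_t_e place_e_R_e(1)[of "r - 2" "r + s" n] by (simp add: eval)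
  next
    case (e_t j)
    then have "j - 1 + 2 \<le> r - 1"
      by auto
    then show ?thesis
      using e_t place_commute[OF e_even R_even e_closed R_closed, of "r - 1" "r + s" "j - 1" n] by (simp add: eval)
  next
    case e_ts_e
    then have "r - 1 + 1 = r" "r + 1 - 1 = r"
      by auto
    then show ?thesis
      using e_ts_e place_e_R_e(2)[of "r - 1" "r + s" n] by (simp add: eval)
  next
    case (e_ts j)
    then have "r - 1 + 2 \<le> r + j - 1"
      by auto
    then show ?thesis
      using e_ts place_commute[OF e_even Rs_even e_closed Rs_closed, of "r - 1" "r + s" "r + j - 1" n] by (simp add: eval)
  next
    case e_long
    then have "r - 2 + 1 = r - 1" "r - 1 - 1 = r - 2" "r - 2 + 2 = r" "r + 1 - 1 = r"
      by auto
    then show ?thesis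
      using e_long place_long[of "r - 2" "r + s" n] by (simp add: eval del: free_eval_diff)
  next
    case (c_sq i)
    then show ?thesis
      using place_squares(1)[of "i - 1" "r + s" n] by (simp add: eval)
  next
    case (c_c i j)
    then have "i - 1 + 1 \<le> j - 1 \<or> j - 1 + 1 \<le> i - 1"
      by auto
    then show ?thesis
      using c_c place_anticommute[OF Phi_odd Phi_odd Phi_closed Phi_closed, of "i - 1" "r + s" "j - 1" n] by (simp add: eval)
  next
    case (c_cs i j)
    then have "i - 1 + 1 \<le> r + j - 1"
      by auto
    then show ?thesis
      using c_cs place_anticommute[OF Phi_odd PhiT_odd Phi_closed PhiT_closed, of "i - 1" "r + s" "r + j - 1" n] by (simp add: eval)
  next
    case (cs_sq i)
    then show ?thesis
      using place_squares(2)[of "r + i - 1" "r + s" n] by (simp add: eval)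
  next
    case (cs_cs i j)
    then have "r + i - 1 + 1 \<le> r + j - 1 \<or> r + j - 1 + 1 \<le> r + i - 1"
      by auto
    then show ?thesis
      using cs_cs place_anticommute[OF PhiT_odd PhiT_odd PhiT_closed PhiT_closed, of "r + i - 1" "r + s" "r + j - 1" n] by (simp add: eval)
  next
    case (t_c i)
    then have "i - 1 + 1 = i"
      by simp
    then show ?thesis
      using t_c place_R_Phi(1)[of "i - 1" "r + s" n] by (simp add: eval)
  next
    case (t_c' i j)
    then have "i - 1 + 2 \<le> j - 1 \<or> j - 1 + 1 \<le> i - 1"
      by auto
    then show ?thesis
      using t_c' place_commute[OF R_even Phi_odd R_closed Phi_closed, of "i - 1" "r + s" "j - 1" n] by (simp add: eval)
  next
    case (ts_cs i)
    then have "r + i - 1 + 1 = r + i"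
      by simp
    then show ?thesis
      using ts_cs place_R_Phi(2)[of "r + i - 1" "r + s" n] by (simp add: eval)
  next
    case (ts_cs' i j)
    then have "r + i - 1 + 2 \<le> r + j - 1 \<or> r + j - 1 + 1 \<le> r + i - 1"
      by auto
    then show ?thesis
      using ts_cs' place_commute[OF Rs_even PhiT_odd Rs_closed PhiT_closed, of "r + i - 1" "r + s" "r + j - 1" n] by (simp add: eval)
  next
    case (t_cs i j)
    then have "i - 1 + 2 \<le> r + j - 1"
      by auto
    then show ?thesis
      using t_cs place_commute[OF R_even PhiT_odd R_closed PhiT_closed, of "i - 1" "r + s" "r + j - 1" n] by (simp add: eval)
  next
    case (ts_c i j)
    then have "j - 1 + 1 \<le> r + i - 1"
      by auto
    then show ?thesis
      using ts_c place_commute[OF Rs_even Phi_odd Rs_closed Phi_closed, of "r + i - 1" "r + s" "j - 1" n] by (simp add: eval)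
  next
    case c_e
    then have "r - 1 + 1 = r" "r + 1 - 1 = r"
      by auto
    then show ?thesis
      using c_e place_R_Phi(3)[of "r - 1" "r + s" n] by (simp add: eval)
  next
    case e_c
    then have "r - 1 + 1 = r" "r + 1 - 1 = r"
      by auto
    then show ?thesis
      using e_c place_R_Phi(4)[of "r - 1" "r + s" n] by (simp add: eval)
  next
    case (c_e' j)
    then have "j - 1 + 1 \<le> r - 1"
      by auto
    then show ?thesis
      using c_e' place_commute[OF e_even Phi_odd e_closed Phi_closed, of "r - 1" "r + s" "j - 1" n] by (simp add: eval)
  next
    case (cs_e' j)
    then have "r - 1 + 2 \<le> r + j - 1"
      by auto
    then show ?thesis
      using cs_e' place_commute[OF e_even PhiT_odd e_closed PhiT_closed, of "r - 1" "r + s" "r + j - 1" n] by (simp add: eval)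
  next
    case e_c_e
    then show ?thesis
      using place_e_Phi_e[of "r - 1" "r + s" n] by (simp add: eval)
  qed
qed

lemma representation_bc: "representation (bc_gens r s) (bc_rels r s) n (r + s) (bc_op n r s)"
  by unfold_locales (auto dest: bc_rels_closed intro: bc_op_closed bc_relations)

text \<open>
  A generator slides through the crossing with the strands that it touches; the list of all strands is split
  accordingly.
\<close>

lemma bc_op_slides:
  assumes "x \<in> bc_gens r s"
  shows "slides n (r + s) (bc_op n r s x) (crossing n (replicate r True @ replicate s False))"
proof -
  note two = numeral_2_eq_2 One_nat_def
  consider i where "x = T i" "1 \<le> i" "i < r" | i where "x = Ts i" "1 \<le> i" "i < s" | i where "x = C i" "1 \<le> i" "i \<le> r"
    | i where "x = Cs i" "1 \<le> i" "i \<le> s" | "x = Ee" "1 \<le> r" "1 \<le> s"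
    using assms by (auto simp: bc_gens_def split: if_splits)
  then show ?thesis
  proof cases
    case 1
    have "replicate r True = replicate (i - 1) True @ [True, True] @ replicate (r - (i - 1) - 2) True"
      using replicate_split[of "i - 1" 2 r True] 1 by (simp add: two)
    then show ?thesis
      using 1 place_slides[OF local_slides(1) R_even R_closed, where ps = "replicate (i - 1) True" and a = "i - 1"
        and vs = "replicate (r - (i - 1) - 2) True @ replicate s False" and m = "r + s"] by simp
  next
    case 2
    have "replicate s False = replicate (i - 1) False @ [False, False] @ replicate (s - (i - 1) - 2) False"
      using replicate_split[of "i - 1" 2 s False] 2 by (simp add: two)
    then show ?thesis
      using 2 place_slides[OF local_slides(2) Rs_even Rs_closed, where ps = "replicate r True @ replicate (i - 1) False" and a = "r + i - 1"
        and vs = "replicate (s - (i - 1) - 2) False" and m = "r + s"] by simp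
  next
    case 3
    have "replicate r True = replicate (i - 1) True @ [True] @ replicate (r - (i - 1) - 1) True"
      using replicate_split[of "i - 1" 1 r True] 3 by (simp add: two)
    then show ?thesis
      using 3 place_slides[OF local_slides(4) Phi_odd Phi_closed, where ps = "replicate (i - 1) True" and a = "i - 1"
        and vs = "replicate (r - (i - 1) - 1) True @ replicate s False" and m = "r + s"] by simp
  next
    case 4
    have "replicate s False = replicate (i - 1) False @ [False] @ replicate (s - (i - 1) - 1) False"
      using replicate_split[of "i - 1" 1 s False] 4 by (simp add: two)
    then show ?thesis
      using 4 place_slides[OF local_slides(5) PhiT_odd PhiT_closed, where ps = "replicate r True @ replicate (i - 1) False" and a = "r + i - 1"
        and vs = "replicate (s - (i - 1) - 1) False" and m = "r + s"] by simp
  next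
    case 5
    have "replicate r True = replicate (r - 1) True @ [True]" "replicate s False = [False] @ replicate (s - 1) False"
      using replicate_split[of "r - 1" 1 r True] replicate_split[of 0 1 s False] 5 by (simp_all add: two)
    then have eq: "replicate r True @ replicate s False = replicate (r - 1) True @ [True, False] @ replicate (s - 1) False"
      by simp
    show ?thesis
      unfolding eq 5(1) bc_op.simps
      by (rule place_slides[OF local_slides(3) e_even e_closed]) (use 5 in auto)
  qed
qed

lemma bc_supercommuting: "supercommuting n r s (induced n (r + s) (bc_op n r s))"
  unfolding supercommuting_def
proof (intro allI ballI)
  fix a b x u
  assume "x \<in> homog (bc_gens r s) (bc_rels r s) bc_par a" "u \<in> homog (uq_gens n) (uq_rels n) uq_par b"
  then obtain f h where f: "x = bc_class r s f" "f \<in> carrier (free_alg (bc_gens r s))"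
      "\<And>w. w \<in> Poly_Mapping.keys f \<Longrightarrow> word_par bc_par w mod 2 = a mod 2"
    and h: "u = uq_class n h" "h \<in> carrier (free_alg (uq_gens n))"
      "\<And>w. w \<in> Poly_Mapping.keys h \<Longrightarrow> word_par uq_par w mod 2 = b mod 2"
    by (auto simp: homog_def)
  have \<rho>: "induced n (r + s) (bc_op n r s) x = bc_eval n r s f"
    unfolding f(1) by (rule representation.induced_class[OF representation_bc])
  have mod: "uq_module n (r + s) (mixed_family n r s)"
    by (rule uq_module_mixed)
  have gens: "mm n (r + s) (bc_op n r s y) ((\<lambda>(i, j). mixed_family n r s i j) z)
    = smul (sg (bc_par y * uq_par z)) (mm n (r + s) ((\<lambda>(i, j). mixed_family n r s i j) z) (bc_op n r s y))"
    if y: "y \<in> bc_gens r s" and z: "z \<in> uq_gens n" for y z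
  proof -
    obtain i j where ij: "z = (i, j)" "i \<in> idx n" "j \<in> idx n"
      using z by (auto simp: uq_gens_def)
    have "slides n (r + s) (bc_op n r s y) (hat n (r + s) (mixed_family n r s))"
      unfolding hat_mixed by (rule bc_op_slides[OF y])
    then have "mm n (r + s) (bc_op n r s y) (mixed_family n r s i j)
      = smul (sg (bc_par y * (par i + par j))) (mm n (r + s) (mixed_family n r s i j) (bc_op n r s y))"
      by (rule hat_slides_supercommute[where L = "mixed_family n r s" and i = i and j = j and d = "bc_par y", OF _ bc_op_closed[OF y] bc_op_par[OF y] ij(2,3) module_props(1,2)[OF mod ij(2,3)]])
    then show ?thesis
      by (simp add: ij(1) uq_par_def)
  qed
  show "mm n (r + s) (induced n (r + s) (bc_op n r s) x) (uq_mixed n r s u)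
    = smul (sg (a * b)) (mm n (r + s) (uq_mixed n r s u) (induced n (r + s) (bc_op n r s) x))"
    unfolding \<rho> unfolding h(1) uq_mixed_class[OF h(2)]
    by (rule supercommute_free_eval[OF bc_op_closed module_gens_closed[OF mod] gens f(2,3) h(2,3)])
qed

section \<open>The matrices of the generators\<close>

lemma flip_sum_app:
  assumes "x \<in> idx n" "y \<in> idx n" "a \<in> idx n" "b \<in> idx n"
  shows "(\<Sum>i\<in>idx n. \<Sum>j\<in>idx n. smul (sg (par i) * qq powi ((of_bool (i = j) + of_bool (- i = j)) * (1 - 2 * int (par j)))) (EE j i i j)) [x, y] [a, b]
    = of_bool (x = b \<and> y = a) * flip_c a b"
proof -
  have neg: "- a = b \<longleftrightarrow> a = - b"
    by auto
  have "(\<Sum>i\<in>idx n. \<Sum>j\<in>idx n. (sg (par i) * qq powi ((of_bool (i = j) + of_bool (- i = j)) * (1 - 2 * int (par j)))) * EE j i i j [x, y] [a, b])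
    = (sg (par a) * qq powi ((of_bool (a = b) + of_bool (- a = b)) * (1 - 2 * int (par b)))) * EE b a a b [x, y] [a, b]"
    by (subst sum2_single[where a = a and b = b]) (use assms in \<open>auto simp: EE_app\<close>)
  also have "\<dots> = of_bool (x = b \<and> y = a) * ((sg (par a) * sg ((par a + par b) * par a)) * qq powi ((of_bool (a = b) + of_bool (a = - b)) * (1 - 2 * int (par b))))"
    unfolding EE_app neg by simp
  also have "sg (par a) * sg ((par a + par b) * par a) = sg (par a * par b)"
    by (cases "even (par a)"; cases "even (par b)"; simp add: sg_eq)
  finally show ?thesis
    by (simp only: sum_fun_app smul_def flip_c_def)
qed

text \<open>
  The terms other than the flip, for both braidings: they differ in the order of \<open>i\<close> and \<open>j\<close> and in a sign.
\<close>

lemma tail_sum_app: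
  assumes "x \<in> idx n" "y \<in> idx n" "a \<in> idx n" "b \<in> idx n" "\<And>i. B i \<subseteq> idx n"
  shows "(\<Sum>i\<in>idx n. \<Sum>j\<in>B i. EE i i j j - smul (c i j) (EE i (- i) (- j) j)) [x, y] [a, b]
    = of_bool (x = a \<and> y = b) * of_bool (b \<in> B a) - of_bool (x = - a \<and> y = - b) * (of_bool (b \<in> B (- a)) * (c (- a) b * sg (par a)))"
proof -
  have fin: "finite (B i)" for i
    using assms(5) finite_subset by (meson finite_idx)
  have s: "sg ((par (- b) + par b) * par a) = sg (par a)"
    using idx_nonzero[OF assms(4)] by (rule sg_par_sum_uminus(2))
  have "(\<Sum>i\<in>idx n. \<Sum>j\<in>B i. EE i i j j [x, y] [a, b]) = of_bool (x = a \<and> y = b) * of_bool (b \<in> B a)"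
    by (subst sum2_single[where a = a and b = b]) (use assms fin in \<open>auto simp: EE_app sg_eq\<close>)
  moreover have "(\<Sum>i\<in>idx n. \<Sum>j\<in>B i. c i j * EE i (- i) (- j) j [x, y] [a, b])
    = of_bool (x = - a \<and> y = - b) * (of_bool (b \<in> B (- a)) * (c (- a) b * sg (par a)))"
    by (subst sum2_single[where a = "- a" and b = b]) (use assms fin s in \<open>auto simp: EE_app\<close>)
  ultimately show ?thesis
    by (simp only: sum_fun_app smul_def minus_apply sum_subtractf)
qed

lemma R_matrix:
  "R_op n = (\<Sum>i\<in>idx n. \<Sum>j\<in>idx n.
      smul (sg (par i) * qq powi ((of_bool (i = j) + of_bool (- i = j)) * (1 - 2 * int (par j)))) (EE j i i j))
    + smul xi (\<Sum>i\<in>idx n. \<Sum>j\<in>{j \<in> idx n. i < j}. EE i i j j - smul (sg (par i + par j)) (EE i (- i) (- j) j))"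
proof (rule Op2_eqI)
  fix x y a b assume *: "x \<in> idx n" "y \<in> idx n" "a \<in> idx n" "b \<in> idx n"
  have ab: "- a < b \<longleftrightarrow> 0 < a + b"
    by auto
  have s: "sg (par (- a) + par b) * sg (par a) = - sg (par b)"
    using idx_nonzero[OF *(3)] by (simp add: sg_add sg_par_uminus mult_ac)
  have "(\<Sum>i\<in>idx n. \<Sum>j\<in>{j \<in> idx n. i < j}. EE i i j j - smul (sg (par i + par j)) (EE i (- i) (- j) j)) [x, y] [a, b]
    = of_bool (x = a \<and> y = b) * of_bool (a < b) + of_bool (x = - a \<and> y = - b) * (of_bool (0 < a + b) * sg (par b))"
    by (subst tail_sum_app) (use * s ab in auto)
  then show "R_op n [x, y] [a, b] = ((\<Sum>i\<in>idx n. \<Sum>j\<in>idx n.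
      smul (sg (par i) * qq powi ((of_bool (i = j) + of_bool (- i = j)) * (1 - 2 * int (par j)))) (EE j i i j))
    + smul xi (\<Sum>i\<in>idx n. \<Sum>j\<in>{j \<in> idx n. i < j}. EE i i j j - smul (sg (par i + par j)) (EE i (- i) (- j) j))) [x, y] [a, b]"
    unfolding plus_fun_apply flip_sum_app[OF *] R_app[OF *] smul_def[of xi] by (simp add: algebra_simps)
qed (auto intro!: Op_add Op_sum Op_smul Op_diff EE_closed)

lemma Rs_matrix:
  "Rs_op n = (\<Sum>i\<in>idx n. \<Sum>j\<in>idx n.
      smul (sg (par i) * qq powi ((of_bool (i = j) + of_bool (- i = j)) * (1 - 2 * int (par j)))) (EE j i i j))
    + smul xi (\<Sum>i\<in>idx n. \<Sum>j\<in>{j \<in> idx n. j < i}. EE i i j j - EE i (- i) (- j) j)"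
proof (rule Op2_eqI)
  fix x y a b assume *: "x \<in> idx n" "y \<in> idx n" "a \<in> idx n" "b \<in> idx n"
  have "(\<Sum>i\<in>idx n. \<Sum>j\<in>{j \<in> idx n. j < i}. EE i i j j - smul 1 (EE i (- i) (- j) j)) [x, y] [a, b]
    = of_bool (x = a \<and> y = b) * of_bool (b < a) - of_bool (x = - a \<and> y = - b) * (of_bool (b < - a) * (1 * sg (par a)))"
    by (subst tail_sum_app) (use * in auto)
  then have tail: "(\<Sum>i\<in>idx n. \<Sum>j\<in>{j \<in> idx n. j < i}. EE i i j j - EE i (- i) (- j) j) [x, y] [a, b]
    = of_bool (x = a \<and> y = b) * of_bool (b < a) - of_bool (x = - a \<and> y = - b) * (of_bool (b < - a) * sg (par a))"
    by (simp only: smul_simps mult_1)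
  have R: "Rs_op n [x, y] [a, b] = of_bool (b = x \<and> a = y) * flip_c y x
    + of_bool (b = y \<and> a = x) * (if y < x then xi else 0) + of_bool (b = - y \<and> a = - x) * (if 0 < y + x then xi * sg (par x) else 0)"
    unfolding Rs_app[OF *] by (rule R_app[OF *(4,3,2,1)])
  have 1: "of_bool (b = x \<and> a = y) * flip_c y x = of_bool (x = b \<and> y = a) * flip_c a b"
    by auto
  have 2: "of_bool (b = y \<and> a = x) * (if y < x then xi else 0) = xi * (of_bool (x = a \<and> y = b) * of_bool (b < a))"
    by auto
  have 3: "of_bool (b = - y \<and> a = - x) * (if 0 < y + x then xi * sg (par x) else 0)
    = - (xi * (of_bool (x = - a \<and> y = - b) * (of_bool (b < - a) * sg (par a))))"
  proof (cases "b = - y \<and> a = - x")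
    case True
    then have "x = - a" "y = - b" "0 < y + x \<longleftrightarrow> b < - a"
      by auto
    moreover have "sg (par a) = - sg (par x)"
      using True sg_par_uminus[OF idx_nonzero[OF *(1)]] by simp
    ultimately show ?thesis
      using True by simp
  qed auto
  show "Rs_op n [x, y] [a, b] = ((\<Sum>i\<in>idx n. \<Sum>j\<in>idx n.
      smul (sg (par i) * qq powi ((of_bool (i = j) + of_bool (- i = j)) * (1 - 2 * int (par j)))) (EE j i i j))
    + smul xi (\<Sum>i\<in>idx n. \<Sum>j\<in>{j \<in> idx n. j < i}. EE i i j j - EE i (- i) (- j) j)) [x, y] [a, b]"
    unfolding plus_fun_apply flip_sum_app[OF *] R smul_def[of xi] tail 1 2 3 by (simp add: right_diff_distrib)
qed (auto intro!: Op_add Op_sum Op_smul Op_diff EE_closed)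

lemma PhiT_matrix: "PhiT_op n = (\<Sum>i\<in>idx n. E i (- i))"
proof (rule Op1_eqI)
  fix x a assume *: "x \<in> idx n" "a \<in> idx n"
  have "(\<Sum>i\<in>idx n. E i (- i)) [x] [a] = (\<Sum>i\<in>idx n. E i (- i) [x] [a])"
    by (rule sum_fun_app)
  also have "\<dots> = E x (- x) [x] [a]"
    by (rule sum_single) (use * in \<open>auto simp: E_app\<close>)
  finally show "PhiT_op n [x] [a] = (\<Sum>i\<in>idx n. E i (- i)) [x] [a]"
    using * by (auto simp: PhiT_app E_app)
qed (auto intro!: Op_sum E_closed)

lemma e_matrix:
  "e_op n = smul (qq powi (- (2 * int n + 1))) (\<Sum>i\<in>idx n. \<Sum>j\<in>idx n.
      smul (sg (par i * par j) * qq powi (2 * j * (1 - 2 * int (par j)))) (EE i j i j))"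
proof (rule Op2_eqI)
  fix x y a b assume *: "x \<in> idx n" "y \<in> idx n" "a \<in> idx n" "b \<in> idx n"
  have "(\<Sum>i\<in>idx n. \<Sum>j\<in>idx n. (sg (par i * par j) * qq powi (2 * j * (1 - 2 * int (par j)))) * EE i j i j [x, y] [a, b])
    = (sg (par x * par a) * qq powi (2 * a * (1 - 2 * int (par a)))) * EE x a x a [x, y] [a, b]"
    by (subst sum2_single[where a = x and b = a]) (use * in \<open>auto simp: EE_app\<close>)
  also have "\<dots> = of_bool (x = y \<and> a = b) * ((sg (par x * par a) * sg ((par x + par a) * par a)) * qq powi (2 * a * (1 - 2 * int (par a))))"
    unfolding EE_app by auto
  also have "sg (par x * par a) * sg ((par x + par a) * par a) = sg (par a)"
    by (cases "even (par x)"; cases "even (par a)"; simp add: sg_eq)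
  finally have sum: "(\<Sum>i\<in>idx n. \<Sum>j\<in>idx n. smul (sg (par i * par j) * qq powi (2 * j * (1 - 2 * int (par j)))) (EE i j i j)) [x, y] [a, b]
    = of_bool (x = y \<and> a = b) * (sg (par a) * qq powi (2 * a * (1 - 2 * int (par a))))"
    by (simp only: sum_fun_app smul_def)
  have "beta n a = qq powi (- (2 * int n + 1)) * (sg (par a) * qq powi (2 * a * (1 - 2 * int (par a))))"
    unfolding beta_def diff_conv_add_uminus power_int_add[OF disjI1[OF qq_nonzero]] by (simp only: mult_ac)
  then show "e_op n [x, y] [a, b] = smul (qq powi (- (2 * int n + 1))) (\<Sum>i\<in>idx n. \<Sum>j\<in>idx n.
      smul (sg (par i * par j) * qq powi (2 * j * (1 - 2 * int (par j)))) (EE i j i j)) [x, y] [a, b]"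
    unfolding smul_def[of "qq powi (- (2 * int n + 1))"] sum using * by (auto simp: e_app)
qed (auto intro!: Op_sum Op_smul EE_closed)

theorem theorem3p16:
  fixes n r s :: nat
  assumes "1 \<le> n"
  shows
    "(\<exists>\<rho>. superalg_action (bc_gens r s) (bc_rels r s) bc_par n (r + s) \<rho>
        \<and> supercommuting n r s \<rho>
        \<and> (\<forall>i \<in> {1..<r}. \<rho> (bc_class r s (tt i))
              = pad n (i - 1) 2 (mm n 2 (P_op n) (S_op n)) (r + s - 1 - i))
        \<and> (\<forall>i \<in> {1..r}. \<rho> (bc_class r s (cc i))
              = pad n (i - 1) 1 (Phi_op n) (r + s - i))
        \<and> (\<forall>i \<in> {1..<s}. \<rho> (bc_class r s (ts i))
              = pad n (r + i - 1) 2 (mm n 2 (str2 n (P_op n)) (str2 n (S_op n))) (s - 1 - i))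
        \<and> (\<forall>i \<in> {1..s}. \<rho> (bc_class r s (cs i))
              = pad n (r + i - 1) 1 (str1 n (Phi_op n)) (s - i))
        \<and> (1 \<le> r \<and> 1 \<le> s \<longrightarrow> \<rho> (bc_class r s ee)
              = pad n (r - 1) 2 (mm n 0 (cap_op n) (cup_op n)) (s - 1)))
     \<and> mm n 2 (P_op n) (S_op n)
         = (\<Sum>i\<in>idx n. \<Sum>j\<in>idx n.
              smul (sg (par i)
                * qq powi ((of_bool (i = j) + of_bool (- i = j)) * (1 - 2 * int (par j))))
                (EE j i i j))
           + smul xi (\<Sum>i\<in>idx n. \<Sum>j\<in>{j \<in> idx n. i < j}.
               EE i i j j - smul (sg (par i + par j)) (EE i (- i) (- j) j))
     \<and> mm n 2 (str2 n (P_op n)) (str2 n (S_op n))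
         = (\<Sum>i\<in>idx n. \<Sum>j\<in>idx n.
              smul (sg (par i)
                * qq powi ((of_bool (i = j) + of_bool (- i = j)) * (1 - 2 * int (par j))))
                (EE j i i j))
           + smul xi (\<Sum>i\<in>idx n. \<Sum>j\<in>{j \<in> idx n. j < i}.
               EE i i j j - EE i (- i) (- j) j)
     \<and> str1 n (Phi_op n) = (\<Sum>i\<in>idx n. E i (- i))
     \<and> mm n 0 (cap_op n) (cup_op n)
         = smul (qq powi (- (2 * int n + 1))) (\<Sum>i\<in>idx n. \<Sum>j\<in>idx n.
              smul (sg (par i * par j) * qq powi (2 * j * (1 - 2 * int (par j)))) (EE i j i j))"
proof (intro conjI)
  interpret representation "bc_gens r s" "bc_rels r s" n "r + s" "bc_op n r s"
    by (rule representation_bc)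
  let ?\<rho> = "induced n (r + s) (bc_op n r s)"
  have gens: "?\<rho> (bc_class r s (gen x)) = bc_op n r s x" if "x \<in> bc_gens r s" for x
    using that by (simp add: bc_eval_gen)
  have "superalg_action (bc_gens r s) (bc_rels r s) bc_par n (r + s) ?\<rho>"
    by (rule superalg_action_induced[OF bc_op_par])
  moreover have "\<forall>i\<in>{1..<r}. ?\<rho> (bc_class r s (tt i)) = pad n (i - 1) 2 (mm n 2 (P_op n) (S_op n)) (r + s - 1 - i)"
  proof
    fix i assume i: "i \<in> {1..<r}"
    then have "r + s - (i - 1) - 2 = r + s - 1 - i"
      by auto
    then show "?\<rho> (bc_class r s (tt i)) = pad n (i - 1) 2 (mm n 2 (P_op n) (S_op n)) (r + s - 1 - i)"
      using i by (simp only: gens bc_gens_simps bc_op.simps place_def R_op_def)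
  qed
  moreover have "\<forall>i\<in>{1..r}. ?\<rho> (bc_class r s (cc i)) = pad n (i - 1) 1 (Phi_op n) (r + s - i)"
  proof
    fix i assume i: "i \<in> {1..r}"
    then have "r + s - (i - 1) - 1 = r + s - i"
      by auto
    then show "?\<rho> (bc_class r s (cc i)) = pad n (i - 1) 1 (Phi_op n) (r + s - i)"
      using i by (simp only: gens bc_gens_simps bc_op.simps place_def)
  qed
  moreover have "\<forall>i\<in>{1..<s}. ?\<rho> (bc_class r s (ts i)) = pad n (r + i - 1) 2 (mm n 2 (str2 n (P_op n)) (str2 n (S_op n))) (s - 1 - i)"
  proof
    fix i assume i: "i \<in> {1..<s}"
    then have "r + s - (r + i - 1) - 2 = s - 1 - i"
      by auto
    then show "?\<rho> (bc_class r s (ts i)) = pad n (r + i - 1) 2 (mm n 2 (str2 n (P_op n)) (str2 n (S_op n))) (s - 1 - i)"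
      using i by (simp only: gens bc_gens_simps bc_op.simps place_def Rs_op_def)
  qed
  moreover have "\<forall>i\<in>{1..s}. ?\<rho> (bc_class r s (cs i)) = pad n (r + i - 1) 1 (str1 n (Phi_op n)) (s - i)"
  proof
    fix i assume i: "i \<in> {1..s}"
    then have "r + s - (r + i - 1) - 1 = s - i"
      by auto
    then show "?\<rho> (bc_class r s (cs i)) = pad n (r + i - 1) 1 (str1 n (Phi_op n)) (s - i)"
      using i by (simp only: gens bc_gens_simps bc_op.simps place_def PhiT_op_def)
  qed
  moreover have "1 \<le> r \<and> 1 \<le> s \<longrightarrow> ?\<rho> (bc_class r s ee) = pad n (r - 1) 2 (mm n 0 (cap_op n) (cup_op n)) (s - 1)"
  proof
    assume rs: "1 \<le> r \<and> 1 \<le> s"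
    then have "r + s - (r - 1) - 2 = s - 1"
      by auto
    then show "?\<rho> (bc_class r s ee) = pad n (r - 1) 2 (mm n 0 (cap_op n) (cup_op n)) (s - 1)"
      using rs by (simp only: gens bc_gens_simps bc_op.simps place_def e_op_def)
  qed
  ultimately show "\<exists>\<rho>. superalg_action (bc_gens r s) (bc_rels r s) bc_par n (r + s) \<rho>
        \<and> supercommuting n r s \<rho>
        \<and> (\<forall>i \<in> {1..<r}. \<rho> (bc_class r s (tt i))
              = pad n (i - 1) 2 (mm n 2 (P_op n) (S_op n)) (r + s - 1 - i))
        \<and> (\<forall>i \<in> {1..r}. \<rho> (bc_class r s (cc i))
              = pad n (i - 1) 1 (Phi_op n) (r + s - i))
        \<and> (\<forall>i \<in> {1..<s}. \<rho> (bc_class r s (ts i))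
              = pad n (r + i - 1) 2 (mm n 2 (str2 n (P_op n)) (str2 n (S_op n))) (s - 1 - i))
        \<and> (\<forall>i \<in> {1..s}. \<rho> (bc_class r s (cs i))
              = pad n (r + i - 1) 1 (str1 n (Phi_op n)) (s - i))
        \<and> (1 \<le> r \<and> 1 \<le> s \<longrightarrow> \<rho> (bc_class r s ee)
              = pad n (r - 1) 2 (mm n 0 (cap_op n) (cup_op n)) (s - 1))"
    using bc_supercommuting[of n r s] by blast
qed (use R_matrix[of n] Rs_matrix[of n] PhiT_matrix[of n] e_matrix[of n] in
  \<open>simp_all only: R_op_def Rs_op_def PhiT_op_def e_op_def\<close>)

end
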